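(* Let $\widehat{x}=x$ (multiplication by $x$) and $\widehat{y}=-\hbar\frac{\partial}{\partial x}$. The wave function $Z(x,\hbar)=x^{-1/\hbar}\,\overline{Z}(x,\hbar)$ satisfies $$\big(\widehat{y}\,\widehat{x}\,\widehat{y}-\widehat{x}\,\widehat{y}+1\big)\,Z(x,\hbar)=0,$$ which is the quantum curve corresponding to the spectral curve $xy^2-xy+1=0$. Precisely, this means that $x^{1/\hbar}\big(\widehat{y}\,\widehat{x}\,\widehat{y}-\widehat{x}\,\widehat{y}+1\big)x^{-1/\hbar}$ annihilates the formal series $\overline{Z}(x,\hbar)\in\mathbb{Q}[\hbar^{\pm1}][[x^{-1}]]$, i.e. $$\Big[x\hbar^2\frac{\partial^2}{\partial x^2}+\hbar(\hbar-2+x)\frac{\partial}{\partial x}+x^{-1}\Big]\overline{Z}(x,\hbar)=0.$$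
   Context: For $\mu=(\mu_1,\ldots,\mu_n)\in\mathbb{Z}_+^n$, let $\mathcal{B}_{g,n}(\mu)$ be the set of isomorphism classes of Belyi maps $\pi:\Sigma\to\mathbb{P}^1$, where $\Sigma$ is a compact connected surface of genus $g$ and $\pi$ is a branched cover unramified over $\mathbb{P}^1\setminus\{0,1,\infty\}$ with $\pi^{-1}(\infty)=\mu_1p_1+\cdots+\mu_np_n$, the points over $\infty$ being labelled $p_1,\ldots,p_n$. Isomorphisms are homeomorphisms of the sources covering the identity of $\mathbb{P}^1$ and preserving the labels over $\infty$. (Equivalently: connected genus $g$ dessins d'enfant, i.e. bicoloured graphs embedded in $\Sigma$ with complement a union of disks, with $n$ labelled boundary components of lengths $2\mu_1,\ldots,2\mu_n$.) Put $$B_{g,n}(\mu_1,\ldots,\mu_n)=\sum_{\Gamma\in\mathcal{B}_{g,n}(\mu)}\frac1{|\mathrm{Aut}\,\Gamma|},\qquad F_{g,n}(x_1,\ldots,x_n)=\sum_{\mu_1,\ldots,\mu_n=1}^\infty B_{g,n}(\mu_1,\ldots,\mu_n)\prod_{i=1}^n x_i^{-\mu_i},$$ and $$\overline{Z}(x,\hbar)=\exp\Big[\sum_{g=0}^\infty\sum_{n=1}^\infty\frac{\hbar^{2g-2+n}}{n!}F_{g,n}(x,x,\ldots,x)\Big],$$ regarded as a formal series in $x^{-1}$ whose coefficients are Laurent polynomials in $\hbar$ with rational coefficients. *)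

theory Defs
  imports
    "HOL-Analysis.Analysis"
    "HOL-Homology.Homology"
    "HOL-Algebra.Free_Abelian_Groups"
    "HOL-Computational_Algebra.Formal_Laurent_Series"
begin

section \<open>Surfaces and branched covers\<close>

definition compact_connected_surface :: "'a topology \<Rightarrow> bool" where
  "compact_connected_surface X \<longleftrightarrow>
     topspace X \<noteq> {} \<and> compact_space X \<and> connected_space X \<and> Hausdorff_space X \<and>
     (\<forall>p\<in>topspace X. \<exists>U. openin X U \<and> p \<in> U \<and>
        subtopology X U homeomorphic_space top_of_set (ball (0::complex) 1))"

text \<open>
  The surface has genus \<open>g\<close> if its first integral homology group is free abelian of rank \<open>2 * g\<close>.
  This is the usual genus of closed orientable surfaces; the sources of branched covers of the
  sphere are orientable.
\<close>

definition has_genus :: "'a topology \<Rightarrow> nat \<Rightarrow> bool" where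
  "has_genus X g \<longleftrightarrow> homology_group 1 X \<cong> free_Abelian_group {..<2 * g}"

text \<open>In suitable discs centred at \<open>p\<close> and \<open>f p\<close>, the map \<open>f\<close> is \<open>z \<mapsto> z ^ k\<close>.\<close>

definition has_local_degree ::
    "'a topology \<Rightarrow> 'b topology \<Rightarrow> ('a \<Rightarrow> 'b) \<Rightarrow> 'a \<Rightarrow> nat \<Rightarrow> bool" where
  "has_local_degree X Y f p k \<longleftrightarrow> 0 < k \<and>
     (\<exists>U V \<phi> \<psi>. openin X U \<and> p \<in> U \<and> openin Y V \<and> f ` U \<subseteq> V \<and>
        homeomorphic_map (subtopology X U) (top_of_set (ball (0::complex) 1)) \<phi> \<and> \<phi> p = 0 \<and>
        homeomorphic_map (subtopology Y V) (top_of_set (ball (0::complex) 1)) \<psi> \<and> \<psi> (f p) = 0 \<and>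
        (\<forall>q\<in>U. \<psi> (f q) = \<phi> q ^ k))"

text \<open>
  For maps between compact connected surfaces, the local condition implies that \<open>f\<close> is a finite
  covering away from its branch points.
\<close>

definition branched_cover :: "'a topology \<Rightarrow> 'b topology \<Rightarrow> ('a \<Rightarrow> 'b) \<Rightarrow> bool" where
  "branched_cover X Y f \<longleftrightarrow> continuous_map X Y f \<and>
     (\<forall>p\<in>topspace X. \<exists>k. has_local_degree X Y f p k)"

definition unramified_over ::
    "'a topology \<Rightarrow> 'b topology \<Rightarrow> ('a \<Rightarrow> 'b) \<Rightarrow> 'b set \<Rightarrow> bool" where
  "unramified_over X Y f B \<longleftrightarrow>
     (\<forall>p\<in>topspace X. f p \<in> B \<longrightarrow> has_local_degree X Y f p 1)"


section \<open>Belyi maps\<close>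

text \<open>The point \<open>None\<close> of the Riemann sphere is infinity.\<close>

definition P1 :: "complex option topology" where
  "P1 = Alexandroff_compactification euclidean"

text \<open>
  Every compact surface has the cardinality of the continuum, so up to homeomorphism its points
  may be taken to be real numbers. The topology on them is arbitrary, so this only makes the
  isomorphism classes range over a set.

  The poles are labelled \<open>0, ..., n - 1\<close>; the values of \<open>pole\<close> at larger arguments, and those of
  \<open>proj\<close> outside the surface, are irrelevant and ignored by isomorphisms.
\<close>

record belyi =
  source :: "real topology"
  proj :: "real \<Rightarrow> complex option"
  pole :: "nat \<Rightarrow> real"

definition belyi_maps :: "nat \<Rightarrow> nat list \<Rightarrow> belyi set" where
  "belyi_maps g \<mu> = {\<Gamma>.
     compact_connected_surface (source \<Gamma>) \<and> has_genus (source \<Gamma>) g \<and>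
     branched_cover (source \<Gamma>) P1 (proj \<Gamma>) \<and>
     unramified_over (source \<Gamma>) P1 (proj \<Gamma>) (topspace P1 - {Some 0, Some 1, None}) \<and>
     bij_betw (pole \<Gamma>) {..<length \<mu>} {p \<in> topspace (source \<Gamma>). proj \<Gamma> p = None} \<and>
     (\<forall>i<length \<mu>. has_local_degree (source \<Gamma>) P1 (proj \<Gamma>) (pole \<Gamma> i) (\<mu> ! i))}"

text \<open>
  Homeomorphisms are made extensional so that each one is counted once as a HOL function.
\<close>

definition belyi_isos :: "nat \<Rightarrow> belyi \<Rightarrow> belyi \<Rightarrow> (real \<Rightarrow> real) set" where
  "belyi_isos n \<Gamma> \<Gamma>' = {h \<in> extensional (topspace (source \<Gamma>)).
     homeomorphic_map (source \<Gamma>) (source \<Gamma>') h \<and>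
     (\<forall>q\<in>topspace (source \<Gamma>). proj \<Gamma>' (h q) = proj \<Gamma> q) \<and>
     (\<forall>i<n. h (pole \<Gamma> i) = pole \<Gamma>' i)}"

definition belyi_rel :: "nat \<Rightarrow> nat list \<Rightarrow> belyi rel" where
  "belyi_rel g \<mu> = {(\<Gamma>, \<Gamma>') \<in> belyi_maps g \<mu> \<times> belyi_maps g \<mu>.
     belyi_isos (length \<mu>) \<Gamma> \<Gamma>' \<noteq> {}}"

definition belyi_classes :: "nat \<Rightarrow> nat list \<Rightarrow> belyi set set" where
  "belyi_classes g \<mu> = belyi_maps g \<mu> // belyi_rel g \<mu>"

text \<open>The size of the automorphism group does not depend on the chosen representative.\<close>

definition aut_count :: "nat \<Rightarrow> belyi set \<Rightarrow> nat" where
  "aut_count n C = (let \<Gamma> = (SOME \<Gamma>. \<Gamma> \<in> C) in card (belyi_isos n \<Gamma> \<Gamma>))"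

text \<open>\<open>B g \<mu>\<close> is the weighted count for \<open>n = length \<mu>\<close>.\<close>

definition B :: "nat \<Rightarrow> nat list \<Rightarrow> rat" where
  "B g \<mu> = (\<Sum>C\<in>belyi_classes g \<mu>. 1 / of_nat (aut_count (length \<mu>) C))"


section \<open>Generating series\<close>

text \<open>
  A formal power series in \<open>n\<close> variables \<open>1/x\<^sub>1, ..., 1/x\<^sub>n\<close> is given by its coefficients, indexed by
  exponent lists of length \<open>n\<close>. Substituting \<open>x\<^sub>1 = ... = x\<^sub>n = x\<close> yields a series in \<open>1/x\<close>.
\<close>

definition F :: "nat \<Rightarrow> nat \<Rightarrow> nat list \<Rightarrow> rat" where
  "F g n \<mu> = (if length \<mu> = n \<and> (\<forall>m\<in>set \<mu>. 1 \<le> m) then B g \<mu> else 0)"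

definition diagonal :: "nat \<Rightarrow> (nat list \<Rightarrow> 'a::comm_monoid_add) \<Rightarrow> 'a fps" where
  "diagonal n f = Abs_fps (\<lambda>d. \<Sum>\<mu> | length \<mu> = n \<and> sum_list \<mu> = d. f \<mu>)"

text \<open>
  In \<open>rat fls fps\<close> the inner variable is \<open>\<hbar>\<close> and the outer one is \<open>1/x\<close>. For every \<open>k\<close> only
  finitely many \<open>(g, n)\<close> contribute to the coefficient of \<open>\<hbar>\<close> to the power \<open>k\<close>, and none do when
  \<open>k < - 1\<close>.
\<close>

definition free_energy :: "rat fls fps" where
  "free_energy = Abs_fps (\<lambda>d. Abs_fls (\<lambda>k.
     \<Sum>(g, n) | 1 \<le> n \<and> 2 * int g - 2 + int n = k. fps_nth (diagonal n (F g n)) d / fact n))"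

definition Zbar :: "rat fls fps" where
  "Zbar = fps_exp 1 oo free_energy"

definition is_laurent_poly :: "'a::zero fls \<Rightarrow> bool" where
  "is_laurent_poly f \<longleftrightarrow> finite {k. fls_nth f k \<noteq> 0}"


section \<open>Differential operators in \<open>x\<close>\<close>

text \<open>
  In \<open>rat fls fls\<close> the outer variable is again \<open>1/x\<close>; hence the derivation
  with respect to \<open>x\<close> is \<open>- (1/x)\<^sup>2\<close> times the one with respect to \<open>1/x\<close>.
\<close>

definition hbar :: "rat fls fls" where
  "hbar = fls_const fls_X"

definition xvar :: "rat fls fls" where
  "xvar = fls_X_inv"

definition ddx :: "rat fls fls \<Rightarrow> rat fls fls" where
  "ddx f = - (fls_X ^ 2 * fls_deriv f)"

text \<open>
  Wave functions: \<open>Wave f\<close> stands for the formal product of \<open>f\<close> with the symbol \<open>x\<close> to the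
  power \<open>- 1/\<hbar>\<close>. The derivative of that symbol is \<open>- 1/(\<hbar> x)\<close> times the symbol, which determines
  the action of \<open>yhat = - \<hbar> \<partial>/\<partial>x\<close> by the product rule.
\<close>

datatype wave = Wave (wave_series: "rat fls fls")

instantiation wave :: "{zero, plus, minus}"
begin
definition zero_wave :: wave where "0 = Wave 0"
definition plus_wave :: "wave \<Rightarrow> wave \<Rightarrow> wave" where
  "v + w = Wave (wave_series v + wave_series w)"
definition minus_wave :: "wave \<Rightarrow> wave \<Rightarrow> wave" where
  "v - w = Wave (wave_series v - wave_series w)"
instance ..
end

fun scale :: "rat fls fls \<Rightarrow> wave \<Rightarrow> wave" where
  "scale r (Wave f) = Wave (r * f)"

fun ddx_wave :: "wave \<Rightarrow> wave" where
  "ddx_wave (Wave f) = Wave (ddx f - inverse (hbar * xvar) * f)"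

definition xhat :: "wave \<Rightarrow> wave" where
  "xhat w = scale xvar w"

definition yhat :: "wave \<Rightarrow> wave" where
  "yhat w = scale (- hbar) (ddx_wave w)"

definition Z :: wave where
  "Z = Wave (fps_to_fls Zbar)"

end

theory Submission imports Defs "HOL-Complex_Analysis.Complex_Analysis" "HOL-Combinatorics.Orbits" begin

text \<open>
 Cutting along the preimage of the real line tiles the source of a Belyi map by triangles, two for
 each of the \<open>d\<close> sheets, so that framed Belyi maps are transitive pairs of permutations of \<open>d\<close> points.
 The weight of a pair is determined by the numbers of cycles of the two permutations, and
 \<open>\<Sum>\<^sub>\<alpha> x ^ c(\<alpha>) = x (x + 1) ... (x + d - 1)\<close>. The exponential formula therefore gives the coefficients
 \<open>\<hbar> ^ d (\<Prod>i<d. 1/\<hbar> + i)\<^sup>2 / d!\<close> of \<open>Zbar\<close>, and their two-term recurrence is the differential equation.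
\<close>

text \<open>The exponent of \<hbar> is where genus and poles disappear: for a transitive pair with n
  poles the Euler characteristic gives c(\<alpha>) + c(\<beta>) + n = d + 2 - 2g, so 2g - 2 + n = d
  - c(\<alpha>) - c(\<beta>), while the n! labellings of the poles cancel the n! in
  \<open>free_energy\<close>. Two definitions shape the rest. Genus is read off from singular
  homology, so Euler's formula has to be proved for tiled surfaces: a spanning tree of the
  one-skeleton and a spanning tree of the dual graph that avoids it leave a set of edges whose
  cycles form a basis of H_1. They span because the stars of the vertices are contractible, and they
  are independent because circle-valued functions separate them by winding numbers. A branched cover
  is given by local models only, so its tiles have to be lifted from the sphere: compactness gives a
  uniform radius for local sections away from the corners, and finiteness of the fibres gives the
  limits at the corners. Automorphisms are divided out by numbering the fibre over an interior point
  of the upper triangle: each map has d! numberings, and its automorphisms act on them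
  freely.\<close>

no_notation fps_nth (infixl "$" 75)
no_notation exact_seq_arrow ("(\<open>indent=3 notation=\<open>mixfix exact_seq\<close>\<close>_ / \<longlongrightarrow>\<index> _)" [1000, 60])

section \<open>The Riemann sphere as a doubled triangle\<close>

lemma topspace_P1 [simp]: "topspace P1 = UNIV"
 by (auto simp: P1_def image_iff)

lemma compact_space_P1: "compact_space P1"
 by (simp add: P1_def)

lemma Hausdorff_space_P1: "Hausdorff_space P1"
 by (simp add: P1_def Hausdorff_space_Alexandroff_compactification locally_compact_space_euclidean)

text \<open>Neighbourhoods of \<open>None\<close> are complements of compact sets, so continuity at
  infinity is a limit along \<open>at_infinity\<close>.\<close>

lemma continuous_map_P1I:
 fixes g :: "complex option \<Rightarrow> 'b::topological_space"
 assumes 1: "continuous_on UNIV (\<lambda>z. g (Some z))" and 2: "((\<lambda>z. g (Some z)) \<longlongrightarrow> g None) at_infinity"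
 shows "continuous_map P1 euclidean g"
 unfolding continuous_map_def
proof (intro conjI allI impI)
 show "g \<in> topspace P1 \<rightarrow> topspace euclidean" by auto
 fix U :: "'b set" assume "openin euclidean U"
 then have U: "open U" by simp
 have o: "open {z. g (Some z) \<in> U}"
  using continuous_open_vimage[OF U, of "\<lambda>z. g (Some z)"] 1
  by (simp add: vimage_def continuous_on_eq_continuous_at)
 show "openin P1 {x \<in> topspace P1. g x \<in> U}"
 proof (cases "g None \<in> U")
  case False
  then have "{x \<in> topspace P1. g x \<in> U} = Some ` {z. g (Some z) \<in> U}"
   by auto (metis (mono_tags, lifting) image_eqI mem_Collect_eq not_None_eq)
  then show ?thesis using o by (simp add: P1_def)
 next
  case True
  let ?C = "- {z. g (Some z) \<in> U}"
  have "\<forall>\<^sub>F z in at_infinity. g (Some z) \<in> U" using 2 U True by (rule topological_tendstoD)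
  then obtain b where b: "\<forall>z. b \<le> norm z \<longrightarrow> g (Some z) \<in> U" by (auto simp: eventually_at_infinity)
  have "bounded ?C" unfolding bounded_iff by (rule exI[of _ b]) (use b linear in auto)
  moreover have "closed ?C" using o by (rule closed_Compl)
  ultimately have "compact ?C" by (simp add: compact_eq_bounded_closed)
  moreover have "{x \<in> topspace P1. g x \<in> U} = insert None (Some ` (UNIV - ?C))"
   using True by auto (metis (mono_tags, lifting) image_eqI mem_Collect_eq not_None_eq)
  ultimately show ?thesis using \<open>closed ?C\<close>
   by (auto simp: P1_def openin_Alexandroff_compactification)
 qed
qed

definition tri :: "(real^3) set" where
 "tri = {v. (\<forall>i. 0 \<le> v $ i) \<and> (\<Sum>i\<in>UNIV. v $ i) = 1}"

text \<open>
 The corners \<open>1, 2, 3\<close> are \<open>0, 1, \<infinity>\<close>. The three coordinates are the defects in the triangle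
 inequalities for the triangle with corners \<open>0, 1, z\<close>.
\<close>

definition bary :: "complex option \<Rightarrow> real^3" where
 "bary y = (case y of None \<Rightarrow> axis 3 1 | Some z \<Rightarrow>
   (let a = cmod z; b = cmod (z - 1) in
   vector [(1 + b - a) / (a + b + 1), (1 + a - b) / (a + b + 1), (a + b - 1) / (a + b + 1)]))"

definition hemi :: "bool \<Rightarrow> complex option set" where
 "hemi s = insert None (Some ` {z. if s then 0 \<le> Im z else Im z \<le> 0})"

text \<open>The two sections of \<open>bary\<close>, onto the closed upper (\<open>True\<close>) and
  lower (\<open>False\<close>) half plane; they present the sphere as the double of the
  triangle.\<close>

definition kap :: "bool \<Rightarrow> real^3 \<Rightarrow> complex option" where
 "kap s = inv_into (hemi s) bary"

lemma axis_3: "axis (3::3) (1::real) = vector [0, 0, 1]" "axis (1::3) (1::real) = vector [1, 0, 0]"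
 "axis (2::3) (1::real) = vector [0, 1, 0]"
 by (simp_all add: vec_eq_iff forall_3 axis_def)

lemma bary_None: "bary None = vector [0, 0, 1]"
 by (simp add: bary_def axis_3)

lemma bary_Some: "bary (Some z) = vector [(1 + cmod (z - 1) - cmod z) / (cmod z + cmod (z - 1) + 1),
  (1 + cmod z - cmod (z - 1)) / (cmod z + cmod (z - 1) + 1),
  (cmod z + cmod (z - 1) - 1) / (cmod z + cmod (z - 1) + 1)]"
 by (simp add: bary_def Let_def)

lemma bary_ineqs: "cmod z \<le> cmod (z - 1) + 1" "cmod (z - 1) \<le> cmod z + 1" "1 \<le> cmod z + cmod (z - 1)"
 "0 < cmod z + cmod (z - 1) + 1"
 using norm_triangle_ineq[of "z - 1" 1] norm_triangle_ineq4[of z 1] norm_triangle_ineq4[of z "z - 1"]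
 by (auto intro: add_nonneg_pos)

lemma bary_in_tri [simp]: "bary y \<in> tri"
proof (cases y)
 case None then show ?thesis by (simp add: bary_None tri_def forall_3 sum_3)
next
 case (Some z)
 then show ?thesis using bary_ineqs[of z]
  by (simp add: bary_Some tri_def forall_3 sum_3 add_divide_distrib[symmetric])
qed

text \<open>Heron's formula for the triangle with corners 0, 1 and z, whose area is |Im z| / 2: one
  of the defects vanishes exactly when the triangle is degenerate.\<close>

lemma bary_eq_0_iff: "(\<exists>i. bary (Some z) $ i = 0) \<longleftrightarrow> Im z = 0"
proof -
 define a where "a = cmod z" define b where "b = cmod (z - 1)"
 have a: "a\<^sup>2 = (Re z)\<^sup>2 + (Im z)\<^sup>2" and b: "b\<^sup>2 = (Re z - 1)\<^sup>2 + (Im z)\<^sup>2"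
  by (simp_all add: a_def b_def cmod_power2)
 have "4 * (Im z)\<^sup>2 = 4 * a\<^sup>2 - (a\<^sup>2 - b\<^sup>2 + 1)\<^sup>2" unfolding a b by (simp add: power2_eq_square algebra_simps)
 also have "\<dots> = (1 + b - a) * (1 + a - b) * (a + b - 1) * (a + b + 1)" by (simp add: power2_eq_square algebra_simps)
 finally have *: "4 * (Im z)\<^sup>2 = (1 + b - a) * (1 + a - b) * (a + b - 1) * (a + b + 1)" .
 have "a + b + 1 \<noteq> 0" using bary_ineqs(4)[of z] by (simp add: a_def b_def)
 then show ?thesis
 proof -
  assume nz: "a + b + 1 \<noteq> 0"
  have "(\<exists>i. bary (Some z) $ i = 0) \<longleftrightarrow> (1 + b - a) * (1 + a - b) * (a + b - 1) * (a + b + 1) = 0"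
  proof
   assume "\<exists>i. bary (Some z) $ i = 0"
   then obtain i where "bary (Some z) $ i = 0" by blast
   then show "(1 + b - a) * (1 + a - b) * (a + b - 1) * (a + b + 1) = 0"
    using exhaust_3[of i] nz by (auto simp: bary_Some simp flip: a_def b_def)
  next
   assume "(1 + b - a) * (1 + a - b) * (a + b - 1) * (a + b + 1) = 0"
   then have "bary (Some z) $ 1 = 0 \<or> bary (Some z) $ 2 = 0 \<or> bary (Some z) $ 3 = 0"
    using nz by (simp add: bary_Some flip: a_def b_def)
   then show "\<exists>i. bary (Some z) $ i = 0" by blast
  qed
  then show ?thesis unfolding *[symmetric] by simp
 qed
qed

lemma bary_in_edge_iff: "(\<exists>i. bary y $ i = 0) \<longleftrightarrow> y \<in> hemi True \<inter> hemi False"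
proof (cases y)
 case None
 have "bary None $ 1 = 0" by (simp add: bary_None)
 then show ?thesis using None by (auto simp: hemi_def)
next
 case (Some z)
 then show ?thesis using bary_eq_0_iff[of z] by (auto simp: hemi_def)
qed

lemma continuous_map_bary: "continuous_map P1 euclidean bary"
proof (rule continuous_map_P1I)
 have nz: "cmod z + cmod (z - 1) + 1 \<noteq> 0" for z using bary_ineqs(4)[of z] by simp
 have "continuous_on UNIV (\<lambda>z. bary (Some z) $ i)" for i
 proof -
  consider "i = 1" | "i = 2" | "i = 3" using exhaust_3 by blast
  then show ?thesis
   by cases (simp_all only: bary_Some vector_3, (intro continuous_intros nz ballI)+)
 qed
 then show "continuous_on UNIV (\<lambda>z. bary (Some z))" using continuous_on_vec_lambda[of UNIV "\<lambda>i z. bary (Some z) $ i"] by simp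
 have top: "filterlim (\<lambda>z. cmod z + cmod (z - 1) + 1) at_top (at_infinity :: complex filter)"
  by (rule filterlim_at_top_mono[OF filterlim_norm_at_top]) auto
 \<comment> \<open>This bounds the first two coordinates, since |z| and |z - 1| differ by at most
   1.\<close>
 have 0: "((\<lambda>z. 2 / (cmod z + cmod (z - 1) + 1)) \<longlongrightarrow> 0) at_infinity"
  by (rule tendsto_divide_0[OF tendsto_const filterlim_at_top_imp_at_infinity[OF top]])
 have "((\<lambda>z. bary (Some z) $ i) \<longlongrightarrow> bary None $ i) at_infinity" for i
 proof -
  consider "i = 1" | "i = 2" | "i = 3" using exhaust_3 by blast
  then show ?thesis
  proof cases
   case 1
   show ?thesis unfolding 1 bary_None vector_3 bary_Some
    by (rule tendsto_sandwich[OF _ _ tendsto_const 0])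
     (use bary_ineqs in \<open>auto intro!: always_eventually divide_right_mono divide_nonneg_pos simp: diff_le_eq add.commute\<close>)
  next
   case 2
   show ?thesis unfolding 2 bary_None vector_3 bary_Some
    by (rule tendsto_sandwich[OF _ _ tendsto_const 0])
     (use bary_ineqs in \<open>auto intro!: always_eventually divide_right_mono divide_nonneg_pos simp: diff_le_eq add.commute\<close>)
  next
   case 3
   have "((\<lambda>z. 1 - 2 / (cmod z + cmod (z - 1) + 1)) \<longlongrightarrow> 1 - 0) at_infinity"
    by (intro tendsto_intros 0)
   moreover have "1 - 2 / (cmod z + cmod (z - 1) + 1) = bary (Some z) $ 3" for z
    using nz[of z] by (simp add: bary_Some field_simps)
   ultimately show ?thesis unfolding 3 bary_None by simp
  qed
 qed
 then show "((\<lambda>z. bary (Some z)) \<longlongrightarrow> bary None) at_infinity" by (rule vec_tendstoI)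
qed

text \<open>The coordinates determine the distances of z from 0 and 1, hence z up to conjugation,
  and the half plane fixes the sign of the imaginary part.\<close>

lemma inj_on_bary: "inj_on bary (hemi s)"
proof -
 have *: "z = w" if eq: "bary (Some z) = bary (Some w)" and z: "if s then 0 \<le> Im z else Im z \<le> 0"
  and w: "if s then 0 \<le> Im w else Im w \<le> 0" for z w
 proof -
  define a b c e where "a = cmod z" and "b = cmod (z - 1)" and "c = cmod w" and "e = cmod (w - 1)"
  note d = this
  have p: "a + b + 1 > 0" "c + e + 1 > 0" using bary_ineqs(4) by (auto simp: d)
  have "bary (Some z) $ 3 = bary (Some w) $ 3" "bary (Some z) $ 1 = bary (Some w) $ 1" using eq by auto
  then have 1: "(a + b - 1) / (a + b + 1) = (c + e - 1) / (c + e + 1)"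
   and 2: "(1 + b - a) / (a + b + 1) = (1 + e - c) / (c + e + 1)" by (simp_all add: bary_Some d)
  have S: "a + b = c + e" using 1 p by (simp add: field_simps)
  have "b - a = e - c" using 2 p unfolding S by (simp add: field_simps)
  with S have "a = c" "b = e" by auto
  then have "a\<^sup>2 = c\<^sup>2" "b\<^sup>2 = e\<^sup>2" by auto
  then have sq: "(Re z)\<^sup>2 + (Im z)\<^sup>2 = (Re w)\<^sup>2 + (Im w)\<^sup>2"
   "(Re z - 1)\<^sup>2 + (Im z)\<^sup>2 = (Re w - 1)\<^sup>2 + (Im w)\<^sup>2" by (simp_all add: d cmod_power2)
  then have re: "Re z = Re w" by (simp add: power2_eq_square algebra_simps)
  then have "(Im z)\<^sup>2 = (Im w)\<^sup>2" using sq by simp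
  then have "Im z = Im w" using z w by (auto simp: power2_eq_iff split: if_splits)
  with re show ?thesis by (simp add: complex_eq_iff)
 qed
 have "bary (Some z) $ 3 \<noteq> 1" for z using bary_ineqs(4)[of z] by (simp add: bary_Some)
 then have nn: "bary (Some z) \<noteq> bary None" for z by (metis bary_None vector_3(3))
 show ?thesis
 proof (rule inj_onI)
  fix y y' assume y: "y \<in> hemi s" and y': "y' \<in> hemi s" and eq: "bary y = bary y'"
  show "y = y'"
  proof (cases y)
   case None then show ?thesis using eq nn by (cases y') auto
  next
   case (Some z)
   then obtain w where w: "y' = Some w" using eq nn[of z] by (cases y') auto
   show ?thesis using *[of z w] y y' eq Some w by (auto simp: hemi_def)
  qed
 qed
qed

lemma tri_eq_axis: assumes "v \<in> tri" "v $ i = 1" shows "v = axis i 1"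
 using assms exhaust_3[of i] by (auto simp: tri_def forall_3 sum_3 vec_eq_iff axis_def)

lemma bary_image: "bary ` hemi s = tri"
proof
 show "bary ` hemi s \<subseteq> tri" by auto
 show "tri \<subseteq> bary ` hemi s"
 proof
  fix v assume v: "v \<in> tri"
  show "v \<in> bary ` hemi s"
  proof (cases "v $ 3 = 1")
   case True
   then have "v = bary None" using tri_eq_axis[OF v True] by (simp add: bary_None axis_3)
   then show ?thesis by (auto simp: hemi_def)
  next
   case False
   have t: "0 \<le> v$1" "0 \<le> v$2" "0 \<le> v$3" "v$1 + v$2 + v$3 = 1" using v by (auto simp: tri_def sum_3)
   define q where "q = 1 - v$3"
   have q: "q > 0" using t False by (auto simp: q_def)
   \<comment> \<open>With \<open>s = a + b + 1\<close> the coordinates satisfy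
     \<open>1 - v$1 = 2 * a / s\<close>, \<open>1 - v$2 = 2 * b / s\<close> and
     \<open>1 - v$3 = 2 / s\<close>, which leaves only these distances of z from 0 and 1.\<close>
   define a where "a = (1 - v$1) / q" define b where "b = (1 - v$2) / q"
   have q': "q = v$1 + v$2" using t by (simp add: q_def)
   have aq: "a * q = v$2 + v$3" "b * q = v$1 + v$3" using q t by (simp_all add: a_def b_def)
   have "a * q \<le> (b + 1) * q" "b * q \<le> (a + 1) * q" "1 * q \<le> (a + b) * q" "(a + b + 1) * q = 2"
    using aq q' t by (simp_all add: distrib_right)
   then have ab: "0 \<le> a" "0 \<le> b" "a \<le> b + 1" "b \<le> a + 1" "1 \<le> a + b" and S: "a + b + 1 = 2 / q"
    using q t by (simp_all only: mult_le_cancel_right nonzero_eq_divide_eq) (simp_all add: a_def b_def)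
   \<comment> \<open>The real part of a point at distance a from 0 and b from 1; Heron's formula
     then shows that the square of the imaginary part is non-negative.\<close>
   define x where "x = (a\<^sup>2 - b\<^sup>2 + 1) / 2"
   have x2: "2 * x = a\<^sup>2 - b\<^sup>2 + 1" by (simp add: x_def)
   have "4 * (a\<^sup>2 - x\<^sup>2) = 4 * a\<^sup>2 - (2 * x)\<^sup>2" by (simp add: power2_eq_square algebra_simps)
   also have "\<dots> = 4 * a\<^sup>2 - (a\<^sup>2 - b\<^sup>2 + 1)\<^sup>2" by (simp only: x2)
   also have "\<dots> = (1 + b - a) * (1 + a - b) * (a + b - 1) * (a + b + 1)" by (simp add: power2_eq_square algebra_simps)
   also have "\<dots> \<ge> 0" using ab by auto
   finally have y: "a\<^sup>2 - x\<^sup>2 \<ge> 0" by simp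
   define z where "z = Complex x ((if s then 1 else -1) * sqrt (a\<^sup>2 - x\<^sup>2))"
   have re: "Re z = x" by (simp add: z_def)
   have im: "(Im z)\<^sup>2 = a\<^sup>2 - x\<^sup>2" using real_sqrt_pow2[OF y] by (cases s) (simp_all add: z_def)
   have "(cmod z)\<^sup>2 = a\<^sup>2" unfolding cmod_power2 im re by simp
   then have z1: "cmod z = a" using ab(1) by (simp add: power2_eq_iff_nonneg)
   have "(cmod (z - 1))\<^sup>2 = (x - 1)\<^sup>2 + (a\<^sup>2 - x\<^sup>2)"
    unfolding cmod_power2 im[symmetric] by (simp add: re)
   also have "\<dots> = a\<^sup>2 - 2 * x + 1" by (simp add: power2_eq_square algebra_simps)
   also have "\<dots> = b\<^sup>2" unfolding x2 by simp
   finally have z2: "cmod (z - 1) = b" using ab(2) by (simp add: power2_eq_iff_nonneg)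
   have "(1 + b - a) * q = q + b * q - a * q" by (simp add: algebra_simps)
   also have "\<dots> = 2 * v$1" unfolding aq by (simp add: q')
   finally have 1: "(1 + b - a) * q = 2 * v$1" .
   have "(1 + a - b) * q = q + a * q - b * q" by (simp add: algebra_simps)
   also have "\<dots> = 2 * v$2" unfolding aq by (simp add: q')
   finally have 2: "(1 + a - b) * q = 2 * v$2" .
   have "(a + b - 1) * q = a * q + b * q - q" by (simp add: algebra_simps)
   also have "\<dots> = 2 * v$3" unfolding aq by (simp add: q')
   finally have 3: "(a + b - 1) * q = 2 * v$3" .
   have e: "bary (Some z) = vector [(1 + b - a) / (2 / q), (1 + a - b) / (2 / q), (a + b - 1) / (2 / q)]"
    unfolding bary_Some z1 z2 S ..
   have "bary (Some z) = vector [v$1, v$2, v$3]" unfolding e divide_divide_eq_right 1 2 3 by simp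
   then have "v = bary (Some z)" by (simp add: vec_eq_iff forall_3)
   moreover have "Some z \<in> hemi s"
    unfolding hemi_def z_def by (intro insertI2 imageI) (use real_sqrt_ge_zero[OF y] in simp)
   ultimately show ?thesis by blast
  qed
 qed
qed

lemma kap_bary: "y \<in> hemi s \<Longrightarrow> kap s (bary y) = y"
 unfolding kap_def by (rule inv_into_f_f[OF inj_on_bary])

lemma bary_kap [simp]: "v \<in> tri \<Longrightarrow> bary (kap s v) = v"
 unfolding kap_def by (rule f_inv_into_f) (simp add: bary_image)

lemma kap_in_hemi: "v \<in> tri \<Longrightarrow> kap s v \<in> hemi s"
 unfolding kap_def by (rule inv_into_into) (simp add: bary_image)

lemma hemi_cases: "\<exists>s. y \<in> hemi s"
proof (cases y)
 case None then show ?thesis by (simp add: hemi_def)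
next
 case (Some z)
 then have "y \<in> hemi (0 \<le> Im z)" by (cases "0 \<le> Im z") (simp_all add: hemi_def)
 then show ?thesis ..
qed

lemma kap_cases: obtains s where "y = kap s (bary y)"
proof -
 obtain s where "y \<in> hemi s" using hemi_cases by blast
 then show thesis by (rule that[OF kap_bary[symmetric]])
qed

text \<open>\<open>bary\<close> recovers the coordinates, and the two half planes meet exactly in
  the points with a vanishing coordinate.\<close>

lemma kap_eq_iff: assumes "v \<in> tri" "w \<in> tri"
 shows "kap s v = kap s' w \<longleftrightarrow> v = w \<and> (s = s' \<or> (\<exists>i. v $ i = 0))"
proof -
 have "kap s v = kap s' v" if "\<exists>i. v $ i = 0"
 proof -
  have "kap s v \<in> hemi True \<inter> hemi False" using that assms(1) bary_in_edge_iff[of "kap s v"] by simp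
  then have "kap s v \<in> hemi s'" by (cases s') auto
  then show ?thesis using kap_bary[of "kap s v" s'] assms by simp
 qed
 moreover have "\<exists>i. v $ i = 0" if "kap s v = kap s' v" "s \<noteq> s'"
 proof -
  have "kap s v \<in> hemi s" "kap s v \<in> hemi s'"
   using kap_in_hemi[OF assms(1), of s] kap_in_hemi[OF assms(1), of s'] that(1) by simp_all
  then have "kap s v \<in> hemi True \<inter> hemi False"
   using that(2) by (cases s; cases s'; simp)
  then show ?thesis using bary_in_edge_iff[of "kap s v"] bary_kap[OF assms(1), of s] by simp
 qed
 moreover have "v = w" if "kap s v = kap s' w"
  using arg_cong[OF that, of bary] bary_kap[OF assms(1), of s] bary_kap[OF assms(2), of s'] by simp
 ultimately show ?thesis by blast
qed

lemma compact_tri: "compact tri"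
proof -
 have "tri \<subseteq> cball 0 2"
 proof
  fix v assume "v \<in> tri"
  then have "(\<Sum>i\<in>UNIV. \<bar>v $ i\<bar>) = 1" by (simp add: tri_def)
  then have "norm v \<le> 1" using norm_le_l1_cart[of v] by simp
  then show "v \<in> cball 0 2" by simp
 qed
 moreover have "closed tri"
 proof -
  have "tri = (\<Inter>i. {v. 0 \<le> v $ i}) \<inter> {v. (\<Sum>i\<in>UNIV. v $ i) = 1}" by (auto simp: tri_def)
  moreover have "closed \<dots>"
   by (intro closed_Int closed_INT ballI closed_Collect_le closed_Collect_eq continuous_intros)
  ultimately show ?thesis by metis
 qed
 ultimately show ?thesis using compact_eq_bounded_closed bounded_subset bounded_cball by blast
qed

lemma convex_tri: "convex tri"
 by (auto simp: convex_def tri_def sum.distrib sum_distrib_left[symmetric])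

lemma closedin_hemi: "closedin P1 (hemi s)"
proof -
 have "- hemi s = Some ` {z. if s then Im z < 0 else 0 < Im z}"
 proof (rule Set.set_eqI)
  fix y show "y \<in> - hemi s \<longleftrightarrow> y \<in> Some ` {z. if s then Im z < 0 else 0 < Im z}"
   by (cases y) (auto simp: hemi_def image_iff not_le)
 qed
 moreover have "openin P1 \<dots>"
  by (cases s) (auto simp: P1_def open_halfspace_Im_lt open_halfspace_Im_gt)
 ultimately have "openin P1 (UNIV - hemi s)" by (simp add: Compl_eq_Diff_UNIV)
 then show ?thesis by (simp add: closedin_def)
qed

text \<open>A continuous bijection from the compact half plane onto the Hausdorff triangle is a
  homeomorphism, so its inverse is continuous.\<close>

lemma continuous_map_kap: "continuous_map (top_of_set tri) P1 (kap s)"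
proof -
 let ?H = "subtopology P1 (hemi s)"
 have "homeomorphic_map ?H (top_of_set tri) bary"
 proof (rule continuous_imp_homeomorphic_map)
  show "continuous_map ?H (top_of_set tri) bary"
   using continuous_map_bary
   by (simp add: continuous_map_in_subtopology continuous_map_from_subtopology)
  show "compact_space ?H" using closedin_hemi compact_space_P1
   by (simp add: closedin_compact_space compact_space_subtopology)
  show "Hausdorff_space (top_of_set tri)" by (simp add: Hausdorff_space_subtopology)
 qed (use bary_image inj_on_bary in \<open>auto\<close>)
 then obtain g where g: "homeomorphic_maps ?H (top_of_set tri) bary g"
  using homeomorphic_map_maps by blast
 then have "continuous_map (top_of_set tri) P1 g"
  by (simp add: homeomorphic_maps_def continuous_map_in_subtopology)
 moreover have "g v = kap s v" if "v \<in> tri" for v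
 proof -
  have "bary (g v) = v" "g v \<in> hemi s" using g that by (auto simp: homeomorphic_maps_def continuous_map_def)
  then show ?thesis using kap_bary[of "g v" s] by simp
 qed
 ultimately show ?thesis using continuous_map_eq[of "top_of_set tri" P1 g "kap s"] by simp
qed

lemma axis_in_tri [simp]: "axis i 1 \<in> tri"
 using exhaust_3[of i] by (auto simp: tri_def axis_3 forall_3 sum_3)

lemma bary_corner: "bary (Some 0) = axis 1 1" "bary (Some 1) = axis 2 1" "bary None = axis 3 1"
 by (simp_all add: bary_Some bary_None axis_3)

lemma kap_corner: "kap s (axis 1 1) = Some 0" "kap s (axis 2 1) = Some 1" "kap s (axis 3 1) = None"
proof -
 have "kap s (bary (Some 0)) = Some 0" "kap s (bary (Some 1)) = Some 1" "kap s (bary None) = None"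
  by (intro kap_bary; simp add: hemi_def)+
 then show "kap s (axis 1 1) = Some 0" "kap s (axis 2 1) = Some 1" "kap s (axis 3 1) = None"
  by (simp_all only: bary_corner)
qed

lemma branch_point_iff: "y \<in> {Some 0, Some 1, None} \<longleftrightarrow> (\<exists>i. bary y = axis i 1)"
proof
 assume "y \<in> {Some 0, Some 1, None}" then consider "y = Some 0" | "y = Some 1" | "y = None" by blast
 then show "\<exists>i. bary y = axis i 1" by cases (metis bary_corner)+
next
 assume "\<exists>i. bary y = axis i 1"
 then obtain i where i: "bary y = axis i 1" by blast
 obtain s where "y = kap s (bary y)" by (rule kap_cases)
 then have "y = kap s (axis i 1)" unfolding i .
 moreover consider "i = 1" | "i = 2" | "i = 3" using exhaust_3 by blast
 ultimately show "y \<in> {Some 0, Some 1, None}"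
  by cases (metis kap_corner insertCI)+
qed

section \<open>Tilings\<close>

declare split_paired_All [simp del] split_paired_Ex [simp del]

lemma continuous_map_scaleR:
 fixes g :: "'a \<Rightarrow> 'b::real_normed_vector"
 assumes "continuous_map X euclideanreal f" "continuous_map X euclidean g"
 shows "continuous_map X euclidean (\<lambda>x. f x *\<^sub>R g x)"
 using assms by (simp add: continuous_map_atin tendsto_scaleR)

definition tiles :: "nat \<Rightarrow> (bool \<times> nat) set" where
 "tiles d = UNIV \<times> {..<d}"

text \<open>\<open>t i\<close> is the passage between sheets across the side opposite corner i:
  along that side the upper tile p meets the lower tile \<open>t i p\<close>.\<close>

definition gstep :: "(3 \<Rightarrow> nat \<Rightarrow> nat) \<Rightarrow> nat \<Rightarrow> real^3 \<Rightarrow> ((bool \<times> nat) \<times> (bool \<times> nat)) set" where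
 "gstep t d v = {((True, p), (False, t i p)) | p i. p < d \<and> v $ i = 0}"

text \<open>The relation depends on v only through its vanishing coordinates. At
  \<open>v = 0\<close>, which is no point of the triangle, all sides count, so
  \<open>glue t d 0\<close> is reachability in the adjacency graph of the tiles.\<close>

definition glue :: "(3 \<Rightarrow> nat \<Rightarrow> nat) \<Rightarrow> nat \<Rightarrow> real^3 \<Rightarrow> ((bool \<times> nat) \<times> (bool \<times> nat)) set" where
 "glue t d v = (gstep t d v \<union> (gstep t d v)\<inverse>)\<^sup>*"

lemma finite_tiles [simp]: "finite (tiles d)"
 by (simp add: tiles_def)

lemma mem_tiles [simp]: "(s, p) \<in> tiles d \<longleftrightarrow> p < d"
 by (simp add: tiles_def)

lemma glue_refl [simp]: "(x, x) \<in> glue t d v"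
 by (simp add: glue_def)

lemma glue_sym: "(x, y) \<in> glue t d v \<Longrightarrow> (y, x) \<in> glue t d v"
 unfolding glue_def by (rule symD[OF sym_rtrancl]) (auto simp: sym_def)

lemma glue_trans: "(x, y) \<in> glue t d v \<Longrightarrow> (y, z) \<in> glue t d v \<Longrightarrow> (x, z) \<in> glue t d v"
 unfolding glue_def by (rule rtrancl_trans)

lemma glue_mono: "(\<And>i. v $ i = 0 \<Longrightarrow> w $ i = 0) \<Longrightarrow> glue t d v \<subseteq> glue t d w"
 unfolding glue_def gstep_def by (intro rtrancl_mono) blast

lemma glue_step: "p < d \<Longrightarrow> v $ i = 0 \<Longrightarrow> ((True, p), (False, t i p)) \<in> glue t d v"
 unfolding glue_def gstep_def by blast

lemma glue_interior: assumes "\<And>i. v $ i \<noteq> 0" shows "glue t d v = Id"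
proof -
 have "gstep t d v = {}" using assms by (auto simp: gstep_def)
 then show ?thesis by (simp add: glue_def)
qed

lemma glue_invariant:
 assumes "(x, y) \<in> glue t d v"
  and "\<And>p i. p < d \<Longrightarrow> v $ i = 0 \<Longrightarrow> P (True, p) \<longleftrightarrow> P (False, t i p)"
 shows "P x \<longleftrightarrow> P y"
 using assms(1) unfolding glue_def
proof (induction rule: rtrancl_induct)
 case (step y z)
 from step(2) have "P y \<longleftrightarrow> P z" using assms(2) by (auto simp: gstep_def)
 with step show ?case by simp
qed simp

text \<open>Only one side is involved and \<open>t i\<close> is injective, so every chain of steps
  runs back and forth between two tiles.\<close>

lemma glue_edge:
 assumes "\<And>i. t i permutes {..<d}" "v $ i = 0" "\<And>j. j \<noteq> i \<Longrightarrow> v $ j \<noteq> 0" "(x, y) \<in> glue t d v"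
 shows "x = y \<or> (\<exists>p<d. (x = (True, p) \<and> y = (False, t i p)) \<or> (y = (True, p) \<and> x = (False, t i p)))"
 using assms(4) unfolding glue_def
proof (induction rule: rtrancl_induct)
 case (step y z)
 have i: "\<And>j. v $ j = 0 \<Longrightarrow> j = i" using assms(3) by blast
 have inj: "inj (t i)" using assms(1) by (rule permutes_inj)
 from step(2) obtain p where p: "p < d" "(y = (True, p) \<and> z = (False, t i p)) \<or> (z = (True, p) \<and> y = (False, t i p))"
  using i by (auto simp: gstep_def)
 with step(3) inj show ?case by (auto dest: injD)
qed simp

lemma tri_cases:
 assumes "v \<in> tri"
 obtains (corner) i where "v = axis i 1" | (edge) i where "v $ i = 0" "\<And>j. j \<noteq> i \<Longrightarrow> 0 < v $ j"
  | (interior) "\<And>i. 0 < v $ i"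
proof -
 have nn: "\<And>i. 0 \<le> v $ i" and s: "v$1 + v$2 + v$3 = 1" using assms by (auto simp: tri_def sum_3)
 show thesis
 proof (cases "\<exists>i. v $ i = 0")
  case False then show ?thesis using nn interior by (metis less_eq_real_def)
 next
  case True
  then obtain i where i: "v $ i = 0" by blast
  show ?thesis
  proof (cases "\<forall>j. j \<noteq> i \<longrightarrow> v $ j \<noteq> 0")
   case True then show ?thesis using nn i edge by (metis less_eq_real_def)
  next
   case False
   then obtain j where j: "j \<noteq> i" "v $ j = 0" by blast
   have "\<exists>k. v $ k = 1" using exhaust_3[of i] exhaust_3[of j] i j s
    by (elim disjE) (auto intro: exI[of _ 1] exI[of _ 2] exI[of _ 3])
   then show ?thesis using tri_eq_axis[OF assms] corner by blast
  qed
 qed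
qed

text \<open>A presentation of X over the sphere as a quotient of 2 d closed triangles. By
  \<open>S_eq\<close> points of tiles coincide only if \<open>glue\<close> forces it, so the
  permutations determine the surface up to homeomorphism over the sphere.\<close>

locale tiling =
 fixes X :: "'a topology" and f :: "'a \<Rightarrow> complex option" and d :: nat
  and t :: "3 \<Rightarrow> nat \<Rightarrow> nat" and S :: "bool \<times> nat \<Rightarrow> real^3 \<Rightarrow> 'a"
 assumes perm: "t i permutes {..<d}"
  and Haus: "Hausdorff_space X"
  and contf: "continuous_map X P1 f"
  and contS: "x \<in> tiles d \<Longrightarrow> continuous_map (top_of_set tri) X (S x)"
  and fS: "\<lbrakk>x \<in> tiles d; v \<in> tri\<rbrakk> \<Longrightarrow> f (S x v) = kap (fst x) v"
  and cover: "y \<in> topspace X \<Longrightarrow> \<exists>x\<in>tiles d. \<exists>v\<in>tri. y = S x v"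
  and S_eq: "\<lbrakk>x \<in> tiles d; x' \<in> tiles d; v \<in> tri\<rbrakk> \<Longrightarrow> S x v = S x' v \<longleftrightarrow> (x, x') \<in> glue t d v"
begin

lemma S_in [simp]: "x \<in> tiles d \<Longrightarrow> v \<in> tri \<Longrightarrow> S x v \<in> topspace X"
 using contS[of x] by (auto simp: continuous_map_def)

lemma bary_fS [simp]: "x \<in> tiles d \<Longrightarrow> v \<in> tri \<Longrightarrow> bary (f (S x v)) = v"
 by (simp add: fS)

lemma S_eq_iff: "\<lbrakk>x \<in> tiles d; x' \<in> tiles d; v \<in> tri; w \<in> tri\<rbrakk>
  \<Longrightarrow> S x v = S x' w \<longleftrightarrow> v = w \<and> (x, x') \<in> glue t d v"
 by (metis S_eq bary_fS)

lemma cont_baryf: "continuous_map X (top_of_set tri) (\<lambda>y. bary (f y))"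
 using continuous_map_compose[OF contf continuous_map_bary]
 by (simp add: continuous_map_in_subtopology o_def)

lemma closedin_S_image: assumes "x \<in> tiles d" "closed C" "C \<subseteq> tri" shows "closedin X (S x ` C)"
proof -
 have "compactin (top_of_set tri) C"
  using assms compact_tri by (simp add: compactin_subtopology compact_eq_bounded_closed)
   (meson bounded_subset)
 then have "compactin X (S x ` C)" using contS[OF assms(1)] image_compactin by blast
 then show ?thesis using Haus compactin_imp_closedin by blast
qed

definition tile_of :: "'a \<Rightarrow> bool \<times> nat" where
 "tile_of y = (SOME x. x \<in> tiles d \<and> S x (bary (f y)) = y)"

lemma tile_of: assumes "y \<in> topspace X" shows "tile_of y \<in> tiles d" "S (tile_of y) (bary (f y)) = y"
proof -
 obtain x v where "x \<in> tiles d" "v \<in> tri" "y = S x v" using cover[OF assms] by blast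
 then have "x \<in> tiles d \<and> S x (bary (f y)) = y" by simp
 then have "\<exists>x. x \<in> tiles d \<and> S x (bary (f y)) = y" by (rule exI)
 from someI_ex[OF this] show "tile_of y \<in> tiles d" "S (tile_of y) (bary (f y)) = y"
  by (auto simp: tile_of_def)
qed

lemma tile_of_S: "x \<in> tiles d \<Longrightarrow> v \<in> tri \<Longrightarrow> (x, tile_of (S x v)) \<in> glue t d v"
 using tile_of[of "S x v"] S_eq[of x "tile_of (S x v)" v] by simp

text \<open>The tiles form a finite closed cover, and \<open>bary \<circ> f\<close> inverts the
  parametrisation of each of them.\<close>

lemma continuous_on_tiles:
 assumes "\<And>x. x \<in> tiles d \<Longrightarrow> continuous_map (top_of_set tri) Y (\<lambda>v. g (S x v))"
 shows "continuous_map X Y g"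
proof (rule pasting_lemma_closed[of "tiles d" X "\<lambda>x. S x ` tri" Y "\<lambda>x y. g (S x (bary (f y)))"])
 show "closedin X (S x ` tri)" if "x \<in> tiles d" for x
  using that by (intro closedin_S_image compact_imp_closed compact_tri) auto
 show "continuous_map (subtopology X (S x ` tri)) Y (\<lambda>y. g (S x (bary (f y))))" if "x \<in> tiles d" for x
  using continuous_map_compose[OF continuous_map_from_subtopology[OF cont_baryf] assms[OF that]]
  by (simp add: o_def)
 show "\<exists>j. j \<in> tiles d \<and> x \<in> S j ` tri \<and> g x = g (S j (bary (f x)))" if "x \<in> topspace X" for x
  using tile_of[OF that] by (metis bary_in_tri imageI)
 show "g (S i (bary (f x))) = g (S j (bary (f x)))"
  if ij: "i \<in> tiles d" "j \<in> tiles d" and x: "x \<in> topspace X \<inter> S i ` tri \<inter> S j ` tri" for i j x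
 proof -
  obtain v w where "v \<in> tri" "w \<in> tri" "x = S i v" "x = S j w" using x by blast
  then have "S i (bary (f x)) = x" "S j (bary (f x)) = x" using bary_fS[OF ij(1)] bary_fS[OF ij(2)] by metis+
  then show ?thesis by simp
 qed
qed simp

lemma compact_X: "compact_space X"
proof -
 have "compactin X (\<Union>x\<in>tiles d. S x ` tri)"
 proof (rule compactin_Union)
  fix C assume "C \<in> (\<lambda>x. S x ` tri) ` tiles d"
  then obtain x where "x \<in> tiles d" "C = S x ` tri" by blast
  then show "compactin X C" using image_compactin[OF _ contS] compact_tri
   by (simp add: compactin_subtopology)
 qed simp
 moreover have "(\<Union>x\<in>tiles d. S x ` tri) = topspace X" using cover by force
 ultimately show ?thesis by (simp add: compact_space_def)
qed

lemma connectedin_S: "x \<in> tiles d \<Longrightarrow> connectedin X (S x ` tri)"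
 using connectedin_continuous_map_image[OF contS] convex_connected[OF convex_tri]
 by (simp add: connectedin_subtopology)

text \<open>Tiles are connected, closed and finitely many. A class of mutually reachable tiles
  therefore covers a clopen set, and conversely a clopen set contains or avoids whole tiles and is
  passed on to neighbours.\<close>

lemma connected_iff: "connected_space X \<longleftrightarrow> (\<forall>x\<in>tiles d. \<forall>x'\<in>tiles d. (x, x') \<in> glue t d 0)"
proof
 assume conn: "connected_space X"
 show "\<forall>x\<in>tiles d. \<forall>x'\<in>tiles d. (x, x') \<in> glue t d 0"
 proof (intro ballI)
  fix x x' assume x: "x \<in> tiles d" and x': "x' \<in> tiles d"
  define C where "C = {z \<in> tiles d. (x, z) \<in> glue t d 0}"
  define U where "U = (\<Union>z\<in>C. S z ` tri)" define W where "W = (\<Union>z\<in>tiles d - C. S z ` tri)"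
  have fin: "finite C" by (simp add: C_def)
  have "closedin X U" "closedin X W" unfolding U_def W_def using compact_imp_closed[OF compact_tri] fin
   by (auto intro!: closedin_Union closedin_S_image simp: C_def)
  moreover have "U \<union> W = topspace X" using cover by (force simp: U_def W_def C_def)
  moreover have "U \<inter> W = {}"
  proof (rule ccontr)
   assume "U \<inter> W \<noteq> {}"
   then obtain z z' v w where z: "z \<in> C" "z' \<in> tiles d" "z' \<notin> C" "v \<in> tri" "w \<in> tri" "S z v = S z' w"
    by (auto simp: U_def W_def)
   then have "(z, z') \<in> glue t d v" using S_eq_iff[of z z' v w] by (auto simp: C_def)
   then have "(z, z') \<in> glue t d 0" using glue_mono[of v 0] by auto
   then show False using z by (auto simp: C_def intro: glue_trans)
  qed
  ultimately have UW: "U = {} \<or> W = {}" using conn unfolding connected_space_closedin by (metis subset_refl)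
  have "x \<in> C" using x by (simp add: C_def)
  then have "S x (axis 1 1) \<in> U" unfolding U_def using axis_in_tri[of 1] by blast
  then have "W = {}" using UW by blast
  then have "x' \<in> C" using x' axis_in_tri[of 1] unfolding W_def by blast
  then show "(x, x') \<in> glue t d 0" by (simp add: C_def)
 qed
next
 assume a: "\<forall>x\<in>tiles d. \<forall>x'\<in>tiles d. (x, x') \<in> glue t d 0"
 show "connected_space X"
  unfolding connected_space_clopen_in
 proof (intro allI impI)
  fix U assume U: "openin X U \<and> closedin X U"
  have all: "S x ` tri \<subseteq> U \<or> S x ` tri \<inter> U = {}" if "x \<in> tiles d" for x
   using connectedin_clopen_cases[OF connectedin_S[OF that], of U] U by (auto simp: disjnt_def)
  define P where "P x \<longleftrightarrow> S x ` tri \<subseteq> U" for x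
  have P: "P x \<longleftrightarrow> S x v \<in> U" if "x \<in> tiles d" "v \<in> tri" for x v
   using all[OF that(1)] that(2) by (auto simp: P_def)
  have eq: "P x \<longleftrightarrow> P x'" if "x \<in> tiles d" "x' \<in> tiles d" for x x'
  proof (rule glue_invariant)
   show "(x, x') \<in> glue t d 0" using a that by blast
   fix p i assume p: "p < d"
   \<comment> \<open>An endpoint of the side opposite corner i, hence a point common to both
     neighbouring tiles.\<close>
   define v :: "real^3" where "v = axis (i + 1) 1"
   have v: "v \<in> tri" unfolding v_def by simp
   have v0: "v $ i = 0" by (simp add: v_def axis_def)
   have t: "(True, p) \<in> tiles d" "(False, t i p) \<in> tiles d"
    using p permutes_in_image[OF perm[of i], of p] by auto
   have "S (True, p) v = S (False, t i p) v" using S_eq[OF t v] glue_step[OF p v0] by simp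
   then show "P (True, p) \<longleftrightarrow> P (False, t i p)" using P t v by simp
  qed
  show "U = {} \<or> U = topspace X"
  proof (rule disjCI)
   assume "U \<noteq> topspace X"
   then obtain y where y: "y \<in> topspace X" "y \<notin> U" using U openin_subset by blast
   then have "\<not> P (tile_of y)" using P[OF tile_of(1) bary_in_tri, OF y(1)] tile_of(2)[OF y(1)] by metis
   then have "\<not> P x" if "x \<in> tiles d" for x using eq[OF that tile_of(1)[OF y(1)]] by simp
   then have "y \<notin> U" if "y \<in> topspace X" for y
    using P[OF tile_of(1) bary_in_tri, OF that] tile_of[OF that] by metis
   then show "U = {}" using U openin_subset by blast
  qed
 qed
qed

section \<open>Vertices of a tiling and their open stars\<close>

definition vertices :: "3 \<Rightarrow> 'a set" where
 "vertices i = (\<lambda>x. S x (axis i 1)) ` tiles d"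

text \<open>The open star of the vertex z; the condition \<open>0 < v $ i\<close> removes the side
  opposite to z from each of its tiles.\<close>

definition star :: "3 \<Rightarrow> 'a \<Rightarrow> 'a set" where
 "star i z = {S x v | x v. x \<in> tiles d \<and> v \<in> tri \<and> 0 < v $ i \<and> S x (axis i 1) = z}"

lemma axis_nth: "axis i (1::real) $ j = (if j = i then 1 else 0)"
 by (simp add: axis_def)

text \<open>A coordinate that vanishes at v is not the i-th one, so it vanishes at corner i as well
  and the gluing at v persists there.\<close>

lemma corner_eq:
 assumes "x \<in> tiles d" "x' \<in> tiles d" "v \<in> tri" "0 < v $ i" "S x v = S x' v"
 shows "S x (axis i 1) = S x' (axis i 1)"
proof -
 have "glue t d v \<subseteq> glue t d (axis i 1)" using assms(4) by (intro glue_mono) (auto simp: axis_nth)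
 then show ?thesis using S_eq assms by auto
qed

lemma star_iff:
 assumes "x \<in> tiles d" "v \<in> tri"
 shows "S x v \<in> star i z \<longleftrightarrow> 0 < v $ i \<and> S x (axis i 1) = z"
proof
 assume "S x v \<in> star i z"
 then obtain x' w where w: "S x v = S x' w" "x' \<in> tiles d" "w \<in> tri" "0 < w $ i" "S x' (axis i 1) = z"
  by (auto simp: star_def)
 then have "v = w" using S_eq_iff assms by auto
 then show "0 < v $ i \<and> S x (axis i 1) = z" using corner_eq[of x x' v i] w assms by auto
qed (use assms in \<open>auto simp: star_def\<close>)

lemma star_subset: "star i z \<subseteq> topspace X"
 by (auto simp: star_def)

text \<open>The complement is a finite union of closed sets: the tiles whose corner i is another
  vertex, and the sides opposite corner i of all tiles.\<close>

lemma openin_star: "openin X (star i z)"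
proof -
 define K where "K = {v \<in> tri. v $ i = 0}"
 define A where "A = (\<Union>x\<in>{x \<in> tiles d. S x (axis i 1) \<noteq> z}. S x ` tri) \<union> (\<Union>x\<in>tiles d. S x ` K)"
 have "closed K" unfolding K_def using compact_imp_closed[OF compact_tri]
  by (intro closed_Collect_conj[unfolded Collect_conj_eq] closed_Int closed_Collect_eq continuous_intros
    | simp add: Collect_conj_eq)+
 then have "closedin X A" unfolding A_def using compact_imp_closed[OF compact_tri]
  by (intro closedin_Un closedin_Union) (auto intro!: closedin_S_image simp: K_def)
 moreover have "star i z = topspace X - A"
 proof (intro equalityI subsetI)
  fix y assume y: "y \<in> star i z"
  then have yX: "y \<in> topspace X" using star_subset by blast
  have "y \<notin> S x ` tri" if "x \<in> tiles d" "S x (axis i 1) \<noteq> z" for x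
   using star_iff[OF that(1)] that y by blast
  moreover have "y \<notin> S x ` K" if "x \<in> tiles d" for x
   using star_iff[OF that] y by (auto simp: K_def)
  ultimately show "y \<in> topspace X - A" using yX by (auto simp: A_def)
 next
  fix y assume y: "y \<in> topspace X - A"
  then obtain x v where x: "x \<in> tiles d" "v \<in> tri" "y = S x v" using cover by blast
  have "S x (axis i 1) = z" using y x by (auto simp: A_def)
  moreover have "v $ i \<noteq> 0" using y x by (auto simp: A_def K_def)
  moreover have "v $ i \<ge> 0" using x by (auto simp: tri_def)
  ultimately show "y \<in> star i z" using star_iff x by auto
 qed
 ultimately show ?thesis by (simp add: openin_diff)
qed

lemma star_cover: assumes "y \<in> topspace X" shows "\<exists>i z. z \<in> vertices i \<and> y \<in> star i z"
proof -
 obtain x v where x: "x \<in> tiles d" "v \<in> tri" "y = S x v" using cover assms by blast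
 have "\<exists>i. 0 < v $ i" using x(2)
 proof (cases rule: tri_cases)
  case (edge i) then show ?thesis by (intro exI[of _ "i + 1"]) simp
 qed (auto simp: axis_nth)
 then show ?thesis using x star_iff unfolding vertices_def by blast
qed

text \<open>Each tile is contracted linearly to its corner i. The contractions fit together: before
  time 1 a vanishing coordinate j \<noteq> i keeps vanishing, so glued points stay glued, and at
  time 1 the corners agree.\<close>

lemma contractible_star: assumes z: "z \<in> vertices i" shows "contractible_space (subtopology X (star i z))"
proof -
 define e :: "real^3" where "e = axis i 1"
 define c where "c s v = (1 - s) *\<^sub>R v + s *\<^sub>R e" for s v
 have c_tri: "c s v \<in> tri" if "v \<in> tri" "0 \<le> s" "s \<le> 1" for s v
  using that unfolding c_def by (intro convexD[OF convex_tri]) (auto simp: e_def)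
 have c_pos: "0 < c s v $ i" if "0 < v $ i" "0 \<le> s" "s \<le> 1" for s v
 proof (cases "s = 1")
  case False
  then have "0 < (1 - s) * v $ i" using that by auto
  then show ?thesis using that by (simp add: c_def e_def add_pos_nonneg)
 qed (simp add: c_def e_def)
 define Y where "Y = prod_topology (top_of_set {0..1::real}) (subtopology X (star i z))"
 define h where "h = (\<lambda>p. S (tile_of (snd p)) (c (fst p) (bary (f (snd p)))))"
 have topY: "topspace Y = {0..1} \<times> star i z" using star_subset by (auto simp: Y_def)
 have snd: "continuous_map Y X snd"
  unfolding Y_def using continuous_map_snd continuous_map_into_fulltopology by blast
 have bs: "continuous_map Y (top_of_set tri) (\<lambda>p. bary (f (snd p)))"
  using continuous_map_compose[OF snd cont_baryf] by (simp add: o_def)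
 have fst: "continuous_map Y euclideanreal fst"
  unfolding Y_def using continuous_map_fst continuous_map_into_fulltopology by blast
 have cc: "continuous_map Y (top_of_set tri) (\<lambda>p. c (fst p) (bary (f (snd p))))"
  unfolding continuous_map_in_subtopology
 proof (intro conjI)
  have "continuous_map Y euclidean (\<lambda>p. bary (f (snd p)))" using bs by (simp add: continuous_map_in_subtopology)
  then show "continuous_map Y euclidean (\<lambda>p. c (fst p) (bary (f (snd p))))"
   unfolding c_def by (intro continuous_map_add continuous_map_scaleR continuous_map_diff fst) simp_all
 qed (auto simp: topY intro!: c_tri)
 have key: "h p = S x (c (fst p) (bary (f (snd p))))"
  if "p \<in> topspace Y" "x \<in> tiles d" "snd p \<in> S x ` tri" for p x
 proof -
  define v where "v = bary (f (snd p))"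
  have v: "v \<in> tri" by (simp add: v_def)
  have yX: "snd p \<in> topspace X" using that star_subset by (auto simp: topY)
  have xv: "S x v = snd p" using that by (auto simp: v_def)
  have "(x, tile_of (snd p)) \<in> glue t d v" using tile_of_S[OF that(2) v] xv by simp
  moreover have "glue t d v \<subseteq> glue t d (c (fst p) v)" if "fst p < 1"
  proof (rule glue_mono)
   fix j assume j: "v $ j = 0"
   have "0 < v $ i" using star_iff[OF \<open>x \<in> tiles d\<close> v, of i z] xv \<open>p \<in> topspace Y\<close> by (auto simp: topY)
   then have "j \<noteq> i" using j by auto
   then show "c (fst p) v $ j = 0" using j by (simp add: c_def e_def axis_nth)
  qed
  moreover have "S (tile_of (snd p)) e = S x e"
   using corner_eq[of "tile_of (snd p)" x v i] tile_of[OF yX] xv that(2) v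
    star_iff[OF \<open>x \<in> tiles d\<close> v, of i z] that(1) by (auto simp: v_def e_def topY)
  moreover have "c 1 v = e" by (simp add: c_def)
  moreover have "fst p \<le> 1" "c (fst p) v \<in> tri" using that(1) c_tri[OF v] by (auto simp: topY)
  ultimately show ?thesis unfolding h_def v_def[symmetric]
   using S_eq[of "tile_of (snd p)" x "c (fst p) v"] tile_of(1)[OF yX] that(2)
   by (cases "fst p < 1") (auto intro: glue_sym)
 qed
 have "continuous_map Y X h"
 proof (rule pasting_lemma_closed[of "tiles d" Y "\<lambda>x. {p \<in> topspace Y. snd p \<in> S x ` tri}" X
    "\<lambda>x p. S x (c (fst p) (bary (f (snd p))))"])
  show "closedin Y {p \<in> topspace Y. snd p \<in> S x ` tri}" if "x \<in> tiles d" for x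
   using snd closedin_continuous_map_preimage closedin_S_image[OF that compact_imp_closed[OF compact_tri]]
   by blast
  show "continuous_map (subtopology Y {p \<in> topspace Y. snd p \<in> S x ` tri}) X
    (\<lambda>p. S x (c (fst p) (bary (f (snd p)))))" if "x \<in> tiles d" for x
   using continuous_map_compose[OF cc contS[OF that]] by (simp add: o_def continuous_map_from_subtopology)
  show "S i (c (fst x) (bary (f (snd x)))) = S j (c (fst x) (bary (f (snd x))))"
   if "i \<in> tiles d" "j \<in> tiles d"
    "x \<in> topspace Y \<inter> {p \<in> topspace Y. snd p \<in> S i ` tri} \<inter> {p \<in> topspace Y. snd p \<in> S j ` tri}" for i j x
   using key[of x i] key[of x j] that by auto
  show "\<exists>j. j \<in> tiles d \<and> p \<in> {p \<in> topspace Y. snd p \<in> S j ` tri} \<and> h p = S j (c (fst p) (bary (f (snd p))))"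
   if "p \<in> topspace Y" for p
  proof -
   have "snd p \<in> topspace X" using that subsetD[OF star_subset[of i z]] by (auto simp: topY)
   then show ?thesis using tile_of[of "snd p"] that by (metis (mono_tags, lifting) bary_in_tri h_def imageI mem_Collect_eq)
  qed
 qed auto
 moreover have "h p \<in> star i z" if "p \<in> topspace Y" for p
 proof -
  have "snd p \<in> star i z" and s: "0 \<le> fst p" "fst p \<le> 1" using that by (auto simp: topY)
  then obtain x v where x: "snd p = S x v" "x \<in> tiles d" "v \<in> tri" "0 < v $ i" "S x (axis i 1) = z"
   by (auto simp: star_def)
  then have "h p = S x (c (fst p) v)" using key[OF that, of x] by auto
  then show ?thesis using star_iff x c_tri[OF x(3) s] c_pos[OF x(4) s] by simp
 qed
 ultimately have "continuous_map Y (subtopology X (star i z)) h"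
  by (simp add: continuous_map_in_subtopology image_subset_iff_funcset[symmetric] image_subset_iff)
 moreover have "h (0, y) = y" if "y \<in> star i z" for y
  using tile_of(2)[of y] that star_subset by (auto simp: h_def c_def)
 moreover have "h (1, y) = z" if "y \<in> star i z" for y
 proof -
  have yX: "y \<in> topspace X" using that star_subset by blast
  then show ?thesis using star_iff[OF tile_of(1)[OF yX] bary_in_tri[of "f y"], of i z] tile_of(2)[OF yX] that
   by (simp add: h_def c_def e_def)
 qed
 ultimately have "homotopic_with (\<lambda>x. True) (subtopology X (star i z)) (subtopology X (star i z)) id (\<lambda>x. z)"
  by (subst homotopic_with) (auto simp: Y_def intro!: exI[of _ h])
 then show ?thesis unfolding contractible_space_def by blast
qed

end

text \<open>Both surfaces make the same identifications, so matching the tiles point by point is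
  well defined in both directions, and continuity can be checked tile by tile.\<close>

lemma tiling_homeomorphic:
 assumes "tiling X f d t S" "tiling X' f' d t S'"
 obtains h where "homeomorphic_map X X' h" "\<And>x v. x \<in> tiles d \<Longrightarrow> v \<in> tri \<Longrightarrow> h (S x v) = S' x v"
  "\<And>y. y \<in> topspace X \<Longrightarrow> f' (h y) = f y"
proof -
 interpret T: tiling X f d t S by fact
 interpret T': tiling X' f' d t S' by fact
 define h where "h y = S' (T.tile_of y) (bary (f y))" for y
 define h' where "h' y = S (T'.tile_of y) (bary (f' y))" for y
 have h: "h (S x v) = S' x v" if "x \<in> tiles d" "v \<in> tri" for x v
  using T.tile_of_S[OF that] that T.tile_of(1)[of "S x v"]
   T'.S_eq[of "T.tile_of (S x v)" x v] by (simp add: h_def glue_sym)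
 have h': "h' (S' x v) = S x v" if "x \<in> tiles d" "v \<in> tri" for x v
  using T'.tile_of_S[OF that] that T'.tile_of(1)[of "S' x v"]
   T.S_eq[of "T'.tile_of (S' x v)" x v] by (simp add: h'_def glue_sym)
 have "continuous_map X X' h"
  by (rule T.continuous_on_tiles) (rule continuous_map_eq[OF T'.contS], auto simp: h)
 moreover have "continuous_map X' X h'"
  by (rule T'.continuous_on_tiles) (rule continuous_map_eq[OF T.contS], auto simp: h')
 moreover have "h' (h y) = y" if "y \<in> topspace X" for y using T.cover[OF that] h h' by auto
 moreover have "h (h' y) = y" if "y \<in> topspace X'" for y using T'.cover[OF that] h h' by auto
 ultimately have "homeomorphic_map X X' h"
  using homeomorphic_maps_imp_map[of X X' h h'] by (auto simp: homeomorphic_maps_def)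
 moreover have "f' (h y) = f y" if "y \<in> topspace X" for y
  using T.cover[OF that] h T.fS T'.fS by auto
 ultimately show thesis using that h by blast
qed

section \<open>Spanning trees\<close>

text \<open>\<open>a v\<close> is the edge, in either orientation, that joins v to its parent. The
  decrease of \<open>rk\<close> rules out cycles and supports induction from the root.\<close>

locale rooted_tree =
 fixes V :: "'v set" and v0 :: 'v and src dst :: "'e \<Rightarrow> 'v" and rk :: "'v \<Rightarrow> nat" and a :: "'v \<Rightarrow> 'e"
 assumes fin: "finite V" and root: "v0 \<in> V"
  and step: "\<lbrakk>v \<in> V; v \<noteq> v0\<rbrakk> \<Longrightarrow> \<exists>w\<in>V. rk w < rk v \<and> (src (a v) = v \<and> dst (a v) = w \<or> dst (a v) = v \<and> src (a v) = w)"
begin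

definition parent :: "'v \<Rightarrow> 'v" where
 "parent v = (if src (a v) = v then dst (a v) else src (a v))"

lemma parent: assumes "v \<in> V" "v \<noteq> v0"
 shows "parent v \<in> V" "rk (parent v) < rk v"
  "src (a v) = v \<and> dst (a v) = parent v \<or> dst (a v) = v \<and> src (a v) = parent v"
 using step[OF assms] by (auto simp: parent_def)

text \<open>Two vertices with the same edge would be parents of each other, against the decrease of
  the rank.\<close>

lemma inj_a: "inj_on a (V - {v0})"
proof (rule inj_onI)
 fix v w assume v: "v \<in> V - {v0}" and w: "w \<in> V - {v0}" and eq: "a v = a w"
 show "v = w"
 proof (rule ccontr)
  assume "v \<noteq> w"
  then have "parent v = w" "parent w = v" using parent(3)[of v] parent(3)[of w] v w eq by auto
  then show False using parent(2)[of v] parent(2)[of w] v w by auto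
 qed
qed

lemma card_edges: "card (a ` (V - {v0})) = card V - 1"
 using inj_a card_image root by fastforce

lemma tree_induct:
 assumes "v \<in> V" "Q v0" "\<And>v. v \<in> V \<Longrightarrow> v \<noteq> v0 \<Longrightarrow> Q (parent v) \<Longrightarrow> Q v"
 shows "Q v"
 using assms(1)
proof (induction "rk v" arbitrary: v rule: less_induct)
 case less then show ?case using assms(2,3) parent by metis
qed

text \<open>On a tree every edge labelling is a coboundary: it is integrated along the path from the
  root.\<close>

lemma potential:
 fixes \<epsilon> :: "'e \<Rightarrow> 'g::ab_group_add"
 obtains P where "P v0 = 0" "\<And>v. v \<in> V \<Longrightarrow> v \<noteq> v0 \<Longrightarrow> P (dst (a v)) = P (src (a v)) + \<epsilon> (a v)"
proof -
 define F where "F = (\<lambda>P v. if v = v0 then 0 else if src (a v) = v then P (parent v) - \<epsilon> (a v) else P (parent v) + \<epsilon> (a v))"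
 define P where "P = wfrec (Wellfounded.measure (\<lambda>v. if v \<in> V then rk v else 0)) F"
 have P: "P v = (if v = v0 then 0 else if src (a v) = v then P (parent v) - \<epsilon> (a v) else P (parent v) + \<epsilon> (a v))"
  if "v \<in> V" for v
 proof -
  have "P v = F (cut P (Wellfounded.measure (\<lambda>v. if v \<in> V then rk v else 0)) v) v"
   unfolding P_def by (rule wfrec[OF wf_measure])
  then show ?thesis using parent[OF that] that by (simp add: F_def cut_apply)
 qed
 show thesis
 proof (rule that[of P])
  show "P v0 = 0" using P[OF root] by simp
  show "P (dst (a v)) = P (src (a v)) + \<epsilon> (a v)" if "v \<in> V" "v \<noteq> v0" for v
   using P[OF that(1)] parent[OF that] that by (cases "src (a v) = v") auto
 qed
qed

end

text \<open>The tree is grown edge by edge: \<open>conn\<close> supplies an edge that leaves the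
  vertices reached so far, and the new vertex gets a rank above all present ones.\<close>

lemma spanning_tree:
 fixes src dst :: "'e \<Rightarrow> 'v"
 assumes V: "finite V" "v0 \<in> V" and E: "\<And>e. e \<in> E \<Longrightarrow> src e \<in> V \<and> dst e \<in> V"
  and conn: "\<And>A. A \<subseteq> V \<Longrightarrow> v0 \<in> A \<Longrightarrow> A \<noteq> V \<Longrightarrow> \<exists>e\<in>E. (src e \<in> A) \<noteq> (dst e \<in> A)"
 obtains rk a where "rooted_tree V v0 src dst rk a" "a ` (V - {v0}) \<subseteq> E"
proof -
 have "\<exists>rk a. rooted_tree V v0 src dst rk a \<and> a ` (V - {v0}) \<subseteq> E"
  if "A \<subseteq> V" "rooted_tree A v0 src dst rk a" "a ` (A - {v0}) \<subseteq> E" for A rk a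
  using that
 proof (induction "card (V - A)" arbitrary: A rk a rule: less_induct)
  case less
  interpret rooted_tree A v0 src dst rk a by fact
  show ?case
  proof (cases "A = V")
   case True then show ?thesis using less.prems by blast
  next
   case False
   then obtain e where e: "e \<in> E" "(src e \<in> A) \<noteq> (dst e \<in> A)" using conn less.prems root by blast
   define w where "w = (if src e \<in> A then dst e else src e)"
   define u where "u = (if src e \<in> A then src e else dst e)"
   have w: "w \<in> V" "w \<notin> A" "w \<noteq> v0" using e E root by (auto simp: w_def)
   have u: "u \<in> A" using e by (auto simp: u_def)
   define rk' where "rk' = rk(w := Suc (Max (rk ` A)))"
   have mx: "rk z < rk' w" if "z \<in> A" for z using that fin by (simp add: rk'_def less_Suc_eq_le)
   have rkA: "rk' z = rk z" if "z \<in> A" for z using that w by (auto simp: rk'_def)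
   have "rooted_tree (insert w A) v0 src dst rk' (a(w := e))"
   proof
    fix v assume v: "v \<in> insert w A" "v \<noteq> v0"
    show "\<exists>z\<in>insert w A. rk' z < rk' v \<and> (src ((a(w := e)) v) = v \<and> dst ((a(w := e)) v) = z
      \<or> dst ((a(w := e)) v) = v \<and> src ((a(w := e)) v) = z)"
    proof (cases "v = w")
     case True
     then show ?thesis using u mx[OF u] rkA[OF u] e
      by (intro bexI[of _ u]) (auto simp: w_def u_def)
    next
     case False
     then have vA: "v \<in> A" using v by simp
     then show ?thesis using step[OF vA v(2)] False rkA by force
    qed
   qed (use fin root in auto)
   moreover have "card (V - insert w A) < card (V - A)"
    using V w by (intro psubset_card_mono) auto
   moreover have "(a(w := e)) ` (insert w A - {v0}) \<subseteq> E" using less.prems w e by auto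
   ultimately show ?thesis using less.hyps[of "insert w A"] less.prems w by blast
  qed
 qed
 from this[of "{v0}" "\<lambda>_. 0" undefined] V show thesis using that
  by (auto simp: rooted_tree_def)
qed

section \<open>Trees in the one-skeleton of a tiling and in its dual\<close>

text \<open>The edge \<open>(i, p)\<close> lies opposite to the corner \<open>i\<close> of the tile \<open>(True, p)\<close>.\<close>

definition edges :: "nat \<Rightarrow> (3 \<times> nat) set" where
 "edges d = UNIV \<times> {..<d}"

lemma mem_edges [simp]: "(i, p) \<in> edges d \<longleftrightarrow> p < d"
 by (simp add: edges_def)

lemma finite_edges [simp]: "finite (edges d)"
 by (simp add: edges_def)

lemma card_edges: "card (edges d) = 3 * d"
 by (simp add: edges_def card_cartesian_product)

lemma card_tiles: "card (tiles d) = 2 * d"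
 by (simp add: tiles_def card_cartesian_product)

text \<open>The side of a tile opposite corner i. A side is named by its upper tile, whence the
  inverse of \<open>t i\<close> for a lower tile.\<close>

definition tedge :: "(3 \<Rightarrow> nat \<Rightarrow> nat) \<Rightarrow> bool \<times> nat \<Rightarrow> 3 \<Rightarrow> 3 \<times> nat" where
 "tedge t x i = (i, if fst x then snd x else Hilbert_Choice.inv (t i) (snd x))"

text \<open>In the dual graph an edge leads from its upper tile (\<open>tsrc\<close>) to its lower
  tile (\<open>tdst\<close>).\<close>

definition tsrc :: "3 \<times> nat \<Rightarrow> bool \<times> nat" where
 "tsrc e = (True, snd e)"

definition tdst :: "(3 \<Rightarrow> nat \<Rightarrow> nat) \<Rightarrow> 3 \<times> nat \<Rightarrow> bool \<times> nat" where
 "tdst t e = (False, t (fst e) (snd e))"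

lemma plus_3 [simp]: "(i::3) + 1 + 1 = i + 2" "(i::3) + 1 + 2 = i" "(i::3) + 2 + 1 = i" "(i::3) + 2 + 2 = i + 1"
 using exhaust_3[of i] by auto

lemma cases_3: obtains "j = i" | "j = i + 1" | "j = i + (2::3)"
 using exhaust_3[of i] exhaust_3[of j] by fastforce

lemma neq_3 [simp]: "(i::3) + 1 \<noteq> i" "(i::3) + 2 \<noteq> i" "(i::3) + 1 \<noteq> i + 2" "(i::3) + 2 \<noteq> i + 1"
  "i \<noteq> (i::3) + 1" "i \<noteq> (i::3) + 2"
 using exhaust_3[of i] by auto

context tiling
begin

lemma t_less [simp]: "t i p < d \<longleftrightarrow> p < d"
 using permutes_in_image[OF perm[of i], of p] by simp

lemma inv_t_less [simp]: "Hilbert_Choice.inv (t i) p < d \<longleftrightarrow> p < d"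
 using permutes_in_image[OF permutes_inv[OF perm[of i]], of p] by simp

lemma t_inv_t [simp]: "t i (Hilbert_Choice.inv (t i) p) = p" "Hilbert_Choice.inv (t i) (t i p) = p"
 using permutes_inverses[OF perm[of i]] by auto

lemma share: "p < d \<Longrightarrow> v \<in> tri \<Longrightarrow> v $ i = 0 \<Longrightarrow> S (True, p) v = S (False, t i p) v"
 using S_eq[of "(True, p)" "(False, t i p)" v] glue_step by auto

end

locale connected_tiling = tiling +
 assumes conn: "connected_space X" and dpos: "0 < d"
begin

lemma all_glued: "x \<in> tiles d \<Longrightarrow> x' \<in> tiles d \<Longrightarrow> (x, x') \<in> glue t d 0"
 using conn connected_iff by blast

lemma all_tiles_invariant:
 assumes "\<And>p i. p < d \<Longrightarrow> P (True, p) \<longleftrightarrow> P (False, t i p)" "x \<in> tiles d" "x' \<in> tiles d" "P x"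
 shows "P x'"
 using glue_invariant[OF all_glued[OF assms(2,3)], of P] assms(1,4) by simp

definition verts :: "'a set" where "verts = (\<Union>i. vertices i)"

text \<open>In the one-skeleton the side opposite corner i leads from corner i + 1 to corner i + 2.
  Indices of type \<open>3\<close> are taken modulo 3, so the three sides of a tile form an oriented
  cycle.\<close>

definition esrc :: "3 \<times> nat \<Rightarrow> 'a" where "esrc e = S (True, snd e) (axis (fst e + 1) 1)"

definition edst :: "3 \<times> nat \<Rightarrow> 'a" where "edst e = S (True, snd e) (axis (fst e + 2) 1)"

lemma tile_edge:
 assumes "x \<in> tiles d"
 shows "tedge t x i \<in> edges d" "v \<in> tri \<Longrightarrow> v $ i = 0 \<Longrightarrow> S (True, snd (tedge t x i)) v = S x v"
  "esrc (tedge t x i) = S x (axis (i + 1) 1)" "edst (tedge t x i) = S x (axis (i + 2) 1)"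
proof -
 obtain s p where x: "x = (s, p)" by fastforce
 show "tedge t x i \<in> edges d" using assms x by (auto simp: tedge_def)
 have *: "S (True, snd (tedge t x i)) v = S x v" if "v \<in> tri" "v $ i = 0" for v
  using share[of "Hilbert_Choice.inv (t i) p" v i] assms x that by (auto simp: tedge_def)
 then show "v \<in> tri \<Longrightarrow> v $ i = 0 \<Longrightarrow> S (True, snd (tedge t x i)) v = S x v" .
 show "esrc (tedge t x i) = S x (axis (i + 1) 1)" "edst (tedge t x i) = S x (axis (i + 2) 1)"
  using * by (auto simp: esrc_def edst_def axis_nth tedge_def)
qed

lemma finite_verts: "finite verts"
 by (simp add: verts_def vertices_def)

lemma S_axis_in_verts: "x \<in> tiles d \<Longrightarrow> S x (axis i 1) \<in> verts"
 by (auto simp: verts_def vertices_def)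

lemma esrc_in: "e \<in> edges d \<Longrightarrow> esrc e \<in> verts" "e \<in> edges d \<Longrightarrow> edst e \<in> verts"
 by (auto simp: esrc_def edst_def edges_def intro!: S_axis_in_verts)

definition root :: 'a where "root = S (True, 0) (axis 1 1)"

lemma root_in: "root \<in> verts"
 using dpos by (simp add: root_def S_axis_in_verts)

text \<open>A vertex set that no edge leaves contains all corners of a tile or none; neighbouring
  tiles share corners, so it contains the corners of every tile once it contains the root.\<close>

lemma one_skeleton_connected:
 assumes A: "A \<subseteq> verts" "root \<in> A" "A \<noteq> verts"
 shows "\<exists>e\<in>edges d. (esrc e \<in> A) \<noteq> (edst e \<in> A)"
proof (rule ccontr)
 assume "\<not> ?thesis"
 then have no: "esrc e \<in> A \<longleftrightarrow> edst e \<in> A" if "e \<in> edges d" for e using that by blast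
 have same: "S x (axis i 1) \<in> A \<longleftrightarrow> S x (axis j 1) \<in> A" if "x \<in> tiles d" for x i j
 proof -
  have *: "S x (axis (k + 1) 1) \<in> A \<longleftrightarrow> S x (axis (k + 2) 1) \<in> A" for k
   using no[OF tile_edge(1)[OF that, of k]] tile_edge(3,4)[OF that, of k] by simp
  show ?thesis
   by (rule cases_3[of j i]) (use *[of i] *[of "i + 1"] *[of "i + 2"] in auto)
 qed
 have "S x (axis 1 1) \<in> A" if x: "x \<in> tiles d" for x
 proof (rule all_tiles_invariant[where P = "\<lambda>x. S x (axis 1 1) \<in> A", OF _ _ x])
  fix p i assume p: "p < d"
  have "S (True, p) (axis (i + 1) 1) = S (False, t i p) (axis (i + 1) 1)"
   using p by (intro share) (auto simp: axis_nth)
  then show "S (True, p) (axis 1 1) \<in> A \<longleftrightarrow> S (False, t i p) (axis 1 1) \<in> A"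
   using same[of "(True, p)" 1 "i + 1"] same[of "(False, t i p)" 1 "i + 1"] p by simp
 qed (use dpos A in \<open>auto simp: root_def\<close>)
 then have "S x (axis i 1) \<in> A" if "x \<in> tiles d" for x i using same[OF that, of i 1] that by blast
 then have "verts \<subseteq> A" unfolding verts_def vertices_def by blast
 then show False using A by blast
qed

lemma vertices_disjoint: "z \<in> vertices i \<Longrightarrow> z \<in> vertices j \<Longrightarrow> i = j"
proof -
 assume "z \<in> vertices i" "z \<in> vertices j"
 then have "axis i (1::real) = axis j 1" using S_eq_iff by (auto simp: vertices_def)
 then show "i = j" by (metis axis_nth zero_neq_one)
qed

text \<open>Both \<open>t (j + 1)\<close> and \<open>t (j + 2)\<close> match the upper tiles at z
  with the lower tiles at z, so either side is the sum of x over the former minus the sum over the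
  latter. For an indicator function this says that the signed number of crossings on a turn about z
  is zero.\<close>

lemma crossing_sum:
 fixes x :: "bool \<times> nat \<Rightarrow> int"
 shows "(\<Sum>p | p < d \<and> S (True, p) (axis j 1) = z. x (True, p) - x (False, t (j + 1) p)) =
     (\<Sum>p | p < d \<and> S (True, p) (axis j 1) = z. x (True, p) - x (False, t (j + 2) p))"
proof -
 define C D where "C = {p. p < d \<and> S (True, p) (axis j 1) = z}" and "D = {p. p < d \<and> S (False, p) (axis j 1) = z}"
 have "(\<Sum>p\<in>C. x (False, t i p)) = (\<Sum>q\<in>D. x (False, q))" if "i \<noteq> j" for i
 proof (rule sum.reindex_bij_witness[of _ "Hilbert_Choice.inv (t i)" "t i"])
  have *: "S (True, p) (axis j 1) = S (False, t i p) (axis j 1)" if "p < d" for p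
   using that \<open>i \<noteq> j\<close> by (intro share) (auto simp: axis_nth)
  show "t i p \<in> D" if "p \<in> C" for p using * that by (auto simp: C_def D_def)
  show "Hilbert_Choice.inv (t i) q \<in> C" if "q \<in> D" for q using *[of "Hilbert_Choice.inv (t i) q"] that by (auto simp: C_def D_def)
 qed auto
 from this[of "j + 1"] this[of "j + 2"] show ?thesis
  unfolding C_def[symmetric] by (simp add: sum_subtractf)
qed

text \<open>Consider the edges that separate A from its complement. By \<open>crossing_sum\<close>
  no vertex meets exactly one of them. If all of them lay in the tree, an endpoint of maximal rank
  would meet only the edge to its parent.\<close>

lemma dual_connected:
 assumes T: "rooted_tree verts root esrc edst rk a" "a ` (verts - {root}) \<subseteq> edges d"
  and A: "A \<subseteq> tiles d" "(True, 0) \<in> A" "A \<noteq> tiles d"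
 shows "\<exists>e\<in>edges d - a ` (verts - {root}). (tsrc e \<in> A) \<noteq> (tdst t e \<in> A)"
proof (rule ccontr)
 interpret T: rooted_tree verts root esrc edst rk a by fact
 assume no: "\<not> ?thesis"
 define CR where "CR = {e \<in> edges d. (tsrc e \<in> A) \<noteq> (tdst t e \<in> A)}"
 have CRT: "CR \<subseteq> a ` (verts - {root})" using no by (auto simp: CR_def)
 have "CR \<noteq> {}"
 proof
  assume "CR = {}"
  then have "(True, p) \<in> A \<longleftrightarrow> (False, t i p) \<in> A" if "p < d" for p i
  proof -
   have "(i, p) \<notin> CR" using \<open>CR = {}\<close> by simp
   then show ?thesis using that by (simp add: CR_def tsrc_def tdst_def)
  qed
  then have "x \<in> A" if "x \<in> tiles d" for x
   using all_tiles_invariant[of "\<lambda>x. x \<in> A", OF _ _ that, of "(True, 0)"] A dpos by auto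
  then show False using A by blast
 qed
 define M where "M = esrc ` CR \<union> edst ` CR"
 have "finite M" "M \<noteq> {}" using \<open>CR \<noteq> {}\<close> by (auto simp: M_def CR_def)
 then have "Max (rk ` M) \<in> rk ` M" by (intro Max_in) simp_all
 then obtain z where "z \<in> M" "rk z = Max (rk ` M)" by (metis imageE)
 then have z: "z \<in> M" "\<And>w. w \<in> M \<Longrightarrow> rk w \<le> rk z" using \<open>finite M\<close> by simp_all
 \<comment> \<open>A separating edge is \<open>a w\<close> for the one of its ends that has larger
   rank; as z has maximal rank, that end is z.\<close>
 have uniq: "e = a z" if e: "e \<in> CR" "esrc e = z \<or> edst e = z" for e
 proof -
  have "e \<in> a ` (verts - {root})" using e(1) CRT by blast
  then obtain w where w: "w \<in> verts" "w \<noteq> root" "e = a w" by blast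
  have "w = esrc e \<or> w = edst e" using T.parent(3)[OF w(1,2)] w(3) by auto
  then have "w \<in> M" using e(1) unfolding M_def by blast
  then have "rk w \<le> rk z" using z by blast
  then have "w = z" using T.parent(2,3)[OF w(1,2)] e w by auto
  then show ?thesis using w by simp
 qed
 have "z \<in> verts" using z(1) esrc_in by (auto simp: M_def CR_def)
 then obtain j where j: "z \<in> vertices j" by (auto simp: verts_def)
 obtain e where e: "e \<in> CR" "esrc e = z \<or> edst e = z" using z(1) by (auto simp: M_def)
 have ends: "esrc (j + 2, p) = S (True, p) (axis j 1)" "edst (j + 1, p) = S (True, p) (axis j 1)" for p
  by (simp_all add: esrc_def edst_def)
 obtain i p where ip: "e = (i, p)" by fastforce
 have p: "p < d" using e ip by (simp add: CR_def)
 have "i = j + 1 \<or> i = j + 2"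
 proof -
  have "esrc e \<in> vertices (i + 1)" "edst e \<in> vertices (i + 2)"
   using p by (auto simp: ip esrc_def edst_def vertices_def)
  then have "j = i + 1 \<or> j = i + 2" using e(2)
  proof (elim disjE)
   assume "esrc e \<in> vertices (i + 1)" "esrc e = z"
   then show ?thesis using vertices_disjoint[OF j, of "i + 1"] by simp
  next
   assume "edst e \<in> vertices (i + 2)" "edst e = z"
   then show ?thesis using vertices_disjoint[OF j, of "i + 2"] by simp
  qed
  then show ?thesis by (elim disjE) simp_all
 qed
 define x :: "bool \<times> nat \<Rightarrow> int" where "x y = of_bool (y \<in> A)" for y
 define C where "C = {p. p < d \<and> S (True, p) (axis j 1) = z}"
 have fin: "finite C" by (simp add: C_def)
 have pC: "p \<in> C" using e(2) p ip \<open>i = j + 1 \<or> i = j + 2\<close>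
 proof (elim disjE)
  assume "esrc e = z" "i = j + 1"
  then have "z \<in> vertices (j + 2)" using p ip by (auto simp: esrc_def vertices_def)
  then have "j = j + 2" using j vertices_disjoint by blast
  then show ?thesis by simp
 next
  assume "edst e = z" "i = j + 2"
  then have "z \<in> vertices (j + 1)" using p ip by (auto simp: edst_def vertices_def)
  then have "j = j + 1" using j vertices_disjoint by blast
  then show ?thesis by simp
 qed (auto simp: C_def ends)
 have zero: "x (True, q) - x (False, t k q) = 0" if "q \<in> C" "k = j + 1 \<or> k = j + 2" "(k, q) \<noteq> e" for q k
 proof -
  have "esrc (k, q) = z \<or> edst (k, q) = z" using that ends by (auto simp: C_def)
  moreover have "a z = e" using uniq[OF e] by (rule sym)
  ultimately have "(k, q) \<notin> CR" using uniq[of "(k, q)"] that(3) by metis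
  then have "(True, q) \<in> A \<longleftrightarrow> (False, t k q) \<in> A"
   using that(1) by (simp add: CR_def C_def tsrc_def tdst_def)
  then show ?thesis by (simp add: x_def)
 qed
 have "(True, p) \<in> A \<longleftrightarrow> (False, t i p) \<notin> A" using e(1) by (simp add: ip CR_def tsrc_def tdst_def)
 then have one: "x (True, p) - x (False, t i p) \<noteq> 0" by (cases "(True, p) \<in> A") (simp_all add: x_def)
 have sum: "(\<Sum>q\<in>C. x (True, q) - x (False, t k q)) = (if k = i then x (True, p) - x (False, t i p) else 0)"
  if k: "k = j + 1 \<or> k = j + 2" for k
 proof (cases "k = i")
  case True
  have "(\<Sum>q\<in>C. x (True, q) - x (False, t k q)) = (\<Sum>q\<in>{p}. x (True, q) - x (False, t k q))"
  proof (intro sum.mono_neutral_right ballI)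
   fix q assume "q \<in> C - {p}"
   then show "x (True, q) - x (False, t k q) = 0" using ip by (intro zero[OF _ k]) simp_all
  qed (use pC fin in simp_all)
  then show ?thesis using True by simp
 next
  case False
  then have "(\<Sum>q\<in>C. x (True, q) - x (False, t k q)) = 0"
   using ip by (intro sum.neutral ballI zero[OF _ k]) simp_all
  then show ?thesis using False by simp
 qed
 have "(\<Sum>q\<in>C. x (True, q) - x (False, t (j + 1) q)) = (\<Sum>q\<in>C. x (True, q) - x (False, t (j + 2) q))"
  unfolding C_def by (rule crossing_sum)
 with sum[of "j + 1"] sum[of "j + 2"]
 have "(if j + 1 = i then x (True, p) - x (False, t i p) else 0) = (if j + 2 = i then x (True, p) - x (False, t i p) else 0)"
  by metis
 then show False using one \<open>i = j + 1 \<or> i = j + 2\<close> by (elim disjE) simp_all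
qed

text \<open>The net flow out of a tile in the dual graph; the sign reflects that edges leave upper
  tiles and enter lower ones.\<close>

definition out :: "(3 \<times> nat \<Rightarrow>\<^sub>0 int) \<Rightarrow> bool \<times> nat \<Rightarrow> int" where
 "out m x = (if fst x then 1 else -1) * (\<Sum>i\<in>UNIV. Poly_Mapping.lookup m (tedge t x i))"

lemma out_add: "out (m + n) x = out m x + out n x" "out (m - n) x = out m x - out n x"
 by (simp_all add: out_def sum.distrib sum_subtractf lookup_add lookup_minus algebra_simps)

lemma out_ind: assumes "e \<in> edges d"
 shows "out (frag_of e) x = of_bool (x = tsrc e) - of_bool (x = tdst t e)"
proof -
 obtain i p where e: "e = (i, p)" by fastforce
 obtain s q where x: "x = (s, q)" by fastforce
 have "(\<Sum>k\<in>UNIV. Poly_Mapping.lookup (frag_of e) (tedge t x k)) = (\<Sum>k\<in>UNIV. if k = i then of_bool (tedge t x i = e) else (0::int))"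
  by (rule sum.cong) (auto simp: tedge_def e)
 also have "\<dots> = of_bool (tedge t x i = e)" by simp
 also have "tedge t x i = e \<longleftrightarrow> (if s then q else Hilbert_Choice.inv (t i) q) = p" by (simp add: tedge_def e x)
 also have "\<dots> \<longleftrightarrow> q = (if s then p else t i p)" by auto
 finally show ?thesis by (auto simp: out_def x e tsrc_def tdst_def)
qed

text \<open>
 A spanning tree \<open>T\<close> of the one-skeleton and a spanning tree \<open>T'\<close> of the dual graph that avoids \<open>T\<close>:
 the remaining edges \<open>R\<close> index a basis of the first homology group.
\<close>

lemma tree_cotree:
 obtains rk a rk' a' where
  "rooted_tree verts root esrc edst rk a" "a ` (verts - {root}) \<subseteq> edges d"
  "rooted_tree (tiles d) (True, 0) tsrc (tdst t) rk' a'"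
  "a' ` (tiles d - {(True, 0)}) \<subseteq> edges d - a ` (verts - {root})"
  "card (edges d - a ` (verts - {root}) - a' ` (tiles d - {(True, 0)})) + card verts = d + 2"
proof -
 obtain rk a where T: "rooted_tree verts root esrc edst rk a" "a ` (verts - {root}) \<subseteq> edges d"
  using spanning_tree[OF finite_verts root_in, of "edges d" esrc edst] esrc_in one_skeleton_connected by blast
 have E': "tsrc e \<in> tiles d \<and> tdst t e \<in> tiles d" if "e \<in> edges d - a ` (verts - {root})" for e
  using that by (cases e) (auto simp: tsrc_def tdst_def)
 have r: "(True, 0) \<in> tiles d" using dpos by simp
 obtain rk' a' where T': "rooted_tree (tiles d) (True, 0) tsrc (tdst t) rk' a'"
  "a' ` (tiles d - {(True, 0)}) \<subseteq> edges d - a ` (verts - {root})"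
  by (rule spanning_tree[OF finite_tiles r E' dual_connected[OF T]])
 interpret T: rooted_tree verts root esrc edst rk a by fact
 interpret T': rooted_tree "tiles d" "(True, 0)" tsrc "tdst t" rk' a' by fact
 have "card verts \<ge> 1" using root_in finite_verts by (metis One_nat_def Suc_leI card_gt_0_iff empty_iff)
 moreover have "card (edges d - a ` (verts - {root})) = 3 * d - (card verts - 1)"
  "card verts - 1 \<le> 3 * d"
  using card_Diff_subset[of "a ` (verts - {root})" "edges d"] T(2) finite_verts T.card_edges
   card_mono[OF finite_edges T(2)] by (simp_all add: card_edges)
 moreover have "card (edges d - a ` (verts - {root}) - a' ` (tiles d - {(True, 0)}))
   = card (edges d - a ` (verts - {root})) - (2 * d - 1)"
  "2 * d - 1 \<le> card (edges d - a ` (verts - {root}))"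
  using card_Diff_subset[of "a' ` (tiles d - {(True, 0)})" "edges d - a ` (verts - {root})"] T'(2)
   T'.card_edges card_mono[OF _ T'(2)] by (simp_all add: card_tiles)
 \<comment> \<open>Of \<open>3 * d\<close> edges, \<open>card verts - 1\<close> lie in the tree and
   \<open>2 * d - 1\<close> in the dual tree.\<close>
 ultimately have "card (edges d - a ` (verts - {root}) - a' ` (tiles d - {(True, 0)})) + card verts = d + 2"
  using dpos by linarith
 then show thesis using that T T' by blast
qed

text \<open>This is the circuit that e closes in the dual tree. Its net flow out of every tile is
  zero, and since the sign in \<open>out\<close> is constant on a tile, its values on the three
  sides of a tile add up to zero: it is a cocycle of the triangulated surface.\<close>

lemma cotree_flow:
 assumes T': "rooted_tree (tiles d) (True, 0) tsrc (tdst t) rk' a'" "a' ` (tiles d - {(True, 0)}) \<subseteq> edges d"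
  and e: "e \<in> edges d" "e \<notin> a' ` (tiles d - {(True, 0)})"
 obtains \<phi> :: "3 \<times> nat \<Rightarrow> int" where "\<And>x. x \<in> tiles d \<Longrightarrow> (\<Sum>i\<in>UNIV. \<phi> (tedge t x i)) = 0"
  "\<And>e'. e' \<notin> a' ` (tiles d - {(True, 0)}) \<Longrightarrow> \<phi> e' = of_bool (e' = e)"
proof -
 interpret T': rooted_tree "tiles d" "(True, 0)" tsrc "tdst t" rk' a' by fact
 obtain P where P: "P (True, 0) = 0"
  "\<And>v. v \<in> tiles d \<Longrightarrow> v \<noteq> (True, 0) \<Longrightarrow> P (tdst t (a' v)) = P (tsrc (a' v)) + frag_of (a' v)"
  by (rule T'.potential[where \<epsilon> = frag_of]) (rule that)
 have 1: "Poly_Mapping.lookup (P x) e' = 0"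
  if x: "x \<in> tiles d" and e': "e' \<notin> a' ` (tiles d - {(True, 0)})" for x e'
 proof (rule T'.tree_induct[OF x])
  fix v assume v: "v \<in> tiles d" "v \<noteq> (True, 0)" "Poly_Mapping.lookup (P (T'.parent v)) e' = 0"
  have "e' \<noteq> a' v" using v e' by blast
  then have eq: "Poly_Mapping.lookup (P (tdst t (a' v))) e' = Poly_Mapping.lookup (P (tsrc (a' v))) e'"
   unfolding P(2)[OF v(1,2)] by (simp add: lookup_add)
  show "Poly_Mapping.lookup (P v) e' = 0" using T'.parent(3)[OF v(1,2)]
  proof (elim disjE conjE)
   assume e: "tsrc (a' v) = v" "tdst t (a' v) = T'.parent v"
   show ?thesis using eq v(3) unfolding e by simp
  next
   assume e: "tdst t (a' v) = v" "tsrc (a' v) = T'.parent v"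
   show ?thesis using eq v(3) unfolding e by simp
  qed
 qed (simp add: P(1))
 \<comment> \<open>\<open>P y\<close> is the path from the root to y in the dual tree, so the flow
   starts in the root and ends in y.\<close>
 have 2: "out (P y) x = of_bool (x = (True, 0)) - of_bool (x = y)" if y: "y \<in> tiles d" for x y
 proof (rule T'.tree_induct[OF y])
  fix v assume v: "v \<in> tiles d" "v \<noteq> (True, 0)"
   "out (P (T'.parent v)) x = of_bool (x = (True, 0)) - of_bool (x = T'.parent v)"
  have "a' v \<in> edges d" using T'(2) v by blast
  then have 3: "out (frag_of (a' v)) x = of_bool (x = tsrc (a' v)) - of_bool (x = tdst t (a' v))"
   by (rule out_ind)
  have 4: "out (P (tdst t (a' v))) x = out (P (tsrc (a' v))) x + out (frag_of (a' v)) x"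
   unfolding P(2)[OF v(1,2)] by (rule out_add(1))
  show "out (P v) x = of_bool (x = (True, 0)) - of_bool (x = v)"
   using T'.parent(3)[OF v(1,2)]
  proof (elim disjE conjE)
   assume e: "tsrc (a' v) = v" "tdst t (a' v) = T'.parent v"
   show ?thesis using v(3) 4 unfolding 3 unfolding e by linarith
  next
   assume e: "tdst t (a' v) = v" "tsrc (a' v) = T'.parent v"
   show ?thesis using v(3) 4 unfolding 3 unfolding e by linarith
  qed
  next
  have "out 0 x = 0" by (simp add: out_def)
  then show "out (P (True, 0)) x = of_bool (x = (True, 0)) - of_bool (x = (True, 0))" unfolding P(1) by simp
 qed
 define \<phi> where "\<phi> = frag_of e + P (tsrc e) - P (tdst t e)"
 have te: "tsrc e \<in> tiles d" "tdst t e \<in> tiles d" using e(1) by (auto simp: tsrc_def tdst_def edges_def)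
 have out0: "out \<phi> x = 0" for x
 proof -
  have "(a - b) + (r - a) - (r - b) = 0" for a b r :: int by simp
  then show ?thesis unfolding \<phi>_def out_add 2[OF te(1)] 2[OF te(2)] out_ind[OF e(1)] .
 qed
 have "(\<Sum>i\<in>UNIV. Poly_Mapping.lookup \<phi> (tedge t x i)) = 0" for x
  using out0[of x] unfolding out_def by (cases "fst x") simp_all
 moreover have "Poly_Mapping.lookup \<phi> e' = of_bool (e' = e)" if "e' \<notin> a' ` (tiles d - {(True, 0)})" for e'
  unfolding \<phi>_def lookup_add lookup_minus 1[OF te(1) that] 1[OF te(2) that] by simp
 ultimately show thesis using that[of "Poly_Mapping.lookup \<phi>"] by blast
qed

end

section \<open>Straight simplices\<close>

text \<open>Singular simplices are extensional on the standard simplex, hence the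
  \<open>restrict\<close>.\<close>

definition seg :: "(real^3 \<Rightarrow> 'a) \<Rightarrow> real^3 \<Rightarrow> real^3 \<Rightarrow> (nat \<Rightarrow> real) \<Rightarrow> 'a" where
 "seg g v w = restrict (\<lambda>u. g (u 0 *\<^sub>R v + u 1 *\<^sub>R w)) (standard_simplex 1)"

definition tsimp :: "(real^3 \<Rightarrow> 'a) \<Rightarrow> real^3 \<Rightarrow> real^3 \<Rightarrow> real^3 \<Rightarrow> (nat \<Rightarrow> real) \<Rightarrow> 'a" where
 "tsimp g v w z = restrict (\<lambda>u. g (u 0 *\<^sub>R v + u 1 *\<^sub>R w + u 2 *\<^sub>R z)) (standard_simplex 2)"

definition pt :: "'a \<Rightarrow> (nat \<Rightarrow> real) \<Rightarrow> 'a" where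
 "pt y = restrict (\<lambda>_. y) (standard_simplex 0)"

definition vtx :: "nat \<Rightarrow> nat \<Rightarrow> real" where
 "vtx i = (\<lambda>j. if j = i then 1 else 0)"

lemma vtx_in [simp]: "vtx i \<in> standard_simplex p \<longleftrightarrow> i \<le> p"
 by (simp add: vtx_def)

lemma num_3: "(4::3) = 1" "(5::3) = 2"
 by simp_all

lemma simplex_0: "standard_simplex 0 = {vtx 0}"
 by (simp add: standard_simplex_0 vtx_def)

lemma simplex_1: "u \<in> standard_simplex 1 \<Longrightarrow> 0 \<le> u 0 \<and> 0 \<le> u 1 \<and> u 0 + u 1 = 1"
 by (simp add: standard_simplex_def atMost_Suc)

lemma simplex_2: "u \<in> standard_simplex 2 \<Longrightarrow> 0 \<le> u 0 \<and> 0 \<le> u 1 \<and> 0 \<le> u 2 \<and> u 0 + u 1 + u 2 = 1"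
 by (simp add: standard_simplex_def numeral_2_eq_2 atMost_Suc)

lemma tri_comb:
 assumes "v \<in> tri" "w \<in> tri" "z \<in> tri" "0 \<le> a" "0 \<le> b" "0 \<le> c" "a + b + c = 1"
 shows "a *\<^sub>R v + b *\<^sub>R w + c *\<^sub>R z \<in> tri"
proof -
 have "(\<Sum>i\<in>UNIV. (a *\<^sub>R v + b *\<^sub>R w + c *\<^sub>R z) $ i)
   = a * (\<Sum>i\<in>UNIV. v $ i) + b * (\<Sum>i\<in>UNIV. w $ i) + c * (\<Sum>i\<in>UNIV. z $ i)"
  by (simp add: sum.distrib sum_distrib_left)
 then show ?thesis using assms by (simp add: tri_def)
qed

lemma continuous_map_coord:
 "continuous_map (subtopology (powertop_real UNIV) A) euclideanreal (\<lambda>u. u i)"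
 by (intro continuous_map_from_subtopology continuous_map_product_projection) simp

lemma singular_simplex_seg:
 assumes g: "continuous_map (top_of_set tri) X g" and v: "v \<in> tri" "w \<in> tri"
 shows "singular_simplex 1 X (seg g v w)"
proof -
 let ?A = "subtopology (powertop_real UNIV) (standard_simplex 1)"
 have "continuous_map ?A euclidean (\<lambda>u. u 0 *\<^sub>R v + u 1 *\<^sub>R w)"
  by (intro continuous_map_add continuous_map_scaleR continuous_map_coord) simp_all
 moreover have "u 0 *\<^sub>R v + u 1 *\<^sub>R w \<in> tri" if "u \<in> standard_simplex 1" for u
  using simplex_1[OF that] tri_comb[OF v v(1), of "u 0" "u 1" 0] by simp
 ultimately have "continuous_map ?A (top_of_set tri) (\<lambda>u. u 0 *\<^sub>R v + u 1 *\<^sub>R w)"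
  by (auto simp: continuous_map_in_subtopology)
 from continuous_map_compose[OF this g] have "continuous_map ?A X (\<lambda>u. g (u 0 *\<^sub>R v + u 1 *\<^sub>R w))"
  by (simp add: o_def)
 then have "continuous_map ?A X (seg g v w)"
  by (rule continuous_map_eq) (simp add: seg_def)
 then show ?thesis by (simp add: singular_simplex_def seg_def)
qed

lemma singular_simplex_tsimp:
 assumes g: "continuous_map (top_of_set tri) X g" and v: "v \<in> tri" "w \<in> tri" "z \<in> tri"
 shows "singular_simplex 2 X (tsimp g v w z)"
proof -
 let ?A = "subtopology (powertop_real UNIV) (standard_simplex 2)"
 have "continuous_map ?A euclidean (\<lambda>u. u 0 *\<^sub>R v + u 1 *\<^sub>R w + u 2 *\<^sub>R z)"
  by (intro continuous_map_add continuous_map_scaleR continuous_map_coord) simp_all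
 moreover have "u 0 *\<^sub>R v + u 1 *\<^sub>R w + u 2 *\<^sub>R z \<in> tri" if "u \<in> standard_simplex 2" for u
  using simplex_2[OF that] tri_comb[OF v] by simp
 ultimately have "continuous_map ?A (top_of_set tri) (\<lambda>u. u 0 *\<^sub>R v + u 1 *\<^sub>R w + u 2 *\<^sub>R z)"
  by (auto simp: continuous_map_in_subtopology)
 from continuous_map_compose[OF this g]
 have "continuous_map ?A X (\<lambda>u. g (u 0 *\<^sub>R v + u 1 *\<^sub>R w + u 2 *\<^sub>R z))" by (simp add: o_def)
 then have "continuous_map ?A X (tsimp g v w z)"
  by (rule continuous_map_eq) (simp add: tsimp_def)
 then show ?thesis by (simp add: singular_simplex_def tsimp_def)
qed

lemma face_in: "p = 1 \<or> p = 2 \<Longrightarrow> k \<le> p \<Longrightarrow> u \<in> standard_simplex (p - Suc 0) \<Longrightarrow> simplical_face k u \<in> standard_simplex p"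
 by (rule simplical_face_in_standard_simplex) auto

lemma boundary_1: "chain_boundary 1 (frag_of s) = frag_of (pt (s (vtx 1))) - frag_of (pt (s (vtx 0)))"
proof -
 have "simplical_face 0 (vtx 0) = vtx 1" "simplical_face 1 (vtx 0) = vtx 0"
  by (auto simp: simplical_face_def vtx_def fun_eq_iff)
 then have "singular_face 1 0 s = pt (s (vtx 1))" "singular_face 1 1 s = pt (s (vtx 0))"
  unfolding singular_face_def pt_def by (auto intro!: restrict_ext simp: simplex_0)
 then show ?thesis by (simp add: chain_boundary_of)
qed

lemma boundary_2: "chain_boundary 2 (frag_of s)
  = frag_of (singular_face 2 0 s) - frag_of (singular_face 2 1 s) + frag_of (singular_face 2 2 s)"
proof -
 have "{..2::nat} = {0, 1, 2}" by auto
 then show ?thesis by (simp add: chain_boundary_of)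
qed

lemma seg_ends: "seg g v w (vtx 0) = g v" "seg g v w (vtx 1) = g w"
 using vtx_in[of 0 1] vtx_in[of 1 1] by (simp_all add: seg_def del: vtx_in) (simp_all add: vtx_def)

lemma boundary_seg: "chain_boundary 1 (frag_of (seg g v w)) = frag_of (pt (g w)) - frag_of (pt (g v))"
 unfolding boundary_1 seg_ends ..

lemma boundary_tsimp: "chain_boundary 2 (frag_of (tsimp g v w z))
  = frag_of (seg g w z) - frag_of (seg g v z) + frag_of (seg g v w)"
proof -
 have f: "simplical_face k u \<in> standard_simplex 2" if "u \<in> standard_simplex (Suc 0)" "k \<le> 2" for u :: "nat \<Rightarrow> real" and k
  using face_in[of 2 k u] that by simp
 have "singular_face 2 0 (tsimp g v w z) = seg g w z" "singular_face 2 1 (tsimp g v w z) = seg g v z"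
  "singular_face 2 2 (tsimp g v w z) = seg g v w"
  unfolding singular_face_def seg_def
  by (auto intro!: restrict_ext simp: tsimp_def f) (simp_all add: simplical_face_def)
 then show ?thesis unfolding boundary_2 by simp
qed

text \<open>The three segments are the faces of the affine 2-simplex on v, w and z; the three points
  may coincide.\<close>

lemma hom_tsimp:
 assumes "continuous_map (top_of_set tri) X g" "v \<in> tri" "w \<in> tri" "z \<in> tri"
 shows "homologous_rel 1 X {} (frag_of (seg g v w) + frag_of (seg g w z)) (frag_of (seg g v z))"
proof -
 have "singular_chain 2 X (frag_of (tsimp g v w z))"
  using singular_simplex_tsimp[OF assms] by (simp add: singular_chain_of)
 moreover have "chain_boundary 2 (frag_of (tsimp g v w z)) = frag_of (seg g v w) + frag_of (seg g w z) - frag_of (seg g v z)"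
  unfolding boundary_tsimp by simp
 ultimately show ?thesis unfolding homologous_rel_def singular_boundary
  by (intro exI[of _ "frag_of (tsimp g v w z)"]) (simp add: numeral_2_eq_2)
qed

text \<open>The first homology of a contractible space is trivial, and a bounding chain in the
  subspace is one in X.\<close>

lemma contractible_cycle_boundary:
 assumes "contractible_space (subtopology X U)" "singular_relcycle 1 (subtopology X U) {} c"
 shows "singular_relboundary 1 X {} c"
proof -
 let ?Y = "subtopology X U"
 have "trivial_group (homology_group 1 ?Y)"
  using trivial_reduced_homology_group_contractible_space[OF assms(1), of 1] by (simp add: un_reduced_homology_group)
 then obtain A where A: "carrier (homology_group (int 1) ?Y) = {A}" by (auto simp: trivial_group_def)
 have "homologous_rel_set 1 ?Y {} c \<in> carrier (homology_group (int 1) ?Y)"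
  "homologous_rel_set 1 ?Y {} 0 \<in> carrier (homology_group (int 1) ?Y)"
  unfolding carrier_relative_homology_group using assms(2) by auto
 then have "homologous_rel_set 1 ?Y {} c = homologous_rel_set 1 ?Y {} 0" unfolding A by blast
 then have "homologous_rel 1 ?Y {} c 0" by (simp add: homologous_rel_set_eq)
 then have "singular_relboundary 1 ?Y {} c" by (simp add: homologous_rel_def)
 then show ?thesis unfolding singular_boundary using singular_chain_subtopology by blast
qed

section \<open>Generators of the first homology group\<close>

text \<open>Working up to homology makes membership invariant under homologous changes
  (\<open>span_hom\<close>), so homotopies of single segments can be carried out inside the
  span.\<close>

definition integer_span :: "nat \<Rightarrow> 'a topology \<Rightarrow> 'a chain set \<Rightarrow> 'a chain set" where
 "integer_span p X C = {c. \<exists>m. homologous_rel p X {} c (\<Sum>b\<in>C. frag_cmul (m b) b)}"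

lemma span_hom: "c \<in> integer_span p X C \<Longrightarrow> homologous_rel p X {} c' c \<Longrightarrow> c' \<in> integer_span p X C"
 unfolding integer_span_def using homologous_rel_trans by blast

lemma span_0 [simp]: "0 \<in> integer_span p X C"
 unfolding integer_span_def by (intro CollectI exI[of _ "\<lambda>_. 0"]) simp

lemma span_diff: assumes "c \<in> integer_span p X C" "c' \<in> integer_span p X C" shows "c - c' \<in> integer_span p X C"
proof -
 obtain m m' where "homologous_rel p X {} c (\<Sum>b\<in>C. frag_cmul (m b) b)" "homologous_rel p X {} c' (\<Sum>b\<in>C. frag_cmul (m' b) b)"
  using assms by (auto simp: integer_span_def)
 then have "homologous_rel p X {} (c - c') ((\<Sum>b\<in>C. frag_cmul (m b) b) - (\<Sum>b\<in>C. frag_cmul (m' b) b))"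
  by (rule homologous_rel_diff)
 then have "homologous_rel p X {} (c - c') (\<Sum>b\<in>C. frag_cmul (m b - m' b) b)"
  by (simp add: sum_subtractf frag_cmul_diff_distrib)
 then show ?thesis unfolding integer_span_def by (intro CollectI exI)
qed

lemma span_uminus: "c \<in> integer_span p X C \<Longrightarrow> - c \<in> integer_span p X C"
 using span_diff[OF span_0, of c] by simp

lemma span_add: "c \<in> integer_span p X C \<Longrightarrow> c' \<in> integer_span p X C \<Longrightarrow> c + c' \<in> integer_span p X C"
 using span_diff[of c p X C "- c'"] span_uminus[of c'] by simp

lemma span_base: assumes "finite C" "b \<in> C" shows "b \<in> integer_span p X C"
proof -
 have "(\<Sum>b'\<in>C. frag_cmul (if b' = b then 1 else 0) b') = (\<Sum>b'\<in>C. if b' = b then b else 0)"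
  by (intro sum.cong) auto
 also have "\<dots> = b" using assms by simp
 finally show ?thesis unfolding integer_span_def
  by (intro CollectI exI[of _ "\<lambda>b'. if b' = b then 1 else 0"]) simp
qed

text \<open>By linearity it is enough to compare each simplex with the value of h on its boundary.
  For a cycle the second term is zero, so the cycle itself lies in the span.\<close>

lemma frag_span:
 assumes "Poly_Mapping.keys c \<subseteq> D" "\<And>k. k \<in> D \<Longrightarrow> frag_of k - frag_extend h (chain_boundary 1 (frag_of k)) \<in> integer_span p X C"
 shows "c - frag_extend h (chain_boundary 1 c) \<in> integer_span p X C"
 using assms(1)
proof (induction c rule: frag_induction)
 case (diff a b)
 have eq: "(a - b) - frag_extend h (chain_boundary 1 (a - b))
   = (a - frag_extend h (chain_boundary 1 a)) - (b - frag_extend h (chain_boundary 1 b))"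
  by (simp add: chain_boundary_diff frag_extend_diff)
 show ?case unfolding eq by (rule span_diff[OF diff])
qed (use assms(2) in auto)

context connected_tiling
begin

abbreviation eseg :: "3 \<times> nat \<Rightarrow> 'a chain" where
 "eseg e \<equiv> frag_of (seg (S (True, snd e)) (axis (fst e + 1) 1) (axis (fst e + 2) 1))"

lemma seg_tile_edge:
 assumes "x \<in> tiles d"
 shows "eseg (tedge t x i) = frag_of (seg (S x) (axis (i + 1) 1) (axis (i + 2) 1))"
proof -
 have fst: "fst (tedge t x i) = i" by (simp add: tedge_def)
 have "S (True, snd (tedge t x i)) (u 0 *\<^sub>R axis (i + 1) 1 + u 1 *\<^sub>R axis (i + 2) 1) = S x (u 0 *\<^sub>R axis (i + 1) 1 + u 1 *\<^sub>R axis (i + 2) 1)"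
  if "u \<in> standard_simplex 1" for u
 proof (rule tile_edge(2)[OF assms])
  show "u 0 *\<^sub>R axis (i + 1) 1 + u 1 *\<^sub>R axis (i + 2) 1 \<in> tri"
   using simplex_1[OF that] tri_comb[of "axis (i + 1) 1" "axis (i + 2) 1" "axis i 1" "u 0" "u 1" 0] by simp
 qed (simp add: axis_nth)
 then have "seg (S (True, snd (tedge t x i))) (axis (i + 1) 1) (axis (i + 2) 1) = seg (S x) (axis (i + 1) 1) (axis (i + 2) 1)"
  unfolding seg_def by (intro restrict_ext) blast
 then show ?thesis by (simp add: fst)
qed

lemma hom_seg: "x \<in> tiles d \<Longrightarrow> v \<in> tri \<Longrightarrow> w \<in> tri \<Longrightarrow> z \<in> tri \<Longrightarrow>
  homologous_rel 1 X {} (frag_of (seg (S x) v w) + frag_of (seg (S x) w z)) (frag_of (seg (S x) v z))"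
 by (rule hom_tsimp[OF contS])

text \<open>In the triangle with three equal corners all sides are the same constant segment, so
  twice that segment is homologous to the segment itself.\<close>

lemma hom_seg_refl: "x \<in> tiles d \<Longrightarrow> v \<in> tri \<Longrightarrow> homologous_rel 1 X {} (frag_of (seg (S x) v v)) 0"
 using hom_seg[of x v v v] by (simp add: homologous_rel_def)

lemma hom_seg_rev: assumes "x \<in> tiles d" "v \<in> tri" "w \<in> tri"
 shows "homologous_rel 1 X {} (frag_of (seg (S x) v w)) (- frag_of (seg (S x) w v))"
 using homologous_rel_trans[OF hom_seg_refl[OF assms(1,2)] hom_seg[OF assms assms(2)]]
 by (simp add: homologous_rel_def)

lemma hom_boundary_tile: assumes "x \<in> tiles d"
 shows "homologous_rel 1 X {} (\<Sum>i\<in>UNIV. eseg (tedge t x i)) 0"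
proof -
 have "homologous_rel 1 X {} (frag_of (seg (S x) (axis 2 1) (axis 3 1)) + frag_of (seg (S x) (axis 3 1) (axis 1 1)))
   (frag_of (seg (S x) (axis 2 1) (axis 1 1)))"
  by (rule hom_seg) (use assms in auto)
 from homologous_rel_add[OF this homologous_rel_refl]
 have 1: "homologous_rel 1 X {} (frag_of (seg (S x) (axis 2 1) (axis 3 1)) + frag_of (seg (S x) (axis 3 1) (axis 1 1))
   + frag_of (seg (S x) (axis 1 1) (axis 2 1))) (frag_of (seg (S x) (axis 2 1) (axis 1 1)) + frag_of (seg (S x) (axis 1 1) (axis 2 1)))" .
 have 2: "homologous_rel 1 X {} (frag_of (seg (S x) (axis 2 1) (axis 1 1)) + frag_of (seg (S x) (axis 1 1) (axis 2 1)))
   (frag_of (seg (S x) (axis 2 1) (axis 2 1)))"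
  by (rule hom_seg) (use assms in auto)
 have 3: "homologous_rel 1 X {} (frag_of (seg (S x) (axis 2 1) (axis 2 1))) 0"
  by (rule hom_seg_refl) (use assms in auto)
 note homologous_rel_trans[OF 3 homologous_rel_trans[OF 2 1]]
 moreover have "(\<Sum>i\<in>UNIV. eseg (tedge t x i)) = frag_of (seg (S x) (axis 2 1) (axis 3 1)) + frag_of (seg (S x) (axis 3 1) (axis 1 1))
   + frag_of (seg (S x) (axis 1 1) (axis 2 1))"
  unfolding sum_3 seg_tile_edge[OF assms] by (simp add: num_3)
 ultimately show ?thesis by simp
qed

text \<open>Together with the radial segments from the centre z to its two ends the simplex forms a
  cycle in the star, which bounds because the star is contractible.\<close>

lemma small_simplex:
 assumes s: "singular_simplex 1 X s" "s ` standard_simplex 1 \<subseteq> star i z"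
  and y: "ya = s (vtx 0)" "yb = s (vtx 1)"
 shows "homologous_rel 1 X {} (frag_of s)
  (frag_of (seg (S (tile_of yb)) (axis i 1) (bary (f yb))) - frag_of (seg (S (tile_of ya)) (axis i 1) (bary (f ya))))"
proof -
 have star: "ya \<in> star i z" "yb \<in> star i z" using s(2) vtx_in[of 0 1] vtx_in[of 1 1] unfolding y by blast+
 then have yX: "ya \<in> topspace X" "yb \<in> topspace X" using star_subset by blast+
 have *: "singular_simplex 1 (subtopology X (star i z)) (seg (S (tile_of y)) (axis i 1) (bary (f y)))"
  "S (tile_of y) (axis i 1) = z" if y: "y \<in> star i z" for y
 proof -
  have yX: "y \<in> topspace X" using y star_subset by blast
  have 1: "0 < bary (f y) $ i" "S (tile_of y) (axis i 1) = z"
   using star_iff[OF tile_of(1)[OF yX] bary_in_tri[of "f y"], of i z] tile_of(2)[OF yX] y by simp_all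
  have "seg (S (tile_of y)) (axis i 1) (bary (f y)) u \<in> star i z" if "u \<in> standard_simplex 1" for u
  proof -
   have u: "0 \<le> u 0" "0 \<le> u 1" "u 0 + u 1 = 1" using simplex_1[OF that] by auto
   have "u 0 *\<^sub>R axis i 1 + u 1 *\<^sub>R bary (f y) \<in> tri"
    using tri_comb[of "axis i 1" "bary (f y)" "axis i 1" "u 0" "u 1" 0] u by simp
   moreover have "0 < (u 0 *\<^sub>R axis i 1 + u 1 *\<^sub>R bary (f y)) $ i"
   proof (cases "u 0 = 0")
    case True then show ?thesis using 1 u by (simp add: axis_nth)
   next
    case False then show ?thesis using 1 u by (simp add: axis_nth add_pos_nonneg)
   qed
   ultimately show ?thesis using star_iff[OF tile_of(1)[OF yX]] 1(2) that by (simp add: seg_def)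
  qed
  then show "singular_simplex 1 (subtopology X (star i z)) (seg (S (tile_of y)) (axis i 1) (bary (f y)))"
   using singular_simplex_seg[OF contS[OF tile_of(1)[OF yX]]] by (auto simp: singular_simplex_subtopology)
  show "S (tile_of y) (axis i 1) = z" by fact
 qed
 define c where "c = frag_of s - (frag_of (seg (S (tile_of yb)) (axis i 1) (bary (f yb))) - frag_of (seg (S (tile_of ya)) (axis i 1) (bary (f ya))))"
 have "singular_chain 1 (subtopology X (star i z)) c"
  unfolding c_def using *(1)[OF star(1)] *(1)[OF star(2)] s
  by (intro singular_chain_diff) (simp_all add: singular_chain_of singular_simplex_subtopology)
 moreover have "chain_boundary 1 c = 0"
  unfolding c_def chain_boundary_diff boundary_seg unfolding boundary_1 y[symmetric]
  using *(2)[OF star(1)] *(2)[OF star(2)] tile_of(2) yX by simp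
 ultimately have cyc: "singular_relcycle 1 (subtopology X (star i z)) {} c" by (simp add: singular_cycle)
 have "z \<in> vertices i" using *(2)[OF star(1)] tile_of(1)[OF yX(1)] by (auto simp: vertices_def)
 then show ?thesis using contractible_cycle_boundary[OF contractible_star cyc] by (simp add: homologous_rel_def c_def)
qed

text \<open>\<open>P v\<close> is the tree path from the root to v, and
  \<open>P (esrc e) + eseg e - P (edst e)\<close> is the cycle that e closes in the tree; for a tree
  edge it is zero. The cycles of the three sides of a tile add up to a boundary, so the cycle of the
  edge from a tile to its parent in the dual tree is expressed by the other two sides. Treating
  tiles of large rank before those of small rank leaves only the edges in R. Arbitrary cycles are
  reduced to edges by subdivision into simplices that lie in stars.\<close>

lemma generation:
 assumes T: "rooted_tree verts root esrc edst rk a" "a ` (verts - {root}) \<subseteq> edges d"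
  and T': "rooted_tree (tiles d) (True, 0) tsrc (tdst t) rk' a'"
   "a' ` (tiles d - {(True, 0)}) \<subseteq> edges d - a ` (verts - {root})"
  and R: "R = edges d - a ` (verts - {root}) - a' ` (tiles d - {(True, 0)})"
 obtains P where "P root = 0"
  "\<And>v. v \<in> verts \<Longrightarrow> v \<noteq> root \<Longrightarrow> P (edst (a v)) = P (esrc (a v)) + eseg (a v)"
  "\<And>e. e \<in> edges d \<Longrightarrow> singular_relcycle 1 X {} (P (esrc e) + eseg e - P (edst e))"
  "\<And>c. singular_relcycle 1 X {} c \<Longrightarrow> c \<in> integer_span 1 X ((\<lambda>e. P (esrc e) + eseg e - P (edst e)) ` R)"
proof -
 interpret T: rooted_tree verts root esrc edst rk a by fact
 interpret T': rooted_tree "tiles d" "(True, 0)" tsrc "tdst t" rk' a' by fact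
 obtain P where P: "P root = 0"
  "\<And>v. v \<in> verts \<Longrightarrow> v \<noteq> root \<Longrightarrow> P (edst (a v)) = P (esrc (a v)) + eseg (a v)"
  by (rule T.potential[where \<epsilon> = eseg]) (rule that)
 define c where "c e = P (esrc e) + eseg e - P (edst e)" for e
 have eseg_chain: "singular_chain 1 X (eseg e)" if "e \<in> edges d" for e
 proof -
  have "(True, snd e) \<in> tiles d" using that by (cases e) simp
  from singular_simplex_seg[OF contS[OF this]] show ?thesis by (simp add: singular_chain_of)
 qed
 have eseg_bd: "chain_boundary 1 (eseg e) = frag_of (pt (edst e)) - frag_of (pt (esrc e))" for e
  unfolding boundary_seg by (simp add: edst_def esrc_def)
 have P_chain: "singular_chain 1 X (P v) \<and> chain_boundary 1 (P v) = frag_of (pt v) - frag_of (pt root)"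
  if "v \<in> verts" for v
 proof (rule T.tree_induct[OF that])
  fix v assume v: "v \<in> verts" "v \<noteq> root"
   and IH: "singular_chain 1 X (P (T.parent v)) \<and> chain_boundary 1 (P (T.parent v)) = frag_of (pt (T.parent v)) - frag_of (pt root)"
  have e: "a v \<in> edges d" using T(2) v by blast
  show "singular_chain 1 X (P v) \<and> chain_boundary 1 (P v) = frag_of (pt v) - frag_of (pt root)"
   using T.parent(3)[OF v]
  proof (elim disjE conjE)
   assume h: "esrc (a v) = v" "edst (a v) = T.parent v"
   have Pv: "P v = P (T.parent v) - eseg (a v)" using P(2)[OF v] unfolding h by simp
   show ?thesis using IH eseg_chain[OF e] unfolding Pv chain_boundary_diff eseg_bd h
    by (simp add: singular_chain_diff)
  next
   assume h: "edst (a v) = v" "esrc (a v) = T.parent v"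
   have Pv: "P v = P (T.parent v) + eseg (a v)" using P(2)[OF v] unfolding h by simp
   show ?thesis using IH eseg_chain[OF e] unfolding Pv chain_boundary_add eseg_bd h
    by (simp add: singular_chain_add)
  qed
 qed (simp add: P(1))
 have c_cycle: "singular_relcycle 1 X {} (c e)" if "e \<in> edges d" for e
  unfolding singular_cycle c_def chain_boundary_add chain_boundary_diff eseg_bd
  using P_chain[OF esrc_in(1)[OF that]] P_chain[OF esrc_in(2)[OF that]] eseg_chain[OF that]
  by (simp add: singular_chain_add singular_chain_diff)
 define G where "G = integer_span 1 X (c ` R)"
 have finR: "finite R" by (simp add: R)
 have cR: "c e \<in> G" if "e \<in> R" for e unfolding G_def using finR that by (intro span_base) auto
 have cT: "c (a v) = 0" if "v \<in> verts" "v \<noteq> root" for v unfolding c_def P(2)[OF that] by simp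
 \<comment> \<open>The path terms cancel cyclically round the tile, and the sides that remain bound
   it.\<close>
 have c_face: "(\<Sum>i\<in>UNIV. c (tedge t x i)) \<in> G" if x: "x \<in> tiles d" for x
 proof -
  have "(\<Sum>i\<in>UNIV. c (tedge t x i)) = (\<Sum>i\<in>UNIV. eseg (tedge t x i))"
   unfolding c_def tile_edge(3)[OF x] tile_edge(4)[OF x] sum_3 by (simp add: num_3 algebra_simps)
  then show ?thesis unfolding G_def using hom_boundary_tile[OF x] span_hom[OF span_0] by metis
 qed
 have tedge_in: "e = tedge t x (fst e) \<longleftrightarrow> x = tsrc e \<or> x = tdst t e" if "e \<in> edges d" for e x
  by (cases e; cases x) (auto simp: tedge_def tsrc_def tdst_def)
 have cT': "c (a' x) \<in> G" if "x \<in> tiles d" "x \<noteq> (True, 0)" for x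
  using that
 proof (induction "Max (rk' ` tiles d) - rk' x" arbitrary: x rule: less_induct)
  case less
  have ax: "a' x \<in> edges d" "x = tsrc (a' x) \<or> x = tdst t (a' x)"
   using T'(2) less.prems T'.parent(3)[OF less.prems] by auto
  have eq: "a' x = tedge t x (fst (a' x))" using tedge_in[OF ax(1), of x] ax(2) by blast
  have other: "c (tedge t x i) \<in> G" if i: "i \<noteq> fst (a' x)" for i
  proof -
   let ?e = "tedge t x i"
   have fst: "fst ?e = i" by (simp add: tedge_def)
   have e: "?e \<in> edges d" by (rule tile_edge(1)[OF less.prems(1)])
   consider "?e \<in> a ` (verts - {root})" | "?e \<in> R" | "?e \<in> a' ` (tiles d - {(True, 0)})"
    using e unfolding R by blast
   then show ?thesis
   proof cases
    case 1
    then obtain v where "v \<in> verts" "v \<noteq> root" "?e = a v" by blast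
    then show ?thesis using cT[of v] by (simp add: G_def)
   next
    case 2 then show ?thesis by (rule cR)
   next
    case 3
    then obtain w where w: "w \<in> tiles d" "w \<noteq> (True, 0)" "?e = a' w" by blast
    have "w \<noteq> x" using w(3) fst i by auto
    have "x = tsrc (a' w) \<or> x = tdst t (a' w)" using tedge_in[OF e, of x] fst unfolding w(3)[symmetric] by simp
    then have "x = T'.parent w" using T'.parent(3)[OF w(1,2)] \<open>w \<noteq> x\<close> by metis
    then have "rk' x < rk' w" using T'.parent(2)[OF w(1,2)] by simp
    moreover have "rk' w \<le> Max (rk' ` tiles d)" using w(1) by simp
    ultimately have "c (a' w) \<in> G" using less.hyps[of w] w by linarith
    then show ?thesis using w(3) by simp
   qed
  qed
  have "(\<Sum>i\<in>UNIV. c (tedge t x i)) = c (a' x) + (\<Sum>i\<in>UNIV - {fst (a' x)}. c (tedge t x i))"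
   using eq by (subst sum.remove[of _ "fst (a' x)"]) auto
  moreover have "(\<Sum>i\<in>I. c (tedge t x i)) \<in> G" if "finite I" "I \<subseteq> UNIV - {fst (a' x)}" for I
   using that by (induction I) (use other in \<open>auto simp: G_def intro!: span_add\<close>)
  ultimately have "c (a' x) = (\<Sum>i\<in>UNIV. c (tedge t x i)) - (\<Sum>i\<in>UNIV - {fst (a' x)}. c (tedge t x i))"
   "(\<Sum>i\<in>UNIV - {fst (a' x)}. c (tedge t x i)) \<in> G" by (simp_all only: add_diff_cancel_right') simp_all
  then show ?case using span_diff c_face[OF less.prems(1)] unfolding G_def by metis
 qed
 have cE: "c e \<in> G" if e: "e \<in> edges d" for e
 proof -
  consider "e \<in> a ` (verts - {root})" | "e \<in> R" | "e \<in> a' ` (tiles d - {(True, 0)})"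
   using e unfolding R by blast
  then show ?thesis
  proof cases
   case 1
   then obtain v where "v \<in> verts" "v \<noteq> root" "e = a v" by blast
   then show ?thesis using cT[of v] by (simp add: G_def)
  next
   case 2 then show ?thesis by (rule cR)
  next
   case 3
   then obtain x where "x \<in> tiles d" "x \<noteq> (True, 0)" "e = a' x" by blast
   then show ?thesis using cT'[of x] by simp
  qed
 qed
 have corners: "P (S x (axis i 1)) + frag_of (seg (S x) (axis i 1) (axis j 1)) - P (S x (axis j 1)) \<in> G"
  if x: "x \<in> tiles d" for x i j
 proof -
  have *: "P (S x (axis (k + 1) 1)) + frag_of (seg (S x) (axis (k + 1) 1) (axis (k + 2) 1)) - P (S x (axis (k + 2) 1)) \<in> G" for k
   using cE[OF tile_edge(1)[OF x, of k]] unfolding c_def tile_edge(3,4)[OF x] seg_tile_edge[OF x] .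
  have **: "P (S x (axis (k + 2) 1)) + frag_of (seg (S x) (axis (k + 2) 1) (axis (k + 1) 1)) - P (S x (axis (k + 1) 1)) \<in> G" for k
  proof (rule span_hom[OF span_uminus[OF *[of k, unfolded G_def]], folded G_def])
   show "homologous_rel 1 X {} (P (S x (axis (k + 2) 1)) + frag_of (seg (S x) (axis (k + 2) 1) (axis (k + 1) 1)) - P (S x (axis (k + 1) 1)))
    (- (P (S x (axis (k + 1) 1)) + frag_of (seg (S x) (axis (k + 1) 1) (axis (k + 2) 1)) - P (S x (axis (k + 2) 1))))"
    using hom_seg_rev[OF x, of "axis (k + 2) 1" "axis (k + 1) 1"] by (simp add: homologous_rel_def)
  qed
  show ?thesis
  proof (rule cases_3[of j i])
   assume "j = i"
   then show ?thesis using span_hom[OF span_0 hom_seg_refl[OF x, of "axis i 1"]] by (simp add: G_def)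
  next
   assume "j = i + 1" then show ?thesis using *[of "i + 2"] by simp
  next
   assume "j = i + 2" then show ?thesis using **[of "i + 1"] by simp
  qed
 qed
 define jj where "jj y = (SOME j. 0 < bary (f y) $ j)" for y
 \<comment> \<open>\<open>\<eta> y\<close> is a chosen path from the root to y: along the tree to a
   corner of a tile containing y, and straight on inside the tile.\<close>
 define \<eta> where "\<eta> y = P (S (tile_of y) (axis (jj y) 1)) + frag_of (seg (S (tile_of y)) (axis (jj y) 1) (bary (f y)))" for y
 have eta: "P z + frag_of (seg (S (tile_of y)) (axis i 1) (bary (f y))) - \<eta> y \<in> G" if y: "y \<in> star i z" for y i z
 proof -
  have yX: "y \<in> topspace X" using y star_subset by blast
  note ty = tile_of(1)[OF yX]
  have z: "S (tile_of y) (axis i 1) = z"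
   using star_iff[OF ty bary_in_tri[of "f y"], of i z] tile_of(2)[OF yX] y by simp
  show ?thesis unfolding z[symmetric] \<eta>_def G_def
  proof (rule span_hom[OF corners[OF ty, of i "jj y", unfolded G_def]])
   have "homologous_rel 1 X {} (frag_of (seg (S (tile_of y)) (axis i 1) (axis (jj y) 1)) + frag_of (seg (S (tile_of y)) (axis (jj y) 1) (bary (f y))))
    (frag_of (seg (S (tile_of y)) (axis i 1) (bary (f y))))" by (rule hom_seg[OF ty]) auto
   then have h: "homologous_rel 1 X {} (frag_of (seg (S (tile_of y)) (axis i 1) (bary (f y))))
    (frag_of (seg (S (tile_of y)) (axis i 1) (axis (jj y) 1)) + frag_of (seg (S (tile_of y)) (axis (jj y) 1) (bary (f y))))"
    by (simp only: homologous_rel_sym)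
   have arith: "(p + u - (q + w)) - (p + u' - q) = u - (u' + w)" for p q u u' w :: "'a chain" by simp
   show "homologous_rel 1 X {} (P (S (tile_of y) (axis i 1)) + frag_of (seg (S (tile_of y)) (axis i 1) (bary (f y)))
     - (P (S (tile_of y) (axis (jj y) 1)) + frag_of (seg (S (tile_of y)) (axis (jj y) 1) (bary (f y)))))
    (P (S (tile_of y) (axis i 1)) + frag_of (seg (S (tile_of y)) (axis i 1) (axis (jj y) 1)) - P (S (tile_of y) (axis (jj y) 1)))"
    using h unfolding homologous_rel_def arith .
  qed
 qed
 have span: "cc \<in> G" if cc: "singular_relcycle 1 X {} cc" for cc
 proof -
  define \<C> where "\<C> = {star i z | i z. True}"
  have "openin X U" if "U \<in> \<C>" for U using that openin_star by (auto simp: \<C>_def)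
  moreover have "topspace X \<subseteq> \<Union>\<C>" using star_cover by (fastforce simp: \<C>_def)
  ultimately obtain c' where c': "singular_relcycle 1 X {} c'" "homologous_rel 1 X {} cc c'"
   "\<And>s. s \<in> Poly_Mapping.keys c' \<Longrightarrow> \<exists>V\<in>\<C>. s \<in> standard_simplex 1 \<rightarrow> V"
   by (rule small_homologous_rel_relcycle_exists[OF _ _ cc]) blast+
  define h where "h s = \<eta> (s (vtx 0))" for s :: "(nat \<Rightarrow> real) \<Rightarrow> 'a"
  \<comment> \<open>Modulo the span a simplex inside a star equals the difference of the chosen
    paths to its ends; over a cycle these differences cancel.\<close>
  have "c' - frag_extend h (chain_boundary 1 c') \<in> G" unfolding G_def
  proof (rule frag_span[OF order_refl])
   fix s assume s: "s \<in> Poly_Mapping.keys c'"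
   obtain i z where iz: "s \<in> standard_simplex 1 \<rightarrow> star i z" using c'(3)[OF s] by (auto simp: \<C>_def)
   have ss: "singular_simplex 1 X s" using s c'(1) by (auto simp: singular_cycle singular_chain_def)
   let ?ya = "s (vtx 0)" and ?yb = "s (vtx 1)"
   have st: "?ya \<in> star i z" "?yb \<in> star i z" using iz by (auto simp: Pi_iff)
   have sim: "s ` standard_simplex 1 \<subseteq> star i z" using iz by auto
   define CA CB where "CA = frag_of (seg (S (tile_of ?ya)) (axis i 1) (bary (f ?ya)))"
    and "CB = frag_of (seg (S (tile_of ?yb)) (axis i 1) (bary (f ?yb)))"
   have 1: "homologous_rel 1 X {} (frag_of s) (CB - CA)"
    unfolding CA_def CB_def by (rule small_simplex[OF ss sim refl refl])
   have "frag_extend h (chain_boundary 1 (frag_of s)) = \<eta> ?yb - \<eta> ?ya"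
    unfolding boundary_1 frag_extend_diff by (simp add: h_def pt_def)
   moreover have "(P z + CB - \<eta> ?yb) - (P z + CA - \<eta> ?ya) \<in> integer_span 1 X (c ` R)"
    using span_diff[OF eta[OF st(2), unfolded G_def] eta[OF st(1), unfolded G_def]] by (simp add: CA_def CB_def)
   moreover have "homologous_rel 1 X {} (frag_of s - (\<eta> ?yb - \<eta> ?ya)) ((P z + CB - \<eta> ?yb) - (P z + CA - \<eta> ?ya))"
    using 1 by (simp add: homologous_rel_def algebra_simps)
   ultimately show "frag_of s - frag_extend h (chain_boundary 1 (frag_of s)) \<in> integer_span 1 X (c ` R)"
    using span_hom by metis
  qed
  moreover have "chain_boundary 1 c' = 0" using c'(1) by (simp add: singular_cycle)
  ultimately have "c' \<in> G" by simp
  then show ?thesis using span_hom[OF _ c'(2)] unfolding G_def by blast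
 qed
 show thesis
  by (rule that[OF P]) (use c_cycle span in \<open>auto simp: c_def G_def\<close>)
qed

end

section \<open>Winding numbers along singular simplices\<close>

definition lin :: "real \<Rightarrow> nat \<Rightarrow> real" where
 "lin r = (\<lambda>i. if i = 0 then 1 - r else if i = 1 then r else 0)"

definition lin2 :: "real \<times> real \<Rightarrow> nat \<Rightarrow> real" where
 "lin2 p = (\<lambda>i. if i = 0 then 1 - fst p - snd p else if i = 1 then fst p else if i = 2 then snd p else 0)"

text \<open>The increment of a continuous logarithm of h along a 1-simplex; by
  \<open>incr_eq\<close> it does not depend on the logarithm chosen.\<close>

definition incr :: "('a \<Rightarrow> complex) \<Rightarrow> ((nat \<Rightarrow> real) \<Rightarrow> 'a) \<Rightarrow> complex" where
 "incr h s = (SOME w. \<exists>g. continuous_on {0..1::real} g \<and> (\<forall>r\<in>{0..1}. h (s (lin r)) = exp (g r)) \<and> w = g 1 - g 0)"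

lemma lin_in: "0 \<le> r \<Longrightarrow> r \<le> 1 \<Longrightarrow> lin r \<in> standard_simplex 1"
 by (simp add: standard_simplex_def lin_def atMost_Suc)

lemma lin2_in: "0 \<le> x \<Longrightarrow> 0 \<le> y \<Longrightarrow> x + y \<le> 1 \<Longrightarrow> lin2 (x, y) \<in> standard_simplex 2"
 by (auto simp: standard_simplex_def lin2_def numeral_2_eq_2 atMost_Suc)

text \<open>Two logarithms differ by a continuous function with values in the integer multiples of 2
  \<pi> i, which is constant on the interval.\<close>

lemma incr_eq:
 assumes g: "continuous_on {0..1} g" "\<And>r. 0 \<le> r \<Longrightarrow> r \<le> 1 \<Longrightarrow> h (s (lin r)) = exp (g r)"
 shows "incr h s = g 1 - g 0"
proof -
 have uniq: "g' 1 - g' 0 = g 1 - g 0"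
  if g': "continuous_on {0..1} g'" "\<forall>r\<in>{0..1}. h (s (lin r)) = exp (g' r)" for g'
 proof -
  have int: "\<exists>n::int. g' r - g r = of_int n * (2 * of_real pi * \<i>)" if "r \<in> {0..1}" for r
  proof -
   have "exp (g' r) = exp (g r)" using g(2)[of r] g'(2) that by simp
   then obtain n :: int where "g' r = g r + of_real (real_of_int (2 * n) * pi) * \<i>" unfolding exp_eq by blast
   then have "g' r - g r = of_real (real_of_int (2 * n) * pi) * \<i>" by simp
   also have "\<dots> = of_int n * (2 * of_real pi * \<i>)" by simp
   finally show ?thesis by (rule exI)
  qed
  have "(\<lambda>r. g' r - g r) constant_on {0..1}"
  proof (rule continuous_discrete_range_constant)
   show "continuous_on {0..1} (\<lambda>r. g' r - g r)" by (intro continuous_on_diff g(1) g'(1))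
   show "\<exists>e>0. \<forall>y. y \<in> {0..1} \<and> g' y - g y \<noteq> g' x - g x \<longrightarrow> e \<le> norm (g' y - g y - (g' x - g x))"
    if x: "x \<in> {0..1}" for x
   proof (intro exI[of _ "2 * pi"] conjI allI impI)
    fix y assume y: "y \<in> {0..1} \<and> g' y - g y \<noteq> g' x - g x"
    obtain m :: int where m: "g' x - g x = of_int m * (2 * of_real pi * \<i>)" using int[OF x] by blast
    obtain n :: int where n: "g' y - g y = of_int n * (2 * of_real pi * \<i>)" using int[of y] y by blast
    note mn = m n
    have "n \<noteq> m" using y m n by metis
    then have "1 \<le> \<bar>real_of_int (n - m)\<bar>" by linarith
    then have le: "1 * (2 * pi) \<le> \<bar>real_of_int (n - m)\<bar> * (2 * pi)" by (rule mult_right_mono) simp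
    have "g' y - g y - (g' x - g x) = of_int (n - m) * (2 * of_real pi * \<i>)"
     unfolding mn of_int_diff left_diff_distrib ..
    then have "norm (g' y - g y - (g' x - g x)) = \<bar>real_of_int (n - m)\<bar> * (2 * pi)"
     unfolding norm_mult norm_of_int by (simp only: norm_mult norm_of_int) (simp add: norm_mult)
    then show "2 * pi \<le> norm (g' y - g y - (g' x - g x))" using le by linarith
   qed simp
  qed simp
  then obtain c where c: "\<forall>r\<in>{0..1}. g' r - g r = c" unfolding constant_on_def by blast
  have "g' 0 - g 0 = c" "g' 1 - g 1 = c" using c by simp_all
  then show ?thesis by (simp add: diff_eq_eq)
 qed
 have "\<exists>w g. continuous_on {0..1::real} g \<and> (\<forall>r\<in>{0..1}. h (s (lin r)) = exp (g r)) \<and> w = g 1 - g 0"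
  by (rule exI[of _ "g 1 - g 0"], rule exI[of _ g]) (simp add: g)
 from someI_ex[OF this] obtain g' where "continuous_on {0..1} g'" "\<forall>r\<in>{0..1}. h (s (lin r)) = exp (g' r)"
  "incr h s = g' 1 - g' 0" unfolding incr_def[symmetric] by (elim exE conjE)
 then show ?thesis using uniq[of g'] by (simp only:)
qed

lemma continuous_map_lin2:
 "continuous_map (top_of_set {p. 0 \<le> fst p \<and> 0 \<le> snd p \<and> fst p + snd p \<le> 1})
   (subtopology (powertop_real UNIV) (standard_simplex 2)) lin2"
proof -
 have "continuous_on A (\<lambda>p. lin2 p k)" for A k
 proof -
  consider "k = 0" | "k = 1" | "k = 2" | "k > 2" by linarith
  then show ?thesis by cases (auto simp: lin2_def intro!: continuous_intros)
 qed
 then show ?thesis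
  using lin2_in by (auto simp: continuous_map_in_subtopology continuous_map_componentwise_UNIV)
qed

text \<open>The triangle is contractible, so h has one continuous logarithm on all of it and the
  increments along the three faces telescope.\<close>

lemma incr_face_sum:
 assumes h: "continuous_map X euclidean h" "\<And>y. y \<in> topspace X \<Longrightarrow> h y \<noteq> 0" and s: "singular_simplex 2 X s"
 shows "incr h (singular_face 2 0 s) - incr h (singular_face 2 1 s) + incr h (singular_face 2 2 s) = 0"
proof -
 define D where "D = {p::real \<times> real. 0 \<le> fst p \<and> 0 \<le> snd p \<and> fst p + snd p \<le> 1}"
 have sX: "continuous_map (subtopology (powertop_real UNIV) (standard_simplex 2)) X s"
  using s by (simp add: singular_simplex_def)
 have "continuous_map (top_of_set D) euclidean (h \<circ> (s \<circ> lin2))"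
  by (rule continuous_map_compose[OF continuous_map_compose[OF continuous_map_lin2[folded D_def] sX] h(1)])
 then have c: "continuous_on D (\<lambda>p. h (s (lin2 p)))" by (simp add: o_def)
 have "convex D"
 proof (rule convexI)
  fix p q :: "real \<times> real" and u v :: real
  assume p: "p \<in> D" "q \<in> D" and uv: "0 \<le> u" "0 \<le> v" "u + v = 1"
  have "u * (fst p + snd p) \<le> u * 1" "v * (fst q + snd q) \<le> v * 1"
   using p uv by (intro mult_left_mono; simp add: D_def)+
  then have "fst (u *\<^sub>R p + v *\<^sub>R q) + snd (u *\<^sub>R p + v *\<^sub>R q) \<le> 1"
   using uv by (simp add: distrib_left)
  then show "u *\<^sub>R p + v *\<^sub>R q \<in> D" using p uv by (simp add: D_def)
 qed
 then have cD: "contractible D" by (rule convex_imp_contractible)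
 have nz: "h (s (lin2 p)) \<noteq> 0" if "p \<in> D" for p
 proof -
  have "lin2 p \<in> standard_simplex 2" using lin2_in[of "fst p" "snd p"] that by (simp add: D_def)
  then show ?thesis using continuous_map_image_subset_topspace[OF sX] by (intro h(2)) auto
 qed
 obtain G where G: "continuous_on D G" "\<And>p. p \<in> D \<Longrightarrow> h (s (lin2 p)) = exp (G p)"
  using continuous_logarithm_on_contractible[OF c cD nz] by blast
 have face: "incr h (singular_face 2 k s) = G (\<gamma> 1) - G (\<gamma> 0)"
  if \<gamma>: "continuous_on {0..1} \<gamma>" "\<And>r. 0 \<le> r \<Longrightarrow> r \<le> 1 \<Longrightarrow> \<gamma> r \<in> D"
   "\<And>r. 0 \<le> r \<Longrightarrow> r \<le> 1 \<Longrightarrow> simplical_face k (lin r) = lin2 (\<gamma> r)" for k \<gamma>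
 proof -
  have "incr h (singular_face 2 k s) = (G \<circ> \<gamma>) 1 - (G \<circ> \<gamma>) 0"
  proof (rule incr_eq)
   show "continuous_on {0..1} (G \<circ> \<gamma>)"
    using \<gamma>(2) by (intro continuous_on_compose[OF \<gamma>(1)] continuous_on_subset[OF G(1)]) auto
   show "h (singular_face 2 k s (lin r)) = exp ((G \<circ> \<gamma>) r)" if "0 \<le> r" "r \<le> 1" for r
    using lin_in[OF that] G(2)[OF \<gamma>(2)[OF that]] \<gamma>(3)[OF that] by (simp add: singular_face_def)
  qed
  then show ?thesis by simp
 qed
 have "incr h (singular_face 2 0 s) = G (1 - 1, 1) - G (1 - 0, 0)"
  by (rule face[where \<gamma> = "\<lambda>r. (1 - r, r)"])
   (auto simp: D_def simplical_face_def lin_def lin2_def fun_eq_iff intro!: continuous_intros)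
 moreover have "incr h (singular_face 2 1 s) = G (0, 1) - G (0, 0)"
  by (rule face[where \<gamma> = "\<lambda>r. (0, r)"])
   (auto simp: D_def simplical_face_def lin_def lin2_def fun_eq_iff intro!: continuous_intros)
 moreover have "incr h (singular_face 2 2 s) = G (1, 0) - G (0, 0)"
  by (rule face[where \<gamma> = "\<lambda>r. (r, 0)"])
   (auto simp: D_def simplical_face_def lin_def lin2_def fun_eq_iff intro!: continuous_intros)
 ultimately show ?thesis by simp
qed

text \<open>The linear extension of \<open>incr\<close> to chains; on a cycle it is 2 \<pi> i times
  the winding number of h.\<close>

definition winding :: "('a \<Rightarrow> complex) \<Rightarrow> 'a chain \<Rightarrow> complex" where
 "winding h c = (\<Sum>s\<in>Poly_Mapping.keys c. of_int (Poly_Mapping.lookup c s) * incr h s)"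

lemma winding_of [simp]: "winding h (frag_of s) = incr h s"
 by (simp add: winding_def)

lemma winding_0 [simp]: "winding h 0 = 0"
 by (simp add: winding_def)

lemma winding_superset: "finite A \<Longrightarrow> Poly_Mapping.keys c \<subseteq> A \<Longrightarrow>
  winding h c = (\<Sum>s\<in>A. of_int (Poly_Mapping.lookup c s) * incr h s)"
 unfolding winding_def by (rule sum.mono_neutral_left) (auto simp: in_keys_iff)

lemma winding_diff: "winding h (a - b) = winding h a - winding h b"
proof -
 let ?A = "Poly_Mapping.keys a \<union> Poly_Mapping.keys b"
 have "Poly_Mapping.keys (a - b) \<subseteq> ?A" by (rule keys_diff)
 then show ?thesis
  using winding_superset[of ?A "a - b" h] winding_superset[of ?A a h] winding_superset[of ?A b h]
  by (simp add: lookup_minus left_diff_distrib sum_subtractf)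
qed

lemma winding_add: "winding h (a + b) = winding h a + winding h b"
 using winding_diff[of h "a + b" b] by simp

text \<open>By \<open>incr_face_sum\<close> the boundary of each 2-simplex has increment zero. Thus
  \<open>winding h\<close> depends only on the homology class and can tell classes apart.\<close>

lemma winding_boundary:
 assumes h: "continuous_map X euclidean h" "\<And>y. y \<in> topspace X \<Longrightarrow> h y \<noteq> 0" and c: "singular_relboundary 1 X {} c"
 shows "winding h c = 0"
proof -
 obtain e where e: "singular_chain 2 X e" "chain_boundary 2 e = c"
  using c by (auto simp: singular_boundary numeral_2_eq_2)
 have "winding h (chain_boundary 2 e) = 0" using e(1) unfolding singular_chain_def
 proof (induction e rule: frag_induction)
  case (one s)
  then show ?case using incr_face_sum[OF h, of s] by (simp add: boundary_2 winding_diff winding_add)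
 next
  case (diff a b) then show ?case by (simp add: chain_boundary_diff winding_diff)
 qed simp
 then show ?thesis using e by simp
qed

lemma sum_cyc: "(\<Sum>j\<in>UNIV. g j) = g i + g (i + 1) + g (i + (2::3))"
 using exhaust_3[of i] by (auto simp: sum_3 num_3 algebra_simps)

text \<open>The product in the homology group is defined as the set of all sums of representatives;
  this evaluates it on classes of chains.\<close>

lemma homologous_rel_set_add:
 "homologous_rel_set p X A (a + b) = (\<Union>r\<in>homologous_rel_set p X A a. \<Union>s\<in>homologous_rel_set p X A b. {r + s})"
proof (intro equalityI subsetI)
 fix x assume "x \<in> homologous_rel_set p X A (a + b)"
 then have "homologous_rel p X A b (x - a)" by (simp add: homologous_rel_def algebra_simps)
 moreover have "x = a + (x - a)" by simp
 ultimately show "x \<in> (\<Union>r\<in>homologous_rel_set p X A a. \<Union>s\<in>homologous_rel_set p X A b. {r + s})"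
  by (metis (mono_tags, lifting) UN_iff homologous_rel_refl insertI1 mem_Collect_eq)
qed (auto intro: homologous_rel_add)

context connected_tiling
begin

text \<open>On a single tile the cocycle has an integer primitive u at the corners. Along a common
  side the primitives of two tiles differ by a constant integer, so their affine extensions
  \<open>pot\<close> agree modulo the integers and exp (2 \<pi> i \<open>pot\<close>) is a
  well-defined circle-valued function. Its logarithm increases along e by 2 \<pi> i times
  \<open>\<phi> e\<close>.\<close>

lemma cocycle_map:
 fixes \<phi> :: "3 \<times> nat \<Rightarrow> int"
 assumes \<phi>: "\<And>x. x \<in> tiles d \<Longrightarrow> (\<Sum>i\<in>UNIV. \<phi> (tedge t x i)) = 0"
 obtains h where "continuous_map X euclidean h" "\<And>y. h y \<noteq> (0::complex)"
  "\<And>e. e \<in> edges d \<Longrightarrow> winding h (eseg e) = of_int (\<phi> e) * (2 * of_real pi * \<i>)"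
proof -
 \<comment> \<open>Side 3 leads from corner 1 to corner 2, and side 1 from corner 2 to corner
   3.\<close>
 define u where "u x j = (if j = 1 then 0 else if j = 2 then \<phi> (tedge t x 3) else \<phi> (tedge t x 3) + \<phi> (tedge t x 1))" for x and j :: 3
 have u: "u x (i + 2) - u x (i + 1) = \<phi> (tedge t x i)" if "x \<in> tiles d" for x i
 proof -
  have 3: "(3::3) = 0" by simp
  show ?thesis using \<phi>[OF that] exhaust_3[of i] by (auto simp: u_def sum_3 num_3 3)
 qed
 define pot where "pot x v = (\<Sum>j\<in>UNIV. of_int (u x j) * v $ j)" for x and v :: "real^3"
 define E where "E x v = exp (2 * of_real pi * \<i> * of_real (pot x v))" for x v
 have E: "E x v = E x' v" if xx: "(x, x') \<in> glue t d v" and v: "v \<in> tri" for x x' v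
 proof -
  have "E x v = E x v \<longleftrightarrow> E x' v = E x v"
  proof (rule glue_invariant[OF xx, of "\<lambda>y. E y v = E x v"])
   fix p i assume p: "p < d" and vi: "v $ i = 0"
   have te: "tedge t (True, p) i = tedge t (False, t i p) i" by (simp add: tedge_def)
   define k where "k = u (True, p) (i + 1) - u (False, t i p) (i + 1)"
   have k2: "k = u (True, p) (i + 2) - u (False, t i p) (i + 2)"
    using u[of "(True, p)" i] u[of "(False, t i p)" i] p te by (simp add: k_def)
   have one: "v $ (i + 1) + v $ (i + 2) = 1" using v vi by (simp add: tri_def sum_cyc[of _ i])
   have "pot (True, p) v - pot (False, t i p) v = of_int k * v $ (i + 1) + of_int k * v $ (i + 2)"
    unfolding pot_def sum_cyc[of _ i] vi by (subst k2) (simp add: k_def algebra_simps)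
   also have "\<dots> = of_int k" using one by (simp flip: distrib_left)
   finally have pk: "pot (True, p) v = pot (False, t i p) v + of_int k" by simp
   have "E (True, p) v = E (False, t i p) v" unfolding E_def exp_eq
    by (rule exI[of _ k]) (simp add: pk algebra_simps)
   then show "E (True, p) v = E x v \<longleftrightarrow> E (False, t i p) v = E x v" by simp
  qed
  then show ?thesis by simp
 qed
 define h where "h y = E (tile_of y) (bary (f y))" for y
 have hS: "h (S x v) = E x v" if "x \<in> tiles d" "v \<in> tri" for x v
  using E[OF tile_of_S[OF that] that(2)] that by (simp add: h_def)
 have contE: "continuous_on A (E x)" for A x
  unfolding E_def pot_def by (intro continuous_intros)
 have "continuous_map X euclidean h"
 proof (rule continuous_on_tiles)
  fix x assume x: "x \<in> tiles d"
  have "continuous_map (top_of_set tri) euclidean (E x)" using contE by simp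
  then show "continuous_map (top_of_set tri) euclidean (\<lambda>v. h (S x v))"
   by (rule continuous_map_eq) (simp add: hS x)
 qed
 moreover have "h y \<noteq> 0" for y by (simp add: h_def E_def)
 moreover have "winding h (eseg e) = of_int (\<phi> e) * (2 * of_real pi * \<i>)" if e: "e \<in> edges d" for e
 proof -
  obtain i p where ip: "e = (i, p)" by fastforce
  have x: "(True, p) \<in> tiles d" using e ip by simp
  define w where "w r = (1 - r) *\<^sub>R axis (i + 1) 1 + r *\<^sub>R (axis (i + 2) 1 :: real^3)" for r
  have w: "w r \<in> tri" if "0 \<le> r" "r \<le> 1" for r
   unfolding w_def using tri_comb[of "axis (i + 1) 1" "axis (i + 2) 1" "axis i 1" "1 - r" r 0] that by simp
  have "incr h (seg (S (True, p)) (axis (i + 1) 1) (axis (i + 2) 1))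
    = 2 * of_real pi * \<i> * of_real (pot (True, p) (w 1)) - 2 * of_real pi * \<i> * of_real (pot (True, p) (w 0))"
  proof (rule incr_eq)
   show "continuous_on {0..1} (\<lambda>r. 2 * of_real pi * \<i> * of_real (pot (True, p) (w r)))"
    unfolding pot_def w_def by (intro continuous_intros)
   show "h (seg (S (True, p)) (axis (i + 1) 1) (axis (i + 2) 1) (lin r))
     = exp (2 * of_real pi * \<i> * of_real (pot (True, p) (w r)))" if r: "0 \<le> r" "r \<le> 1" for r
   proof -
    have "seg (S (True, p)) (axis (i + 1) 1) (axis (i + 2) 1) (lin r) = S (True, p) (w r)"
     using lin_in[OF r] by (simp add: seg_def w_def) (simp add: lin_def)
    then show ?thesis using hS[OF x w[OF r]] by (simp add: E_def)
   qed
  qed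
  also have "\<dots> = 2 * of_real pi * \<i> * of_real (pot (True, p) (w 1) - pot (True, p) (w 0))"
   by (simp add: algebra_simps)
  also have "pot (True, p) (w 1) - pot (True, p) (w 0) = of_int (u (True, p) (i + 2) - u (True, p) (i + 1))"
   unfolding pot_def sum_cyc[of _ i] w_def by (simp add: axis_nth)
  also have "u (True, p) (i + 2) - u (True, p) (i + 1) = \<phi> e"
   unfolding u[OF x] by (simp add: tedge_def ip)
  finally show ?thesis by (simp add: ip algebra_simps)
 qed
 ultimately show thesis using that by blast
qed

text \<open>The cycles of the edges in R span by \<open>generation\<close>. For independence,
  \<open>cotree_flow\<close> gives for each e in R a cocycle that is 1 on e and 0 on all other edges
  outside the dual tree, in particular on the tree. The circle-valued function belonging to it winds
  once along the cycle of e and not at all along those of the other edges in R.\<close>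

lemma homology_free:
 obtains r where "r + card verts = d + 2" "homology_group 1 X \<cong> free_Abelian_group {..<r}"
proof -
 obtain rk a rk' a' where T: "rooted_tree verts root esrc edst rk a" "a ` (verts - {root}) \<subseteq> edges d"
  and T': "rooted_tree (tiles d) (True, 0) tsrc (tdst t) rk' a'"
   "a' ` (tiles d - {(True, 0)}) \<subseteq> edges d - a ` (verts - {root})"
  and card: "card (edges d - a ` (verts - {root}) - a' ` (tiles d - {(True, 0)})) + card verts = d + 2"
  by (rule tree_cotree)
 interpret T: rooted_tree verts root esrc edst rk a by fact
 define R where "R = edges d - a ` (verts - {root}) - a' ` (tiles d - {(True, 0)})"
 obtain P where P: "P root = 0"
  "\<And>v. v \<in> verts \<Longrightarrow> v \<noteq> root \<Longrightarrow> P (edst (a v)) = P (esrc (a v)) + eseg (a v)"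
  "\<And>e. e \<in> edges d \<Longrightarrow> singular_relcycle 1 X {} (P (esrc e) + eseg e - P (edst e))"
  "\<And>c. singular_relcycle 1 X {} c \<Longrightarrow> c \<in> integer_span 1 X ((\<lambda>e. P (esrc e) + eseg e - P (edst e)) ` R)"
  by (rule generation[OF T T' R_def]) blast
 define c where "c e = P (esrc e) + eseg e - P (edst e)" for e
 have dual: "\<exists>h. continuous_map X euclidean h \<and> (\<forall>y. h y \<noteq> (0::complex)) \<and> (\<forall>e'\<in>R. winding h (c e') = of_bool (e' = e) * (2 * of_real pi * \<i>))"
  if e: "e \<in> R" for e
 proof -
  have e1: "e \<in> edges d" "e \<notin> a' ` (tiles d - {(True, 0)})" using e by (auto simp: R_def)
  have T'2: "a' ` (tiles d - {(True, 0)}) \<subseteq> edges d" using T'(2) by blast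
  obtain \<phi> :: "3 \<times> nat \<Rightarrow> int" where \<phi>: "\<And>x. x \<in> tiles d \<Longrightarrow> (\<Sum>i\<in>UNIV. \<phi> (tedge t x i)) = 0"
   "\<And>e'. e' \<notin> a' ` (tiles d - {(True, 0)}) \<Longrightarrow> \<phi> e' = of_bool (e' = e)"
   by (rule cotree_flow[OF T'(1) T'2 e1]) blast
  obtain h where h: "continuous_map X euclidean h" "\<And>y. h y \<noteq> (0::complex)"
   "\<And>e. e \<in> edges d \<Longrightarrow> winding h (eseg e) = of_int (\<phi> e) * (2 * of_real pi * \<i>)"
   by (rule cocycle_map[OF \<phi>(1)]) blast+
  have wP: "winding h (P v) = 0" if "v \<in> verts" for v
  proof (rule T.tree_induct[OF that])
   fix v assume v: "v \<in> verts" "v \<noteq> root" "winding h (P (T.parent v)) = 0"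
   have "a v \<in> a ` (verts - {root})" using v by blast
   then have av: "a v \<in> edges d" "a v \<notin> a' ` (tiles d - {(True, 0)})" "a v \<noteq> e"
    using T(2) T'(2) e unfolding R_def by blast+
   have "winding h (eseg (a v)) = 0" using h(3)[OF av(1)] \<phi>(2)[OF av(2)] av(3) by simp
   then have eq: "winding h (P (edst (a v))) = winding h (P (esrc (a v)))"
    unfolding P(2)[OF v(1,2)] winding_add by simp
   show "winding h (P v) = 0" using T.parent(3)[OF v(1,2)]
   proof (elim disjE conjE)
    assume g: "esrc (a v) = v" "edst (a v) = T.parent v"
    show ?thesis using eq v(3) unfolding g by simp
   next
    assume g: "edst (a v) = v" "esrc (a v) = T.parent v"
    show ?thesis using eq v(3) unfolding g by simp
   qed
  qed (simp add: P(1))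
  have "winding h (c e') = of_bool (e' = e) * (2 * of_real pi * \<i>)" if e': "e' \<in> R" for e'
  proof -
   have e'1: "e' \<in> edges d" "e' \<notin> a' ` (tiles d - {(True, 0)})" using e' by (auto simp: R_def)
   show ?thesis unfolding c_def winding_diff winding_add wP[OF esrc_in(1)[OF e'1(1)]]
     wP[OF esrc_in(2)[OF e'1(1)]] h(3)[OF e'1(1)] \<phi>(2)[OF e'1(2)] by simp
  qed
  then show ?thesis using h by blast
 qed
 have finR: "finite R" by (simp add: R_def)
 obtain en where en: "bij_betw en {0..<card R} R" using ex_bij_betw_nat_finite[OF finR] by blast
 define r where "r = card R"
 have enR: "en k \<in> R" if "k < r" for k using en that by (auto simp: bij_betw_def r_def)
 have en_inj: "en k = en l \<longleftrightarrow> k = l" if "k < r" "l < r" for k l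
  using en that by (auto simp: bij_betw_def r_def inj_on_def)
 define \<Phi> where "\<Phi> m = frag_extend (\<lambda>k. c (en k)) m" for m
 define \<Psi> where "\<Psi> m = homologous_rel_set 1 X {} (\<Phi> m)" for m
 have c_cyc: "singular_relcycle 1 X {} (c e)" if "e \<in> R" for e
  unfolding c_def using that by (intro P(3)) (simp add: R_def)
 have \<Phi>_cyc: "singular_relcycle 1 X {} (\<Phi> m)" if "Poly_Mapping.keys m \<subseteq> {..<r}" for m
  using that
 proof (induction m rule: frag_induction)
  case (one k) then show ?case using c_cyc enR by (simp add: \<Phi>_def)
 next
  case (diff m n)
  have "\<Phi> (m - n) = \<Phi> m - \<Phi> n" by (simp add: \<Phi>_def frag_extend_diff)
  then show ?case using singular_relcycle_diff[OF diff] by simp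
 qed (simp add: \<Phi>_def)
 have inj: "m = n" if mn: "Poly_Mapping.keys m \<subseteq> {..<r}" "Poly_Mapping.keys n \<subseteq> {..<r}" "\<Psi> m = \<Psi> n" for m n
 proof (rule poly_mapping_eqI)
  fix k
  show "Poly_Mapping.lookup m k = Poly_Mapping.lookup n k"
  proof (cases "k < r")
   case False
   then have "k \<notin> Poly_Mapping.keys m" "k \<notin> Poly_Mapping.keys n" using mn by auto
   then show ?thesis by (simp add: in_keys_iff)
  next
   case True
   obtain h where h: "continuous_map X euclidean h" "\<And>y. h y \<noteq> (0::complex)"
    "\<And>e'. e' \<in> R \<Longrightarrow> winding h (c e') = of_bool (e' = en k) * (2 * of_real pi * \<i>)"
    using dual[OF enR[OF True]] by blast
   have w: "winding h (\<Phi> l) = of_int (Poly_Mapping.lookup l k) * (2 * of_real pi * \<i>)"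
    if "Poly_Mapping.keys l \<subseteq> {..<r}" for l
    using that
   proof (induction l rule: frag_induction)
    case (one j)
    then have j: "j < r" by simp
    show ?case using h(3)[OF enR[OF j]] en_inj[OF j True] by (auto simp: \<Phi>_def)
   next
    case (diff l l')
    have "\<Phi> (l - l') = \<Phi> l - \<Phi> l'" by (simp add: \<Phi>_def frag_extend_diff)
    then show ?case using diff by (simp add: winding_diff lookup_minus left_diff_distrib)
   qed (simp add: \<Phi>_def)
   have "homologous_rel 1 X {} (\<Phi> m) (\<Phi> n)" using mn(3) by (simp add: \<Psi>_def homologous_rel_set_eq)
   then have "winding h (\<Phi> m - \<Phi> n) = 0" using winding_boundary[OF h(1,2)] by (simp add: homologous_rel_def)
   then show ?thesis using w[OF mn(1)] w[OF mn(2)] by (simp add: winding_diff)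
  qed
 qed
 have surj: "\<exists>m. Poly_Mapping.keys m \<subseteq> {..<r} \<and> homologous_rel_set 1 X {} z = \<Psi> m"
  if z: "singular_relcycle 1 X {} z" for z
 proof -
  obtain m where m: "homologous_rel 1 X {} z (\<Sum>b\<in>c ` R. frag_cmul (m b) b)"
   using P(4)[OF z] unfolding c_def[symmetric] by (auto simp: integer_span_def)
  have "\<exists>k<r. c (en k) = b" if "b \<in> c ` R" for b
   using that en unfolding bij_betw_def r_def by force
  then obtain k where k: "\<And>b. b \<in> c ` R \<Longrightarrow> k b < r \<and> c (en (k b)) = b" by metis
  define M where "M = (\<Sum>b\<in>c ` R. frag_cmul (m b) (frag_of (k b)))"
  have "\<Phi> M = (\<Sum>b\<in>c ` R. frag_cmul (m b) (c (en (k b))))"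
   unfolding M_def \<Phi>_def using finR by (simp add: frag_extend_sum frag_extend_cmul o_def)
  also have "\<dots> = (\<Sum>b\<in>c ` R. frag_cmul (m b) b)" by (intro sum.cong) (simp_all add: k)
  finally have "homologous_rel_set 1 X {} z = \<Psi> M" using m by (simp add: \<Psi>_def homologous_rel_set_eq)
  moreover have "Poly_Mapping.keys M \<subseteq> {..<r}"
  proof -
   have "Poly_Mapping.keys M \<subseteq> (\<Union>b\<in>c ` R. Poly_Mapping.keys (frag_cmul (m b) (frag_of (k b))))"
    unfolding M_def by (rule keys_sum)
   also have "\<dots> \<subseteq> {..<r}" using k by (force simp: keys_frag_of dest: subsetD[OF keys_cmul])
   finally show ?thesis .
  qed
  ultimately show ?thesis by blast
 qed
 have "\<Psi> \<in> iso (free_Abelian_group {..<r}) (homology_group (int 1) X)"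
 proof (rule isoI)
  show "\<Psi> \<in> hom (free_Abelian_group {..<r}) (homology_group (int 1) X)"
  proof (rule homI)
   fix m assume "m \<in> carrier (free_Abelian_group {..<r})"
   then show "\<Psi> m \<in> carrier (homology_group (int 1) X)"
    unfolding carrier_relative_homology_group \<Psi>_def using \<Phi>_cyc by simp
  next
   fix m n
   show "\<Psi> (m \<otimes>\<^bsub>free_Abelian_group {..<r}\<^esub> n) = \<Psi> m \<otimes>\<^bsub>homology_group (int 1) X\<^esub> \<Psi> n"
    unfolding mult_relative_homology_group mult_free_Abelian_group \<Psi>_def \<Phi>_def frag_extend_add
    by (rule homologous_rel_set_add)
  qed
  show "bij_betw \<Psi> (carrier (free_Abelian_group {..<r})) (carrier (homology_group (int 1) X))"
   unfolding bij_betw_def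
  proof
   show "inj_on \<Psi> (carrier (free_Abelian_group {..<r}))"
   proof (rule inj_onI)
    fix m n assume m: "m \<in> carrier (free_Abelian_group {..<r})" and n: "n \<in> carrier (free_Abelian_group {..<r})"
     and eq: "\<Psi> m = \<Psi> n"
    show "m = n" by (rule inj[OF m[unfolded carrier_free_Abelian_group_iff] n[unfolded carrier_free_Abelian_group_iff] eq])
   qed
   show "\<Psi> ` carrier (free_Abelian_group {..<r}) = carrier (homology_group (int 1) X)"
    unfolding carrier_relative_homology_group
   proof (intro equalityI subsetI)
    fix y assume "y \<in> \<Psi> ` carrier (free_Abelian_group {..<r})"
    then obtain m where m: "y = \<Psi> m" "m \<in> carrier (free_Abelian_group {..<r})" by (rule imageE)
    then have "\<Phi> m \<in> singular_relcycle_set 1 X {}" using \<Phi>_cyc[of m] by simp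
    then show "y \<in> homologous_rel_set 1 X {} ` singular_relcycle_set 1 X {}"
     unfolding m(1) \<Psi>_def by (rule imageI)
   next
    fix y assume "y \<in> homologous_rel_set 1 X {} ` singular_relcycle_set 1 X {}"
    then obtain z where z: "y = homologous_rel_set 1 X {} z" "z \<in> singular_relcycle_set 1 X {}" by (rule imageE)
    have "singular_relcycle 1 X {} z" using z(2) by (rule CollectD)
    from surj[OF this] obtain m where "Poly_Mapping.keys m \<subseteq> {..<r}" "homologous_rel_set 1 X {} z = \<Psi> m"
     by (elim exE conjE)
    then show "y \<in> \<Psi> ` carrier (free_Abelian_group {..<r})" unfolding z(1) by (intro image_eqI[of _ _ m]) simp_all
   qed
  qed
 qed
 then have "free_Abelian_group {..<r} \<cong> homology_group (int 1) X" by (rule is_isoI)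
 from group.iso_sym[OF group_free_Abelian_group this]
 have iso: "homology_group 1 X \<cong> free_Abelian_group {..<r}" by simp
 show thesis
 proof (rule that)
  show "r + card verts = d + 2" using card by (simp add: r_def R_def)
 qed (rule iso)
qed

text \<open>Euler's formula V - E + F = 2 - 2g with E = 3 d edges and F = 2 d tiles; the rank of a
  free abelian group is unique.\<close>

lemma has_genus_iff: "has_genus X g \<longleftrightarrow> card verts + 2 * g = d + 2"
proof -
 obtain r where r: "r + card verts = d + 2" "homology_group 1 X \<cong> free_Abelian_group {..<r}"
  by (rule homology_free) blast
 have "has_genus X g \<longleftrightarrow> free_Abelian_group {..<r} \<cong> free_Abelian_group {..<2 * g}"
  unfolding has_genus_def
 proof
  assume "homology_group 1 X \<cong> free_Abelian_group {..<2 * g}"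
  with group.iso_sym[OF group_relative_homology_group r(2)]
  show "free_Abelian_group {..<r} \<cong> free_Abelian_group {..<2 * g}" by (rule iso_trans)
 next
  assume "free_Abelian_group {..<r} \<cong> free_Abelian_group {..<2 * g}"
  with r(2) show "homology_group 1 X \<cong> free_Abelian_group {..<2 * g}" by (rule iso_trans)
 qed
 also have "\<dots> \<longleftrightarrow> r = 2 * g" by (simp add: isomorphic_free_Abelian_groups eqpoll_iff_card)
 finally show ?thesis using r(1) by auto
qed

end

section \<open>Local degrees\<close>

text \<open>Continuity in polar form: at points where the radius is zero, boundedness of the angular
  factor replaces its continuity.\<close>

lemma continuous_on_scaled_unit:
 fixes u :: "'b::metric_space \<Rightarrow> complex"
 assumes r: "continuous_on A r" and u: "continuous_on {v \<in> A. r v \<noteq> 0} u" "\<And>v. v \<in> A \<Longrightarrow> norm (u v) \<le> 1"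
 shows "continuous_on A (\<lambda>v. of_real (r v) * u v)"
 unfolding continuous_on_def
proof
 fix v assume v: "v \<in> A"
 have rt: "(r \<longlongrightarrow> r v) (at v within A)" using r v by (simp add: continuous_on_def)
 show "((\<lambda>v. of_real (r v) * u v) \<longlongrightarrow> of_real (r v) * u v) (at v within A)"
 proof (cases "r v = 0")
  case True
  have "((\<lambda>v. \<bar>r v\<bar>) \<longlongrightarrow> 0) (at v within A)" using tendsto_rabs[OF rt] True by simp
  moreover have "\<forall>\<^sub>F w in at v within A. norm (of_real (r w) * u w) \<le> \<bar>r w\<bar>"
   unfolding eventually_at_filter
   by (rule always_eventually) (use u(2) in \<open>auto simp: norm_mult intro: mult_left_le\<close>)
  ultimately have "((\<lambda>v. of_real (r v) * u v) \<longlongrightarrow> 0) (at v within A)"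
   by (rule Lim_null_comparison[rotated])
  then show ?thesis using True by simp
 next
  case False
  have "\<forall>\<^sub>F w in at v within A. r w \<noteq> 0" using rt False by (rule tendsto_imp_eventually_ne)
  then have nz: "\<forall>\<^sub>F w in nhds v. w \<noteq> v \<longrightarrow> w \<in> A \<longrightarrow> r w \<noteq> 0" by (simp add: eventually_at_filter)
  have ut: "(u \<longlongrightarrow> u v) (at v within {v \<in> A. r v \<noteq> 0})" using u(1) v False by (simp add: continuous_on_def)
  have "(u \<longlongrightarrow> u v) (at v within A)"
  proof (rule topological_tendstoI)
   fix S assume "open S" "u v \<in> S"
   from topological_tendstoD[OF ut this]
   have "\<forall>\<^sub>F w in nhds v. w \<noteq> v \<longrightarrow> w \<in> {v \<in> A. r v \<noteq> 0} \<longrightarrow> u w \<in> S" by (simp add: eventually_at_filter)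
   with nz have "\<forall>\<^sub>F w in nhds v. w \<noteq> v \<longrightarrow> w \<in> A \<longrightarrow> u w \<in> S" by eventually_elim simp
   then show "\<forall>\<^sub>F w in at v within A. u w \<in> S" by (simp add: eventually_at_filter)
  qed
  then show ?thesis using rt by (intro tendsto_intros)
 qed
qed

section \<open>Disc charts around the vertices of a tiling\<close>

definition theta :: "3 \<Rightarrow> real^3 \<Rightarrow> real" where
 "theta i v = v $ (i + 2) / (1 - v $ i)"

text \<open>Polar coordinates about corner i. \<open>theta i\<close> runs from 0 on the side
  \<open>v $ (i + 2) = 0\<close> to 1 on the side \<open>v $ (i + 1) = 0\<close>, so the upper
  triangle fills the half disc of angles 0 to \<pi> and the lower one its mirror image.\<close>

definition std_chart :: "3 \<Rightarrow> bool \<Rightarrow> real^3 \<Rightarrow> complex" where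
 "std_chart i s v = of_real (1 - v $ i) * cis (pi * (if s then theta i v else - theta i v))"

lemma tri_nth: assumes "v \<in> tri"
 shows "0 \<le> v $ j" "v $ i + v $ (i + 1) + v $ (i + 2) = 1" "v $ j \<le> 1"
proof -
 have nn: "0 \<le> v $ j" for j using assms by (simp add: tri_def)
 show "0 \<le> v $ j" by fact
 have s: "v $ i + v $ (i + 1) + v $ (i + 2) = 1" for i using assms sum_cyc[of "\<lambda>j. v $ j" i] by (simp add: tri_def)
 show "v $ i + v $ (i + 1) + v $ (i + 2) = 1" by fact
 show "v $ j \<le> 1" using s[of j] nn[of "j + 1"] nn[of "j + 2"] by simp
qed

lemma theta_range: "v \<in> tri \<Longrightarrow> 0 \<le> theta i v" "v \<in> tri \<Longrightarrow> theta i v \<le> 1"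
proof -
 assume v: "v \<in> tri"
 have eq: "1 - v $ i = v $ (i + 1) + v $ (i + 2)" using tri_nth(2)[OF v, of i] by simp
 note nn = tri_nth(1)[OF v, of "i + 1"] tri_nth(1)[OF v, of "i + 2"]
 show "0 \<le> theta i v" unfolding theta_def eq using nn by simp
 show "theta i v \<le> 1" unfolding theta_def eq divide_le_eq_1 using nn by linarith
qed

text \<open>The inverse of the coordinates \<open>1 - v $ i\<close> and
  \<open>theta i v\<close>.\<close>

definition polar :: "3 \<Rightarrow> real \<Rightarrow> real \<Rightarrow> real^3" where
 "polar i r \<theta> = (\<chi> j. if j = i then 1 - r else if j = i + 2 then r * \<theta> else r * (1 - \<theta>))"

lemma polar: assumes "0 < r" "r \<le> 1" "0 \<le> \<theta>" "\<theta> \<le> 1"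
 shows "polar i r \<theta> \<in> tri" "polar i r \<theta> $ i = 1 - r" "theta i (polar i r \<theta>) = \<theta>"
proof -
 have c: "polar i r \<theta> $ i = 1 - r" "polar i r \<theta> $ (i + 2) = r * \<theta>" "polar i r \<theta> $ (i + 1) = r * (1 - \<theta>)"
  by (simp_all add: polar_def)
 show "polar i r \<theta> $ i = 1 - r" "theta i (polar i r \<theta>) = \<theta>" using assms by (simp_all add: theta_def c)
 have "(\<Sum>j\<in>UNIV. polar i r \<theta> $ j) = 1" unfolding sum_cyc[of _ i] c by (simp add: algebra_simps)
 moreover have "0 \<le> polar i r \<theta> $ j" for j using assms by (simp add: polar_def)
 ultimately show "polar i r \<theta> \<in> tri" by (simp add: tri_def)
qed

lemma tri_polar_eqI:
 assumes "v \<in> tri" "w \<in> tri" "v $ i = w $ i" "v $ i < 1" "theta i v = theta i w"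
 shows "v = w"
proof -
 have "v $ (i + 2) = w $ (i + 2)" using assms by (simp add: theta_def)
 moreover have "v $ (i + 1) = w $ (i + 1)"
  using tri_nth(2)[OF assms(1), of i] tri_nth(2)[OF assms(2), of i] assms(3) calculation by simp
 ultimately have "v $ j = w $ j" for j by (rule_tac cases_3[of j i]) (simp_all add: assms(3))
 then show ?thesis by (simp add: vec_eq_iff)
qed

lemma theta_edge: assumes "v \<in> tri" "v $ i < 1"
 shows "theta i v = 1 \<longleftrightarrow> v $ (i + 1) = 0" "theta i v = 0 \<longleftrightarrow> v $ (i + 2) = 0"
 using assms tri_nth(2)[OF assms(1), of i] by (auto simp: theta_def)

lemma cis_eq_iff: "cis a = cis b \<longleftrightarrow> (\<exists>n::int. a = b + 2 * pi * of_int n)"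
proof
 assume "cis a = cis b"
 then obtain n :: int where "\<i> * of_real a = \<i> * of_real b + of_real (real_of_int (2 * n) * pi) * \<i>"
  unfolding cis_conv_exp exp_eq by blast
 then have "Im (\<i> * of_real a) = Im (\<i> * of_real b + of_real (real_of_int (2 * n) * pi) * \<i>)" by metis
 then have "a = b + 2 * pi * of_int n" by simp
 then show "\<exists>n::int. a = b + 2 * pi * of_int n" by blast
next
 assume "\<exists>n::int. a = b + 2 * pi * of_int n"
 then obtain n :: int where "a = b + 2 * pi * of_int n" by blast
 then show "cis a = cis b" by (simp add: cis_multiple_2pi flip: cis_mult)
qed

lemma funpow_mod_period: assumes "(g ^^ k) x = x" shows "(g ^^ (m mod k)) x = (g ^^ m) x"
 using funpow_mod_eq[OF assms] by simp

context tiling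
begin

text \<open>One step of the rotation about corner i: from an upper tile across side i + 1, and from
  the lower tile reached across side i + 2 to the next upper tile.\<close>

definition rot :: "3 \<Rightarrow> nat \<Rightarrow> nat" where
 "rot i = Hilbert_Choice.inv (t (i + 2)) \<circ> t (i + 1)"

lemma rot_permutes: "rot i permutes {..<d}"
 unfolding rot_def by (intro permutes_compose perm permutes_inv)

lemma rot_orbit_self: "p \<in> orbit (rot i) p"
 using rot_permutes by (intro permutation_self_in_orbit) (auto simp: permutation_permutes)

text \<open>At corner i exactly the sides i + 1 and i + 2 glue tiles, and crossing them alternately
  is the rotation \<open>rot i\<close>.\<close>

lemma corner_orbit:
 assumes "p < d" "q < d"
 shows "S (True, p) (axis i 1) = S (True, q) (axis i 1) \<longleftrightarrow> q \<in> orbit (rot i) p"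
proof
 \<comment> \<open>A lower tile is represented by the upper tile from which it is reached across
   side i + 1.\<close>
 define P where "P y \<longleftrightarrow> (if fst y then snd y else Hilbert_Choice.inv (t (i + 1)) (snd y)) \<in> orbit (rot i) p" for y
 have rot_mem: "rot i a \<in> orbit (rot i) p \<longleftrightarrow> a \<in> orbit (rot i) p" for a
 proof
  assume a: "rot i a \<in> orbit (rot i) p"
  have "a \<in> orbit (rot i) (rot i a)"
   using orbit_swap[OF rot_orbit_self orbit.base] .
  then show "a \<in> orbit (rot i) p" using a by (rule orbit_trans)
 qed (rule orbit.step)
 assume eq: "S (True, p) (axis i 1) = S (True, q) (axis i 1)"
 then have "((True, p), (True, q)) \<in> glue t d (axis i 1)" using S_eq assms by simp
 moreover have "P (True, a) \<longleftrightarrow> P (False, t j a)" if "a < d" "axis i (1::real) $ j = 0" for a j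
 proof -
  have "j \<noteq> i" using that(2) by (auto simp: axis_nth)
  then consider "j = i + 1" | "j = i + 2" using cases_3[of j i] by metis
  then show ?thesis
  proof cases
   case 1 then show ?thesis by (simp add: P_def)
  next
   case 2
   have "rot i (Hilbert_Choice.inv (t (i + 1)) (t (i + 2) a)) = a" by (simp add: rot_def)
   then show ?thesis using rot_mem[of "Hilbert_Choice.inv (t (i + 1)) (t (i + 2) a)"] 2 by (simp add: P_def)
  qed
 qed
 ultimately have "P (True, p) \<longleftrightarrow> P (True, q)" by (rule glue_invariant)
 then show "q \<in> orbit (rot i) p" using rot_orbit_self by (simp add: P_def)
next
 assume "q \<in> orbit (rot i) p"
 have step: "a < d \<Longrightarrow> S (True, rot i a) (axis i 1) = S (True, a) (axis i 1) \<and> rot i a < d" for a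
 proof -
  assume a: "a < d"
  have r: "rot i a < d" using permutes_in_image[OF rot_permutes[of i], of a] a by simp
  have "S (True, rot i a) (axis i 1) = S (False, t (i + 2) (rot i a)) (axis i 1)"
   by (rule share[OF r]) (simp_all add: axis_nth)
  also have "t (i + 2) (rot i a) = t (i + 1) a" by (simp add: rot_def)
  also have "S (False, t (i + 1) a) (axis i 1) = S (True, a) (axis i 1)"
   by (rule share[OF a, symmetric]) (simp_all add: axis_nth)
  finally show "S (True, rot i a) (axis i 1) = S (True, a) (axis i 1) \<and> rot i a < d" using r by simp
 qed
 from \<open>q \<in> orbit (rot i) p\<close> have "S (True, q) (axis i 1) = S (True, p) (axis i 1) \<and> q < d"
  by induction (use step assms(1) in simp_all)
 then show "S (True, p) (axis i 1) = S (True, q) (axis i 1)" by simp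
qed

lemma vertex_enumeration:
 assumes p0: "p0 < d" and z: "z = S (True, p0) (axis i 1)" and k: "k = card {p. p < d \<and> S (True, p) (axis i 1) = z}"
 defines "pp \<equiv> \<lambda>j. (rot i ^^ j) p0"
 shows "0 < k" "pp ` {..<k} = {p. p < d \<and> S (True, p) (axis i 1) = z}" "inj_on pp {..<k}" "pp k = p0"
  "\<And>j. pp j < d" "\<And>j. S (True, pp j) (axis i 1) = z"
proof -
 let ?k = "funpow_dist1 (rot i) p0 p0"
 have orb: "orbit (rot i) p0 = {p. p < d \<and> S (True, p) (axis i 1) = z}"
 proof -
  have "S (True, q) (axis i 1) = z \<longleftrightarrow> q \<in> orbit (rot i) p0" if "q < d" for q
   unfolding z using corner_orbit[OF p0 that, of i] by (simp only: eq_commute)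
  then show ?thesis using permutes_orbit_subset[OF rot_permutes[of i], of p0] p0 by auto
 qed
 have img: "pp ` {..<?k} = orbit (rot i) p0" unfolding pp_def
  using orbit_conv_funpow_dist1[OF rot_orbit_self, of i p0] by (simp add: atLeast0LessThan)
 have inj: "inj_on pp {..<?k}" unfolding pp_def
  using inj_on_funpow_dist1[OF rot_orbit_self, of i p0] by (simp add: atLeast0LessThan)
 have kk: "k = ?k" unfolding k orb[symmetric] img[symmetric] by (simp add: card_image[OF inj])
 show "0 < k" unfolding kk by simp
 show "pp ` {..<k} = {p. p < d \<and> S (True, p) (axis i 1) = z}" unfolding kk img orb ..
 show "inj_on pp {..<k}" unfolding kk by (rule inj)
 show "pp k = p0" unfolding kk pp_def by (rule funpow_dist1_prop[OF rot_orbit_self])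
 have "pp j \<in> orbit (rot i) p0" for j
 proof (induction j)
  case 0 show ?case by (simp add: pp_def rot_orbit_self)
 next
  case (Suc j) then show ?case by (simp add: pp_def orbit.step)
 qed
 then show "\<And>j. pp j < d" "\<And>j. S (True, pp j) (axis i 1) = z" using orb by auto
qed

text \<open>The 2 k tiles around z are developed one after the other: \<open>T m\<close> is the m-th
  tile met in the rotation, upper for even m, and \<open>ang m\<close> runs through the interval
  from m to m + 1 on it. A full turn is 2 k, so radius \<open>root k (1 - v $ i)\<close> and angle
  \<pi> \<open>ang\<close> / k define a disc chart whose k-th power is
  \<open>std_chart\<close>.\<close>

lemma vertex_chart:
 assumes p0: "p0 < d" and z: "z = S (True, p0) (axis i 1)" and k: "k = card {p. p < d \<and> S (True, p) (axis i 1) = z}"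
 obtains \<phi> where "homeomorphic_map (subtopology X (star i z)) (top_of_set (ball (0::complex) 1)) \<phi>" "\<phi> z = 0"
  "\<And>x v. x \<in> tiles d \<Longrightarrow> v \<in> tri \<Longrightarrow> S x v \<in> star i z \<Longrightarrow> \<phi> (S x v) ^ k = std_chart i (fst x) v"
proof -
 define pp where "pp j = (rot i ^^ j) p0" for j
 note en = vertex_enumeration[OF p0 z k, folded pp_def]
 have pp_Suc: "t (i + 2) (pp (Suc j)) = t (i + 1) (pp j)" for j by (simp add: pp_def rot_def)
 have pp_mod: "pp (m mod k) = pp m" for m
  unfolding pp_def by (rule funpow_mod_period) (use en(4) in \<open>simp add: pp_def\<close>)
 define T where "T m = (if even m then (True, pp (m div 2)) else (False, t (i + 1) (pp (m div 2))))" for m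
 have T_tiles: "T m \<in> tiles d" for m using en(5) by (simp add: T_def)
 have fstT: "fst (T m) \<longleftrightarrow> even m" for m by (simp add: T_def)
 have T_corner: "S (T m) (axis i 1) = z" for m
 proof (cases "even m")
  case False
  have "S (False, t (i + 1) (pp (m div 2))) (axis i 1) = S (True, pp (m div 2)) (axis i 1)"
   by (rule share[OF en(5), symmetric]) (simp_all add: axis_nth)
  then show ?thesis using False en(6) by (simp add: T_def)
 qed (simp add: T_def en(6))
 have T_all: "\<exists>m. T m = x" if x: "x \<in> tiles d" "S x (axis i 1) = z" for x
 proof -
  obtain s p where sp: "x = (s, p)" by fastforce
  show ?thesis
  proof (cases s)
   case True
   then have "p \<in> pp ` {..<k}" unfolding en(2) using x sp by simp
   then obtain j where "p = pp j" by blast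
   then have "T (2 * j) = x" using sp True by (simp add: T_def)
   then show ?thesis ..
  next
   case False
   define q where "q = Hilbert_Choice.inv (t (i + 1)) p"
   have q: "q < d" "t (i + 1) q = p" using x sp by (simp_all add: q_def)
   have "S (True, q) (axis i 1) = S (False, t (i + 1) q) (axis i 1)"
    by (rule share[OF q(1)]) (simp_all add: axis_nth)
   then have "q \<in> pp ` {..<k}" unfolding en(2) using q x sp False by simp
   then obtain j where "q = pp j" by blast
   then have "T (Suc (2 * j)) = x" using sp False q by (simp add: T_def)
   then show ?thesis ..
  qed
 qed
 have T_share: "S (T m) v = S (T (Suc m)) v" if v: "v \<in> tri" "v $ (if even m then i + 1 else i + 2) = 0" for m v
 proof (cases "even m")
  case True
  then show ?thesis using share[OF en(5)[of "m div 2"] v(1), of "i + 1"] v(2) by (simp add: T_def)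
 next
  case False
  then have "Suc m div 2 = Suc (m div 2)" by presburger
  then show ?thesis using share[OF en(5)[of "Suc (m div 2)"] v(1), of "i + 2"] v(2) False by (simp add: T_def pp_Suc)
 qed
 \<comment> \<open>Lower tiles are mirror images, so \<open>theta\<close> runs backwards on the odd
   ones.\<close>
 define ang where "ang m v = real m + (if even m then theta i v else 1 - theta i v)" for m v
 define e where "e m v = cis (pi * ang m v / k)" for m v
 \<comment> \<open>Equal tiles have indices that differ by a multiple of 2 k, that is, by full
   turns.\<close>
 have e_T: "e m v = e m' v" if "T m = T m'" for m m' v
 proof -
  have par: "even m \<longleftrightarrow> even m'" using that fstT by metis
  have "pp (m div 2) = pp (m' div 2)"
  proof (cases "even m")
   case True
   then show ?thesis using that par by (simp add: T_def)
  next
   case False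
   then have "t (i + 1) (pp (m div 2)) = t (i + 1) (pp (m' div 2))" using that par by (simp add: T_def)
   then show ?thesis by (rule injD[OF permutes_inj[OF perm]])
  qed
  then have "pp (m div 2 mod k) = pp (m' div 2 mod k)" unfolding pp_mod .
  then have "m div 2 mod k = m' div 2 mod k" using inj_onD[OF en(3)] en(1) by simp
  then have "int (m div 2) mod int k = int (m' div 2) mod int k" unfolding zmod_int[symmetric] by simp
  then have "int k dvd int (m div 2) - int (m' div 2)" by (simp only: mod_eq_dvd_iff)
  then obtain n :: int where n: "int (m div 2) - int (m' div 2) = int k * n" by (rule dvdE)
  have "int (m mod 2) = int (m' mod 2)" using par by (simp add: mod_2_eq_odd)
  moreover have "int l = 2 * int (l div 2) + int (l mod 2)" for l using div_mult_mod_eq[of l 2] by linarith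
  note this[of m] this[of m']
  moreover have "a - b = 2 * (p - q)" if "r = r'" "a = 2 * p + r" "b = 2 * q + r'" for a b p q r r' :: int
   using that by simp
  ultimately have "int m - int m' = 2 * (int (m div 2) - int (m' div 2))" by blast
  then have "int m - int m' = 2 * int k * n" unfolding n by simp
  then have "real_of_int (int m - int m') = real_of_int (2 * int k * n)" by (simp only:)
  then have "real m = real m' + 2 * real k * of_int n" by simp
  then have "ang m v = ang m' v + 2 * real k * of_int n" using par by (simp add: ang_def)
  then have "pi * ang m v / k = pi * ang m' v / k + 2 * pi * of_int n" using en(1) by (simp add: field_simps)
  then show ?thesis unfolding e_def cis_eq_iff by blast
 qed
 have e_Suc: "e m v = e (Suc m) v" if "v \<in> tri" "v $ i < 1" "v $ (if even m then i + 1 else i + 2) = 0" for m v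
  using that theta_edge[OF that(1,2)] by (auto simp: e_def ang_def add.commute split: if_splits)
 define mm where "mm x = (SOME m. T m = x)" for x
 have mm: "T (mm x) = x" if "x \<in> tiles d" "S x (axis i 1) = z" for x
  unfolding mm_def using T_all[OF that] by (rule someI_ex)
 define \<Phi> where "\<Phi> x v = of_real (root k (1 - v $ i)) * e (mm x) v" for x v
 have \<Phi>_T: "\<Phi> (T m) v = of_real (root k (1 - v $ i)) * e m v" for m v
  using e_T[OF mm[OF T_tiles T_corner]] by (simp add: \<Phi>_def)
 have \<Phi>_glue: "\<Phi> x v = \<Phi> x' v"
  if xx: "(x, x') \<in> glue t d v" and x: "x \<in> tiles d" "S x (axis i 1) = z" and v: "v \<in> tri" "0 < v $ i" for x x' v
 proof (cases "v $ i = 1")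
  case True then show ?thesis using en(1) by (simp add: \<Phi>_def)
 next
  case False
  then have v1: "v $ i < 1" using tri_nth(3)[OF v(1), of i] by simp
  have "(S x (axis i 1) = z \<and> \<Phi> x v = \<Phi> x v) \<longleftrightarrow> (S x' (axis i 1) = z \<and> \<Phi> x' v = \<Phi> x v)"
  proof (rule glue_invariant[OF xx, of "\<lambda>y. S y (axis i 1) = z \<and> \<Phi> y v = \<Phi> x v"])
   fix p j assume p: "p < d" and vj: "v $ j = 0"
   have ji: "j \<noteq> i" using vj v(2) by auto
   have c: "S (True, p) (axis i 1) = S (False, t j p) (axis i 1)"
    by (rule share[OF p]) (use ji in \<open>simp_all add: axis_nth\<close>)
   have "\<Phi> (True, p) v = \<Phi> (False, t j p) v" if cz: "S (True, p) (axis i 1) = z"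
   proof -
    obtain m0 where m0: "T m0 = (True, p)" using T_all[of "(True, p)"] p cz by auto
    have ev0: "even m0" using m0 fstT[of m0] by simp
    \<comment> \<open>Adding a full turn makes the index positive, so that it has a
      predecessor.\<close>
    define m where "m = m0 + 2 * k"
    have ev: "even m" "m div 2 = m0 div 2 + k" using ev0 by (auto simp: m_def)
    have "pp (m div 2) = pp (m0 div 2)" unfolding ev(2) by (metis mod_add_self2 pp_mod)
    then have m: "T m = (True, p)" using m0 ev ev0 by (simp add: T_def)
    consider "j = i + 1" | "j = i + 2" using ji cases_3[of j i] by metis
    then show ?thesis
    proof cases
     case 1
     have "T (Suc m) = (False, t j p)" using m ev 1 by (simp add: T_def)
     moreover have "e m v = e (Suc m) v" using e_Suc[OF v(1) v1, of m] ev vj 1 by simp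
     ultimately show ?thesis using \<Phi>_T[of m v] \<Phi>_T[of "Suc m" v] m by simp
    next
     case 2
     obtain l where l: "m = Suc l" using en(1) by (cases m) (auto simp: m_def)
     have od: "odd l" using ev l by simp
     have "m div 2 = Suc (l div 2)" using od l by presburger
     then have "p = pp (Suc (l div 2))" using m ev by (simp add: T_def)
     then have "T l = (False, t j p)" using od 2 by (simp add: T_def pp_Suc)
     moreover have "e l v = e m v" using e_Suc[OF v(1) v1, of l] od vj 2 l by simp
     ultimately show ?thesis using \<Phi>_T[of m v] \<Phi>_T[of l v] m by simp
    qed
   qed
   then show "(S (True, p) (axis i 1) = z \<and> \<Phi> (True, p) v = \<Phi> x v) \<longleftrightarrow>
     (S (False, t j p) (axis i 1) = z \<and> \<Phi> (False, t j p) v = \<Phi> x v)" using c by metis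
  qed
  then show ?thesis using x by simp
 qed
 define \<phi> where "\<phi> y = \<Phi> (tile_of y) (bary (f y))" for y
 let ?N = "star i z"
 have \<phi>_S: "\<phi> (S x v) = \<Phi> x v" if x: "x \<in> tiles d" "v \<in> tri" "S x v \<in> ?N" for x v
  using \<Phi>_glue[OF tile_of_S[OF x(1,2)] x(1) _ x(2)] x star_iff[OF x(1,2), of i z] by (simp add: \<phi>_def)
 have N_T: "\<exists>m v. v \<in> tri \<and> 0 < v $ i \<and> y = S (T m) v" if y: "y \<in> ?N" for y
 proof -
  obtain x v where "x \<in> tiles d" "v \<in> tri" "0 < v $ i" "S x (axis i 1) = z" "y = S x v" using y by (auto simp: star_def)
  then show ?thesis using mm[of x] by metis
 qed
 have T_N: "S (T m) v \<in> ?N" if "v \<in> tri" "0 < v $ i" for m v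
  using star_iff[OF T_tiles that(1), of m i z] that T_corner by simp
 have \<phi>_T: "\<phi> (S (T m) v) = of_real (root k (1 - v $ i)) * e m v" if "v \<in> tri" "0 < v $ i" for m v
  using \<phi>_S[OF T_tiles that(1) T_N[OF that], of m] \<Phi>_T[of m v] by simp
 have norm_e: "norm (e m v) = 1" for m v by (simp add: e_def)
 have norm_\<phi>: "norm (\<phi> (S (T m) v)) = root k (1 - v $ i)" if "v \<in> tri" "0 < v $ i" for m v
  unfolding \<phi>_T[OF that] norm_mult norm_e
  using tri_nth(3)[OF that(1), of i] real_root_ge_zero[of "1 - v $ i" k] by simp
 have powk: "\<phi> (S x v) ^ k = std_chart i (fst x) v" if x: "x \<in> tiles d" "v \<in> tri" "S x v \<in> ?N" for x v
 proof -
  have xv: "0 < v $ i" "S x (axis i 1) = z" using star_iff[OF x(1,2), of i z] x(3) by simp_all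
  define m where "m = mm x"
  have m: "T m = x" unfolding m_def by (rule mm[OF x(1) xv(2)])
  have "\<phi> (S x v) ^ k = of_real (root k (1 - v $ i) ^ k) * e m v ^ k"
   using \<phi>_T[OF x(2) xv(1), of m] m by (simp add: power_mult_distrib)
  also have "root k (1 - v $ i) ^ k = 1 - v $ i"
   using en(1) tri_nth(3)[OF x(2), of i] by (intro real_root_pow_pos2) simp_all
  also have "e m v ^ k = cis (pi * ang m v)" using en(1) by (simp add: e_def Complex.DeMoivre)
  also have "cis (pi * ang m v) = cis (pi * (if fst x then theta i v else - theta i v))"
  proof (cases "even m")
   case True
   then obtain n where "m = 2 * n" by (rule evenE)
   then show ?thesis unfolding cis_eq_iff m[symmetric] fstT
    by (intro exI[of _ "int n"]) (simp add: ang_def algebra_simps)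
  next
   case False
   then obtain n where "m = 2 * n + 1" by (rule oddE)
   then show ?thesis unfolding cis_eq_iff m[symmetric] fstT
    by (intro exI[of _ "int n + 1"]) (simp add: ang_def algebra_simps)
  qed
  finally show ?thesis by (simp add: std_chart_def)
 qed
 have z_T: "z = S (T 0) (axis i 1)" using T_corner by simp
 have \<phi>z: "\<phi> z = 0" unfolding z_T using \<phi>_T[of "axis i 1" 0] en(1) by (simp add: axis_nth)
 \<comment> \<open>Points with equal radius and equal angle lie in the same tile, or in consecutive
   tiles on the side that these share.\<close>
 have inj_le: "S (T m) v = S (T m') v'"
  if v: "v \<in> tri" "0 < v $ i" and v': "v' \<in> tri" "0 < v' $ i" and eq: "v $ i = v' $ i" "v $ i < 1"
   and ang: "ang m v = ang m' v'" and le: "m \<le> m'" for m m' v v'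
 proof -
  define \<tau> \<tau>' where "\<tau> = ang m v - m" and "\<tau>' = ang m' v' - m'"
  have \<tau>: "0 \<le> \<tau>" "\<tau> \<le> 1" "0 \<le> \<tau>'" "\<tau>' \<le> 1"
   using theta_range[OF v(1), of i] theta_range[OF v'(1), of i] by (auto simp: \<tau>_def \<tau>'_def ang_def)
  have sum: "real m + \<tau> = real m' + \<tau>'" using ang by (simp add: \<tau>_def \<tau>'_def)
  then have "real m' \<le> real (Suc m)" using \<tau> by simp
  then have "m' \<le> Suc m" by (simp only: of_nat_le_iff)
  then consider "m' = m" | "m' = Suc m" using le by linarith
  then show ?thesis
  proof cases
   case 1
   then have "theta i v = theta i v'" using ang by (simp add: ang_def split: if_splits)
   then have "v = v'" using tri_polar_eqI[OF v(1) v'(1) eq] by simp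
   then show ?thesis using 1 by simp
  next
   case 2
   then have "\<tau> = 1" "\<tau>' = 0" using sum \<tau> by auto
   then have th: "theta i v = (if even m then 1 else 0)" "theta i v' = (if even m then 1 else 0)"
    using 2 by (auto simp: \<tau>_def \<tau>'_def ang_def split: if_splits)
   then have "v = v'" using tri_polar_eqI[OF v(1) v'(1) eq] by simp
   moreover have "v $ (if even m then i + 1 else i + 2) = 0"
    using th(1) theta_edge[OF v(1) eq(2)] by (simp split: if_splits)
   ultimately show ?thesis using T_share[OF v(1), of m] 2 by simp
  qed
 qed
 have T_period: "T (m + 2 * k * n) = T m" for m n
 proof -
  have "(m + 2 * k * n) div 2 = m div 2 + k * n" by (simp add: mult.assoc)
  moreover have "pp (m div 2 + k * n) = pp (m div 2)" by (metis mod_mult_self2 pp_mod)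
  moreover have "even (m + 2 * k * n) \<longleftrightarrow> even m" by simp
  ultimately show ?thesis unfolding T_def by presburger
 qed
 have ang_shift: "ang (m + 2 * k * n) v = ang m v + 2 * k * n" for m n v by (simp add: ang_def)
 have inj: "y = y'" if y: "y \<in> ?N" "y' \<in> ?N" "\<phi> y = \<phi> y'" for y y'
 proof -
  obtain m v where v: "v \<in> tri" "0 < v $ i" "y = S (T m) v" using N_T[OF y(1)] by blast
  obtain m' v' where v': "v' \<in> tri" "0 < v' $ i" "y' = S (T m') v'" using N_T[OF y(2)] by blast
  have "root k (1 - v $ i) = root k (1 - v' $ i)"
   using norm_\<phi>[OF v(1,2), of m] norm_\<phi>[OF v'(1,2), of m'] y(3) v(3) v'(3) by simp
  then have eq: "v $ i = v' $ i" using en(1) by simp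
  show ?thesis
  proof (cases "v $ i = 1")
   case True
   then have "v = axis i 1" "v' = axis i 1" using tri_eq_axis v(1) v'(1) eq by auto
   then show ?thesis using v(3) v'(3) T_corner by simp
  next
   case False
   then have lt: "v $ i < 1" using tri_nth(3)[OF v(1), of i] by simp
   have "e m v = e m' v'" using y(3) \<phi>_T[OF v(1,2), of m] \<phi>_T[OF v'(1,2), of m'] v(3) v'(3) eq lt en(1) by simp
   then obtain n :: int where "pi * ang m v / k = pi * ang m' v' / k + 2 * pi * of_int n"
    unfolding e_def cis_eq_iff by blast
   then have "ang m v * pi = (ang m' v' + 2 * k * of_int n) * pi" using en(1) by (simp add: field_simps)
   then have n: "ang m v = ang m' v' + 2 * k * of_int n" by simp
   define a b where "a = nat (- n)" and "b = nat n"
   have "real a - real b = - of_int n" by (cases "0 \<le> n") (simp_all add: a_def b_def)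
   then have ab: "real b = of_int n + real a" by simp
   have "ang (m + 2 * k * a) v = ang (m' + 2 * k * b) v'"
    unfolding ang_shift n by (simp add: ab algebra_simps)
   then have "S (T (m + 2 * k * a)) v = S (T (m' + 2 * k * b)) v'"
    using inj_le[OF v(1,2) v'(1,2) eq lt, of "m + 2 * k * a" "m' + 2 * k * b"]
     inj_le[OF v'(1,2) v(1,2) eq[symmetric], of "m' + 2 * k * b" "m + 2 * k * a"] lt eq
    by (cases "m + 2 * k * a \<le> m' + 2 * k * b") simp_all
   then show ?thesis unfolding T_period using v(3) v'(3) by simp
  qed
 qed
 have img: "\<phi> ` ?N = ball 0 1"
 proof (intro equalityI subsetI)
  fix w assume "w \<in> \<phi> ` ?N"
  then obtain y where y: "y \<in> ?N" "w = \<phi> y" by blast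
  obtain m v where v: "v \<in> tri" "0 < v $ i" "y = S (T m) v" using N_T[OF y(1)] by blast
  have "root k (1 - v $ i) < root k 1" using v(2) en(1) by simp
  then show "w \<in> ball 0 1" using norm_\<phi>[OF v(1,2), of m] y(2) v(3) en(1) by simp
 next
  fix w :: complex assume w: "w \<in> ball 0 1"
  show "w \<in> \<phi> ` ?N"
  proof (cases "w = 0")
   case True
   have "S (T 0) (axis i 1) \<in> ?N" by (rule T_N) (simp_all add: axis_nth)
   then have "z \<in> ?N" by (simp only: T_corner)
   then show ?thesis using \<phi>z True by (metis imageI)
  next
   case False
   define \<alpha> where "\<alpha> = Arg2pi w"
   have \<alpha>: "0 \<le> \<alpha>" "w = of_real (norm w) * cis \<alpha>"
    using Arg2pi[of w] unfolding \<alpha>_def cis_conv_exp is_Arg_def by blast+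
   \<comment> \<open>\<open>m\<close> tiles are passed completely before the direction \<alpha> is
     reached, and \<tau> is the part of the next one.\<close>
   define a where "a = k * \<alpha> / pi"
   have a: "0 \<le> a" using \<alpha> by (simp add: a_def)
   define m where "m = nat \<lfloor>a\<rfloor>"
   define \<tau> where "\<tau> = a - m"
   have rm: "real m = of_int \<lfloor>a\<rfloor>" using a by (simp add: m_def)
   have \<tau>: "0 \<le> \<tau>" "\<tau> \<le> 1" using floor_correct[of a] unfolding \<tau>_def rm by linarith+
   define \<theta> where "\<theta> = (if even m then \<tau> else 1 - \<tau>)"
   have \<theta>: "0 \<le> \<theta>" "\<theta> \<le> 1" using \<tau> by (auto simp: \<theta>_def)
   define r where "r = norm w ^ k"
   have nw: "0 < norm w" "norm w < 1" using w False by simp_all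
   have r: "0 < r" "r < 1" unfolding r_def using nw en(1) by (simp_all add: power_less_one_iff)
   define v where "v = polar i r \<theta>"
   have v: "v \<in> tri" "v $ i = 1 - r" "theta i v = \<theta>" unfolding v_def using polar[of r \<theta> i] r \<theta> by simp_all
   have "ang m v = a" by (auto simp: ang_def v(3) \<theta>_def \<tau>_def)
   then have "pi * ang m v / k = \<alpha>" using en(1) by (simp add: a_def)
   then have "e m v = cis \<alpha>" by (simp add: e_def)
   moreover have "root k (1 - v $ i) = norm w" unfolding v(2) r_def using en(1) by (simp add: real_root_power_cancel)
   ultimately have "\<phi> (S (T m) v) = of_real (norm w) * cis \<alpha>" using \<phi>_T[OF v(1), of m] v(2) r by simp
   also have "\<dots> = w" by (rule \<alpha>(2)[symmetric])
   finally have "\<phi> (S (T m) v) = w" .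
   moreover have "S (T m) v \<in> ?N" using T_N[OF v(1)] v(2) r by simp
   ultimately show ?thesis by blast
  qed
 qed
 have cont_e: "continuous_on {v \<in> A. root k (1 - v $ i) \<noteq> 0} (e m)" for A m
  unfolding e_def ang_def theta_def
  by (cases "even m") (auto intro!: continuous_intros)
 have cont_\<Phi>: "continuous_on A (\<Phi> x)" for A x
  unfolding \<Phi>_def
  by (rule continuous_on_scaled_unit) (auto intro!: continuous_intros cont_e simp: norm_e)
 have contS_pre: "continuous_map (subtopology X ?N) euclidean \<phi>"
 proof (rule pasting_lemma_closed[of "tiles d" _ "\<lambda>x. ?N \<inter> S x ` tri" _ "\<lambda>x y. \<Phi> x (bary (f y))"])
  show "closedin (subtopology X ?N) (?N \<inter> S x ` tri)" if "x \<in> tiles d" for x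
   using closedin_S_image[OF that compact_imp_closed[OF compact_tri] order_refl]
   by (rule closedin_subtopology_Int_closed)
  have cb: "continuous_map (subtopology (subtopology X ?N) A) (top_of_set tri) (\<lambda>y. bary (f y))" for A
   by (intro continuous_map_from_subtopology cont_baryf)
  have "continuous_map (top_of_set tri) euclidean (\<Phi> x)" for x using cont_\<Phi> by simp
  from continuous_map_compose[OF cb this]
  show "continuous_map (subtopology (subtopology X ?N) (?N \<inter> S x ` tri)) euclidean (\<lambda>y. \<Phi> x (bary (f y)))" for x
   by (simp add: o_def)
  have eq: "\<Phi> x (bary (f y)) = \<phi> y" if x: "x \<in> tiles d" and y: "y \<in> ?N \<inter> S x ` tri" for x y
  proof -
   obtain v where v: "v \<in> tri" "y = S x v" using y by blast
   then show ?thesis using \<phi>_S[OF x v(1)] y bary_fS[OF x v(1)] by simp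
  qed
  show "\<Phi> x (bary (f y)) = \<Phi> x' (bary (f y))" if "x \<in> tiles d" "x' \<in> tiles d"
   "y \<in> topspace (subtopology X ?N) \<inter> (?N \<inter> S x ` tri) \<inter> (?N \<inter> S x' ` tri)" for x x' y
   using eq[OF that(1), of y] eq[OF that(2), of y] that(3) by simp
  show "\<exists>x. x \<in> tiles d \<and> y \<in> ?N \<inter> S x ` tri \<and> \<phi> y = \<Phi> x (bary (f y))"
   if y: "y \<in> topspace (subtopology X ?N)" for y
  proof -
   have yX: "y \<in> topspace X" "y \<in> ?N" using y by simp_all
   have "y \<in> S (tile_of y) ` tri" using tile_of(2)[OF yX(1)] bary_in_tri[of "f y"] by (metis imageI)
   then show ?thesis using tile_of(1)[OF yX(1)] yX(2) by (intro exI[of _ "tile_of y"]) (simp add: \<phi>_def)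
  qed
 qed simp
 have topN: "topspace (subtopology X ?N) = ?N" using star_subset by (simp add: inf_absorb2)
 have cont: "continuous_map (subtopology X ?N) (top_of_set (ball 0 1)) \<phi>"
  using contS_pre img topN by (auto simp: continuous_map_in_subtopology)
 \<comment> \<open>The star is not compact. Closedness is checked on the discs of radius c < 1, over
   which the sets \<open>W c\<close> are compact.\<close>
 have closed: "closedin (top_of_set (ball 0 1)) (\<phi> ` C)" if C: "closedin (subtopology X ?N) C" for C
 proof -
  have CN: "C \<subseteq> ?N" using closedin_subset[OF C] topN by simp
  obtain C' where C': "closedin X C'" "C = C' \<inter> ?N" using C by (auto simp: closedin_subtopology)
  define K where "K c = {v \<in> tri. 1 - c ^ k \<le> v $ i}" for c
  define W where "W c = (\<Union>m<2*k. S (T m) ` K c)" for c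
  have KN: "W c \<subseteq> ?N" if c: "0 < c" "c < 1" for c
  proof -
   have "0 < 1 - c ^ k" using c en(1) by (simp add: power_less_one_iff)
   then have "S (T m) v \<in> ?N" if "v \<in> K c" for m v using that by (intro T_N) (simp_all add: K_def)
   then show ?thesis unfolding W_def by blast
  qed
  have cl: "closed (\<phi> ` (C' \<inter> W c))" if c: "0 < c" "c < 1" for c
  proof -
   have "closed {v::real^3. 1 - c ^ k \<le> v $ i}" by (intro closed_Collect_le continuous_intros)
   moreover have "K c = tri \<inter> {v. 1 - c ^ k \<le> v $ i}" by (auto simp: K_def)
   ultimately have "compact (K c)" using compact_tri by (simp add: compact_Int_closed)
   then have "compactin (top_of_set tri) (K c)" by (simp add: compactin_subtopology K_def)
   then have "compactin X (S (T m) ` K c)" for m by (rule image_compactin[OF _ contS[OF T_tiles]])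
   then have "compactin X (W c)" unfolding W_def by (intro compactin_Union) auto
   then have "compactin X (C' \<inter> W c)" by (rule closed_Int_compactin[OF C'(1)])
   then have "compactin (subtopology X ?N) (C' \<inter> W c)"
    using KN[OF c] by (simp add: compactin_subtopology le_infI2)
   from image_compactin[OF this contS_pre] show ?thesis by (simp add: compact_imp_closed)
  qed
  have "openin (top_of_set (ball 0 1)) (ball 0 1 - \<phi> ` C)"
  proof (subst openin_subopen, intro ballI)
   fix w assume w: "w \<in> ball 0 1 - \<phi> ` C"
   define c where "c = (1 + norm w) / 2"
   have nw: "norm w < 1" using w by simp
   have c: "0 < c" "c < 1" "norm w < c" using nw unfolding c_def by (simp_all add: add_pos_nonneg)
   define V where "V = ball 0 c - \<phi> ` (C' \<inter> W c)"
   have "open V" unfolding V_def using cl[OF c(1,2)] by (simp add: open_Diff)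
   have sub: "V \<subseteq> ball 0 1 - \<phi> ` C"
   proof
    fix u assume u: "u \<in> V"
    then have nu: "norm u < c" by (simp add: V_def)
    have "u \<notin> \<phi> ` C"
    proof
     assume "u \<in> \<phi> ` C"
     then obtain y where y: "u = \<phi> y" "y \<in> C" by (rule imageE)
     then have yN: "y \<in> ?N" using CN by blast
     obtain x v where xv: "x \<in> tiles d" "v \<in> tri" "0 < v $ i" "S x (axis i 1) = z" "y = S x v"
      using yN unfolding star_def by blast
     obtain m0 where m0: "T m0 = x" using T_all[OF xv(1,4)] by blast
     define m where "m = m0 mod (2 * k)"
     have "m + 2 * k * (m0 div (2 * k)) = m0" unfolding m_def by (rule mod_mult_div_eq)
     then have Tm: "T m = x" using T_period[of m "m0 div (2 * k)"] m0 by simp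
     then have my: "y = S (T m) v" using xv(5) by simp
     have m: "m < 2 * k" using en(1) by (simp add: m_def)
     have "root k (1 - v $ i) < c" using norm_\<phi>[OF xv(2,3), of m] nu unfolding y(1) my by simp
     then have "root k (1 - v $ i) ^ k \<le> c ^ k"
      using tri_nth(3)[OF xv(2), of i] real_root_ge_zero[of "1 - v $ i" k] by (intro power_mono) simp_all
     then have "1 - v $ i \<le> c ^ k" using en(1) tri_nth(3)[OF xv(2), of i] by (simp add: real_root_pow_pos2)
     then have "v \<in> K c" using xv(2) by (simp add: K_def)
     then have "y \<in> S (T m) ` K c" unfolding my by (rule imageI)
     then have "y \<in> W c" unfolding W_def using m by (intro UN_I[of m]) simp_all
     moreover have "y \<in> C'" using y(2) C'(2) by simp
     ultimately have "u \<in> \<phi> ` (C' \<inter> W c)" unfolding y(1) by (intro imageI IntI)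
     then show False using u by (simp add: V_def)
    qed
    then show "u \<in> ball 0 1 - \<phi> ` C" using nu c(2) by simp
   qed
   have "C' \<inter> W c \<subseteq> C" unfolding C'(2) using KN[OF c(1,2)] by (intro Int_mono order_refl)
   then have "\<phi> ` (C' \<inter> W c) \<subseteq> \<phi> ` C" by (rule image_mono)
   then have "w \<notin> \<phi> ` (C' \<inter> W c)" using w by blast
   then have wV: "w \<in> V" using c(3) by (simp add: V_def)
   have "V = ball 0 1 \<inter> V" using sub by blast
   then have oV: "openin (top_of_set (ball 0 1)) V" using openin_open_Int[OF \<open>open V\<close>, of "ball 0 1"] by simp
   show "\<exists>V. openin (top_of_set (ball 0 1)) V \<and> w \<in> V \<and> V \<subseteq> ball 0 1 - \<phi> ` C"
    by (intro exI[of _ V] conjI oV wV sub)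
  qed
  moreover have "\<phi> ` C \<subseteq> ball 0 1" unfolding img[symmetric] using CN by (rule image_mono)
  ultimately show ?thesis by (simp add: closedin_def)
 qed
 have "homeomorphic_map (subtopology X ?N) (top_of_set (ball 0 1)) \<phi>"
 proof (rule bijective_closed_imp_homeomorphic_map[OF cont])
  show "closed_map (subtopology X ?N) (top_of_set (ball 0 1)) \<phi>" using closed by (simp add: closed_map_def)
  show "\<phi> ` topspace (subtopology X ?N) = topspace (top_of_set (ball 0 1))" unfolding topN using img by simp
  show "inj_on \<phi> (topspace (subtopology X ?N))" unfolding topN using inj by (rule inj_onI)
 qed
 then show thesis using \<phi>z powk by (rule that)
qed

end

section \<open>Local degrees of the projection of a tiling\<close>

lemma homeomorphic_map_restrict:
 assumes \<phi>: "homeomorphic_map (subtopology X U) (top_of_set C) \<phi>" and U: "U \<subseteq> topspace X" and D: "D \<subseteq> C"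
 shows "homeomorphic_map (subtopology X {x \<in> U. \<phi> x \<in> D}) (top_of_set D) \<phi>"
proof -
 have top: "topspace (subtopology X U) = U" using U by (simp add: inf_absorb2)
 have img: "\<phi> ` U = C" using homeomorphic_imp_surjective_map[OF \<phi>] unfolding top by simp
 have "\<phi> ` (topspace (subtopology X U) \<inter> {x \<in> U. \<phi> x \<in> D}) = topspace (top_of_set C) \<inter> D"
  unfolding top using img D by auto
 from homeomorphic_map_subtopologies[OF \<phi> this]
 have "homeomorphic_map (subtopology X (U \<inter> {x \<in> U. \<phi> x \<in> D})) (top_of_set (C \<inter> D)) \<phi>"
  by (simp only: subtopology_subtopology)
 moreover have "U \<inter> {x \<in> U. \<phi> x \<in> D} = {x \<in> U. \<phi> x \<in> D}" "C \<inter> D = D" using D by auto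
 ultimately show ?thesis by simp
qed

text \<open>Away from 0 the k-th power has non-zero derivative, so it is locally injective and, by
  invariance of domain, a homeomorphism onto an open set. Its local inverse is absorbed into the
  chart of the target.\<close>

lemma local_degree_one:
 assumes U: "openin X U" and V: "openin Y V" and fUV: "f ` U \<subseteq> V"
  and \<phi>: "homeomorphic_map (subtopology X U) (top_of_set (ball (0::complex) 1)) \<phi>"
  and \<psi>: "homeomorphic_map (subtopology Y V) (top_of_set (ball (0::complex) 1)) \<psi>"
  and pow: "\<And>q. q \<in> U \<Longrightarrow> \<psi> (f q) = \<phi> q ^ k" and k: "0 < k" and q: "q \<in> U" "\<phi> q \<noteq> 0"
 shows "has_local_degree X Y f q 1"
proof -
 define P where "P = (\<lambda>z::complex. z ^ k)"
 have UX: "U \<subseteq> topspace X" and VY: "V \<subseteq> topspace Y" using U V openin_subset by blast+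
 have topU: "topspace (subtopology X U) = U" and topV: "topspace (subtopology Y V) = V"
  using UX VY by (simp_all add: inf_absorb2)
 have img\<phi>: "\<phi> ` U = ball 0 1" and img\<psi>: "\<psi> ` V = ball 0 1"
  using homeomorphic_imp_surjective_map[OF \<phi>] homeomorphic_imp_surjective_map[OF \<psi>] topU topV by simp_all
 have inj\<phi>: "inj_on \<phi> U" and inj\<psi>: "inj_on \<psi> V"
  using homeomorphic_imp_injective_map[OF \<phi>] homeomorphic_imp_injective_map[OF \<psi>] topU topV by simp_all
 have w: "\<phi> q \<in> ball 0 1" using img\<phi> q(1) by blast
 have hol: "P holomorphic_on ball 0 1" unfolding P_def by (intro holomorphic_intros)
 have "(P has_field_derivative of_nat k * \<phi> q ^ (k - 1)) (at (\<phi> q))"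
  unfolding P_def by (auto intro!: derivative_eq_intros)
 then have "deriv P (\<phi> q) \<noteq> 0" using k q(2) by (simp add: DERIV_imp_deriv)
 then obtain r where r: "0 < r" "ball (\<phi> q) r \<subseteq> ball 0 1" "inj_on P (ball (\<phi> q) r)"
  using has_complex_derivative_locally_injective[OF hol w open_ball] by metis
 define D where "D = ball (\<phi> q) r"
 have "continuous_on D P" unfolding P_def by (intro continuous_intros)
 then obtain g where g: "homeomorphism D (P ` D) P g"
  using invariance_of_domain_homeomorphism[of D P] r by (auto simp: D_def)
 have openPD: "open (P ` D)" using invariance_of_domain[of D P] r \<open>continuous_on D P\<close> by (simp add: D_def)
 have PD: "P ` D \<subseteq> ball 0 1"
 proof
  fix y assume "y \<in> P ` D"
  then obtain x where x: "x \<in> D" "y = x ^ k" by (auto simp: P_def)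
  then have "norm x < 1" using r(2) by (auto simp: D_def)
  then have "norm x ^ k < 1" using k by (simp add: power_less_one_iff)
  then show "y \<in> ball 0 1" by (simp add: x(2) norm_power)
 qed
 define U' V' where "U' = {x \<in> U. \<phi> x \<in> D}" and "V' = {y \<in> V. \<psi> y \<in> P ` D}"
 define A where "A = (\<lambda>x::complex. (x - \<phi> q) / of_real r)"
 have hA: "homeomorphic_map (top_of_set D) (top_of_set (ball 0 1)) A"
 proof -
  have "homeomorphic_maps (top_of_set D) (top_of_set (ball 0 1)) A (\<lambda>x. of_real r * x + \<phi> q)"
   unfolding homeomorphic_maps_def using r(1)
   by (auto simp: A_def D_def dist_norm norm_divide norm_mult norm_minus_commute divide_less_eq mult_less_cancel_left1 intro!: continuous_intros)
  then show ?thesis by (rule homeomorphic_maps_imp_map)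
 qed
 have h\<phi>: "homeomorphic_map (subtopology X U') (top_of_set D) \<phi>"
  unfolding U'_def by (rule homeomorphic_map_restrict[OF \<phi> UX]) (use r(2) in \<open>simp add: D_def\<close>)
 have h\<psi>: "homeomorphic_map (subtopology Y V') (top_of_set (P ` D)) \<psi>"
  unfolding V'_def using homeomorphic_map_restrict[OF \<psi> VY PD] .
 have hg: "homeomorphic_map (top_of_set (P ` D)) (top_of_set D) g"
 proof -
  have "homeomorphic_maps (top_of_set (P ` D)) (top_of_set D) g P"
   using g by (auto simp: homeomorphic_maps_def homeomorphism_def image_subset_iff)
  then show ?thesis by (rule homeomorphic_maps_imp_map)
 qed
 have qU': "q \<in> U'" using q(1) r(1) by (simp add: U'_def D_def)
 have oU: "openin X U'"
 proof -
  have "continuous_map (subtopology X U) euclidean \<phi>"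
   using homeomorphic_imp_continuous_map[OF \<phi>] by (simp add: continuous_map_in_subtopology)
  then have "openin (subtopology X U) {x \<in> topspace (subtopology X U). \<phi> x \<in> D}"
   by (rule openin_continuous_map_preimage) (simp add: D_def)
  then show ?thesis unfolding topU U'_def using U by (rule openin_trans_full)
 qed
 have oV: "openin Y V'"
 proof -
  have "continuous_map (subtopology Y V) euclidean \<psi>"
   using homeomorphic_imp_continuous_map[OF \<psi>] by (simp add: continuous_map_in_subtopology)
  then have "openin (subtopology Y V) {y \<in> topspace (subtopology Y V). \<psi> y \<in> P ` D}"
   by (rule openin_continuous_map_preimage) (simp add: openPD)
  then show ?thesis unfolding topV V'_def using V by (rule openin_trans_full)
 qed
 have gP: "g (P x) = x" if "x \<in> D" for x using g that by (simp add: homeomorphism_def)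
 have 1: "f ` U' \<subseteq> V'"
 proof
  fix y assume "y \<in> f ` U'"
  then obtain x where x: "x \<in> U" "\<phi> x \<in> D" "y = f x" by (auto simp: U'_def)
  have "\<psi> (f x) = P (\<phi> x)" using pow[OF x(1)] by (simp add: P_def)
  then show "y \<in> V'" using x fUV by (auto simp: V'_def)
 qed
 have 2: "(A \<circ> g \<circ> \<psi>) (f x) = (A \<circ> \<phi>) x ^ 1" if "x \<in> U'" for x
  using that pow[of x] gP[of "\<phi> x"] by (simp add: U'_def P_def)
 show ?thesis unfolding has_local_degree_def
 proof (intro conjI exI[of _ U'] exI[of _ V'] exI[of _ "A \<circ> \<phi>"] exI[of _ "A \<circ> g \<circ> \<psi>"])
  show "homeomorphic_map (subtopology X U') (top_of_set (ball 0 1)) (A \<circ> \<phi>)"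
   by (rule homeomorphic_map_compose[OF h\<phi> hA])
  show "homeomorphic_map (subtopology Y V') (top_of_set (ball 0 1)) (A \<circ> g \<circ> \<psi>)"
   by (simp only: comp_assoc) (rule homeomorphic_map_compose[OF homeomorphic_map_compose[OF h\<psi> hg] hA, unfolded comp_assoc])
  show "(A \<circ> \<phi>) q = 0" by (simp add: A_def)
  then show "(A \<circ> g \<circ> \<psi>) (f q) = 0" using 2[OF qU'] by simp
  show "\<forall>q\<in>U'. (A \<circ> g \<circ> \<psi>) (f q) = (A \<circ> \<phi>) q ^ 1" using 2 by blast
 qed (use oU oV qU' 1 in auto)
qed

text \<open>The sphere is its own one-sheeted tiling, so that \<open>vertex_chart\<close> also
  supplies charts on the target.\<close>

lemma tiling_P1: "tiling P1 id 1 (\<lambda>_. id) (\<lambda>x. kap (fst x))"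
proof
 show "id permutes {..<1::nat}" for i :: 3 by (rule permutes_id)
 show "continuous_map P1 P1 id" by (rule continuous_map_id)
 show "\<exists>x\<in>tiles 1. \<exists>v\<in>tri. y = kap (fst x) v" for y
 proof -
  obtain s where "y = kap s (bary y)" by (rule kap_cases)
  then show ?thesis by (intro bexI[of _ "(s, 0)"] bexI[of _ "bary y"]) simp_all
 qed
 show "kap (fst x) v = kap (fst x') v \<longleftrightarrow> (x, x') \<in> glue (\<lambda>_. id) 1 v"
  if x: "x \<in> tiles 1" "x' \<in> tiles 1" and v: "v \<in> tri" for x x' v
 proof -
  obtain s s' where ss: "x = (s, 0)" "x' = (s', 0)" using x by (cases x; cases x') simp
  have st: "((True, 0), (False, 0)) \<in> glue (\<lambda>_. id) 1 v" if "v $ i = 0" for i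
   using glue_step[of 0 1 v i "\<lambda>_. id"] that by simp
  have "(x, x') \<in> glue (\<lambda>_. id) 1 v" if "s = s' \<or> (\<exists>i. v $ i = 0)"
   using that st glue_sym unfolding ss by (cases s; cases s') (auto intro: glue_sym)
  moreover have "s = s' \<or> (\<exists>i. v $ i = 0)" if "(x, x') \<in> glue (\<lambda>_. id) 1 v"
   using that glue_interior[of v "\<lambda>_. id" 1] unfolding ss by auto
  ultimately show ?thesis using kap_eq_iff[OF v v, of s s'] unfolding ss by auto
 qed
qed (simp_all add: Hausdorff_space_P1 continuous_map_kap)

text \<open>The case k = 1 of \<open>vertex_chart\<close> for the two half planes; the power in its
  conclusion disappears.\<close>

lemma P1_chart:
 obtains V \<psi> where "openin P1 V" "homeomorphic_map (subtopology P1 V) (top_of_set (ball (0::complex) 1)) \<psi>"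
  "\<And>s v. v \<in> tri \<Longrightarrow> kap s v \<in> V \<longleftrightarrow> 0 < v $ i"
  "\<And>s v. v \<in> tri \<Longrightarrow> 0 < v $ i \<Longrightarrow> \<psi> (kap s v) = std_chart i s v"
proof -
 interpret P1: tiling P1 id 1 "\<lambda>_. id" "\<lambda>x. kap (fst x)" by (rule tiling_P1)
 define z where "z = kap True (axis i 1)"
 have kz: "kap s (axis i 1) = z" for s
 proof -
  have "axis i (1::real) $ (i + 1) = 0" by (simp add: axis_def)
  then show ?thesis unfolding z_def using kap_eq_iff[of "axis i 1" "axis i 1" s True] axis_in_tri by blast
 qed
 have "{p. p < (1::nat) \<and> kap (fst (True, p)) (axis i 1) = z} = {0}" using kz by auto
 then have c: "1 = card {p. p < (1::nat) \<and> kap (fst (True, p)) (axis i 1) = z}" by simp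
 obtain \<psi> where \<psi>: "homeomorphic_map (subtopology P1 (P1.star i z)) (top_of_set (ball (0::complex) 1)) \<psi>"
  "\<And>x v. x \<in> tiles 1 \<Longrightarrow> v \<in> tri \<Longrightarrow> kap (fst x) v \<in> P1.star i z \<Longrightarrow> \<psi> (kap (fst x) v) ^ 1 = std_chart i (fst x) v"
  by (rule P1.vertex_chart[OF _ _ c]) (simp_all add: z_def)
 have st: "kap s v \<in> P1.star i z \<longleftrightarrow> 0 < v $ i" if "v \<in> tri" for s v
  using P1.star_iff[of "(s, 0)" v i z] that kz by simp
 show thesis
 proof (rule that[OF P1.openin_star \<psi>(1) st])
  show "\<psi> (kap s v) = std_chart i s v" if "v \<in> tri" "0 < v $ i" for s v
   using \<psi>(2)[of "(s, 0)" v] st[OF that(1)] that by simp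
 qed
qed

context tiling
begin

lemma vertex_True: assumes "z \<in> vertices i" obtains p where "p < d" "z = S (True, p) (axis i 1)"
proof -
 obtain x where x: "x \<in> tiles d" "z = S x (axis i 1)" using assms by (auto simp: vertices_def)
 obtain s p where sp: "x = (s, p)" by fastforce
 show thesis
 proof (cases s)
  case True then show ?thesis using that x sp by simp
 next
  case False
  have p: "Hilbert_Choice.inv (t (i + 1)) p < d" using x sp by simp
  have "S (True, Hilbert_Choice.inv (t (i + 1)) p) (axis i 1) = S (False, p) (axis i 1)"
   using share[OF p, of "axis i 1" "i + 1"] by (simp add: axis_nth)
  then show ?thesis using that[OF p] x sp False by simp
 qed
qed

text \<open>The charts on X and on the sphere are both tied to \<open>std_chart\<close>, so between
  them f is the k-th power map, with k the number of upper tiles at z. At the other points of the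
  star the chart is non-zero and \<open>local_degree_one\<close> applies.\<close>

lemma vertex_local_degrees:
 assumes p0: "p0 < d" and z: "z = S (True, p0) (axis i 1)"
 shows "has_local_degree X P1 f z (card {p. p < d \<and> S (True, p) (axis i 1) = z})"
  "y \<in> star i z \<Longrightarrow> y \<noteq> z \<Longrightarrow> has_local_degree X P1 f y 1"
proof -
 define k where "k = card {p. p < d \<and> S (True, p) (axis i 1) = z}"
 have k: "0 < k" using vertex_enumeration(1)[OF p0 z k_def] .
 obtain \<phi> where \<phi>: "homeomorphic_map (subtopology X (star i z)) (top_of_set (ball (0::complex) 1)) \<phi>" "\<phi> z = 0"
  "\<And>x v. x \<in> tiles d \<Longrightarrow> v \<in> tri \<Longrightarrow> S x v \<in> star i z \<Longrightarrow> \<phi> (S x v) ^ k = std_chart i (fst x) v"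
  by (rule vertex_chart[OF p0 z k_def]) blast
 obtain V \<psi> where V: "openin P1 V" "homeomorphic_map (subtopology P1 V) (top_of_set (ball (0::complex) 1)) \<psi>"
  "\<And>s v. v \<in> tri \<Longrightarrow> kap s v \<in> V \<longleftrightarrow> 0 < v $ i"
  "\<And>s v. v \<in> tri \<Longrightarrow> 0 < v $ i \<Longrightarrow> \<psi> (kap s v) = std_chart i s v"
  by (rule P1_chart[of i]) blast
 have zs: "z \<in> star i z" unfolding z using p0 star_iff[of "(True, p0)" "axis i 1" i] by (simp add: axis_nth)
 have key: "f y \<in> V \<and> \<psi> (f y) = \<phi> y ^ k" if y: "y \<in> star i z" for y
 proof -
  obtain x v where xv: "x \<in> tiles d" "v \<in> tri" "0 < v $ i" "y = S x v" using y unfolding star_def by blast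
  have "f y = kap (fst x) v" unfolding xv(4) by (rule fS[OF xv(1,2)])
  then show ?thesis using V(3)[OF xv(2)] V(4)[OF xv(2,3)] xv(3) \<phi>(3)[OF xv(1,2)] y xv(4) by simp
 qed
 have fV: "f ` star i z \<subseteq> V" using key by blast
 show "has_local_degree X P1 f z (card {p. p < d \<and> S (True, p) (axis i 1) = z})"
  unfolding k_def[symmetric] has_local_degree_def
 proof (intro conjI exI[of _ "star i z"] exI[of _ V] exI[of _ \<phi>] exI[of _ \<psi>])
  show "\<psi> (f z) = 0" using key[OF zs] \<phi>(2) k by simp
  show "\<forall>q\<in>star i z. \<psi> (f q) = \<phi> q ^ k" using key by blast
 qed (fact k openin_star zs V fV \<phi>)+
 assume y: "y \<in> star i z" "y \<noteq> z"
 have "inj_on \<phi> (star i z)" using homeomorphic_imp_injective_map[OF \<phi>(1)] star_subset[of i z] by (simp add: inf_absorb2)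
 then have "\<phi> y \<noteq> 0" using inj_onD[of \<phi> "star i z" y z] y zs \<phi>(2) by auto
 then show "has_local_degree X P1 f y 1"
  using local_degree_one[OF openin_star V(1) fV \<phi>(1) V(2) _ k y(1)] key by blast
qed

text \<open>Every point lies in the star of some vertex, and here it is not the centre.\<close>

lemma local_degree_off_vertices:
 assumes y: "y \<in> topspace X" "\<And>i. bary (f y) \<noteq> axis i 1"
 shows "has_local_degree X P1 f y 1"
proof -
 obtain i z where iz: "z \<in> vertices i" "y \<in> star i z" using star_cover[OF y(1)] by blast
 obtain p where p: "p < d" "z = S (True, p) (axis i 1)" using vertex_True[OF iz(1)] .
 have "bary (f z) = axis i 1" using p by simp
 then have "y \<noteq> z" using y(2)[of i] by auto
 then show ?thesis by (rule vertex_local_degrees(2)[OF p iz(2)])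
qed

lemma branched_cover: "branched_cover X P1 f"
 unfolding branched_cover_def
proof (intro conjI contf ballI)
 fix y assume y: "y \<in> topspace X"
 show "\<exists>k. has_local_degree X P1 f y k"
 proof (cases "\<exists>i. bary (f y) = axis i 1")
  case True
  then obtain i where "bary (f y) = axis i 1" by blast
  then have "y = S (tile_of y) (axis i 1)" using tile_of(2)[OF y] by simp
  then have "y \<in> vertices i" using tile_of(1)[OF y] by (auto simp: vertices_def)
  then obtain p where "p < d" "y = S (True, p) (axis i 1)" by (rule vertex_True)
  then show ?thesis using vertex_local_degrees(1) by blast
 next
  case False then show ?thesis using local_degree_off_vertices[OF y] by blast
 qed
qed

lemma unramified: "unramified_over X P1 f (topspace P1 - {Some 0, Some 1, None})"
 unfolding unramified_over_def
proof (intro ballI impI)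
 fix y assume y: "y \<in> topspace X" "f y \<in> topspace P1 - {Some 0, Some 1, None}"
 then have "f y \<notin> {Some 0, Some 1, None}" by blast
 then show "has_local_degree X P1 f y 1" using branch_point_iff[of "f y"] by (intro local_degree_off_vertices[OF y(1)]) blast
qed

lemma compact_connected_surface:
 assumes "connected_space X" "0 < d" shows "compact_connected_surface X"
 unfolding compact_connected_surface_def
proof (intro conjI compact_X Haus assms(1) ballI)
 have "S (True, 0) (axis 1 1) \<in> topspace X" using assms(2) by simp
 then show "topspace X \<noteq> {}" by blast
 fix y assume "y \<in> topspace X"
 then obtain k where "has_local_degree X P1 f y k" using branched_cover by (auto simp: branched_cover_def)
 then obtain U \<phi> where "openin X U" "y \<in> U" "homeomorphic_map (subtopology X U) (top_of_set (ball (0::complex) 1)) \<phi>"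
  unfolding has_local_degree_def by blast
 then show "\<exists>U. openin X U \<and> y \<in> U \<and> subtopology X U homeomorphic_space top_of_set (ball (0::complex) 1)"
  using homeomorphic_map_imp_homeomorphic_space by blast
qed

end

section \<open>Existence of tilings\<close>

text \<open>The surface to be glued consists of pairs of a triangle point and a gluing class, but
  sources of Belyi maps live on \<open>real\<close>. A real number codes a set of naturals, and four
  such sets can be merged into one.\<close>

lemma inj_code: obtains J :: "(real^3) \<times> (bool \<times> nat) set \<Rightarrow> real" where "inj J"
proof -
 obtain b :: "real \<Rightarrow> nat set" where b: "inj b"
  using eqpoll_sym[OF nat_sets_eqpoll_reals] by (auto simp: eqpoll_def bij_betw_def)
 obtain c :: "nat set \<Rightarrow> real" where c: "inj c"
  using nat_sets_eqpoll_reals by (auto simp: eqpoll_def bij_betw_def)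
 define N where "N p = to_nat ` ({0::nat} \<times> b (fst p $ 1) \<union> {1} \<times> b (fst p $ 2) \<union> {2} \<times> b (fst p $ 3) \<union> {3} \<times> to_nat ` snd p)"
  for p :: "(real^3) \<times> (bool \<times> nat) set"
 have "inj N"
 proof (rule injI)
  fix p q assume "N p = N q"
  then have eq: "{0::nat} \<times> b (fst p $ 1) \<union> {1} \<times> b (fst p $ 2) \<union> {2} \<times> b (fst p $ 3) \<union> {3} \<times> to_nat ` snd p
    = {0} \<times> b (fst q $ 1) \<union> {1} \<times> b (fst q $ 2) \<union> {2} \<times> b (fst q $ 3) \<union> {3} \<times> to_nat ` snd q"
   unfolding N_def by (simp only: inj_image_eq_iff[OF inj_to_nat])
  have col: "{n. (k, n) \<in> {0::nat} \<times> b (fst r $ 1) \<union> {1} \<times> b (fst r $ 2) \<union> {2} \<times> b (fst r $ 3) \<union> {3} \<times> to_nat ` snd r}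
   = (if k = 0 then b (fst r $ 1) else if k = 1 then b (fst r $ 2) else if k = 2 then b (fst r $ 3) else if k = 3 then to_nat ` snd r else {})"
   for k and r :: "(real^3) \<times> (bool \<times> nat) set" by auto
  have "b (fst p $ 1) = b (fst q $ 1)" "b (fst p $ 2) = b (fst q $ 2)" "b (fst p $ 3) = b (fst q $ 3)"
   "to_nat ` snd p = to_nat ` snd q"
   using col[of 0 p] col[of 0 q] col[of 1 p] col[of 1 q] col[of 2 p] col[of 2 q] col[of 3 p] col[of 3 q] unfolding eq by simp_all
  then have "fst p = fst q" "snd p = snd q"
   using injD[OF b] by (simp_all add: vec_eq_iff forall_3 inj_image_eq_iff[OF inj_to_nat])
  then show "p = q" by (rule prod_eqI)
 qed
 then have "inj (c \<circ> N)" using c by (rule inj_compose[rotated])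
 then show thesis by (rule that)
qed

text \<open>The quotient of 2 d triangles by \<open>glue\<close>, with the quotient topology. Only
  the Hausdorff property takes work: points over different points of the sphere are separated there,
  and different classes over the same v by the sets \<open>W\<close>.\<close>

theorem tiling_exists:
 assumes perm: "\<And>i. t i permutes {..<d}"
 obtains X :: "real topology" and f S where "tiling X f d t S"
proof -
 obtain J :: "(real^3) \<times> (bool \<times> nat) set \<Rightarrow> real" where J: "inj J" by (rule inj_code)
 define cl where "cl x v = {x'. (x, x') \<in> glue t d v}" for x and v :: "real^3"
 have cl_eq: "cl x v = cl x' v \<longleftrightarrow> (x, x') \<in> glue t d v" for x x' v
  unfolding cl_def by (auto intro: glue_trans glue_sym)
 define pi where "pi x v = J (v, cl x v)" for x v
 have pi_eq: "pi x v = pi x' w \<longleftrightarrow> v = w \<and> (x, x') \<in> glue t d v" for x x' v w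
 proof -
  have "pi x v = pi x' w \<longleftrightarrow> v = w \<and> cl x v = cl x' w" by (simp add: pi_def inj_eq[OF J])
  then show ?thesis using cl_eq[of x v x'] by blast
 qed
 define M where "M = (\<Union>x\<in>tiles d. pi x ` tri)"
 define f where "f r = (case Hilbert_Choice.inv J r of (v, A) \<Rightarrow> kap (fst (SOME x. x \<in> A)) v)" for r
 \<comment> \<open>Any tile of the class may be used: tiles are glued only where a coordinate
   vanishes, and there both half planes give the same point.\<close>
 have f_pi: "f (pi x v) = kap (fst x) v" if v: "v \<in> tri" for x v
 proof -
  have "(SOME y. y \<in> cl x v) \<in> cl x v" by (rule someI[of _ x]) (simp add: cl_def)
  then have g: "(x, SOME y. y \<in> cl x v) \<in> glue t d v" by (simp add: cl_def)
  have "kap (fst x) v = kap (fst x) v \<longleftrightarrow> kap (fst (SOME y. y \<in> cl x v)) v = kap (fst x) v"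
  proof (rule glue_invariant[OF g, of "\<lambda>y. kap (fst y) v = kap (fst x) v"])
   fix p i assume "v $ i = 0"
   then have "kap True v = kap False v" using kap_eq_iff[OF v v] by blast
   then show "kap (fst (True, p)) v = kap (fst x) v \<longleftrightarrow> kap (fst (False, t i p)) v = kap (fst x) v" by simp
  qed
  then show ?thesis by (simp add: f_def pi_def J)
 qed
 define op where "op W \<longleftrightarrow> W \<subseteq> M \<and> (\<forall>x\<in>tiles d. openin (top_of_set tri) {v \<in> tri. pi x v \<in> W})" for W
 have "istopology op" unfolding istopology_def
 proof (intro conjI allI impI)
  fix W W' assume "op W" "op W'"
  moreover have "{v \<in> tri. pi x v \<in> W \<inter> W'} = {v \<in> tri. pi x v \<in> W} \<inter> {v \<in> tri. pi x v \<in> W'}" for x by blast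
  ultimately show "op (W \<inter> W')" by (auto simp: op_def)
 next
  fix \<W> assume *: "\<forall>W\<in>\<W>. op W"
  have "{v \<in> tri. pi x v \<in> \<Union>\<W>} = (\<Union>W\<in>\<W>. {v \<in> tri. pi x v \<in> W})" for x by blast
  then show "op (\<Union>\<W>)" using * by (auto simp: op_def)
 qed
 define X where "X = topology op"
 have openX: "openin X W \<longleftrightarrow> op W" for W unfolding X_def using \<open>istopology op\<close> by (simp add: topology_inverse')
 have "op M"
 proof -
  have "{v \<in> tri. pi x v \<in> M} = tri" if "x \<in> tiles d" for x using that by (auto simp: M_def)
  then show ?thesis by (simp add: op_def openin_subtopology_refl)
 qed
 then have topX: "topspace X = M" using openin_subset[of X] openin_topspace[of X] unfolding openX by (auto simp: op_def)
 have pi_M: "pi x v \<in> M" if "x \<in> tiles d" "v \<in> tri" for x v using that by (auto simp: M_def)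
 have cont_pi: "continuous_map (top_of_set tri) X (pi x)" if "x \<in> tiles d" for x
  unfolding continuous_map_def openX topX using that pi_M by (auto simp: op_def)
 have cont_f: "continuous_map X P1 f"
  unfolding continuous_map_def openX topX
 proof (intro conjI allI impI)
  fix U assume U: "openin P1 U"
  have "openin (top_of_set tri) {v \<in> tri. pi x v \<in> {y \<in> M. f y \<in> U}}" if x: "x \<in> tiles d" for x
  proof -
   have "{v \<in> tri. pi x v \<in> {y \<in> M. f y \<in> U}} = {v \<in> topspace (top_of_set tri). kap (fst x) v \<in> U}"
    using pi_M[OF x] f_pi[of _ x] by auto
   then show ?thesis using openin_continuous_map_preimage[OF continuous_map_kap U] by simp
  qed
  then show "op {y \<in> M. f y \<in> U}" by (auto simp: op_def)
 qed simp
 have "tiling X f d t pi"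
 proof
  show "t i permutes {..<d}" for i by (rule perm)
  show "\<exists>x\<in>tiles d. \<exists>v\<in>tri. y = pi x v" if "y \<in> topspace X" for y using that by (auto simp: topX M_def)
  show "pi x v = pi x' v \<longleftrightarrow> (x, x') \<in> glue t d v" for x x' v by (simp add: pi_eq)
  show "Hausdorff_space X" unfolding Hausdorff_space_def
  proof (intro allI impI)
   fix y y' assume yy: "y \<in> topspace X \<and> y' \<in> topspace X \<and> y \<noteq> y'"
   then obtain x v x' v' where x: "x \<in> tiles d" "v \<in> tri" "y = pi x v" "x' \<in> tiles d" "v' \<in> tri" "y' = pi x' v'"
    by (auto simp: topX M_def)
   show "\<exists>U V. openin X U \<and> openin X V \<and> y \<in> U \<and> y' \<in> V \<and> disjnt U V"
   proof (cases "f y = f y'")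
    case False
    then obtain U V where UV: "openin P1 U" "openin P1 V" "f y \<in> U" "f y' \<in> V" "disjnt U V"
     using Hausdorff_space_P1 unfolding Hausdorff_space_def by (metis UNIV_I topspace_P1)
    show ?thesis
    proof (intro exI conjI)
     show "openin X {y \<in> topspace X. f y \<in> U}" "openin X {y \<in> topspace X. f y \<in> V}"
      by (intro openin_continuous_map_preimage[OF cont_f] UV)+
    qed (use yy UV in \<open>auto simp: disjnt_def\<close>)
   next
    case True
    then have vv: "v' = v" using f_pi[OF x(2), of x] f_pi[OF x(5), of x'] x kap_eq_iff[OF x(2,5)] by simp
    \<comment> \<open>A neighbourhood of the class A at v. A coordinate may vanish at w only if it
      vanishes at v, so gluing at w refines gluing at v and different classes have disjoint
      neighbourhoods.\<close>
    define W where "W A = {pi z w | z w. z \<in> A \<and> z \<in> tiles d \<and> w \<in> tri \<and> (\<forall>i. w $ i = 0 \<longrightarrow> v $ i = 0)}" for A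
    have W_pi: "pi z w \<in> W (cl u v) \<longleftrightarrow> z \<in> cl u v \<and> (\<forall>i. w $ i = 0 \<longrightarrow> v $ i = 0)"
     if "z \<in> tiles d" "w \<in> tri" for z w u
    proof
     assume "pi z w \<in> W (cl u v)"
     then obtain z' w' where z': "pi z w = pi z' w'" "z' \<in> cl u v" "\<forall>i. w' $ i = 0 \<longrightarrow> v $ i = 0" by (auto simp: W_def)
     then have "w' = w" "(z, z') \<in> glue t d w" using pi_eq by auto
     then have "(z, z') \<in> glue t d v" using glue_mono[of w v t d] z'(3) by blast
     then show "z \<in> cl u v \<and> (\<forall>i. w $ i = 0 \<longrightarrow> v $ i = 0)"
      using z' \<open>w' = w\<close> by (auto simp: cl_def intro: glue_trans glue_sym)
    qed (use that in \<open>unfold W_def, blast\<close>)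
    have openW: "openin X (W (cl u v))" for u
     unfolding openX op_def
    proof (intro conjI ballI)
     show "W (cl u v) \<subseteq> M" unfolding W_def M_def by blast
     fix z assume z: "z \<in> tiles d"
     have "{w \<in> tri. pi z w \<in> W (cl u v)} = (if z \<in> cl u v then tri \<inter> (\<Inter>i\<in>{i. v $ i \<noteq> 0}. {w. w $ i \<noteq> 0}) else {})"
      using W_pi[OF z, of _ u] by auto
     moreover have "open (\<Inter>i\<in>{i. v $ i \<noteq> 0}. {w::real^3. w $ i \<noteq> 0})"
      by (intro open_INT ballI open_Collect_neq continuous_intros) simp
     ultimately show "openin (top_of_set tri) {w \<in> tri. pi z w \<in> W (cl u v)}" by (simp add: openin_open_Int)
    qed
    show ?thesis
    proof (intro exI conjI)
     show "openin X (W (cl x v))" "openin X (W (cl x' v))" by (rule openW)+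
     show "y \<in> W (cl x v)" "y' \<in> W (cl x' v)" using W_pi[OF x(1,2)] W_pi[OF x(4,2)] x vv by (simp_all add: cl_def)
     have nx: "(x, x') \<notin> glue t d v" using yy x vv pi_eq by auto
     show "disjnt (W (cl x v)) (W (cl x' v))" unfolding disjnt_iff
     proof (intro allI notI)
      fix u assume u: "u \<in> W (cl x v) \<and> u \<in> W (cl x' v)"
      then obtain z w where z: "z \<in> tiles d" "w \<in> tri" "u = pi z w" by (auto simp: W_def)
      then have "z \<in> cl x v" "z \<in> cl x' v" using W_pi[OF z(1,2)] u by blast+
      then show False using nx by (auto simp: cl_def intro: glue_trans glue_sym)
     qed
    qed
   qed
  qed
 qed (use cont_pi cont_f f_pi in auto)
 then show thesis by (rule that)
qed

section \<open>From Belyi maps to tilings\<close>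

lemma homeomorphic_chartE:
 assumes \<phi>: "homeomorphic_map (subtopology X U) (top_of_set (ball (0::complex) 1)) \<phi>" and U: "openin X U"
 obtains g where "continuous_map (top_of_set (ball 0 1)) X g" "\<And>q. q \<in> U \<Longrightarrow> g (\<phi> q) = q \<and> \<phi> q \<in> ball 0 1"
  "\<And>u. u \<in> ball 0 1 \<Longrightarrow> g u \<in> U \<and> \<phi> (g u) = u" "continuous_map (subtopology X U) (top_of_set (ball 0 1)) \<phi>"
proof -
 have top: "topspace (subtopology X U) = U" using openin_subset[OF U] by (simp add: inf_absorb2)
 obtain g where g: "homeomorphic_maps (subtopology X U) (top_of_set (ball (0::complex) 1)) \<phi> g"
  using \<phi> homeomorphic_map_maps by blast
 have cg: "continuous_map (top_of_set (ball 0 1)) (subtopology X U) g" using g by (simp add: homeomorphic_maps_def)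
 have c\<phi>: "continuous_map (subtopology X U) (top_of_set (ball 0 1)) \<phi>" using g by (simp add: homeomorphic_maps_def)
 show thesis
 proof (rule that[of g])
  show "continuous_map (top_of_set (ball 0 1)) X g" using cg by (rule continuous_map_into_fulltopology)
  show "g (\<phi> q) = q \<and> \<phi> q \<in> ball 0 1" if "q \<in> U" for q
   using g that continuous_map_funspace[OF c\<phi>] unfolding homeomorphic_maps_def top by auto
  show "g u \<in> U \<and> \<phi> (g u) = u" if "u \<in> ball 0 1" for u
   using g that continuous_map_funspace[OF cg] unfolding homeomorphic_maps_def top by auto
 qed (rule c\<phi>)
qed

lemma chart_small:
 assumes \<phi>: "homeomorphic_map (subtopology X U) (top_of_set (ball (0::complex) 1)) \<phi>" and U: "openin X U"
  and z: "z \<in> U" "\<phi> z = 0" and N: "openin X N" "z \<in> N"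
 obtains r where "0 < r" "r \<le> 1" "\<And>q. q \<in> U \<Longrightarrow> norm (\<phi> q) < r \<Longrightarrow> q \<in> N"
proof -
 obtain g where g: "continuous_map (top_of_set (ball 0 1)) X g" "\<And>q. q \<in> U \<Longrightarrow> g (\<phi> q) = q \<and> \<phi> q \<in> ball 0 1"
  by (rule homeomorphic_chartE[OF \<phi> U]) blast
 have "openin (top_of_set (ball 0 1)) {u \<in> topspace (top_of_set (ball (0::complex) 1)). g u \<in> N}"
  by (rule openin_continuous_map_preimage[OF g(1) N(1)])
 then have "open {u \<in> ball 0 1. g u \<in> N}" by (simp add: openin_open_eq)
 moreover have "0 \<in> {u \<in> ball 0 1. g u \<in> N}" using g(2)[OF z(1)] z(2) N(2) by simp
 ultimately obtain r where r: "0 < r" "ball 0 r \<subseteq> {u \<in> ball 0 1. g u \<in> N}" by (rule openE)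
 show thesis
 proof (rule that[of "min r 1"])
  show "q \<in> N" if "q \<in> U" "norm (\<phi> q) < min r 1" for q
  proof -
   have "\<phi> q \<in> ball 0 r" using that(2) by simp
   then have "g (\<phi> q) \<in> N" using r(2) by blast
   then show ?thesis using g(2)[OF that(1)] by simp
  qed
 qed (use r in auto)
qed

text \<open>A value close to but different from f z has k preimages near z in the one chart; in the
  other chart these are distinct l-th roots of one non-zero number.\<close>

lemma local_degree_le:
 assumes "has_local_degree X Y f z k" "has_local_degree X Y f z l" shows "k \<le> l"
proof -
 obtain U V \<phi> \<psi> where 1: "0 < k" "openin X U" "z \<in> U" "openin Y V" "f ` U \<subseteq> V"
  "homeomorphic_map (subtopology X U) (top_of_set (ball (0::complex) 1)) \<phi>" "\<phi> z = 0"
  "homeomorphic_map (subtopology Y V) (top_of_set (ball (0::complex) 1)) \<psi>" "\<psi> (f z) = 0"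
  "\<And>q. q \<in> U \<Longrightarrow> \<psi> (f q) = \<phi> q ^ k"
  using assms(1) unfolding has_local_degree_def by blast
 obtain U' V' \<phi>' \<psi>' where 2: "0 < l" "openin X U'" "z \<in> U'" "f ` U' \<subseteq> V'"
  "homeomorphic_map (subtopology X U') (top_of_set (ball (0::complex) 1)) \<phi>'" "\<phi>' z = 0"
  "\<And>q. q \<in> U' \<Longrightarrow> \<psi>' (f q) = \<phi>' q ^ l" "openin Y V'"
  using assms(2) unfolding has_local_degree_def by blast
 obtain g where g: "\<And>q. q \<in> U \<Longrightarrow> g (\<phi> q) = q \<and> \<phi> q \<in> ball 0 1" "\<And>u. u \<in> ball 0 1 \<Longrightarrow> g u \<in> U \<and> \<phi> (g u) = u"
  by (rule homeomorphic_chartE[OF 1(6,2)]) blast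
 obtain g' where g': "\<And>q. q \<in> U' \<Longrightarrow> g' (\<phi>' q) = q \<and> \<phi>' q \<in> ball 0 1"
  by (rule homeomorphic_chartE[OF 2(5,2)]) blast
 obtain h where h: "\<And>y. y \<in> V \<Longrightarrow> h (\<psi> y) = y \<and> \<psi> y \<in> ball 0 1"
  by (rule homeomorphic_chartE[OF 1(8,4)]) blast
 obtain r where r: "0 < r" "r \<le> 1" "\<And>q. q \<in> U \<Longrightarrow> norm (\<phi> q) < r \<Longrightarrow> q \<in> U'"
  by (rule chart_small[OF 1(6,2,3,7) 2(2,3)]) blast
 define c :: complex where "c = of_real (r / 2)"
 have nc: "norm c < r" "norm c < 1" "c \<noteq> 0" using r by (simp_all add: c_def)
 define R where "R = {u. u ^ k = c ^ k}"
 have R: "card R = k" "finite R" using card_nth_roots[of "c ^ k" k] finite_nth_roots[of k "c ^ k"] nc 1(1) by (simp_all add: R_def)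
 have Rn: "norm u = norm c" if "u \<in> R" for u
 proof -
  have "norm u ^ k = norm c ^ k" using that by (simp add: R_def flip: norm_power)
  then show ?thesis using 1(1) by (simp add: power_eq_iff_eq_base)
 qed
 have gR: "g u \<in> U \<and> \<phi> (g u) = u \<and> g u \<in> U' \<and> f (g u) = f (g c)" if u: "u \<in> R" for u
 proof -
  have a: "g u \<in> U" "\<phi> (g u) = u" using g(2)[of u] Rn[OF u] nc by simp_all
  have b: "g c \<in> U" "\<phi> (g c) = c" using g(2)[of c] nc by simp_all
  have "g u \<in> U'" using r(3)[OF a(1)] a(2) Rn[OF u] nc by simp
  moreover have "\<psi> (f (g u)) = \<psi> (f (g c))" using 1(10)[OF a(1)] 1(10)[OF b(1)] a(2) b(2) u by (simp add: R_def)
  then have "f (g u) = f (g c)" using h[of "f (g u)"] h[of "f (g c)"] 1(5) a b by (metis image_subset_iff)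
  ultimately show ?thesis using a by simp
 qed
 have cR: "c \<in> R" by (simp add: R_def)
 define c' where "c' = \<phi>' (g c) ^ l"
 have "c' \<noteq> 0"
 proof
  assume "c' = 0"
  then have "\<phi>' (g c) = \<phi>' z" using 2(1,6) by (simp add: c'_def)
  then have "g c = z" using g'[of "g c"] g'[OF 2(3)] gR[OF cR] by metis
  then show False using gR[OF cR] 1(7) nc by simp
 qed
 then have R': "card {u. u ^ l = c'} = l" "finite {u. u ^ l = c'}" using card_nth_roots[of c' l] finite_nth_roots[of l c'] 2(1) by simp_all
 have "inj_on (\<lambda>u. \<phi>' (g u)) R"
 proof (rule inj_onI)
  fix u v assume uv: "u \<in> R" "v \<in> R" "\<phi>' (g u) = \<phi>' (g v)"
  have "g u = g v" using g'[of "g u"] g'[of "g v"] gR[OF uv(1)] gR[OF uv(2)] uv(3) by metis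
  then show "u = v" using gR[OF uv(1)] gR[OF uv(2)] by metis
 qed
 moreover have "(\<lambda>u. \<phi>' (g u)) ` R \<subseteq> {u. u ^ l = c'}"
 proof
  fix w assume "w \<in> (\<lambda>u. \<phi>' (g u)) ` R"
  then obtain u where u: "w = \<phi>' (g u)" "u \<in> R" by (rule imageE)
  have "w ^ l = \<psi>' (f (g u))" using 2(7)[of "g u"] gR[OF u(2)] u(1) by simp
  also have "\<dots> = \<psi>' (f (g c))" using gR[OF u(2)] by simp
  also have "\<dots> = c'" using 2(7)[of "g c"] gR[OF cR] by (simp add: c'_def)
  finally show "w \<in> {u. u ^ l = c'}" by simp
 qed
 ultimately have "card R \<le> card {u. u ^ l = c'}" using R'(2) by (rule card_inj_on_le)
 then show ?thesis using R R' by simp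
qed

lemma local_degree_unique: "has_local_degree X Y f z k \<Longrightarrow> has_local_degree X Y f z l \<Longrightarrow> k = l"
 using local_degree_le by (metis le_antisym)

lemma continuous_map_locallyI:
 assumes "\<And>a. a \<in> A \<Longrightarrow> \<exists>\<delta>>0. \<exists>g. continuous_map (top_of_set (A \<inter> ball a \<delta>)) X g \<and> (\<forall>v\<in>A \<inter> ball a \<delta>. h v = g v)"
 shows "continuous_map (top_of_set A) X h"
proof -
 have "\<forall>a\<in>A. \<exists>\<delta>>0. continuous_map (top_of_set (A \<inter> ball a \<delta>)) X h"
 proof
  fix a assume "a \<in> A"
  then obtain \<delta> g where "\<delta> > 0" and g: "continuous_map (top_of_set (A \<inter> ball a \<delta>)) X g" "\<forall>v\<in>A \<inter> ball a \<delta>. h v = g v"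
   using assms by blast
  have "continuous_map (top_of_set (A \<inter> ball a \<delta>)) X h" by (rule continuous_map_eq[OF g(1)]) (use g(2) in simp)
  then show "\<exists>\<delta>>0. continuous_map (top_of_set (A \<inter> ball a \<delta>)) X h" using \<open>\<delta> > 0\<close> by blast
 qed
 then obtain \<delta> where \<delta>: "\<And>a. a \<in> A \<Longrightarrow> 0 < \<delta> a \<and> continuous_map (top_of_set (A \<inter> ball a (\<delta> a))) X h" by metis
 show ?thesis
 proof (rule pasting_lemma[of A _ "\<lambda>a. A \<inter> ball a (\<delta> a)" _ "\<lambda>_. h"])
  show "continuous_map (subtopology (top_of_set A) (A \<inter> ball a (\<delta> a))) X h" if "a \<in> A" for a
   using \<delta>[OF that] by (simp add: subtopology_subtopology inf_absorb2)
  show "\<exists>j. j \<in> A \<and> x \<in> A \<inter> ball j (\<delta> j) \<and> h x = h x" if "x \<in> topspace (top_of_set A)" for x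
   using \<delta>[of x] that by auto
 qed (auto simp: openin_open_Int)
qed

section \<open>Lifting the triangle through a branched cover of the sphere\<close>

definition ctr :: "real^3" where "ctr = (\<chi> i. 1 / 3)"

definition corners :: "(real^3) set" where "corners = range (\<lambda>i. axis i 1)"

text \<open>Only the corners are removed: the cover is unramified over the open sides as well, so
  lifts cross into the sides without difficulty.\<close>

definition ptri :: "(real^3) set" where "ptri = tri - corners"

lemma tri_le_1: assumes "v \<in> tri" shows "v $ i \<le> 1"
proof -
 have "0 \<le> v $ 1" "0 \<le> v $ 2" "0 \<le> v $ 3" "v $ 1 + v $ 2 + v $ 3 = 1" using assms by (auto simp: tri_def sum_3)
 then show ?thesis using exhaust_3[of i] by auto
qed

lemma corners_iff: "v \<in> tri \<Longrightarrow> v \<in> corners \<longleftrightarrow> (\<exists>i. 1 \<le> v $ i)"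
proof
 assume v: "v \<in> tri" "\<exists>i. 1 \<le> v $ i"
 then obtain i where "1 \<le> v $ i" by blast
 moreover have "v $ i \<le> 1" using tri_le_1[OF v(1)] .
 ultimately have "v = axis i 1" using tri_eq_axis[OF v(1)] by simp
 then show "v \<in> corners" by (simp add: corners_def)
next
 assume "v \<in> corners"
 then obtain i where "v = axis i 1" by (auto simp: corners_def)
 then show "\<exists>i. 1 \<le> v $ i" by (intro exI[of _ i]) simp
qed

lemma ptri_iff: "v \<in> ptri \<longleftrightarrow> v \<in> tri \<and> (\<forall>i. v $ i < 1)"
proof (cases "v \<in> tri")
 case True
 then show ?thesis using corners_iff[OF True] by (simp add: ptri_def not_le)
qed (simp add: ptri_def)

lemma ctr_ptri: "ctr \<in> ptri"
 by (simp add: ptri_iff tri_def ctr_def)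

lemma ptri_tri: "v \<in> ptri \<Longrightarrow> v \<in> tri"
 by (simp add: ptri_def)

lemma ptri_not_corner: "v \<in> ptri \<Longrightarrow> v \<notin> corners"
 by (simp add: ptri_def)

lemma convex_ptri: "convex ptri"
 unfolding convex_alt
proof (intro ballI allI impI)
 fix v w :: "real^3" and u :: real assume v: "v \<in> ptri" "w \<in> ptri" and u: "0 \<le> u \<and> u \<le> 1"
 have "(1 - u) *\<^sub>R v + u *\<^sub>R w \<in> tri" using v u by (intro convexD[OF convex_tri]) (auto simp: ptri_def)
 moreover have "(1 - u) * v $ i + u * w $ i < 1" for i
  using v u by (intro convex_bound_lt) (auto simp: ptri_iff)
 ultimately show "(1 - u) *\<^sub>R v + u *\<^sub>R w \<in> ptri" by (simp add: ptri_iff)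
qed

lemma ptri_dense:
 assumes "v \<in> tri" "0 < e" obtains w where "w \<in> ptri" "dist v w < e"
proof -
 define n where "n = 1 + norm (ctr - v)"
 define u where "u = min 1 (e / (2 * n))"
 have n: "0 < n" by (simp add: n_def add_pos_nonneg)
 have u: "0 < u" "u \<le> 1" using assms(2) n by (auto simp: u_def)
 define w where "w = (1 - u) *\<^sub>R v + u *\<^sub>R ctr"
 have "w \<in> tri" unfolding w_def using u assms(1) ptri_tri[OF ctr_ptri] by (intro convexD[OF convex_tri]) auto
 moreover have "w $ i < 1" for i
 proof -
  have "v $ i \<le> 1" using tri_le_1[OF assms(1)] .
  then have "(1 - u) * v $ i \<le> (1 - u) * 1" using u by (intro mult_left_mono) auto
  then show ?thesis using u by (simp add: w_def ctr_def)
 qed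
 moreover have "dist v w < e"
 proof -
  have "v - w = u *\<^sub>R (v - ctr)" by (simp add: w_def algebra_simps)
  then have "dist v w = u * norm (ctr - v)" using u by (simp add: dist_norm norm_minus_commute)
  also have "\<dots> \<le> e / (2 * n) * n"
   using u n assms(2) by (intro mult_mono) (auto simp: u_def n_def)
  also have "\<dots> = e / 2" using n by simp
  finally show ?thesis using assms(2) by simp
 qed
 ultimately have "w \<in> ptri" "dist v w < e" by (simp_all add: ptri_iff)
 then show thesis by (rule that)
qed

text \<open>The local models of a Belyi map together with compactness, which is what the lifting
  arguments work with; a tiling satisfies these conditions too.\<close>

locale P1_cover =
 fixes X :: "'a topology" and f :: "'a \<Rightarrow> complex option"
 assumes compactX: "compact_space X" and Haus: "Hausdorff_space X" and contf: "continuous_map X P1 f"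
  and deg: "y \<in> topspace X \<Longrightarrow> \<exists>k. has_local_degree X P1 f y k"
  and unram: "y \<in> topspace X \<Longrightarrow> f y \<notin> {Some 0, Some 1, None} \<Longrightarrow> has_local_degree X P1 f y 1"
begin

lemma cont_baryf: "continuous_map X (top_of_set tri) (\<lambda>y. bary (f y))"
 using continuous_map_compose[OF contf continuous_map_bary]
 by (simp add: continuous_map_in_subtopology o_def)

text \<open>In the local model every small value has a k-th root, and this root is small.\<close>

lemma f_open:
 assumes y: "y \<in> topspace X" and N: "openin X N" "y \<in> N"
 obtains W where "openin P1 W" "f y \<in> W" "W \<subseteq> f ` N"
proof -
 obtain k where k: "has_local_degree X P1 f y k" using deg[OF y] by blast
 obtain U V \<phi> \<psi> where 1: "0 < k" "openin X U" "y \<in> U" "openin P1 V" "f ` U \<subseteq> V"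
  "homeomorphic_map (subtopology X U) (top_of_set (ball (0::complex) 1)) \<phi>" "\<phi> y = 0"
  "homeomorphic_map (subtopology P1 V) (top_of_set (ball (0::complex) 1)) \<psi>" "\<psi> (f y) = 0"
  "\<And>q. q \<in> U \<Longrightarrow> \<psi> (f q) = \<phi> q ^ k"
  using k unfolding has_local_degree_def by blast
 obtain g where g: "\<And>q. q \<in> U \<Longrightarrow> g (\<phi> q) = q \<and> \<phi> q \<in> ball 0 1" "\<And>u. u \<in> ball 0 1 \<Longrightarrow> g u \<in> U \<and> \<phi> (g u) = u"
  by (rule homeomorphic_chartE[OF 1(6,2)]) blast
 obtain h where h: "\<And>y. y \<in> V \<Longrightarrow> h (\<psi> y) = y \<and> \<psi> y \<in> ball 0 1" "continuous_map (subtopology P1 V) (top_of_set (ball 0 1)) \<psi>"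
  by (rule homeomorphic_chartE[OF 1(8,4)]) blast
 obtain r where r: "0 < r" "r \<le> 1" "\<And>q. q \<in> U \<Longrightarrow> norm (\<phi> q) < r \<Longrightarrow> q \<in> N"
  by (rule chart_small[OF 1(6,2,3,7) N]) blast
 define W where "W = {w \<in> topspace (subtopology P1 V). \<psi> w \<in> ball 0 (r ^ k)}"
 have rk: "0 < r ^ k" "r ^ k \<le> 1" using r by (simp_all add: power_le_one)
 have "continuous_map (subtopology P1 V) euclidean \<psi>" using h(2) by (simp add: continuous_map_in_subtopology)
 then have "openin (subtopology P1 V) W" unfolding W_def by (rule openin_continuous_map_preimage) simp
 then have "openin P1 W" using 1(4) by (rule openin_trans_full)
 moreover have "f y \<in> W" using 1(3,5,9) rk by (auto simp: W_def)
 moreover have "W \<subseteq> f ` N"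
 proof
  fix w assume w: "w \<in> W"
  then have wV: "w \<in> V" "norm (\<psi> w) < r ^ k" by (simp_all add: W_def)
  define \<rho> where "\<rho> = root k (norm (\<psi> w))"
  define u where "u = of_real \<rho> * cis (Arg (\<psi> w) / k)"
  have "u ^ k = of_real (\<rho> ^ k) * cis (Arg (\<psi> w))"
   using 1(1) by (simp add: u_def power_mult_distrib Complex.DeMoivre)
  also have "\<rho> ^ k = norm (\<psi> w)" unfolding \<rho>_def using 1(1) by (simp add: real_root_pow_pos2)
  also have "of_real (norm (\<psi> w)) * cis (Arg (\<psi> w)) = \<psi> w" using rcis_cmod_Arg[of "\<psi> w"] by (simp add: rcis_def)
  finally have uk: "u ^ k = \<psi> w" .
  then have "norm u ^ k < r ^ k" using wV(2) by (simp flip: norm_power)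
  then have nu: "norm u < r" by (rule power_less_imp_less_base[OF _ less_imp_le[OF r(1)]])
  then have gu: "g u \<in> U" "\<phi> (g u) = u" using g(2)[of u] r(2) by simp_all
  then have "g u \<in> N" using r(3) nu by simp
  moreover have "\<psi> (f (g u)) = \<psi> w" using 1(10)[OF gu(1)] gu(2) uk by simp
  moreover have "f (g u) \<in> V" using 1(5) gu(1) by blast
  ultimately have "f (g u) = w" "g u \<in> N" using h(1)[OF wV(1)] h(1)[of "f (g u)"] by auto
  then show "w \<in> f ` N" by (intro image_eqI[of _ _ "g u"]) simp_all
 qed
 ultimately show thesis by (rule that)
qed

text \<open>In the local model 0 is the only preimage of 0, so each point is isolated in its fibre,
  and the fibre is compact.\<close>

lemma finite_fibre: "finite {q \<in> topspace X. f q = w}"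
proof -
 let ?A = "{q \<in> topspace X. f q = w}"
 have isolated: "\<exists>U. openin X U \<and> y \<in> U \<and> (\<forall>q\<in>U. f q = f y \<longrightarrow> q = y)" if y: "y \<in> topspace X" for y
 proof -
  obtain k where k: "has_local_degree X P1 f y k" using deg[OF y] by blast
  obtain U V \<phi> \<psi> where 1: "0 < k" "openin X U" "y \<in> U"
   "homeomorphic_map (subtopology X U) (top_of_set (ball (0::complex) 1)) \<phi>" "\<phi> y = 0" "\<psi> (f y) = 0"
   "\<And>q. q \<in> U \<Longrightarrow> \<psi> (f q) = \<phi> q ^ k"
   using k unfolding has_local_degree_def by blast
  obtain g where g: "\<And>q. q \<in> U \<Longrightarrow> g (\<phi> q) = q \<and> \<phi> q \<in> ball 0 1"
   by (rule homeomorphic_chartE[OF 1(4,2)]) blast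
  have "q = y" if "q \<in> U" "f q = f y" for q
  proof -
   have "\<phi> q ^ k = 0" using 1(7)[OF that(1)] that(2) 1(6) by simp
   then have "\<phi> q = \<phi> y" using 1(5) by simp
   then show ?thesis using g[OF that(1)] g[OF 1(3)] by metis
  qed
  then show ?thesis using 1(2,3) by (intro exI[of _ U]) simp
 qed
 have "closedin P1 {w}" using Hausdorff_space_P1 by (simp add: closedin_Hausdorff_singleton)
 from closedin_continuous_map_preimage[OF contf this] have "closedin X ?A" by simp
 then have "compactin X ?A" using compactX closedin_compact_space by blast
 moreover define \<U> where "\<U> = {U. openin X U \<and> (\<exists>y. \<forall>q\<in>U. f q = w \<longrightarrow> q = y)}"
 have "?A \<subseteq> \<Union>\<U>"
 proof
  fix y assume y: "y \<in> ?A"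
  then have y': "y \<in> topspace X" "f y = w" by simp_all
  obtain U where U: "openin X U" "y \<in> U" "\<forall>q\<in>U. f q = f y \<longrightarrow> q = y" using isolated[OF y'(1)] by blast
  have "U \<in> \<U>" unfolding \<U>_def using U(1) U(3)[unfolded y'(2)] by blast
  then show "y \<in> \<Union>\<U>" using U(2) by blast
 qed
 moreover have "\<forall>U\<in>\<U>. openin X U" by (simp add: \<U>_def)
 ultimately have "\<exists>\<F>. finite \<F> \<and> \<F> \<subseteq> \<U> \<and> ?A \<subseteq> \<Union>\<F>" unfolding compactin_def by meson
 then obtain \<F> where \<F>: "finite \<F>" "\<F> \<subseteq> \<U>" "?A \<subseteq> \<Union>\<F>" by blast
 have "finite (U \<inter> ?A)" if U: "U \<in> \<F>" for U
 proof -
  have "U \<in> \<U>" using U \<F>(2) by blast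
  then have "\<exists>y. \<forall>q\<in>U. f q = w \<longrightarrow> q = y" unfolding \<U>_def by blast
  then obtain y where "\<forall>q\<in>U. f q = w \<longrightarrow> q = y" by (rule exE)
  then have "U \<inter> ?A \<subseteq> {y}" by blast
  then show ?thesis by (rule finite_subset) simp
 qed
 then have "finite (\<Union>U\<in>\<F>. U \<inter> ?A)" by (intro finite_UN_I \<F>(1)) blast
 moreover have "?A \<subseteq> (\<Union>U\<in>\<F>. U \<inter> ?A)" using \<F>(3) by blast
 ultimately show ?thesis by (rule finite_subset[rotated])
qed

text \<open>At local degree 1 the chart of the target followed by the inverse chart of the source is
  a local inverse of f.\<close>

lemma local_section:
 assumes y: "y \<in> topspace X" "bary (f y) \<notin> corners"
 obtains U V g where "openin X U" "y \<in> U" "openin P1 V" "f y \<in> V" "continuous_map (subtopology P1 V) X g"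
  "\<And>w. w \<in> V \<Longrightarrow> g w \<in> U \<and> f (g w) = w" "\<And>q. q \<in> U \<Longrightarrow> f q \<in> V \<and> g (f q) = q"
proof -
 have "f y \<notin> {Some 0, Some 1, None}" unfolding branch_point_iff using y(2) by (auto simp: corners_def)
 then obtain U V \<phi> \<psi> where 1: "openin X U" "y \<in> U" "openin P1 V" "f ` U \<subseteq> V"
  "homeomorphic_map (subtopology X U) (top_of_set (ball (0::complex) 1)) \<phi>"
  "homeomorphic_map (subtopology P1 V) (top_of_set (ball (0::complex) 1)) \<psi>"
  "\<And>q. q \<in> U \<Longrightarrow> \<psi> (f q) = \<phi> q ^ 1"
  using unram[OF y(1)] unfolding has_local_degree_def by blast
 obtain g where g: "continuous_map (top_of_set (ball 0 1)) X g" "\<And>q. q \<in> U \<Longrightarrow> g (\<phi> q) = q \<and> \<phi> q \<in> ball 0 1"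
  "\<And>u. u \<in> ball 0 1 \<Longrightarrow> g u \<in> U \<and> \<phi> (g u) = u"
  by (rule homeomorphic_chartE[OF 1(5,1)]) blast
 obtain h where h: "\<And>y. y \<in> V \<Longrightarrow> h (\<psi> y) = y \<and> \<psi> y \<in> ball 0 1" "continuous_map (subtopology P1 V) (top_of_set (ball 0 1)) \<psi>"
  by (rule homeomorphic_chartE[OF 1(6,3)]) blast
 show thesis
 proof (rule that[of U V "g \<circ> \<psi>"])
  show "continuous_map (subtopology P1 V) X (g \<circ> \<psi>)" by (rule continuous_map_compose[OF h(2) g(1)])
  show "f q \<in> V \<and> (g \<circ> \<psi>) (f q) = q" if "q \<in> U" for q using 1(4) 1(7)[OF that] g(2)[OF that] that by (simp add: image_subset_iff)
  show "(g \<circ> \<psi>) w \<in> U \<and> f ((g \<circ> \<psi>) w) = w" if w: "w \<in> V" for w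
  proof -
   have a: "g (\<psi> w) \<in> U" "\<phi> (g (\<psi> w)) = \<psi> w" using g(3)[of "\<psi> w"] h(1)[OF w] by simp_all
   have V: "f (g (\<psi> w)) \<in> V" using a(1) 1(4) by blast
   have "\<psi> (f (g (\<psi> w))) = \<psi> w" using 1(7)[OF a(1)] a(2) by simp
   then have "f (g (\<psi> w)) = w" using h(1)[OF w] h(1)[OF V] by simp
   then show ?thesis using a by simp
  qed
  show "f y \<in> V" using 1(2,4) by blast
 qed (fact 1)+
qed

text \<open>The set on which two lifts agree is closed because X is Hausdorff and open by
  \<open>local_section\<close>, while A is connected.\<close>

lemma section_unique:
 fixes A :: "(real^3) set"
 assumes A: "connected A" and h: "continuous_map (top_of_set A) X h" "continuous_map (top_of_set A) X h'"
  and eq: "\<And>v. v \<in> A \<Longrightarrow> f (h v) = f (h' v)" "\<And>v. v \<in> A \<Longrightarrow> bary (f (h v)) \<notin> corners"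
  and a: "a \<in> A" "h a = h' a" and v: "v \<in> A"
 shows "h v = h' v"
proof -
 define E where "E = {v \<in> A. h v = h' v}"
 have hX: "h v \<in> topspace X" if "v \<in> A" for v using continuous_map_funspace[OF h(1)] that by auto
 have "openin (top_of_set A) E"
 proof (subst openin_subopen, intro ballI)
  fix v assume v: "v \<in> E"
  then have vA: "v \<in> A" by (simp add: E_def)
  obtain U V g where U: "openin X U" "h v \<in> U" "\<And>q. q \<in> U \<Longrightarrow> f q \<in> V \<and> g (f q) = q"
   by (rule local_section[OF hX[OF vA] eq(2)[OF vA]]) blast
  define T where "T = {u \<in> topspace (top_of_set A). h u \<in> U} \<inter> {u \<in> topspace (top_of_set A). h' u \<in> U}"
  have "openin (top_of_set A) T" unfolding T_def
   by (intro openin_Int openin_continuous_map_preimage[OF h(1) U(1)] openin_continuous_map_preimage[OF h(2) U(1)])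
  moreover have "v \<in> T" using v U(2) by (simp add: T_def E_def)
  moreover have "T \<subseteq> E"
  proof
   fix u assume u: "u \<in> T"
   then have "u \<in> A" "h u \<in> U" "h' u \<in> U" by (auto simp: T_def)
   note a = this
   have "h u = g (f (h u))" by (rule U(3)[OF a(2), THEN conjunct2, symmetric])
   also have "\<dots> = g (f (h' u))" by (rule arg_cong[where f = g], rule eq(1)[OF a(1)])
   also have "\<dots> = h' u" by (rule U(3)[OF a(3), THEN conjunct2])
   finally have "h u = h' u" .
   then show "u \<in> E" using \<open>u \<in> A\<close> by (simp add: E_def)
  qed
  ultimately show "\<exists>T. openin (top_of_set A) T \<and> v \<in> T \<and> T \<subseteq> E" by blast
 qed
 moreover have "closedin (top_of_set A) E"
 proof -
  have "closedin (top_of_set A) {v \<in> topspace (top_of_set A). h v = h' v}"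
   by (rule closedin_continuous_maps_eq[OF Haus h])
  then show ?thesis by (simp add: E_def)
 qed
 ultimately have "E = {} \<or> E = A" using A connected_clopen by blast
 moreover have "a \<in> E" using a by (simp add: E_def)
 ultimately have "v \<in> E" using v by blast
 then show ?thesis by (simp add: E_def)
qed

text \<open>A Lebesgue number argument: the part of X over the compact set is covered by finitely
  many domains of local sections, and the smallest of their radii serves everywhere.\<close>

lemma uniform_sections:
 assumes C: "compact C" "C \<subseteq> ptri"
 obtains e where "0 < e" "\<And>y v. y \<in> topspace X \<Longrightarrow> v \<in> C \<Longrightarrow> f y = kap s v \<Longrightarrow>
  \<exists>g. continuous_map (top_of_set (ball v e \<inter> C)) X g \<and> g v = y \<and> (\<forall>w\<in>ball v e \<inter> C. f (g w) = kap s w)"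
proof -
 define K where "K = {y \<in> topspace X. f y \<in> kap s ` C}"
 have Ctri: "C \<subseteq> tri" using C(2) ptri_tri by blast
 have "compactin P1 (kap s ` C)"
  by (rule image_compactin[OF _ continuous_map_kap]) (use C(1) Ctri in \<open>simp add: compactin_subtopology\<close>)
 then have "closedin P1 (kap s ` C)" using Hausdorff_space_P1 compactin_imp_closedin by blast
 from closedin_continuous_map_preimage[OF contf this] have "closedin X K" by (simp add: K_def)
 then have cK: "compactin X K" using compactX closedin_compact_space by blast
 \<comment> \<open>The section lives on a ball of twice the radius e, so that a ball of radius e
   about any point near the centre still fits in.\<close>
 define Q where "Q y e N g \<longleftrightarrow> 0 < e \<and> openin X N \<and> y \<in> N \<and> continuous_map (top_of_set (ball (bary (f y)) (2 * e) \<inter> tri)) X g \<and>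
   (\<forall>w\<in>ball (bary (f y)) (2 * e) \<inter> tri. f (g w) = kap s w) \<and>
   (\<forall>q\<in>N. bary (f q) \<in> ball (bary (f y)) e \<and> (kap s (bary (f q)) = f q \<longrightarrow> g (bary (f q)) = q))" for y e N and g :: "real^3 \<Rightarrow> 'a"
 have loc: "\<exists>T. Q y (fst T) (fst (snd T)) (snd (snd T))" if y: "y \<in> K" for y
 proof -
  obtain v where v: "v \<in> C" "f y = kap s v" "y \<in> topspace X" using y by (auto simp: K_def)
  have vt: "v \<in> tri" "v \<notin> corners" using v(1) C(2) ptri_not_corner ptri_tri by auto
  have bv: "bary (f y) = v" using v(2) vt(1) by simp
  obtain U V g where U: "openin X U" "y \<in> U" "openin P1 V" "f y \<in> V" "continuous_map (subtopology P1 V) X g"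
   "\<And>w. w \<in> V \<Longrightarrow> g w \<in> U \<and> f (g w) = w" "\<And>q. q \<in> U \<Longrightarrow> f q \<in> V \<and> g (f q) = q"
   by (rule local_section[OF v(3), unfolded bv, OF vt(2)]) blast
  have "openin (top_of_set tri) {w \<in> topspace (top_of_set tri). kap s w \<in> V}"
   by (rule openin_continuous_map_preimage[OF continuous_map_kap U(3)])
  then obtain T where T: "open T" "{w \<in> tri. kap s w \<in> V} = tri \<inter> T" by (auto simp: openin_open)
  have "v \<in> T" using T(2) vt(1) U(4) v(2) by auto
  then obtain e where e: "0 < e" "ball v e \<subseteq> T" using T(1) open_contains_ball by blast
  have inV: "kap s w \<in> V" if "w \<in> ball v e \<inter> tri" for w using that e(2) T(2) by blast
  define N where "N = {q \<in> topspace X. bary (f q) \<in> ball v (e / 2)} \<inter> U"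
  have "continuous_map X euclidean (\<lambda>y. bary (f y))" using cont_baryf by (simp add: continuous_map_in_subtopology)
  then have "openin X {q \<in> topspace X. bary (f q) \<in> ball v (e / 2)}" by (rule openin_continuous_map_preimage) simp
  then have "openin X N" using U(1) by (simp add: N_def openin_Int)
  moreover have "y \<in> N" using v(3) bv e(1) U(2) by (simp add: N_def)
  moreover have "continuous_map (top_of_set (ball v e \<inter> tri)) X (g \<circ> kap s)"
  proof (rule continuous_map_compose[OF _ U(5)])
   have "continuous_map (top_of_set (ball v e \<inter> tri)) P1 (kap s)"
    using continuous_map_from_subtopology_mono[OF continuous_map_kap, of "ball v e \<inter> tri" s] by simp
   then show "continuous_map (top_of_set (ball v e \<inter> tri)) (subtopology P1 V) (kap s)"
    using inV by (auto simp: continuous_map_in_subtopology)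
  qed
  moreover have "f ((g \<circ> kap s) w) = kap s w" if "w \<in> ball v e \<inter> tri" for w using U(6)[OF inV[OF that]] by simp
  moreover have "(g \<circ> kap s) (bary (f q)) = q" if "q \<in> N" "kap s (bary (f q)) = f q" for q
   using U(7)[of q] that by (simp add: N_def)
  moreover have "bary (f q) \<in> ball v (e / 2)" if "q \<in> N" for q using that by (simp add: N_def)
  moreover have "0 < e / 2" and e2: "2 * (e / 2) = e" using e(1) by simp_all
  ultimately have "Q y (e / 2) N (g \<circ> kap s)" unfolding Q_def bv e2 by blast
  then show ?thesis by (intro exI[of _ "(e / 2, N, g \<circ> kap s)"]) simp
 qed
 then have "\<forall>y\<in>K. \<exists>T. Q y (fst T) (fst (snd T)) (snd (snd T))" by blast
 from bchoice[OF this] obtain T where T: "\<forall>y\<in>K. Q y (fst (T y)) (fst (snd (T y))) (snd (snd (T y)))" by blast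
 define ee where "ee y = fst (T y)" for y
 define NN where "NN y = fst (snd (T y))" for y
 define gg where "gg y = snd (snd (T y))" for y
 have lo: "0 < ee y \<and> openin X (NN y) \<and> y \<in> NN y \<and>
   continuous_map (top_of_set (ball (bary (f y)) (2 * ee y) \<inter> tri)) X (gg y) \<and>
   (\<forall>w\<in>ball (bary (f y)) (2 * ee y) \<inter> tri. f (gg y w) = kap s w) \<and>
   (\<forall>q\<in>NN y. bary (f q) \<in> ball (bary (f y)) (ee y) \<and> (kap s (bary (f q)) = f q \<longrightarrow> gg y (bary (f q)) = q))" if "y \<in> K" for y
  using T[rule_format, OF that] unfolding Q_def ee_def NN_def gg_def .
 have "openin X U" if U: "U \<in> NN ` K" for U
 proof -
  obtain y where "U = NN y" "y \<in> K" using U by (rule imageE)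
  then show ?thesis using lo[of y] by simp
 qed
 moreover have "K \<subseteq> \<Union>(NN ` K)"
 proof
  fix y assume y: "y \<in> K"
  then have "y \<in> NN y" using lo[OF y] by simp
  then show "y \<in> \<Union>(NN ` K)" using y by blast
 qed
 ultimately have "\<exists>\<F>. finite \<F> \<and> \<F> \<subseteq> NN ` K \<and> K \<subseteq> \<Union>\<F>" by (intro compactinD[OF cK])
 then obtain \<F> where \<F>: "finite \<F>" "\<F> \<subseteq> NN ` K" "K \<subseteq> \<Union>\<F>" by (elim exE conjE)
 obtain K0 where K0: "K0 \<subseteq> K" "finite K0" "\<F> = NN ` K0" using finite_subset_image[OF \<F>(1,2)] by (elim exE conjE)
 define e where "e = Min (insert 1 (ee ` K0))"
 have e: "0 < e" unfolding e_def using K0(1,2) lo by (subst Min_gr_iff) (simp_all add: subset_iff)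
 have ele: "e \<le> ee y" if "y \<in> K0" for y unfolding e_def using K0(2) that by (intro Min_le) auto
 show thesis
 proof (rule that[OF e])
  fix y v assume y: "y \<in> topspace X" "v \<in> C" "f y = kap s v"
  have vt: "v \<in> tri" using y(2) Ctri by blast
  have bv: "bary (f y) = v" unfolding y(3) by (rule bary_kap[OF vt])
  have "f y \<in> kap s ` C" unfolding y(3) using y(2) by (rule imageI)
  then have "y \<in> K" unfolding K_def using y(1) by (intro CollectI conjI)
  then have "y \<in> (\<Union>y0\<in>K0. NN y0)" using \<F>(3) unfolding K0(3) by (rule subsetD[rotated])
  then obtain y0 where y0: "y0 \<in> K0" "y \<in> NN y0" by (rule UN_E)
  then have y0K: "y0 \<in> K" using K0(1) by blast
  have d: "dist (bary (f y0)) v < ee y0" using lo[OF y0K] y0(2) unfolding bv[symmetric] by simp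
  have sub: "ball v e \<inter> C \<subseteq> ball (bary (f y0)) (2 * ee y0) \<inter> tri"
  proof
   fix w assume w: "w \<in> ball v e \<inter> C"
   have "dist (bary (f y0)) w \<le> dist (bary (f y0)) v + dist v w" by (rule dist_triangle)
   also have "\<dots> < 2 * ee y0" using d w ele[OF y0(1)] by simp
   finally show "w \<in> ball (bary (f y0)) (2 * ee y0) \<inter> tri" using w Ctri by auto
  qed
  have "kap s (bary (f y)) = f y" unfolding bv by (rule y(3)[symmetric])
  then have "gg y0 (bary (f y)) = y" using lo[OF y0K] y0(2) by blast
  then have "gg y0 v = y" unfolding bv .
  moreover have "continuous_map (top_of_set (ball v e \<inter> C)) X (gg y0)"
   using lo[OF y0K] continuous_map_from_subtopology_mono[OF _ sub] by blast
  ultimately show "\<exists>g. continuous_map (top_of_set (ball v e \<inter> C)) X g \<and> g v = y \<and> (\<forall>w\<in>ball v e \<inter> C. f (g w) = kap s w)"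
   using lo[OF y0K] sub by (intro exI[of _ "gg y0"]) blast
 qed
qed

end

text \<open>A compact convex exhaustion of the triangle without its corners, as r tends to
  0.\<close>

definition shell :: "real \<Rightarrow> (real^3) set" where "shell r = {v \<in> tri. \<forall>i. v $ i \<le> 1 - r}"

lemma compact_shell: "compact (shell r)"
proof -
 have "shell r = tri \<inter> (\<Inter>i. {v. v $ i \<le> 1 - r})" by (auto simp: shell_def)
 moreover have "closed (\<Inter>i. {v :: real^3. v $ i \<le> 1 - r})"
  by (intro closed_INT ballI closed_Collect_le continuous_intros)
 ultimately show ?thesis using compact_Int_closed[OF compact_tri] by metis
qed

lemma convex_shell: "convex (shell r)"
 unfolding convex_alt
proof (intro ballI allI impI)
 fix v w :: "real^3" and u :: real assume v: "v \<in> shell r" "w \<in> shell r" and u: "0 \<le> u \<and> u \<le> 1"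
 have "(1 - u) *\<^sub>R v + u *\<^sub>R w \<in> tri" using v u by (intro convexD[OF convex_tri]) (auto simp: shell_def)
 moreover have "(1 - u) * v $ i + u * w $ i \<le> 1 - r" for i
  using v u by (intro convex_bound_le) (auto simp: shell_def)
 ultimately show "(1 - u) *\<^sub>R v + u *\<^sub>R w \<in> shell r" by (simp add: shell_def)
qed

lemma shell_ptri: "0 < r \<Longrightarrow> shell r \<subseteq> ptri"
proof
 fix v assume r: "0 < r" and v: "v \<in> shell r"
 have "v $ i < 1" for i
 proof -
  have "v $ i \<le> 1 - r" using v by (simp add: shell_def)
  then show ?thesis using r by linarith
 qed
 then show "v \<in> ptri" using v by (simp add: ptri_iff shell_def)
qed

lemma ptri_shell: assumes "v \<in> ptri" obtains r where "0 < r" "v \<in> shell r"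
proof -
 define r where "r = min (1 - v $ 1) (min (1 - v $ 2) (1 - v $ 3))"
 have "v $ i \<le> 1 - r" for i using exhaust_3[of i] by (auto simp: r_def)
 then have "v \<in> shell r" using assms by (simp add: shell_def ptri_def)
 moreover have "0 < r" using assms by (simp add: ptri_iff r_def)
 ultimately show thesis using that by blast
qed

lemma shell_mono: "r \<le> r' \<Longrightarrow> shell r' \<subseteq> shell r"
 unfolding shell_def by (auto intro: order_trans)

lemma continuous_map_top_of_set_mono: "continuous_map (top_of_set A) X h \<Longrightarrow> B \<subseteq> A \<Longrightarrow> continuous_map (top_of_set B) X h" for B
 by (rule continuous_map_from_subtopology_mono)

context P1_cover
begin

lemma sec_unique:
 assumes "connected A" "A \<subseteq> ptri" "continuous_map (top_of_set A) X h" "continuous_map (top_of_set A) X h'"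
  "\<And>v. v \<in> A \<Longrightarrow> f (h v) = kap s v" "\<And>v. v \<in> A \<Longrightarrow> f (h' v) = kap s v" "a \<in> A" "h a = h' a" "v \<in> A"
 shows "h v = h' v"
proof (rule section_unique[OF assms(1,3,4) _ _ assms(7,8,9)])
 fix u assume u: "u \<in> A"
 then show "f (h u) = f (h' u)" using assms(5,6) by simp
 show "bary (f (h u)) \<notin> corners" using u assms(2,5) ptri_tri ptri_not_corner by (metis bary_kap subsetD)
qed

text \<open>The lift is extended along rays from c in N stages, where \<open>Cj j\<close> is C
  shrunk towards c by the factor j / N. From one stage to the next a point moves by less than the
  uniform radius, and uniqueness of lifts makes the local extensions agree.\<close>

lemma section_compact:
 assumes C: "compact C" "convex C" "C \<subseteq> ptri" and c: "c \<in> C" and y: "y \<in> topspace X" "f y = kap s c"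
 obtains h where "continuous_map (top_of_set C) X h" "h c = y" "\<And>w. w \<in> C \<Longrightarrow> f (h w) = kap s w"
proof -
 obtain e where e: "0 < e" "\<And>y v. y \<in> topspace X \<Longrightarrow> v \<in> C \<Longrightarrow> f y = kap s v \<Longrightarrow>
  \<exists>g. continuous_map (top_of_set (ball v e \<inter> C)) X g \<and> g v = y \<and> (\<forall>w\<in>ball v e \<inter> C. f (g w) = kap s w)"
  by (rule uniform_sections[OF C(1,3), of s]) blast
 obtain b where b: "0 < b" "\<And>w. w \<in> C \<Longrightarrow> norm w \<le> b" using compact_imp_bounded[OF C(1)] by (auto simp: bounded_pos)
 \<comment> \<open>A stage moves points by at most 2 b / N, which thereby stays below e.\<close>
 obtain N :: nat where N: "2 * b / e < real N" using reals_Archimedean2 by blast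
 have N0: "0 < real N" using N b(1) e(1) by (intro le_less_trans[OF _ N]) simp
 have Ne: "2 * b / real N < e" using N N0 e(1) by (simp add: field_simps)
 define Cj where "Cj j = (\<lambda>w. (1 - real j / N) *\<^sub>R c + (real j / N) *\<^sub>R w) ` C" for j :: nat
 have Cconv: "convex (Cj j)" for j unfolding Cj_def by (rule convex_affinity[OF C(2)])
 have Csub: "Cj j \<subseteq> C" if "j \<le> N" for j
 proof -
  have "real j / N \<le> 1" using that N0 by simp
  then show ?thesis unfolding Cj_def using convexD[OF C(2) c] by auto
 qed
 have cC: "c \<in> Cj j" for j unfolding Cj_def by (rule image_eqI[OF _ c]) (simp flip: scaleR_left.add)
 have "\<exists>h. continuous_map (top_of_set (Cj j)) X h \<and> h c = y \<and> (\<forall>w\<in>Cj j. f (h w) = kap s w)" if "j \<le> N" for j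
  using that
 proof (induction j)
  case 0
  have "Cj 0 = {c}" using c by (auto simp: Cj_def)
  moreover have "continuous_map (top_of_set {c}) X (\<lambda>_. y)" using y by simp
  ultimately show ?case using y by (intro exI[of _ "\<lambda>_. y"]) simp
 next
  case (Suc j)
  then obtain h where h: "continuous_map (top_of_set (Cj j)) X h" "h c = y" "\<forall>w\<in>Cj j. f (h w) = kap s w" by auto
  define q where "q = real j / real (Suc j)"
  have q: "0 \<le> q" "q \<le> 1" by (auto simp: q_def)
  \<comment> \<open>Shrinks the next copy of C into the current one, where the lift is already
    defined.\<close>
  define \<pi> where "\<pi> w = (1 - q) *\<^sub>R c + q *\<^sub>R w" for w
  have CjC: "Cj j \<subseteq> C" "Cj (Suc j) \<subseteq> C" using Csub Suc.prems by auto
  have \<pi>: "\<pi> w \<in> Cj j" "dist (\<pi> w) w < e" if w: "w \<in> Cj (Suc j)" for w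
  proof -
   obtain u where u: "u \<in> C" "w = (1 - real (Suc j) / N) *\<^sub>R c + (real (Suc j) / N) *\<^sub>R u" using w unfolding Cj_def by blast
   have qq: "q * (real (Suc j) / N) = real j / N" by (simp add: q_def)
   have "\<pi> w = (1 - q * (real (Suc j) / N)) *\<^sub>R c + (q * (real (Suc j) / N)) *\<^sub>R u"
    unfolding \<pi>_def u(2) by (simp add: algebra_simps)
   then show "\<pi> w \<in> Cj j" unfolding qq Cj_def using u(1) by blast
   have q1: "(1 - q) * (real (Suc j) / N) = 1 / N" by (simp add: q_def field_simps)
   have "(1 - s) *\<^sub>R c + s *\<^sub>R u - c = s *\<^sub>R (u - c)" for s by (simp add: algebra_simps)
   then have wc: "w - c = (real (Suc j) / N) *\<^sub>R (u - c)" unfolding u(2) by blast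
   have "w - \<pi> w = (1 - q) *\<^sub>R (w - c)" by (simp add: \<pi>_def algebra_simps)
   then have "w - \<pi> w = ((1 - q) * (real (Suc j) / N)) *\<^sub>R (u - c)" unfolding wc scaleR_scaleR .
   then have "w - \<pi> w = (1 / N) *\<^sub>R (u - c)" unfolding q1 .
   then have "dist (\<pi> w) w = (1 / N) * norm (u - c)" by (simp add: dist_commute dist_norm)
   also have "\<dots> \<le> (1 / N) * (2 * b)"
    using norm_triangle_ineq4[of u c] b(2)[OF u(1)] b(2)[OF c] by (intro mult_left_mono) auto
   also have "\<dots> < e" using Ne by simp
   finally show "dist (\<pi> w) w < e" .
  qed
  have \<pi>d: "dist (\<pi> a) (\<pi> w) \<le> dist a w" for a w
  proof -
   have "\<pi> a - \<pi> w = q *\<^sub>R (a - w)" by (simp add: \<pi>_def algebra_simps)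
   then have "dist (\<pi> a) (\<pi> w) = q * dist a w" using q by (simp add: dist_norm)
   also have "\<dots> \<le> 1 * dist a w" using q by (intro mult_right_mono) auto
   finally show ?thesis by simp
  qed
  have hX: "h w \<in> topspace X" if "w \<in> Cj j" for w using continuous_map_funspace[OF h(1)] that by auto
  have "\<forall>w\<in>Cj (Suc j). \<exists>g. continuous_map (top_of_set (ball (\<pi> w) e \<inter> C)) X g \<and> g (\<pi> w) = h (\<pi> w) \<and>
    (\<forall>u\<in>ball (\<pi> w) e \<inter> C. f (g u) = kap s u)"
  proof
   fix w assume "w \<in> Cj (Suc j)"
   then have a: "\<pi> w \<in> Cj j" by (rule \<pi>)
   show "\<exists>g. continuous_map (top_of_set (ball (\<pi> w) e \<inter> C)) X g \<and> g (\<pi> w) = h (\<pi> w) \<and>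
    (\<forall>u\<in>ball (\<pi> w) e \<inter> C. f (g u) = kap s u)"
    by (rule e(2)) (use a hX h(3) CjC in auto)
  qed
  then obtain G where G: "\<And>w. w \<in> Cj (Suc j) \<Longrightarrow> continuous_map (top_of_set (ball (\<pi> w) e \<inter> C)) X (G w)"
   "\<And>w. w \<in> Cj (Suc j) \<Longrightarrow> G w (\<pi> w) = h (\<pi> w)"
   "\<And>w u. w \<in> Cj (Suc j) \<Longrightarrow> u \<in> ball (\<pi> w) e \<inter> C \<Longrightarrow> f (G w u) = kap s u" by metis
  have "continuous_map (top_of_set (Cj (Suc j))) X (\<lambda>w. G w w)"
  proof (rule continuous_map_locallyI)
   fix a assume a: "a \<in> Cj (Suc j)"
   define \<delta> where "\<delta> = e - dist (\<pi> a) a"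
   have \<delta>: "0 < \<delta>" "\<delta> \<le> e" using \<pi>(2)[OF a] by (auto simp: \<delta>_def)
   have near: "dist (\<pi> a) w < e" "dist (\<pi> a) (\<pi> w) < e" if "dist a w < \<delta>" for w
   proof -
    show "dist (\<pi> a) w < e" using that dist_triangle[of "\<pi> a" w a] unfolding \<delta>_def by linarith
    show "dist (\<pi> a) (\<pi> w) < e" using that \<pi>d[of a w] \<delta>(2) by linarith
   qed
   have "ball a \<delta> \<inter> Cj (Suc j) \<subseteq> ball (\<pi> a) e \<inter> C" using near CjC by auto
   then have "continuous_map (top_of_set (Cj (Suc j) \<inter> ball a \<delta>)) X (G a)"
    by (intro continuous_map_top_of_set_mono[OF G(1)[OF a]]) auto
   moreover have "G w w = G a w" if w: "w \<in> Cj (Suc j) \<inter> ball a \<delta>" for w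
   proof -
    have wC: "w \<in> Cj (Suc j)" and d: "dist a w < \<delta>" using w by auto
    have hG: "h u = G a u" if u: "u \<in> Cj j \<inter> ball (\<pi> a) e" for u
    proof (rule sec_unique[where A = "Cj j \<inter> ball (\<pi> a) e" and a = "\<pi> a"])
     show "connected (Cj j \<inter> ball (\<pi> a) e)" by (intro convex_connected convex_Int Cconv convex_ball)
     show "continuous_map (top_of_set (Cj j \<inter> ball (\<pi> a) e)) X h" by (rule continuous_map_top_of_set_mono[OF h(1)]) simp
     show "continuous_map (top_of_set (Cj j \<inter> ball (\<pi> a) e)) X (G a)"
      by (rule continuous_map_top_of_set_mono[OF G(1)[OF a]]) (use CjC in auto)
    qed (use CjC C(3) h(3) G(2,3)[OF a] \<pi>(1)[OF a] e(1) u in auto)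
    have eq: "G w (\<pi> w) = G a (\<pi> w)" using hG[of "\<pi> w"] \<pi>(1)[OF wC] near[OF d] G(2)[OF wC] by simp
    show ?thesis
    proof (rule sec_unique[where A = "ball (\<pi> w) e \<inter> (ball (\<pi> a) e \<inter> C)" and a = "\<pi> w" and h = "G w" and h' = "G a" and s = s])
     show "connected (ball (\<pi> w) e \<inter> (ball (\<pi> a) e \<inter> C))" by (intro convex_connected convex_Int C(2) convex_ball)
     show "continuous_map (top_of_set (ball (\<pi> w) e \<inter> (ball (\<pi> a) e \<inter> C))) X (G w)"
      by (rule continuous_map_top_of_set_mono[OF G(1)[OF wC]]) auto
     show "continuous_map (top_of_set (ball (\<pi> w) e \<inter> (ball (\<pi> a) e \<inter> C))) X (G a)"
      by (rule continuous_map_top_of_set_mono[OF G(1)[OF a]]) auto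
     show "G w (\<pi> w) = G a (\<pi> w)" by (rule eq)
     show "w \<in> ball (\<pi> w) e \<inter> (ball (\<pi> a) e \<inter> C)" using \<pi>(2)[OF wC] near[OF d] wC CjC by auto
     show "\<pi> w \<in> ball (\<pi> w) e \<inter> (ball (\<pi> a) e \<inter> C)" using e(1) near[OF d] \<pi>(1)[OF wC] CjC by auto
    qed (use C(3) G(3)[OF a] G(3)[OF wC] in auto)
   qed
   ultimately show "\<exists>\<delta>>0. \<exists>g. continuous_map (top_of_set (Cj (Suc j) \<inter> ball a \<delta>)) X g \<and>
     (\<forall>w\<in>Cj (Suc j) \<inter> ball a \<delta>. G w w = g w)" using \<delta>(1) by blast
  qed
  moreover have "G c c = y"
  proof -
   have "\<pi> c = c" by (simp add: \<pi>_def flip: scaleR_left.add)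
   then show ?thesis using G(2)[OF cC] h(2) by simp
  qed
  moreover have "f (G w w) = kap s w" if "w \<in> Cj (Suc j)" for w using G(3)[OF that, of w] \<pi>(2)[OF that] that CjC by auto
  ultimately show ?case by (intro exI[of _ "\<lambda>w. G w w"]) blast
 qed
 from this[of N] obtain h where h: "continuous_map (top_of_set (Cj N)) X h" "h c = y" "\<forall>w\<in>Cj N. f (h w) = kap s w" by blast
 have "Cj N = C" using N0 by (simp add: Cj_def)
 then show thesis using h by (intro that[of h]) auto
qed

text \<open>The lifts over the compact shells agree on overlaps by uniqueness, since all take the
  value y at v0.\<close>

lemma section_ptri:
 assumes v0: "v0 \<in> ptri" and y: "y \<in> topspace X" "f y = kap s v0"
 obtains h where "continuous_map (top_of_set ptri) X h" "h v0 = y" "\<And>w. w \<in> ptri \<Longrightarrow> f (h w) = kap s w"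
proof -
 obtain r0 where r0: "0 < r0" "v0 \<in> shell r0" using ptri_shell[OF v0] .
 have "\<exists>h. continuous_map (top_of_set (shell r)) X h \<and> h v0 = y \<and> (\<forall>w\<in>shell r. f (h w) = kap s w)" if r: "0 < r" "r \<le> r0" for r
 proof -
  have "v0 \<in> shell r" using r0(2) shell_mono[OF r(2)] by blast
  then obtain h where "continuous_map (top_of_set (shell r)) X h" "h v0 = y" "\<And>w. w \<in> shell r \<Longrightarrow> f (h w) = kap s w"
   by (rule section_compact[OF compact_shell convex_shell shell_ptri[OF r(1)] _ y]) blast
  then show ?thesis by (intro exI[of _ h]) simp
 qed
 then obtain H where H: "\<And>r. 0 < r \<Longrightarrow> r \<le> r0 \<Longrightarrow> continuous_map (top_of_set (shell r)) X (H r)"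
  "\<And>r. 0 < r \<Longrightarrow> r \<le> r0 \<Longrightarrow> H r v0 = y" "\<And>r w. 0 < r \<Longrightarrow> r \<le> r0 \<Longrightarrow> w \<in> shell r \<Longrightarrow> f (H r w) = kap s w" by metis
 have agree1: "H r v = H r' v" if r: "0 < r" "r \<le> r'" "r' \<le> r0" "v \<in> shell r'" for r r' v
 proof (rule sec_unique[where A = "shell r'" and a = v0])
  show "connected (shell r')" by (rule convex_connected[OF convex_shell])
  show "shell r' \<subseteq> ptri" using shell_ptri[of r'] r by simp
  show "continuous_map (top_of_set (shell r')) X (H r)"
   by (rule continuous_map_top_of_set_mono[OF H(1) shell_mono]) (use r in auto)
  show "f (H r w) = kap s w" if "w \<in> shell r'" for w
   by (rule H(3)) (use r that shell_mono[OF r(2)] in auto)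
  have r': "0 < r'" "r \<le> r0" using r by simp_all
  show "continuous_map (top_of_set (shell r')) X (H r')" by (rule H(1)[OF r'(1) r(3)])
  show "f (H r' w) = kap s w" if "w \<in> shell r'" for w by (rule H(3)[OF r'(1) r(3) that])
  show "v0 \<in> shell r'" using r0(2) shell_mono[OF r(3)] by blast
  show "H r v0 = H r' v0" using H(2)[OF r(1) r'(2)] H(2)[OF r'(1) r(3)] by simp
  show "v \<in> shell r'" by (rule r(4))
 qed
 have agree: "H r v = H r' v" if "0 < r" "r \<le> r0" "0 < r'" "r' \<le> r0" "v \<in> shell r" "v \<in> shell r'" for r r' v
 proof (cases "r \<le> r'")
  case True show ?thesis by (rule agree1[OF that(1) True that(4,6)])
 next
  case False
  then have "r' \<le> r" by simp
  from agree1[OF that(3) this that(2,5)] show ?thesis by (rule sym)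
 qed
 define \<rho> where "\<rho> v = (SOME r. 0 < r \<and> r \<le> r0 \<and> v \<in> shell r)" for v
 have \<rho>: "0 < \<rho> v \<and> \<rho> v \<le> r0 \<and> v \<in> shell (\<rho> v)" if v: "v \<in> ptri" for v
 proof -
  obtain r where r: "0 < r" "v \<in> shell r" using ptri_shell[OF v] .
  then have "0 < min r r0 \<and> min r r0 \<le> r0 \<and> v \<in> shell (min r r0)" using r0 shell_mono[of "min r r0" r] by auto
  then show ?thesis unfolding \<rho>_def by (rule someI)
 qed
 show thesis
 proof (rule that[of "\<lambda>v. H (\<rho> v) v"])
  show "continuous_map (top_of_set ptri) X (\<lambda>v. H (\<rho> v) v)"
  proof (rule continuous_map_locallyI)
   fix a assume a: "a \<in> ptri"
   \<comment> \<open>Half of the margin at a keeps a whole ball around a inside one shell.\<close>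
   define r where "r = \<rho> a / 2"
   have r: "0 < r" "r \<le> r0" using \<rho>[OF a] by (auto simp: r_def)
   have sub: "ptri \<inter> ball a r \<subseteq> shell r"
   proof
    fix w assume w: "w \<in> ptri \<inter> ball a r"
    have "w $ i \<le> 1 - r" for i
    proof -
     have "\<bar>(a - w) $ i\<bar> \<le> norm (a - w)" by (rule component_le_norm_cart)
     moreover have "norm (a - w) < r" using w by (simp add: dist_norm)
     moreover have "a $ i \<le> 1 - \<rho> a" using \<rho>[OF a] by (simp add: shell_def)
     ultimately show ?thesis by (simp add: r_def abs_if split: if_splits)
    qed
    then show "w \<in> shell r" using w by (simp add: shell_def ptri_def)
   qed
   have "continuous_map (top_of_set (ptri \<inter> ball a r)) X (H r)" by (rule continuous_map_top_of_set_mono[OF H(1)[OF r] sub])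
   moreover have "H (\<rho> w) w = H r w" if w: "w \<in> ptri \<inter> ball a r" for w
    using agree[of "\<rho> w" r w] \<rho>[of w] w r sub by blast
   ultimately show "\<exists>\<delta>>0. \<exists>g. continuous_map (top_of_set (ptri \<inter> ball a \<delta>)) X g \<and> (\<forall>w\<in>ptri \<inter> ball a \<delta>. H (\<rho> w) w = g w)"
    using r(1) by blast
  qed
 qed (use \<rho>[OF v0] \<rho> H in auto)
qed

text \<open>By compactness the lift enters every neighbourhood of the finite fibre over a. Small
  balls meet \<open>ptri\<close> in convex sets, so their images are connected and must settle at a
  single point of the fibre.\<close>

lemma corner_limit:
 assumes h: "continuous_map (top_of_set ptri) X h" "\<And>w. w \<in> ptri \<Longrightarrow> f (h w) = kap s w" and a: "a \<in> tri"
 shows "\<exists>q. q \<in> topspace X \<and> f q = kap s a \<and> (\<forall>N. openin X N \<longrightarrow> q \<in> N \<longrightarrow> (\<exists>\<delta>>0. h ` (ptri \<inter> ball a \<delta>) \<subseteq> N))"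
proof -
 define Q where "Q = {q \<in> topspace X. f q = kap s a}"
 have hX: "h w \<in> topspace X" if "w \<in> ptri" for w using continuous_map_funspace[OF h(1)] that by auto
 have near: "\<exists>\<delta>>0. h ` (ptri \<inter> ball a \<delta>) \<subseteq> U" if U: "openin X U" "Q \<subseteq> U" for U
 proof -
  have "closedin X (topspace X - U)" using U(1) by blast
  then have "compactin X (topspace X - U)" using compactX closedin_compact_space by blast
  then have "compactin P1 (f ` (topspace X - U))" using image_compactin contf by blast
  then have "closedin P1 (f ` (topspace X - U))" using Hausdorff_space_P1 compactin_imp_closedin by blast
  then have "openin P1 (UNIV - f ` (topspace X - U))" by (metis openin_diff openin_topspace topspace_P1)
  from openin_continuous_map_preimage[OF continuous_map_kap this, of s]
  have "openin (top_of_set tri) {v \<in> tri. kap s v \<notin> f ` (topspace X - U)}" by simp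
  moreover have "a \<in> {v \<in> tri. kap s v \<notin> f ` (topspace X - U)}"
  proof -
   have "kap s a \<notin> f ` (topspace X - U)"
   proof
    assume "kap s a \<in> f ` (topspace X - U)"
    then obtain q where "q \<in> topspace X - U" "kap s a = f q" by (rule imageE)
    then have "q \<in> Q" "q \<notin> U" by (simp_all add: Q_def)
    then show False using U(2) by blast
   qed
   then show ?thesis using a by simp
  qed
  ultimately obtain \<delta> where \<delta>: "\<delta> > 0" "ball a \<delta> \<inter> tri \<subseteq> {v \<in> tri. kap s v \<notin> f ` (topspace X - U)}"
   using openin_contains_ball by (metis (no_types, lifting))
  have "h w \<in> U" if w: "w \<in> ptri" "w \<in> ball a \<delta>" for w
  proof (rule ccontr)
   assume n: "h w \<notin> U"
   have "kap s w \<notin> f ` (topspace X - U)" using \<delta>(2) w ptri_tri by blast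
   moreover have "f (h w) \<in> f ` (topspace X - U)" using n hX[OF w(1)] by simp
   ultimately show False using h(2)[OF w(1)] by simp
  qed
  then show ?thesis using \<delta>(1) by blast
 qed
 \<comment> \<open>One candidate q is separated from the others by disjoint open sets; connectedness
   puts the lift near a into one of the two, and the induction discards the other.\<close>
 have claim: "\<exists>q\<in>Q'. \<forall>N. openin X N \<longrightarrow> q \<in> N \<longrightarrow> (\<exists>\<delta>>0. h ` (ptri \<inter> ball a \<delta>) \<subseteq> N)"
  if "finite Q'" "Q' \<subseteq> topspace X" "\<And>U. openin X U \<Longrightarrow> Q' \<subseteq> U \<Longrightarrow> \<exists>\<delta>>0. h ` (ptri \<inter> ball a \<delta>) \<subseteq> U" for Q'
  using that
 proof (induction Q' rule: finite_induct)
  case empty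
  obtain \<delta> where "\<delta> > 0" "h ` (ptri \<inter> ball a \<delta>) \<subseteq> {}" using empty(2)[of "{}"] by auto
  moreover obtain w where "w \<in> ptri" "dist a w < \<delta>" using ptri_dense[OF a \<open>\<delta> > 0\<close>] .
  ultimately show ?case by auto
 next
  case (insert q Q')
  have "compactin X {q}" "compactin X Q'" using insert.prems(1) insert.hyps(1) by (auto intro: finite_imp_compactin)
  moreover have "disjnt {q} Q'" using insert.hyps(2) by simp
  ultimately obtain U V where UV: "openin X U" "openin X V" "{q} \<subseteq> U" "Q' \<subseteq> V" "disjnt U V"
   using Hausdorff_space_compact_separation[OF Haus] by metis
  obtain \<delta>0 where \<delta>0: "\<delta>0 > 0" "h ` (ptri \<inter> ball a \<delta>0) \<subseteq> U \<union> V"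
   using insert.prems(2)[of "U \<union> V"] UV by (auto simp: openin_Un)
  have conn: "connectedin X (h ` (ptri \<inter> ball a \<delta>0))"
  proof (rule connectedin_continuous_map_image[OF h(1)])
   show "connectedin (top_of_set ptri) (ptri \<inter> ball a \<delta>0)"
    by (simp add: connectedin_subtopology convex_connected convex_Int convex_ptri)
  qed
  have "h ` (ptri \<inter> ball a \<delta>0) \<subseteq> U \<or> h ` (ptri \<inter> ball a \<delta>0) \<subseteq> V"
  proof (rule ccontr)
   assume n: "\<not> ?thesis"
   have "U \<inter> V \<inter> h ` (ptri \<inter> ball a \<delta>0) = {}" using UV(5) by (auto simp: disjnt_def)
   moreover have "U \<inter> h ` (ptri \<inter> ball a \<delta>0) \<noteq> {}" "V \<inter> h ` (ptri \<inter> ball a \<delta>0) \<noteq> {}" using n \<delta>0(2) by blast+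
   ultimately show False using conn UV(1,2) \<delta>0(2) unfolding connectedin by blast
  qed
  then show ?case
  proof
   assume hU: "h ` (ptri \<inter> ball a \<delta>0) \<subseteq> U"
   have "\<exists>\<delta>>0. h ` (ptri \<inter> ball a \<delta>) \<subseteq> N" if N: "openin X N" "q \<in> N" for N
   proof -
    obtain \<delta> where \<delta>: "\<delta> > 0" "h ` (ptri \<inter> ball a \<delta>) \<subseteq> N \<union> V"
     using insert.prems(2)[of "N \<union> V"] N UV by (auto simp: openin_Un)
    have "h ` (ptri \<inter> ball a (min \<delta> \<delta>0)) \<subseteq> h ` (ptri \<inter> ball a \<delta>) \<inter> h ` (ptri \<inter> ball a \<delta>0)" by auto
    then have "h ` (ptri \<inter> ball a (min \<delta> \<delta>0)) \<subseteq> (N \<union> V) \<inter> U" using \<delta>(2) hU by blast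
    then have "h ` (ptri \<inter> ball a (min \<delta> \<delta>0)) \<subseteq> N" using UV(5) unfolding disjnt_def by blast
    then show ?thesis using \<delta>(1) \<delta>0(1) by (intro exI[of _ "min \<delta> \<delta>0"]) simp
   qed
   then show ?thesis by blast
  next
   assume hV: "h ` (ptri \<inter> ball a \<delta>0) \<subseteq> V"
   have "\<exists>\<delta>>0. h ` (ptri \<inter> ball a \<delta>) \<subseteq> N" if N: "openin X N" "Q' \<subseteq> N" for N
   proof -
    obtain \<delta> where \<delta>: "\<delta> > 0" "h ` (ptri \<inter> ball a \<delta>) \<subseteq> N \<union> U"
     using insert.prems(2)[of "N \<union> U"] N UV by (auto simp: openin_Un)
    have "h ` (ptri \<inter> ball a (min \<delta> \<delta>0)) \<subseteq> h ` (ptri \<inter> ball a \<delta>) \<inter> h ` (ptri \<inter> ball a \<delta>0)" by auto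
    then have "h ` (ptri \<inter> ball a (min \<delta> \<delta>0)) \<subseteq> (N \<union> U) \<inter> V" using \<delta>(2) hV by blast
    then have "h ` (ptri \<inter> ball a (min \<delta> \<delta>0)) \<subseteq> N" using UV(5) unfolding disjnt_def by blast
    then show ?thesis using \<delta>(1) \<delta>0(1) by (intro exI[of _ "min \<delta> \<delta>0"]) simp
   qed
   then show ?thesis using insert.IH insert.prems(1) by blast
  qed
 qed
 have "\<exists>q\<in>Q. \<forall>N. openin X N \<longrightarrow> q \<in> N \<longrightarrow> (\<exists>\<delta>>0. h ` (ptri \<inter> ball a \<delta>) \<subseteq> N)"
  by (rule claim) (use finite_fibre near in \<open>auto simp: Q_def\<close>)
 then show ?thesis by (auto simp: Q_def)
qed

text \<open>The lift over \<open>ptri\<close> is completed by its limits at the corners.\<close>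

lemma section_tri:
 assumes v0: "v0 \<in> ptri" and y: "y \<in> topspace X" "f y = kap s v0"
 obtains S where "continuous_map (top_of_set tri) X S" "S v0 = y" "\<And>w. w \<in> tri \<Longrightarrow> f (S w) = kap s w"
proof -
 obtain h where h: "continuous_map (top_of_set ptri) X h" "h v0 = y" "\<And>w. w \<in> ptri \<Longrightarrow> f (h w) = kap s w"
  by (rule section_ptri[OF assms]) blast
 have "\<forall>a\<in>tri. \<exists>q. q \<in> topspace X \<and> f q = kap s a \<and> (\<forall>N. openin X N \<longrightarrow> q \<in> N \<longrightarrow> (\<exists>\<delta>>0. h ` (ptri \<inter> ball a \<delta>) \<subseteq> N))"
  using corner_limit[OF h(1,3)] by blast
 then obtain q where q: "\<And>a. a \<in> tri \<Longrightarrow> q a \<in> topspace X \<and> f (q a) = kap s a"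
  "\<And>a N. a \<in> tri \<Longrightarrow> openin X N \<Longrightarrow> q a \<in> N \<Longrightarrow> \<exists>\<delta>>0. h ` (ptri \<inter> ball a \<delta>) \<subseteq> N" by metis
 define S where "S v = (if v \<in> ptri then h v else q v)" for v
 have fincorner: "closed A" if "A \<subseteq> corners" for A
  using that finite_subset[OF that] by (intro finite_imp_closed) (simp add: corners_def)
 have ptri_open: "openin (top_of_set tri) ptri"
  unfolding openin_open using fincorner[of corners] by (intro exI[of _ "- corners"]) (auto simp: ptri_def)
 have "continuous_map (top_of_set tri) X S"
  unfolding continuous_map
 proof (intro conjI allI impI)
  show "S ` topspace (top_of_set tri) \<subseteq> topspace X"
   using q(1) continuous_map_funspace[OF h(1)] by (auto simp: S_def ptri_def)
  fix N assume N: "openin X N"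
  show "openin (top_of_set tri) {v \<in> topspace (top_of_set tri). S v \<in> N}"
  proof (subst openin_subopen, intro ballI)
   fix v assume "v \<in> {v \<in> topspace (top_of_set tri). S v \<in> N}"
   then have v: "v \<in> tri" "S v \<in> N" by auto
   show "\<exists>T. openin (top_of_set tri) T \<and> v \<in> T \<and> T \<subseteq> {v \<in> topspace (top_of_set tri). S v \<in> N}"
   proof (cases "v \<in> ptri")
    case True
    have "openin (top_of_set ptri) {u \<in> topspace (top_of_set ptri). h u \<in> N}"
     by (rule openin_continuous_map_preimage[OF h(1) N])
    then have "openin (top_of_set tri) {u \<in> ptri. h u \<in> N}" using openin_trans ptri_open by fastforce
    moreover have "{u \<in> ptri. h u \<in> N} \<subseteq> {v \<in> topspace (top_of_set tri). S v \<in> N}" by (auto simp: S_def ptri_def)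
    moreover have "v \<in> {u \<in> ptri. h u \<in> N}" using True v by (simp add: S_def)
    ultimately show ?thesis by blast
   next
    case False
    then have "q v \<in> N" using v by (simp add: S_def)
    then obtain \<delta> where \<delta>: "\<delta> > 0" "h ` (ptri \<inter> ball v \<delta>) \<subseteq> N" using q(2)[OF v(1) N] by blast
    \<comment> \<open>With the other corners removed, v is the only point of this neighbourhood at
      which S is not given by h.\<close>
    define T where "T = tri \<inter> (ball v \<delta> - (corners - {v}))"
    have "openin (top_of_set tri) T" unfolding T_def by (intro openin_open_Int open_Diff fincorner) auto
    moreover have "v \<in> T" using \<delta>(1) v(1) by (simp add: T_def)
    moreover have "S u \<in> N" if u: "u \<in> T" for u
    proof (cases "u = v")
     case False
     then have "u \<in> ptri \<inter> ball v \<delta>" using u by (auto simp: T_def ptri_def)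
     then show ?thesis using \<delta>(2) by (auto simp: S_def)
    qed (use v in simp)
    then have "T \<subseteq> {v \<in> topspace (top_of_set tri). S v \<in> N}" by (auto simp: T_def)
    ultimately show ?thesis by blast
   qed
  qed
 qed
 moreover have "S v0 = y" using v0 h(2) by (simp add: S_def)
 moreover have "f (S w) = kap s w" if "w \<in> tri" for w using h(3) q(1)[OF that] by (simp add: S_def)
 ultimately show thesis by (rule that)
qed

end

section \<open>Lifted triangles as tiles and their adjacency\<close>

definition midp :: "3 \<Rightarrow> real^3" where "midp i = (\<chi> j. if j = i then 0 else 1 / 2)"

lemma midp: "midp i \<in> ptri" "midp i $ i = 0"
proof -
 have "midp i $ 1 + midp i $ 2 + midp i $ 3 = 1" using exhaust_3[of i] by (auto simp: midp_def)
 then show "midp i \<in> ptri" by (simp add: ptri_iff tri_def sum_3 midp_def)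
qed (simp add: midp_def)

lemma kap_edge: "v \<in> tri \<Longrightarrow> v $ i = 0 \<Longrightarrow> kap s v = kap s' v"
 using kap_eq_iff[of v v s s'] by blast

context P1_cover
begin

definition centres :: "bool \<Rightarrow> 'a set" where "centres s = {y \<in> topspace X. f y = kap s ctr}"

text \<open>The lifted triangle with centre x, which exists by \<open>section_tri\<close> and is
  unique by \<open>sections_agree\<close>.\<close>

definition sec :: "bool \<Rightarrow> 'a \<Rightarrow> real^3 \<Rightarrow> 'a" where
 "sec s x = (SOME S. continuous_map (top_of_set tri) X S \<and> S ctr = x \<and> (\<forall>w\<in>tri. f (S w) = kap s w))"

lemma sec:
 assumes "x \<in> centres s"
 shows sec_cont: "continuous_map (top_of_set tri) X (sec s x)" and sec_ctr: "sec s x ctr = x"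
  and f_sec: "w \<in> tri \<Longrightarrow> f (sec s x w) = kap s w"
proof -
 have x: "x \<in> topspace X" "f x = kap s ctr" using assms by (simp_all add: centres_def)
 obtain S where "continuous_map (top_of_set tri) X S" "S ctr = x" "\<And>w. w \<in> tri \<Longrightarrow> f (S w) = kap s w"
  by (rule section_tri[OF ctr_ptri x]) blast
 then have "\<exists>S. continuous_map (top_of_set tri) X S \<and> S ctr = x \<and> (\<forall>w\<in>tri. f (S w) = kap s w)"
  by (intro exI[of _ S]) simp
 then have *: "continuous_map (top_of_set tri) X (sec s x) \<and> sec s x ctr = x \<and> (\<forall>w\<in>tri. f (sec s x w) = kap s w)"
  unfolding sec_def by (rule someI_ex)
 show "continuous_map (top_of_set tri) X (sec s x)" "sec s x ctr = x" using * by blast+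
 show "w \<in> tri \<Longrightarrow> f (sec s x w) = kap s w" using * by blast
qed

lemma sec_in: "x \<in> centres s \<Longrightarrow> w \<in> tri \<Longrightarrow> sec s x w \<in> topspace X"
 using continuous_map_funspace[OF sec_cont] by (fastforce simp: Pi_iff)

text \<open>Lifts agree on \<open>ptri\<close> by \<open>sec_unique\<close> and at the corners by
  density and closedness.\<close>

lemma sections_agree:
 assumes S: "continuous_map (top_of_set tri) X S" "continuous_map (top_of_set tri) X S'"
  and f: "\<And>v. v \<in> tri \<Longrightarrow> f (S v) = kap s v" "\<And>v. v \<in> tri \<Longrightarrow> f (S' v) = kap s v"
  and a: "a \<in> ptri" "S a = S' a" and v: "v \<in> tri"
 shows "S v = S' v"
proof (rule ccontr)
 assume n: "S v \<noteq> S' v"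
 have p: "S u = S' u" if "u \<in> ptri" for u
  by (rule sec_unique[OF convex_connected[OF convex_ptri] order_refl, where a = a and s = s])
   (use S f a that ptri_tri in \<open>auto intro: continuous_map_top_of_set_mono\<close>)
 have "closedin (top_of_set tri) {v \<in> topspace (top_of_set tri). S v = S' v}"
  by (rule closedin_continuous_maps_eq[OF Haus S])
 then have "closed {v \<in> tri. S v = S' v}" using closedin_closed_trans compact_imp_closed[OF compact_tri] by fastforce
 then have "open (- {v \<in> tri. S v = S' v})" by (simp add: open_Compl)
 moreover have "v \<in> - {v \<in> tri. S v = S' v}" using n by simp
 ultimately obtain e where e: "e > 0" "ball v e \<subseteq> - {v \<in> tri. S v = S' v}" by (rule openE)
 obtain w where w: "w \<in> ptri" "dist v w < e" using ptri_dense[OF v e(1)] .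
 then have "w \<in> ball v e" by simp
 then have "w \<in> - {v \<in> tri. S v = S' v}" using e(2) by blast
 then show False using p[OF w(1)] ptri_tri[OF w(1)] by simp
qed

lemma sec_inj: "x \<in> centres s \<Longrightarrow> x' \<in> centres s \<Longrightarrow> v \<in> ptri \<Longrightarrow> sec s x v = sec s x' v \<Longrightarrow> x = x'"
 using sections_agree[of "sec s x" "sec s x'" s v ctr] sec_cont sec_ctr f_sec ptri_tri[OF ctr_ptri] by metis

lemma finite_centres: "finite (centres s)"
 unfolding centres_def by (rule finite_fibre)

lemma compactin_sec: "x \<in> centres s \<Longrightarrow> closedin X (sec s x ` tri)"
 using image_compactin[OF _ sec_cont] compact_tri Haus
 by (intro compactin_imp_closedin) (auto simp: compactin_subtopology)

lemma sec_cover_ptri: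
 assumes z: "z \<in> topspace X" "f z = kap s v" and v: "v \<in> ptri"
 obtains x where "x \<in> centres s" "z = sec s x v"
proof -
 obtain S where S: "continuous_map (top_of_set tri) X S" "S v = z" "\<And>w. w \<in> tri \<Longrightarrow> f (S w) = kap s w"
  by (rule section_tri[OF v z]) blast
 have ct: "ctr \<in> tri" by (rule ptri_tri[OF ctr_ptri])
 have "S ctr \<in> topspace X" using continuous_map_funspace[OF S(1)] ct by auto
 then have x: "S ctr \<in> centres s" using S(3)[OF ct] by (simp add: centres_def)
 have "S v = sec s (S ctr) v"
  by (rule sections_agree[where a = ctr and s = s]) (use S x sec_cont[OF x] f_sec[OF x] sec_ctr[OF x] ctr_ptri ptri_tri[OF v] in auto)
 then show thesis using x S(2) by (intro that[of "S ctr"]) simp_all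
qed

text \<open>Points over \<open>ptri\<close> are reached by lifting from them. The lifted triangles
  have a closed union; a missed point would have a missed neighbourhood, whose image is a
  neighbourhood because f is open and so would contain points of \<open>ptri\<close>.\<close>

lemma sec_cover:
 assumes z: "z \<in> topspace X" "f z = kap s v" and v: "v \<in> tri"
 obtains x where "x \<in> centres s" "z = sec s x v"
proof -
 define K where "K = (\<Union>x\<in>centres s. sec s x ` tri)"
 have "closedin X K" unfolding K_def using finite_centres compactin_sec by (intro closedin_Union) auto
 have "z \<in> K"
 proof (rule ccontr)
  assume n: "z \<notin> K"
  have N: "openin X (topspace X - K)" "z \<in> topspace X - K" using \<open>closedin X K\<close> z n by auto
  obtain W where W: "openin P1 W" "f z \<in> W" "W \<subseteq> f ` (topspace X - K)" by (rule f_open[OF z(1) N]) blast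
  have "openin (top_of_set tri) {v \<in> topspace (top_of_set tri). kap s v \<in> W}"
   by (rule openin_continuous_map_preimage[OF continuous_map_kap W(1)])
  moreover have "v \<in> {v \<in> topspace (top_of_set tri). kap s v \<in> W}" using v W(2) z(2) by simp
  ultimately obtain e where e: "e > 0" "ball v e \<inter> tri \<subseteq> {v \<in> topspace (top_of_set tri). kap s v \<in> W}"
   using openin_contains_ball by (metis (no_types, lifting))
  obtain w where w: "w \<in> ptri" "dist v w < e" using ptri_dense[OF v e(1)] .
  have wt: "w \<in> tri" by (rule ptri_tri[OF w(1)])
  have "w \<in> ball v e \<inter> tri" using w wt by simp
  then have "kap s w \<in> f ` (topspace X - K)" using e(2) W(3) by blast
  then obtain q where q: "kap s w = f q" "q \<in> topspace X - K" by (rule imageE)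
  obtain x where "x \<in> centres s" "q = sec s x w"
   by (rule sec_cover_ptri[of q s w]) (use q w in auto)
  then have "q \<in> K" using wt by (auto simp: K_def)
  then show False using q by blast
 qed
 then obtain x u where x: "x \<in> centres s" "u \<in> tri" "z = sec s x u" by (auto simp: K_def)
 have "kap s u = kap s v" using f_sec[OF x(1,2)] x(3) z(2) by simp
 then have "u = v" using kap_eq_iff[OF x(2) v] by simp
 then show thesis using x by (intro that[of x]) simp_all
qed

text \<open>Along an open side both triangles restrict to lifts of the same connected set, which
  agree if they agree once; the ends of the side follow by closedness.\<close>

lemma edge_agree:
 assumes x: "x \<in> centres True" "x' \<in> centres False" and w: "w \<in> ptri" "w $ i = 0" "sec True x w = sec False x' w"
  and v: "v \<in> tri" "v $ i = 0"
 shows "sec True x v = sec False x' v"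
proof -
 define A where "A = {u \<in> ptri. u $ i = 0}"
 have "convex A"
 proof -
  have "A = ptri \<inter> {u. axis i 1 \<bullet> u = 0}" by (auto simp: A_def inner_axis')
  then show ?thesis using convex_Int[OF convex_ptri convex_hyperplane] by metis
 qed
 have p: "sec True x u = sec False x' u" if u: "u \<in> A" for u
 proof (rule section_unique[OF convex_connected[OF \<open>convex A\<close>], where a = w])
  have sub: "A \<subseteq> tri" by (auto simp: A_def ptri_def)
  show "continuous_map (top_of_set A) X (sec True x)" "continuous_map (top_of_set A) X (sec False x')"
   using continuous_map_top_of_set_mono[OF sec_cont sub] x by blast+
  fix u assume "u \<in> A"
  then have u: "u \<in> ptri" "u \<in> tri" "u $ i = 0" by (auto simp: A_def ptri_def)
  show "f (sec True x u) = f (sec False x' u)" using f_sec x u kap_edge[OF u(2,3), of True False] by simp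
  show "bary (f (sec True x u)) \<notin> corners" using f_sec x u ptri_not_corner by simp
 qed (use w u in \<open>auto simp: A_def\<close>)
 have "closedin (top_of_set tri) {v \<in> topspace (top_of_set tri). sec True x v = sec False x' v}"
  by (rule closedin_continuous_maps_eq[OF Haus sec_cont[OF x(1)] sec_cont[OF x(2)]])
 then have cl: "closed {v \<in> tri. sec True x v = sec False x' v}" using closedin_closed_trans compact_imp_closed[OF compact_tri] by fastforce
 \<comment> \<open>Points of the open side that tend to v along the segment from the
   midpoint.\<close>
 define b where "b n = v + (1 / Suc n) *\<^sub>R (midp i - v)" for n
 have "b n \<in> A" for n
 proof -
  define u where "u = 1 / real (Suc n)"
  have u: "0 < u" "u \<le> 1" by (simp_all add: u_def)
  have b: "b n = (1 - u) *\<^sub>R v + u *\<^sub>R midp i" by (simp add: b_def u_def algebra_simps)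
  have "b n \<in> tri" unfolding b using u v(1) ptri_tri[OF midp(1)] by (intro convexD[OF convex_tri]) auto
  moreover have "b n $ j < 1" for j
  proof -
   have "v $ j \<le> 1" using tri_le_1[OF v(1)] .
   then have "(1 - u) * v $ j \<le> (1 - u) * 1" using u by (intro mult_left_mono) auto
   moreover have "u * midp i $ j < u * 1" using u midp(1)[of i] by (intro mult_strict_left_mono) (auto simp: ptri_iff)
   ultimately show ?thesis by (simp add: b)
  qed
  moreover have "b n $ i = 0" using v(2) midp(2) by (simp add: b_def)
  ultimately show ?thesis by (simp add: A_def ptri_iff)
 qed
 then have bA: "b n \<in> {v \<in> tri. sec True x v = sec False x' v}" for n using p by (auto simp: A_def ptri_def)
 have "(\<lambda>n. (1 / real (Suc n)) *\<^sub>R (midp i - v)) \<longlonglongrightarrow> 0 *\<^sub>R (midp i - v)"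
  using LIMSEQ_inverse_real_of_nat by (intro tendsto_scaleR tendsto_const) (simp add: inverse_eq_divide)
 then have "b \<longlonglongrightarrow> v + 0 *\<^sub>R (midp i - v)" unfolding b_def by (intro tendsto_add tendsto_const)
 then have "b \<longlonglongrightarrow> v" by simp
 then have "v \<in> {v \<in> tri. sec True x v = sec False x' v}" using closed_sequentially[OF cl] bA by blast
 then show ?thesis by simp
qed

lemma edge_partner:
 assumes "x \<in> centres s"
 obtains x' where "x' \<in> centres s'" "sec s x (midp i) = sec s' x' (midp i)"
proof -
 have m: "midp i \<in> tri" by (rule ptri_tri[OF midp(1)])
 have "f (sec s x (midp i)) = kap s' (midp i)" using f_sec[OF assms m] kap_edge[OF m midp(2)] by metis
 then show thesis using sec_cover[OF sec_in[OF assms m] _ m, of s'] that by metis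
qed

text \<open>The lower tile on the other side of the side opposite corner i, recognised by the lifted
  midpoint; \<open>sec_inj\<close> makes it unique.\<close>

definition nb :: "3 \<Rightarrow> 'a \<Rightarrow> 'a" where
 "nb i x = (SOME x'. x' \<in> centres False \<and> sec True x (midp i) = sec False x' (midp i))"

lemma nb: assumes "x \<in> centres True"
 shows nb_in: "nb i x \<in> centres False" and nb_eq: "sec True x (midp i) = sec False (nb i x) (midp i)"
proof -
 have "\<exists>x'. x' \<in> centres False \<and> sec True x (midp i) = sec False x' (midp i)"
  using edge_partner[OF assms, of False i] by metis
 then have "nb i x \<in> centres False \<and> sec True x (midp i) = sec False (nb i x) (midp i)"
  unfolding nb_def by (rule someI_ex)
 then show "nb i x \<in> centres False" "sec True x (midp i) = sec False (nb i x) (midp i)" by auto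
qed

lemma bij_nb: "bij_betw (nb i) (centres True) (centres False)"
proof (rule bij_betw_imageI)
 show "inj_on (nb i) (centres True)"
 proof (rule inj_onI)
  fix x y assume xy: "x \<in> centres True" "y \<in> centres True" "nb i x = nb i y"
  have "sec True x (midp i) = sec True y (midp i)" using nb_eq[OF xy(1)] nb_eq[OF xy(2)] xy(3) by simp
  then show "x = y" by (rule sec_inj[OF xy(1,2) midp(1)])
 qed
 show "nb i ` centres True = centres False"
 proof
  show "centres False \<subseteq> nb i ` centres True"
  proof
   fix y assume y: "y \<in> centres False"
   obtain x where x: "x \<in> centres True" "sec False y (midp i) = sec True x (midp i)" by (rule edge_partner[OF y])
   have "sec False (nb i x) (midp i) = sec False y (midp i)" using nb_eq[OF x(1), of i] x(2) by simp
   then have "nb i x = y" by (rule sec_inj[OF nb_in[OF x(1)] y midp(1)])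
   then show "y \<in> nb i ` centres True" using x(1) by blast
  qed
 qed (use nb_in in blast)
qed

text \<open>The framing numbers the upper tiles, and t records their neighbours. The delicate point
  is \<open>S_eq\<close> at the corners: tiles might meet in a vertex without being connected
  through sides, which the local model at the vertex excludes.\<close>

theorem tiling_of_framing:
 assumes \<phi>: "bij_betw \<phi> {..<d} (centres True)"
 obtains t S where "tiling X f d t S" "t 3 = id" "\<And>p. p < d \<Longrightarrow> S (True, p) ctr = \<phi> p"
proof -
 \<comment> \<open>Lower tiles inherit their number across side 3, which normalises
   \<open>t 3\<close> to the identity.\<close>
 define \<psi> where "\<psi> p = nb 3 (\<phi> p)" for p
 have \<psi>: "bij_betw \<psi> {..<d} (centres False)"
 proof -
  have "\<psi> = nb 3 \<circ> \<phi>" by (simp add: \<psi>_def fun_eq_iff)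
  then show ?thesis using bij_betw_trans[OF \<phi> bij_nb[of 3]] by (simp only:)
 qed
 have \<phi>in: "\<phi> p \<in> centres True" if "p < d" for p using bij_betwE[OF \<phi>] that by blast
 have \<psi>in: "\<psi> p \<in> centres False" if "p < d" for p using bij_betwE[OF \<psi>] that by blast
 define t where "t i p = (if p < d then inv_into {..<d} \<psi> (nb i (\<phi> p)) else p)" for i p
 have bt: "bij_betw (\<lambda>p. inv_into {..<d} \<psi> (nb i (\<phi> p))) {..<d} {..<d}" for i
  using bij_betw_trans[OF bij_betw_trans[OF \<phi> bij_nb[of i]] bij_betw_inv_into[OF \<psi>]] by (simp add: comp_def)
 have perm: "t i permutes {..<d}" for i
 proof (rule bij_imp_permutes)
  show "bij_betw (t i) {..<d} {..<d}" using bt[of i] by (rule bij_betw_cong[THEN iffD1, rotated]) (simp add: t_def)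
 qed (simp add: t_def)
 have \<psi>t: "\<psi> (t i p) = nb i (\<phi> p)" if p: "p < d" for i p
  using bij_betw_inv_into_right[OF \<psi> nb_in[OF \<phi>in[OF p]]] p by (simp add: t_def)
 have t3: "t 3 = id"
 proof
  fix p show "t 3 p = id p"
   using bij_betw_inv_into_left[OF \<psi>, of p] by (simp add: t_def \<psi>_def)
 qed
 define c where "c x = (if fst x then \<phi> (snd x) else \<psi> (snd x))" for x :: "bool \<times> nat"
 define S where "S x = sec (fst x) (c x)" for x :: "bool \<times> nat"
 have cin: "c x \<in> centres (fst x)" if "x \<in> tiles d" for x using that \<phi>in \<psi>in by (auto simp: c_def tiles_def)
 have ST: "S (True, p) = sec True (\<phi> p)" and SF: "S (False, p) = sec False (\<psi> p)" for p by (simp_all add: S_def c_def)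
 have contS: "continuous_map (top_of_set tri) X (S x)" if "x \<in> tiles d" for x unfolding S_def by (rule sec_cont[OF cin[OF that]])
 have fS: "f (S x v) = kap (fst x) v" if "x \<in> tiles d" "v \<in> tri" for x v unfolding S_def by (rule f_sec[OF cin[OF that(1)] that(2)])
 have SX: "S x v \<in> topspace X" if "x \<in> tiles d" "v \<in> tri" for x v unfolding S_def by (rule sec_in[OF cin[OF that(1)] that(2)])
 have cover: "\<exists>x\<in>tiles d. \<exists>v\<in>tri. y = S x v" if y: "y \<in> topspace X" for y
 proof -
  obtain s where s: "f y = kap s (bary (f y))" by (rule kap_cases)
  obtain x where x: "x \<in> centres s" "y = sec s x (bary (f y))" using sec_cover[OF y s bary_in_tri] .
  have "\<exists>p<d. c (s, p) = x"
  proof (cases s)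
   case True
   then have "x \<in> \<phi> ` {..<d}" using x(1) bij_betw_imp_surj_on[OF \<phi>] by simp
   then obtain p where "x = \<phi> p" "p \<in> {..<d}" by (rule imageE)
   then show ?thesis using True by (intro exI[of _ p]) (simp add: c_def)
  next
   case False
   then have "x \<in> \<psi> ` {..<d}" using x(1) bij_betw_imp_surj_on[OF \<psi>] by simp
   then obtain p where "x = \<psi> p" "p \<in> {..<d}" by (rule imageE)
   then show ?thesis using False by (intro exI[of _ p]) (simp add: c_def)
  qed
  then obtain p where "p < d" "c (s, p) = x" by blast
  then have "(s, p) \<in> tiles d" "y = S (s, p) (bary (f y))" using x(2) by (simp_all add: tiles_def S_def)
  then show ?thesis using bary_in_tri by blast
 qed
 have step: "S (True, p) v = S (False, t i p) v" if "p < d" "v \<in> tri" "v $ i = 0" for p i v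
 proof -
  have "t i p < d" using permutes_in_image[OF perm[of i], of p] that by simp
  then show ?thesis unfolding ST SF \<psi>t[OF that(1)]
   using edge_agree[OF \<phi>in[OF that(1)] nb_in[OF \<phi>in[OF that(1)]] midp nb_eq[OF \<phi>in[OF that(1)]] that(2,3)] by simp
 qed
 have glue_S: "S x v = S x' v" if "(x, x') \<in> glue t d v" "v \<in> tri" for x x' v
 proof -
  have "(S x v = S x v) = (S x v = S x' v)"
   by (rule glue_invariant[OF that(1), where P = "\<lambda>y. S x v = S y v"]) (use step that(2) in auto)
  then show ?thesis by simp
 qed
 have cross: "((True, p), (False, q)) \<in> glue t d v" if "p < d" "q < d" "v \<in> ptri" "S (True, p) v = S (False, q) v" for p q v
 proof -
  have vt: "v \<in> tri" by (rule ptri_tri[OF that(3)])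
  have "kap True v = kap False v" using fS[of "(True, p)" v] fS[of "(False, q)" v] that vt by (simp add: tiles_def)
  then obtain i where i: "v $ i = 0" using kap_eq_iff[OF vt vt] by auto
  have "S (False, t i p) v = S (False, q) v" using step[OF that(1) vt i] that(4) by simp
  then have "\<psi> (t i p) = \<psi> q" unfolding SF
   using sec_inj[OF _ \<psi>in[OF that(2)] that(3)] nb_in[OF \<phi>in[OF that(1)], of i] \<psi>t[OF that(1), of i] by metis
  moreover have "t i p < d" using permutes_in_image[OF perm[of i], of p] that by simp
  ultimately have "t i p = q" using \<psi> that(2) by (meson bij_betw_imp_inj_on inj_onD lessThan_iff)
  then show ?thesis using glue_step[OF that(1) i] by metis
 qed
 have eq_glue: "(x, x') \<in> glue t d v" if x: "x \<in> tiles d" "x' \<in> tiles d" and v: "v \<in> ptri" "S x v = S x' v" for x x' v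
 proof -
  obtain s p s' p' where xx: "x = (s, p)" "x' = (s', p')" by (metis surj_pair)
  have pd: "p < d" "p' < d" using x xx by (auto simp: tiles_def)
  have same: "p = p'" if "s = s'"
  proof (cases s)
   case True
   then have "\<phi> p = \<phi> p'" using v(2) sec_inj[OF \<phi>in[OF pd(1)] \<phi>in[OF pd(2)] v(1)] unfolding xx using ST that by simp
   then show ?thesis using bij_betw_imp_inj_on[OF \<phi>] pd by (simp add: inj_on_eq_iff)
  next
   case False
   then have "\<psi> p = \<psi> p'" using v(2) sec_inj[OF \<psi>in[OF pd(1)] \<psi>in[OF pd(2)] v(1)] unfolding xx using SF that by simp
   then show ?thesis using bij_betw_imp_inj_on[OF \<psi>] pd by (simp add: inj_on_eq_iff)
  qed
  consider "s = s'" | "s" "\<not> s'" | "\<not> s" "s'" by blast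
  then show ?thesis
  proof cases
   case 1 then show ?thesis using same xx by simp
  next
   case 2 then show ?thesis using cross[OF pd v(1)] v(2) xx by simp
  next
   case 3 then show ?thesis using cross[OF pd(2,1) v(1)] v(2) xx glue_sym by simp
  qed
 qed
 \<comment> \<open>If the tiles at z fell into two gluing classes, these would divide a punctured
   disc about z into two disjoint non-empty closed parts, although it is connected.\<close>
 have corner_glue: "(x, x') \<in> glue t d (axis i 1)"
  if x: "x \<in> tiles d" "x' \<in> tiles d" and eq: "S x (axis i 1) = S x' (axis i 1)" for x x' i
 proof (rule ccontr)
  define a :: "real^3" where "a = axis i 1"
  have a: "a \<in> tri" "a $ i = 1" "\<And>j. j \<noteq> i \<Longrightarrow> a $ j = 0"
   by (simp add: a_def, simp_all add: a_def axis_def)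
  assume "(x, x') \<notin> glue t d (axis i 1)"
  then have n: "(x, x') \<notin> glue t d a" by (simp add: a_def)
  define z where "z = S x a"
  have z: "z \<in> topspace X" using SX[OF x(1) a(1)] by (simp add: z_def)
  define A where "A = {y \<in> tiles d. (x, y) \<in> glue t d a}"
  define K where "K T = (\<Union>y\<in>T. S y ` tri)" for T
  have clK: "closedin X (K T)" if "T \<subseteq> tiles d" for T
  proof -
   have "closedin X (S y ` tri)" if "y \<in> T" for y unfolding S_def by (rule compactin_sec[OF cin]) (use that \<open>T \<subseteq> tiles d\<close> in blast)
   then show ?thesis unfolding K_def using finite_subset[OF that finite_tiles] by (intro closedin_Union) auto
  qed
  obtain k where "has_local_degree X P1 f z k" using deg[OF z] by blast
  then obtain U V \<xi> \<psi>' where 1: "0 < k" "openin X U" "z \<in> U"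
   "homeomorphic_map (subtopology X U) (top_of_set (ball (0::complex) 1)) \<xi>" "\<xi> z = 0" "\<psi>' (f z) = 0"
   "\<And>q. q \<in> U \<Longrightarrow> \<psi>' (f q) = \<xi> q ^ k"
   unfolding has_local_degree_def by blast
  obtain g where g: "continuous_map (top_of_set (ball 0 1)) X g" "\<And>q. q \<in> U \<Longrightarrow> g (\<xi> q) = q \<and> \<xi> q \<in> ball 0 1"
   "\<And>u. u \<in> ball 0 1 \<Longrightarrow> g u \<in> U \<and> \<xi> (g u) = u" "continuous_map (subtopology X U) (top_of_set (ball 0 1)) \<xi>"
   by (rule homeomorphic_chartE[OF 1(4,2)]) blast
  define N where "N = {q \<in> topspace X. bary (f q) \<in> {u. 0 < u $ i}}"
  have oN: "openin X N" unfolding N_def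
  proof (rule openin_continuous_map_preimage)
   show "continuous_map X euclidean (\<lambda>y. bary (f y))" using cont_baryf by (simp add: continuous_map_in_subtopology)
   show "openin euclidean {u :: real^3. 0 < u $ i}" by (simp add: open_Collect_less continuous_intros)
  qed
  have fz: "f z = kap (fst x) a" using fS[OF x(1) a(1)] by (simp add: z_def)
  have zN: "z \<in> N" using z fz a by (simp add: N_def)
  obtain r where r: "0 < r" "r \<le> 1" "\<And>q. q \<in> U \<Longrightarrow> norm (\<xi> q) < r \<Longrightarrow> q \<in> N"
   by (rule chart_small[OF 1(4,2,3,5) oN zN]) blast
  \<comment> \<open>A punctured disc about z, small enough for the i-th coordinate to stay positive,
    so that two tiles sharing a point of it are glued at the corner too.\<close>
  define P where "P = g ` (ball 0 r - {0})"
  have sub: "ball 0 r - {0} \<subseteq> ball (0::complex) 1" using r(2) by auto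
  have "connectedin (top_of_set (ball 0 1)) (ball 0 r - {0 :: complex})"
   using connected_punctured_ball[of "0 :: complex" r] sub by (simp add: connectedin_subtopology)
  then have conn: "connectedin X P" unfolding P_def by (rule connectedin_continuous_map_image[OF g(1)])
  have Pin: "q \<in> U \<and> norm (\<xi> q) < r \<and> \<xi> q \<noteq> 0" if q: "q \<in> P" for q
  proof -
   obtain u where "q = g u" "u \<in> ball 0 r - {0}" using q unfolding P_def by (rule imageE)
   then show ?thesis using g(3)[of u] sub by auto
  qed
  have P: "q \<in> N" "f q \<noteq> f z" if "q \<in> P" for q
  proof -
   show "q \<in> N" using Pin[OF that] r(3) by blast
   show "f q \<noteq> f z" using 1(6) 1(7)[of q] Pin[OF that] by auto
  qed
  have inter: "False" if q: "q \<in> P" "q \<in> K A" "q \<in> K (tiles d - A)" for q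
  proof -
   obtain y u where y: "y \<in> A" "u \<in> tri" "q = S y u" using q(2) by (auto simp: K_def)
   obtain y' u' where y': "y' \<in> tiles d - A" "u' \<in> tri" "q = S y' u'" using q(3) by (auto simp: K_def)
   have yt: "y \<in> tiles d" "y' \<in> tiles d" using y(1) y'(1) by (auto simp: A_def)
   have fq: "f q = kap (fst y) u" "f q = kap (fst y') u'"
    by (unfold y(3), rule fS[OF yt(1) y(2)], fold y(3), unfold y'(3), rule fS[OF yt(2) y'(2)])
   have b: "u = bary (f q)" "u' = bary (f q)" using fq(1) fq(2) y(2) y'(2) by (metis bary_kap)+
   have ui: "0 < u $ i" using P(1)[OF q(1)] b(1) by (simp add: N_def)
   have "u \<in> ptri"
   proof (rule ccontr)
    assume "u \<notin> ptri"
    then obtain j where j: "u = axis j 1" using y(2) by (auto simp: ptri_def corners_def)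
    have "j = i" using ui unfolding j by (simp add: axis_def split: if_splits)
    then have "u = a" using j by (simp add: a_def)
    then have "f q = kap (fst x) a" using fq(1) kap_edge[OF a(1) a(3)[of "i + 1"], of "fst y" "fst x"] by simp
    then show False using P(2)[OF q(1)] fz by simp
   qed
   moreover have "S y u = S y' u" using y(3) y'(3) b by metis
   ultimately have "(y, y') \<in> glue t d u" by (rule eq_glue[OF yt])
   moreover have "glue t d u \<subseteq> glue t d a"
   proof (rule glue_mono)
    fix j assume "u $ j = 0"
    then have "j \<noteq> i" using ui by auto
    then show "a $ j = 0" by (rule a(3))
   qed
   ultimately have "(y, y') \<in> glue t d a" by blast
   moreover have "(x, y) \<in> glue t d a" using y(1) by (simp add: A_def)
   ultimately have "(x, y') \<in> glue t d a" by (rule glue_trans[rotated])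
   then have "y' \<in> A" using yt(2) by (simp add: A_def)
   then show False using y'(1) by blast
  qed
  have meet: "\<exists>w\<in>tri. S y w \<in> P" if y: "y \<in> tiles d" "S y a = z" for y
  proof -
   define D where "D = {q \<in> topspace (subtopology X U). \<xi> q \<in> ball 0 r}"
   have "continuous_map (subtopology X U) euclidean \<xi>" using g(4) by (simp add: continuous_map_in_subtopology)
   then have "openin (subtopology X U) D" unfolding D_def by (rule openin_continuous_map_preimage) simp
   then have oD: "openin X D" using 1(2) by (rule openin_trans_full)
   have zD: "z \<in> D" using z 1(3,5) r(1) by (simp add: D_def)
   have "openin (top_of_set tri) {w \<in> topspace (top_of_set tri). S y w \<in> D}"
    by (rule openin_continuous_map_preimage[OF contS[OF y(1)] oD])
   moreover have "a \<in> {w \<in> topspace (top_of_set tri). S y w \<in> D}" using a(1) y(2) zD by simp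
   ultimately obtain e where e: "e > 0" "ball a e \<inter> tri \<subseteq> {w \<in> topspace (top_of_set tri). S y w \<in> D}"
    using openin_contains_ball by (metis (no_types, lifting))
   obtain w where w: "w \<in> ptri" "dist a w < e" using ptri_dense[OF a(1) e(1)] .
   have wt: "w \<in> tri" by (rule ptri_tri[OF w(1)])
   have "w \<in> ball a e \<inter> tri" using w wt by simp
   then have D: "S y w \<in> U" "\<xi> (S y w) \<in> ball 0 r" using e(2) by (auto simp: D_def)
   have "\<xi> (S y w) \<noteq> 0"
   proof
    assume "\<xi> (S y w) = 0"
    then have "S y w = z" using g(2)[OF D(1)] g(2)[OF 1(3)] 1(5) by metis
    then have "kap (fst y) w = kap (fst x) a" using fS[OF y(1) wt] fz by simp
    then have "w = a" using kap_eq_iff[OF wt a(1)] by blast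
    then show False using ptri_not_corner[OF w(1)] by (simp add: a_def corners_def)
   qed
   then have "S y w \<in> P" unfolding P_def using g(2)[OF D(1)] D(2) by (intro image_eqI[of _ _ "\<xi> (S y w)"]) auto
   then show ?thesis using wt by blast
  qed
  have xA: "x \<in> A" using x(1) by (simp add: A_def)
  have x'A: "x' \<in> tiles d - A" using x(2) n by (simp add: A_def)
  have "S x a = z" "S x' a = z" using eq by (simp_all add: z_def a_def)
  then obtain w w' where "w \<in> tri" "S x w \<in> P" "w' \<in> tri" "S x' w' \<in> P" using meet x by metis
  then have ne: "K A \<inter> P \<noteq> {}" "K (tiles d - A) \<inter> P \<noteq> {}" using xA x'A unfolding K_def by blast+
  have PX: "P \<subseteq> topspace X" using connectedin_subset_topspace[OF conn] .
  have cov: "P \<subseteq> K A \<union> K (tiles d - A)"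
  proof
   fix q assume "q \<in> P"
   then obtain y v where "y \<in> tiles d" "v \<in> tri" "q = S y v" using cover PX by blast
   then show "q \<in> K A \<union> K (tiles d - A)" unfolding K_def by blast
  qed
  have "K A \<inter> K (tiles d - A) \<inter> P = {}" using inter by blast
  then show False using conn clK[of A] clK[of "tiles d - A"] ne cov unfolding connectedin_closedin
   by (metis (no_types, lifting) A_def Diff_subset mem_Collect_eq subsetI)
 qed
 have "tiling X f d t S"
 proof
  show "S x v = S x' v \<longleftrightarrow> (x, x') \<in> glue t d v" if x: "x \<in> tiles d" "x' \<in> tiles d" and v: "v \<in> tri" for x x' v
  proof
   show "(x, x') \<in> glue t d v" if eq: "S x v = S x' v"
   proof (cases "v \<in> ptri")
    case False
    then obtain i where i: "v = axis i 1" using v by (auto simp: ptri_def corners_def)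
    show ?thesis using corner_glue[OF x] eq unfolding i by blast
   qed (rule eq_glue[OF x _ eq])
  qed (rule glue_S[OF _ v])
 qed (use perm Haus contf contS fS cover in auto)
 moreover have "S (True, p) ctr = \<phi> p" if "p < d" for p unfolding ST by (rule sec_ctr[OF \<phi>in[OF that]])
 ultimately show thesis using t3 by (intro that[of t S]) auto
qed

end

section \<open>Permutations by their number of cycles\<close>

definition ncyc :: "'a set \<Rightarrow> ('a \<Rightarrow> 'a) \<Rightarrow> nat" where "ncyc D p = card (orbit p ` D)"

lemma orbit_self: "finite D \<Longrightarrow> p permutes D \<Longrightarrow> x \<in> orbit p x"
 by (rule permutation_self_in_orbit) (auto simp: permutation_permutes)

lemma orbit_eq_iff: assumes "finite D" "p permutes D" shows "orbit p x = orbit p y \<longleftrightarrow> y \<in> orbit p x"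
proof -
 have "permutation p" using assms by (auto simp: permutation_permutes)
 then have "orbit p y = orbit p x" if "y \<in> orbit p x" using orbit_cyclic_eq3[OF cyclic_on_orbit' that] by blast
 then show ?thesis using orbit_self[OF assms, of y] by blast
qed

lemma orbit_sub: assumes "p permutes D" "x \<in> D" shows "orbit p x \<subseteq> D"
proof
 fix y assume "y \<in> orbit p x" then show "y \<in> D"
  by (induction) (use assms in \<open>auto simp: permutes_in_image\<close>)
qed

lemma orbit_agree:
 assumes "\<And>y. y \<in> K \<Longrightarrow> f y = g y" "f ` K \<subseteq> K" "x \<in> K" shows "orbit f x = orbit g x"
proof -
 have 1: "y \<in> orbit g x \<and> y \<in> K" if "y \<in> orbit f x" for y
  using that by induction (use assms in \<open>auto intro: orbit.intros\<close>)
 have 2: "y \<in> orbit f x \<and> y \<in> K" if "y \<in> orbit g x" for y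
  using that
 proof induction
  case base
  have "g x = f x" using assms by simp
  then show ?case using assms orbit.base[of f x] by auto
 next
  case (step y)
  then have "g y = f y" using assms by simp
  then show ?case using assms step orbit.step[of y f x] by auto
 qed
 show ?thesis using 1 2 by blast
qed

lemma card_image_cong:
 assumes "\<And>x y. x \<in> A \<Longrightarrow> y \<in> A \<Longrightarrow> g x = g y \<longleftrightarrow> h x = h y" shows "card (g ` A) = card (h ` A)"
proof -
 have "bij_betw (\<lambda>u. h (SOME x. x \<in> A \<and> g x = u)) (g ` A) (h ` A)"
 proof -
  have s: "(SOME x. x \<in> A \<and> g x = g a) \<in> A \<and> g (SOME x. x \<in> A \<and> g x = g a) = g a" if "a \<in> A" for a
   by (rule someI[of "\<lambda>x. x \<in> A \<and> g x = g a" a]) (use that in simp)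
  have e: "h (SOME x. x \<in> A \<and> g x = g a) = h a" if "a \<in> A" for a using s[OF that] assms that by blast
  show ?thesis
  proof (rule bij_betw_imageI)
   show "inj_on (\<lambda>u. h (SOME x. x \<in> A \<and> g x = u)) (g ` A)"
   proof (rule inj_onI)
    fix u v assume u: "u \<in> g ` A" and v: "v \<in> g ` A"
     and eq: "h (SOME x. x \<in> A \<and> g x = u) = h (SOME x. x \<in> A \<and> g x = v)"
    from u obtain a where a: "u = g a" "a \<in> A" by (rule imageE)
    from v obtain b where b: "v = g b" "b \<in> A" by (rule imageE)
    have "h a = h b" using eq unfolding a(1) b(1) e[OF a(2)] e[OF b(2)] .
    then show "u = v" using assms a b by metis
   qed
   have "(\<lambda>u. h (SOME x. x \<in> A \<and> g x = u)) ` g ` A = (\<lambda>a. h (SOME x. x \<in> A \<and> g x = g a)) ` A" by (simp add: image_image)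
   also have "\<dots> = h ` A" by (rule image_cong) (simp_all add: e)
   finally show "(\<lambda>u. h (SOME x. x \<in> A \<and> g x = u)) ` g ` A = h ` A" .
  qed
 qed
 then show ?thesis by (rule bij_betw_same_card)
qed

lemma ncyc_insert_fix:
 assumes D: "finite D" "a \<notin> D" and p: "p permutes D" shows "ncyc (insert a D) p = Suc (ncyc D p)"
proof -
 have pa: "p a = a" using p D(2) by (simp add: permutes_not_in)
 have "y = a" if "y \<in> orbit p a" for y using that by induction (simp_all add: pa)
 then have "orbit p a \<subseteq> {a}" by blast
 moreover have "a \<in> orbit p x" if "orbit p x = orbit p a" for x using orbit_self[OF D(1) p] that by blast
 ultimately have "orbit p a \<notin> orbit p ` D" using orbit_sub[OF p] D(2) by (metis (no_types, lifting) imageE subsetD)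
 then show ?thesis using D(1) by (simp add: ncyc_def)
qed

text \<open>The transposition inserts a into the cycle of b, immediately before b.\<close>

lemma ncyc_insert_join:
 assumes D: "finite D" "a \<notin> D" and p: "p permutes D" and b: "b \<in> D"
 shows "ncyc (insert a D) (Transposition.transpose a b \<circ> p) = ncyc D p"
proof -
 define q where "q = Transposition.transpose a b \<circ> p"
 have q: "q permutes insert a D" unfolding q_def
  by (intro permutes_compose permutes_swap_id permutes_subset[OF p]) (use b in auto)
 have fin: "finite (insert a D)" using D(1) by simp
 have pD: "p x \<in> D" if "x \<in> D" for x using that p by (simp add: permutes_in_image)
 have qa: "q a = b" using p D(2) by (simp add: q_def permutes_not_in)
 have qb: "q x = a" if "x \<in> D" "p x = b" for x using that by (simp add: q_def)
 have qp: "q x = p x" if "x \<in> D" "p x \<noteq> b" for x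
 proof -
  have "p x \<noteq> a" using pD[OF that(1)] D(2) by blast
  then show ?thesis using that by (simp add: q_def transpose_def)
 qed
 have f: "p u \<in> orbit q x" if "u \<in> D" "q u \<in> orbit q x" for u x
 proof (cases "p u = b")
  case True
  then have "a \<in> orbit q x" using qb[OF that(1)] that(2) by simp
  then have "q a \<in> orbit q x" by (rule orbit.step)
  then show ?thesis using qa True by simp
 next
  case False then show ?thesis using qp[OF that(1)] that(2) by simp
 qed
 have 1: "y \<in> orbit q x \<and> y \<in> D" if "x \<in> D" "y \<in> orbit p x" for x y
  using that(2)
 proof induction
  case base show ?case using f[OF that(1) orbit.base] pD that(1) by blast
 next
  case (step y) then show ?case using f[of y x] orbit.step[of y q x] pD by blast
 qed
 have g: "(q u = a \<and> b \<in> orbit p x) \<or> (q u \<in> D \<and> q u \<in> orbit p x)" if "u \<in> D" "p u \<in> orbit p x" for u x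
  using qb[OF that(1)] qp[OF that(1)] that pD by (cases "p u = b") auto
 have 2: "(y = a \<and> b \<in> orbit p x) \<or> (y \<in> D \<and> y \<in> orbit p x)" if "x \<in> D" "y \<in> orbit q x" for x y
  using that(2)
 proof induction
  case base show ?case by (rule g[OF that(1) orbit.base])
 next
  case (step y)
  from step(2) show ?case
  proof
   assume "y = a \<and> b \<in> orbit p x" then show ?thesis using qa b by auto
  next
   assume "y \<in> D \<and> y \<in> orbit p x" then show ?thesis using g[of y x] orbit.step[of y p x] by blast
  qed
 qed
 have "orbit q a = orbit q b" using orbit_eq_iff[OF fin q, of a b] orbit.base[of q a] qa by simp
 then have "orbit q ` insert a D = orbit q ` D" using b by auto
 moreover have "orbit q x = orbit q y \<longleftrightarrow> orbit p x = orbit p y" if "x \<in> D" "y \<in> D" for x y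
  unfolding orbit_eq_iff[OF fin q] orbit_eq_iff[OF D(1) p] using 1 2 that D(2) by blast
 ultimately show ?thesis unfolding ncyc_def q_def[symmetric] using card_image_cong[of D "orbit q" "orbit p"] by simp
qed

lemma sum_permutes_insert:
 fixes g :: "_ \<Rightarrow> 'b::comm_monoid_add"
 assumes D: "finite D" "a \<notin> D"
 shows "(\<Sum>p | p permutes insert a D. g p) = (\<Sum>p | p permutes D. g p + (\<Sum>b\<in>D. g (Transposition.transpose a b \<circ> p)))"
proof -
 have "(\<Sum>p | p permutes insert a D. g p) = (\<Sum>b\<in>insert a D. \<Sum>q | q permutes D. g (Transposition.transpose a b \<circ> q))"
  by (rule sum_over_permutations_insert[OF D])
 also have "\<dots> = (\<Sum>q | q permutes D. \<Sum>b\<in>insert a D. g (Transposition.transpose a b \<circ> q))" by (rule sum.swap)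
 also have "\<dots> = (\<Sum>p | p permutes D. g p + (\<Sum>b\<in>D. g (Transposition.transpose a b \<circ> p)))"
  using D by (simp add: sum.insert)
 finally show ?thesis .
qed

text \<open>A new element either forms a cycle of its own, with factor x, or is inserted before one
  of the \<open>card D\<close> old elements without a change in the number of cycles.\<close>

lemma sum_ncyc: "finite D \<Longrightarrow> (\<Sum>p | p permutes D. x ^ ncyc D p) = (\<Prod>i<card D. x + of_nat i)" for x :: "'b::comm_ring_1"
proof (induction D rule: finite_induct)
 case empty then show ?case by (simp add: ncyc_def)
next
 case (insert a D)
 have "(\<Sum>p | p permutes insert a D. x ^ ncyc (insert a D) p) =
   (\<Sum>p | p permutes D. x ^ ncyc (insert a D) p + (\<Sum>b\<in>D. x ^ ncyc (insert a D) (Transposition.transpose a b \<circ> p)))"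
  by (rule sum_permutes_insert[OF insert.hyps])
 also have "\<dots> = (\<Sum>p | p permutes D. (x + of_nat (card D)) * x ^ ncyc D p)"
  using insert.hyps by (intro sum.cong refl) (simp add: ncyc_insert_fix ncyc_insert_join algebra_simps)
 also have "\<dots> = (x + of_nat (card D)) * (\<Prod>i<card D. x + of_nat i)" by (simp add: insert.IH flip: sum_distrib_left)
 finally show ?case using insert.hyps by (simp add: mult.commute)
qed

text \<open>In the same recursion, an insertion before an old element is one transposition and keeps
  the number of cycles, while a new fixed point raises \<open>card D\<close> and the number of
  cycles together.\<close>

lemma sign_ncyc: "finite D \<Longrightarrow> p permutes D \<Longrightarrow> sign p = (- 1) ^ (card D + ncyc D p)"
proof (induction D arbitrary: p rule: finite_induct)
 case empty then show ?case by (simp add: ncyc_def sign_id)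
next
 case (insert a D)
 have "p \<in> {p. p permutes insert a D}" using insert.prems by simp
 then obtain z where z: "p = (\<lambda>(b, p). Transposition.transpose a b \<circ> p) z" "z \<in> {(b, p). b \<in> insert a D \<and> p \<in> {p. p permutes D}}"
  unfolding permutes_insert by (rule imageE)
 define b q where "b = fst z" and "q = snd z"
 have bq: "b \<in> insert a D" "q permutes D" "p = Transposition.transpose a b \<circ> q"
  using z by (simp_all add: b_def q_def case_prod_unfold)
 have pq: "permutation q" "permutation (Transposition.transpose a b)"
  by (use bq(2) insert.hyps(1) permutation_permutes in blast) (rule permutation_swap_id)
 have IH: "sign q = (- 1) ^ (card D + ncyc D q)" by (rule insert.IH[OF bq(2)])
 show ?case
 proof (cases "b = a")
  case True
  then have "p = q" using bq(3) by simp
  then show ?thesis using IH insert.hyps bq(2) by (simp add: ncyc_insert_fix)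
 next
  case False
  then have bD: "b \<in> D" using bq(1) by blast
  have "sign p = - sign q" unfolding bq(3) using sign_compose[OF pq(2,1)] False sign_swap_id[of a b] by simp
  moreover have "ncyc (insert a D) p = ncyc D q" unfolding bq(3) by (rule ncyc_insert_join[OF insert.hyps bq(2) bD])
  ultimately show ?thesis using IH insert.hyps by simp
 qed
qed

section \<open>Transitive pairs of permutations and the exponential formula\<close>

definition transitive_on :: "'a set \<Rightarrow> ('a \<Rightarrow> 'a) \<Rightarrow> ('a \<Rightarrow> 'a) \<Rightarrow> bool" where
 "transitive_on D \<alpha> \<beta> \<longleftrightarrow> (\<forall>K\<subseteq>D. K \<noteq> {} \<longrightarrow> \<alpha> ` K \<subseteq> K \<longrightarrow> \<beta> ` K \<subseteq> K \<longrightarrow> K = D)"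

definition perm_pairs :: "'a set \<Rightarrow> (('a \<Rightarrow> 'a) \<times> ('a \<Rightarrow> 'a)) set" where
 "perm_pairs D = {p. p permutes D} \<times> {p. p permutes D}"

definition transitive_pairs :: "'a set \<Rightarrow> (('a \<Rightarrow> 'a) \<times> ('a \<Rightarrow> 'a)) set" where
 "transitive_pairs D = {w \<in> perm_pairs D. transitive_on D (fst w) (snd w)}"

definition weight :: "'b::comm_ring_1 \<Rightarrow> 'a set \<Rightarrow> ('a \<Rightarrow> 'a) \<times> ('a \<Rightarrow> 'a) \<Rightarrow> 'b" where
 "weight x D w = x ^ ncyc D (fst w) * x ^ ncyc D (snd w)"

text \<open>The weighted number of all pairs on n points, by \<open>sum_perm_pairs\<close>;
  \<open>ctotal\<close> is its transitive part.\<close>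

definition total :: "'b::comm_ring_1 \<Rightarrow> nat \<Rightarrow> 'b" where "total x n = (\<Prod>i<n. x + of_nat i)\<^sup>2"

definition ctotal :: "'b::comm_ring_1 \<Rightarrow> nat set \<Rightarrow> 'b" where "ctotal x D = (\<Sum>w\<in>transitive_pairs D. weight x D w)"

lemma finite_perm_pairs: "finite D \<Longrightarrow> finite (perm_pairs D)"
 by (simp add: perm_pairs_def finite_permutations)

lemma sum_perm_pairs: assumes "finite D" shows "(\<Sum>w\<in>perm_pairs D. weight x D w) = total x (card D)"
proof -
 have "(\<Sum>w\<in>perm_pairs D. weight x D w) = (\<Sum>p | p permutes D. x ^ ncyc D p) * (\<Sum>p | p permutes D. x ^ ncyc D p)"
  unfolding sum_product perm_pairs_def weight_def sum.cartesian_product' fst_conv snd_conv ..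
 then show ?thesis unfolding sum_ncyc[OF assms] total_def power2_eq_square .
qed

definition restr :: "'a set \<Rightarrow> ('a \<Rightarrow> 'a) \<Rightarrow> 'a \<Rightarrow> 'a" where "restr K p x = (if x \<in> K then p x else x)"

text \<open>An injection of a finite set into itself is onto. Hence on finite sets the condition in
  \<open>transitive_on\<close> includes invariance under the inverses, and it is transitivity of the
  group generated by the pair.\<close>

lemma invariant_image: assumes "finite K" "p permutes D" "p ` K \<subseteq> K" shows "p ` K = K"
 using assms by (intro endo_inj_surj) (auto intro: inj_on_subset[OF permutes_inj])

lemma restr_permutes: assumes "finite K" "p permutes D" "p ` K \<subseteq> K" shows "restr K p permutes K"
proof (rule bij_imp_permutes)
 have "bij_betw p K K" using invariant_image[OF assms] permutes_inj_on[OF assms(2)] by (simp add: bij_betw_def)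
 then show "bij_betw (restr K p) K K" by (rule bij_betw_cong[THEN iffD1, rotated]) (simp add: restr_def)
qed (simp add: restr_def)

lemma invariant_compl: assumes "finite K" "p permutes D" "p ` K \<subseteq> K" "K \<subseteq> L" "p ` L \<subseteq> L" shows "p ` (L - K) \<subseteq> L - K"
proof
 fix y assume "y \<in> p ` (L - K)"
 then obtain x where x: "y = p x" "x \<in> L - K" by (rule imageE)
 have "y \<notin> K"
 proof
  assume "y \<in> K"
  then obtain z where "z \<in> K" "y = p z" using invariant_image[OF assms(1-3)] by blast
  then have "x = z" using x(1) permutes_inj[OF assms(2)] by (simp add: inj_eq)
  then show False using x(2) \<open>z \<in> K\<close> by blast
 qed
 then show "y \<in> L - K" using x assms(5) by blast
qed

text \<open>Each cycle lies either in K or in its complement, and the restrictions have the same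
  orbits there.\<close>

lemma ncyc_split:
 assumes D: "finite D" "K \<subseteq> D" and p: "p permutes D" "p ` K \<subseteq> K"
 shows "ncyc D p = ncyc K (restr K p) + ncyc (D - K) (restr (D - K) p)"
proof -
 have fK: "finite K" using D finite_subset by blast
 have pC: "p ` (D - K) \<subseteq> D - K" by (rule invariant_compl[OF fK p D(2)]) (simp add: permutes_image[OF p(1)])
 have o1: "orbit (restr K p) x = orbit p x \<and> orbit p x \<subseteq> K" if "x \<in> K" for x
  using orbit_agree[of K "restr K p" p x] that p(2) orbit_sub[OF restr_permutes[OF fK p] that] by (auto simp: restr_def)
 have o2: "orbit (restr (D - K) p) x = orbit p x \<and> orbit p x \<subseteq> D - K" if "x \<in> D - K" for x
  using orbit_agree[of "D - K" "restr (D - K) p" p x] that pC orbit_sub[OF restr_permutes[OF _ p(1) pC] that] D(1) by (auto simp: restr_def)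
 have "orbit p ` D = orbit p ` K \<union> orbit p ` (D - K)" using D(2) by blast
 moreover have "orbit p ` K \<inter> orbit p ` (D - K) = {}"
 proof -
  have "False" if "x \<in> K" "y \<in> D - K" "orbit p x = orbit p y" for x y
   using o1[OF that(1)] o2[OF that(2)] orbit_self[OF D(1) p(1), of x] that(3) by blast
  then show ?thesis by blast
 qed
 ultimately have "ncyc D p = card (orbit p ` K) + card (orbit p ` (D - K))"
  unfolding ncyc_def using D(1) fK by (simp add: card_Un_disjoint)
 also have "orbit p ` K = orbit (restr K p) ` K" using o1 by (intro image_cong) auto
 also have "orbit p ` (D - K) = orbit (restr (D - K) p) ` (D - K)" using o2 by (intro image_cong) auto
 finally show ?thesis unfolding ncyc_def .
qed

text \<open>The orbit of x0 under the group generated by the pair, obtained as the least invariant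
  set.\<close>

definition component :: "'a set \<Rightarrow> 'a \<Rightarrow> ('a \<Rightarrow> 'a) \<times> ('a \<Rightarrow> 'a) \<Rightarrow> 'a set" where
 "component D x0 w = \<Inter>{K. K \<subseteq> D \<and> x0 \<in> K \<and> fst w ` K \<subseteq> K \<and> snd w ` K \<subseteq> K}"

lemma component:
 assumes "w \<in> perm_pairs D" "x0 \<in> D"
 shows "component D x0 w \<subseteq> D" "x0 \<in> component D x0 w" "fst w ` component D x0 w \<subseteq> component D x0 w"
  "snd w ` component D x0 w \<subseteq> component D x0 w"
  "\<And>K. K \<subseteq> D \<Longrightarrow> x0 \<in> K \<Longrightarrow> fst w ` K \<subseteq> K \<Longrightarrow> snd w ` K \<subseteq> K \<Longrightarrow> component D x0 w \<subseteq> K"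
proof -
 define \<K> where "\<K> = {K. K \<subseteq> D \<and> x0 \<in> K \<and> fst w ` K \<subseteq> K \<and> snd w ` K \<subseteq> K}"
 have c: "component D x0 w = \<Inter>\<K>" by (simp add: component_def \<K>_def)
 have p: "fst w permutes D" "snd w permutes D" using assms(1) by (simp_all add: perm_pairs_def mem_Times_iff)
 have "D \<in> \<K>" using assms(2) permutes_image[OF p(1)] permutes_image[OF p(2)] by (simp add: \<K>_def)
 then show "component D x0 w \<subseteq> D" unfolding c by (rule Inter_lower)
 show "x0 \<in> component D x0 w" unfolding c by (rule InterI) (simp add: \<K>_def)
 have inv: "h ` \<Inter>\<K> \<subseteq> \<Inter>\<K>" if h: "\<And>K. K \<in> \<K> \<Longrightarrow> h ` K \<subseteq> K" for h
 proof (intro image_subsetI InterI)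
  fix x K assume x: "x \<in> \<Inter>\<K>" and K: "K \<in> \<K>"
  show "h x \<in> K" using h[OF K] InterD[OF x K] by blast
 qed
 show "fst w ` component D x0 w \<subseteq> component D x0 w" "snd w ` component D x0 w \<subseteq> component D x0 w"
  unfolding c by (rule inv; simp add: \<K>_def)+
 show "component D x0 w \<subseteq> K" if "K \<subseteq> D" "x0 \<in> K" "fst w ` K \<subseteq> K" "snd w ` K \<subseteq> K" for K
  unfolding component_def by (rule Inter_lower) (simp add: that)
qed

text \<open>A pair for which the orbit of x0 is K amounts to a transitive pair on K and an arbitrary
  pair on D - K, and the weight is multiplicative by \<open>ncyc_split\<close>.\<close>

lemma component_sum:
 assumes D: "finite D" "x0 \<in> D" and K: "K \<subseteq> D" "x0 \<in> K"
 shows "(\<Sum>w | w \<in> perm_pairs D \<and> component D x0 w = K. weight x D w) = ctotal x K * total x (card (D - K))"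
proof -
 have fin: "finite K" "finite (D - K)" using D K finite_subset by auto
 define R where "R = (\<lambda>w :: (nat \<Rightarrow> nat) \<times> (nat \<Rightarrow> nat). ((restr K (fst w), restr K (snd w)), (restr (D - K) (fst w), restr (D - K) (snd w))))"
 define J where "J = (\<lambda>z :: ((nat \<Rightarrow> nat) \<times> (nat \<Rightarrow> nat)) \<times> (nat \<Rightarrow> nat) \<times> (nat \<Rightarrow> nat). (fst (fst z) \<circ> fst (snd z), snd (fst z) \<circ> snd (snd z)))"
 have RJ1: "restr K (p \<circ> q) = p" "restr (D - K) (p \<circ> q) = q" "(p \<circ> q) permutes D" "\<And>u. u \<in> K \<Longrightarrow> (p \<circ> q) u = p u"
  if "p permutes K" "q permutes (D - K)" for p q
 proof -
  have q: "q u = u" if "u \<in> K" for u using \<open>q permutes (D - K)\<close> that by (simp add: permutes_not_in)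
  show "restr K (p \<circ> q) = p"
  proof
   fix u show "restr K (p \<circ> q) u = p u" using q permutes_not_in[OF \<open>p permutes K\<close>, of u] by (simp add: restr_def)
  qed
  show "restr (D - K) (p \<circ> q) = q"
  proof
   fix u show "restr (D - K) (p \<circ> q) u = q u"
   proof (cases "u \<in> D - K")
    case True
    then have "q u \<in> D - K" using permutes_in_image[OF that(2), of u] by blast
    then show ?thesis using True permutes_not_in[OF that(1), of "q u"] by (simp add: restr_def)
   next
    case False then show ?thesis using permutes_not_in[OF that(2) False] by (simp only: restr_def if_False)
   qed
  qed
  show "(p \<circ> q) permutes D" using K that by (intro permutes_compose permutes_subset[OF that(1)] permutes_subset[OF that(2)]) auto
  show "(p \<circ> q) u = p u" if "u \<in> K" for u using q[OF that] by simp
 qed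
 have JR: "restr K p \<circ> restr (D - K) p = p" if p: "p permutes D" "p ` K \<subseteq> K" for p
 proof
  fix u
  have pC: "p ` (D - K) \<subseteq> D - K" by (rule invariant_compl[OF fin(1) p K(1)]) (simp add: permutes_image[OF p(1)])
  consider "u \<in> K" | "u \<in> D - K" | "u \<notin> D" using K(1) by blast
  then show "(restr K p \<circ> restr (D - K) p) u = p u"
  proof cases
   case 2
   then have "p u \<in> D - K" using pC by blast
   then show ?thesis using 2 by (simp add: restr_def)
  qed (use K(1) permutes_not_in[OF p(1), of u] in \<open>auto simp: restr_def\<close>)
 qed
 have "(\<Sum>w | w \<in> perm_pairs D \<and> component D x0 w = K. weight x D w) =
  (\<Sum>z\<in>transitive_pairs K \<times> perm_pairs (D - K). weight x K (fst z) * weight x (D - K) (snd z))"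
 proof (rule sum.reindex_bij_witness[where i = J and j = R])
  fix w assume "w \<in> {w \<in> perm_pairs D. component D x0 w = K}"
  then have w: "w \<in> perm_pairs D" "component D x0 w = K" by auto
  have p: "fst w permutes D" "snd w permutes D" using w(1) by (auto simp: perm_pairs_def)
  have iK: "fst w ` K \<subseteq> K" "snd w ` K \<subseteq> K" using component(3,4)[OF w(1) D(2)] w(2) by auto
  have iC: "fst w ` (D - K) \<subseteq> D - K" "snd w ` (D - K) \<subseteq> D - K"
   by (rule invariant_compl[OF fin(1) p(1) iK(1) K(1)], simp add: permutes_image[OF p(1)],
     rule invariant_compl[OF fin(1) p(2) iK(2) K(1)], simp add: permutes_image[OF p(2)])
  show "J (R w) = w" unfolding J_def R_def using JR[OF p(1) iK(1)] JR[OF p(2) iK(2)] by (simp add: prod_eq_iff)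
  have "transitive_on K (restr K (fst w)) (restr K (snd w))"
   unfolding transitive_on_def
  proof (intro allI impI)
   fix L assume L: "L \<subseteq> K" "L \<noteq> {}" "restr K (fst w) ` L \<subseteq> L" "restr K (snd w) ` L \<subseteq> L"
   have r: "restr K p ` L = p ` L" for p :: "nat \<Rightarrow> nat" using L(1) by (intro image_cong) (auto simp: restr_def)
   have iL: "fst w ` L \<subseteq> L" "snd w ` L \<subseteq> L" using L(3,4) unfolding r .
   have fL: "finite L" using finite_subset[OF L(1) fin(1)] .
   show "L = K"
   proof (cases "x0 \<in> L")
    case True
    then have "K \<subseteq> L" using component(5)[OF w(1) D(2), of L] iL L(1) K(1) w(2) by blast
    then show ?thesis using L(1) by blast
   next
    case False
    have "fst w ` (K - L) \<subseteq> K - L" "snd w ` (K - L) \<subseteq> K - L"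
     using invariant_compl[OF fL p(1) iL(1) L(1) iK(1)] invariant_compl[OF fL p(2) iL(2) L(1) iK(2)] by blast+
    then have "K \<subseteq> K - L" using component(5)[OF w(1) D(2), of "K - L"] K False w(2) by blast
    then show ?thesis using L(1,2) by blast
   qed
  qed
  then show "R w \<in> transitive_pairs K \<times> perm_pairs (D - K)"
   using restr_permutes[OF fin(1) p(1) iK(1)] restr_permutes[OF fin(1) p(2) iK(2)]
    restr_permutes[OF fin(2) p(1) iC(1)] restr_permutes[OF fin(2) p(2) iC(2)]
   by (simp add: R_def transitive_pairs_def perm_pairs_def)
  show "weight x K (fst (R w)) * weight x (D - K) (snd (R w)) = weight x D w"
   unfolding weight_def R_def using ncyc_split[OF D(1) K(1) p(1) iK(1)] ncyc_split[OF D(1) K(1) p(2) iK(2)]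
   by (simp add: power_add mult_ac)
 next
  fix z assume z: "z \<in> transitive_pairs K \<times> perm_pairs (D - K)"
  obtain a b c e where zz: "z = ((a, b), (c, e))" by (metis surj_pair)
  have p: "a permutes K" "b permutes K" "c permutes (D - K)" "e permutes (D - K)" and tr: "transitive_on K a b"
   using z unfolding zz by (auto simp: transitive_pairs_def perm_pairs_def)
  have J: "J z = (a \<circ> c, b \<circ> e)" by (simp add: J_def zz)
  show "R (J z) = z" unfolding J R_def using RJ1(1,2)[OF p(1,3)] RJ1(1,2)[OF p(2,4)] by (simp add: zz)
  have JD: "J z \<in> perm_pairs D" unfolding J perm_pairs_def using RJ1(3)[OF p(1,3)] RJ1(3)[OF p(2,4)] by simp
  have im: "(a \<circ> c) ` L = a ` L" "(b \<circ> e) ` L = b ` L" if "L \<subseteq> K" for L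
   using RJ1(4)[OF p(1,3)] RJ1(4)[OF p(2,4)] that by (auto intro!: image_cong)
  note c = component[OF JD D(2)]
  have sub: "component D x0 (J z) \<subseteq> K"
   by (rule c(5)[OF K]) (use im[of K] permutes_image[OF p(1)] permutes_image[OF p(2)] in \<open>auto simp: J\<close>)
  have "component D x0 (J z) = K"
   using tr[unfolded transitive_on_def] sub c(2,3,4) im[OF sub] unfolding J by auto
  then show "J z \<in> {w \<in> perm_pairs D. component D x0 w = K}" using JD by simp
 qed
 also have "\<dots> = ctotal x K * (\<Sum>w\<in>perm_pairs (D - K). weight x (D - K) w)"
  unfolding ctotal_def sum_product sum.cartesian_product' fst_conv snd_conv ..
 finally show ?thesis using sum_perm_pairs[OF fin(2)] by metis
qed

text \<open>The pairs are sorted by the orbit of x0.\<close>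

lemma total_recursion:
 assumes D: "finite D" "x0 \<in> D"
 shows "total x (card D) = (\<Sum>K | K \<subseteq> D \<and> x0 \<in> K. ctotal x K * total x (card D - card K))"
proof -
 have fin: "finite {K. K \<subseteq> D \<and> x0 \<in> K}" by (rule finite_subset[of _ "Pow D"]) (use D(1) in auto)
 have "total x (card D) = (\<Sum>w\<in>perm_pairs D. weight x D w)" using sum_perm_pairs[OF D(1)] by metis
 also have "\<dots> = (\<Sum>K | K \<subseteq> D \<and> x0 \<in> K. \<Sum>w | w \<in> perm_pairs D \<and> component D x0 w = K. weight x D w)"
  by (rule sum.group[symmetric]) (use finite_perm_pairs[OF D(1)] fin component(1,2)[OF _ D(2)] in auto)
 also have "\<dots> = (\<Sum>K | K \<subseteq> D \<and> x0 \<in> K. ctotal x K * total x (card D - card K))"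
  by (intro sum.cong refl) (use component_sum[OF D] D(1) in \<open>auto simp: card_Diff_subset finite_subset\<close>)
 finally show ?thesis .
qed

lemma sum_subsets_containing:
 fixes G :: "nat \<Rightarrow> 'b::comm_ring_1"
 assumes D: "finite D" "x0 \<in> D"
 shows "(\<Sum>K | K \<subseteq> D \<and> x0 \<in> K. G (card K)) = (\<Sum>j<card D. of_nat (card D - 1 choose j) * G (Suc j))"
proof -
 let ?M = "D - {x0}"
 have cD: "card D = Suc (card ?M)" by (rule card.remove[OF D])
 have "(\<Sum>K | K \<subseteq> D \<and> x0 \<in> K. G (card K)) = (\<Sum>L\<in>Pow ?M. G (Suc (card L)))"
 proof (rule sum.reindex_bij_witness[where i = "insert x0" and j = "\<lambda>K. K - {x0}"])
  fix K assume "K \<in> {K. K \<subseteq> D \<and> x0 \<in> K}"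
  then have K: "K \<subseteq> D" "x0 \<in> K" by auto
  show "insert x0 (K - {x0}) = K" "K - {x0} \<in> Pow ?M" using K by auto
  show "G (Suc (card (K - {x0}))) = G (card K)" using card.remove[OF finite_subset[OF K(1) D(1)] K(2)] by simp
 next
  fix L assume "L \<in> Pow ?M"
  then have L: "L \<subseteq> D" "x0 \<notin> L" by blast+
  show "insert x0 L - {x0} = L" using L(2) by simp
  show "insert x0 L \<in> {K. K \<subseteq> D \<and> x0 \<in> K}" using L(1) D(2) by simp
 qed
 also have "\<dots> = (\<Sum>j<card D. \<Sum>L | L \<in> Pow ?M \<and> card L = j. G (Suc (card L)))"
 proof (rule sum.group[symmetric])
  show "card ` Pow ?M \<subseteq> {..<card D}"
  proof (rule image_subsetI)
   fix L assume "L \<in> Pow ?M"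
   then have "card L \<le> card ?M" using D(1) by (intro card_mono) simp_all
   then show "card L \<in> {..<card D}" unfolding cD by simp
  qed
 qed (use D(1) in simp_all)
 also have "\<dots> = (\<Sum>j<card D. of_nat (card D - 1 choose j) * G (Suc j))"
 proof (intro sum.cong refl)
  fix j
  have "(\<Sum>L | L \<in> Pow ?M \<and> card L = j. G (Suc (card L))) = of_nat (card {L. L \<subseteq> ?M \<and> card L = j}) * G (Suc j)" by simp
  then show "(\<Sum>L | L \<in> Pow ?M \<and> card L = j. G (Suc (card L))) = of_nat (card D - 1 choose j) * G (Suc j)"
   using n_subsets[of ?M j] D(1) cD by simp
 qed
 finally show ?thesis .
qed

text \<open>Invariance under relabelling comes from the recursion: it expresses the transitive sum
  by \<open>total\<close>, which depends only on the cardinality, and by transitive sums over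
  smaller sets.\<close>

lemma ctotal_card: "finite D \<Longrightarrow> ctotal x D = ctotal x {..<card D}"
proof (induction "card D" arbitrary: D rule: less_induct)
 case less
 show ?case
 proof (cases "D = {}")
  case False
  define n where "n = card D"
  \<comment> \<open>The cut-off at n drops the term of the full set, which is the unknown of the
    recursion.\<close>
  define G where "G k = (if k < n then ctotal x {..<k} * total x (n - k) else 0)" for k
  have key: "ctotal x E = total x n - (\<Sum>j<n. of_nat (n - 1 choose j) * G (Suc j))" if E: "finite E" "card E = n" "e \<in> E" for E e
  proof -
   have fin: "finite {K. K \<subseteq> E \<and> e \<in> K}" by (rule finite_subset[of _ "Pow E"]) (use E(1) in auto)
   have "total x n = (\<Sum>K | K \<subseteq> E \<and> e \<in> K. ctotal x K * total x (n - card K))"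
    using total_recursion[OF E(1,3), of x] unfolding E(2) .
   also have "\<dots> = ctotal x E * total x (n - card E) + (\<Sum>K\<in>{K. K \<subseteq> E \<and> e \<in> K} - {E}. ctotal x K * total x (n - card K))"
    by (rule sum.remove[OF fin]) (use E in auto)
   also have "(\<Sum>K\<in>{K. K \<subseteq> E \<and> e \<in> K} - {E}. ctotal x K * total x (n - card K)) = (\<Sum>K\<in>{K. K \<subseteq> E \<and> e \<in> K} - {E}. G (card K))"
   proof (intro sum.cong refl)
    fix K assume "K \<in> {K. K \<subseteq> E \<and> e \<in> K} - {E}"
    then have K: "K \<subset> E" by auto
    have c: "card K < n" using psubset_card_mono[OF E(1) K] E(2) by simp
    have "ctotal x K = ctotal x {..<card K}"
     by (rule less.hyps) (use c K E(1) n_def in \<open>auto intro: finite_subset\<close>)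
    then show "ctotal x K * total x (n - card K) = G (card K)" using c by (simp add: G_def)
   qed
   also have "\<dots> = (\<Sum>K | K \<subseteq> E \<and> e \<in> K. G (card K))"
    by (rule sum.mono_neutral_left[OF fin]) (use E in \<open>auto simp: G_def\<close>)
   also have "\<dots> = (\<Sum>j<n. of_nat (n - 1 choose j) * G (Suc j))" using sum_subsets_containing[OF E(1,3), of G] E(2) by simp
   finally show ?thesis using E(2) by (simp add: total_def)
  qed
  have "n \<noteq> 0" using False less.prems by (simp add: n_def)
  then have "0 \<in> {..<n}" by simp
  from key[OF _ _ this] obtain e where "e \<in> D" and k: "ctotal x {..<n} = total x n - (\<Sum>j<n. of_nat (n - 1 choose j) * G (Suc j))"
   using False by auto
  then show ?thesis using key[OF less.prems n_def[symmetric] \<open>e \<in> D\<close>] by (simp flip: n_def)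
 qed simp
qed

text \<open>In terms of exponential generating functions this is A' = F' A, with A for all pairs and
  F for the transitive ones.\<close>

lemma total_Suc: "total x (Suc m) = (\<Sum>j\<le>m. of_nat (m choose j) * (ctotal x {..<Suc j} * total x (m - j)))"
proof -
 have "total x (Suc m) = (\<Sum>K | K \<subseteq> {..<Suc m} \<and> 0 \<in> K. ctotal x K * total x (Suc m - card K))"
  using total_recursion[of "{..<Suc m}" 0 x] by simp
 also have "\<dots> = (\<Sum>K | K \<subseteq> {..<Suc m} \<and> 0 \<in> K. ctotal x {..<card K} * total x (Suc m - card K))"
 proof (intro sum.cong refl)
  fix K assume "K \<in> {K. K \<subseteq> {..<Suc m} \<and> 0 \<in> K}"
  then have "finite K" by (intro finite_subset[of K "{..<Suc m}"]) simp_all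
  then show "ctotal x K * total x (Suc m - card K) = ctotal x {..<card K} * total x (Suc m - card K)"
   using ctotal_card[of K x] by (intro arg_cong2[where f = times] refl) blast
 qed
 also have "\<dots> = (\<Sum>j<Suc m. of_nat (m choose j) * (ctotal x {..<Suc j} * total x (Suc m - Suc j)))"
  using sum_subsets_containing[of "{..<Suc m}" 0 "\<lambda>k. ctotal x {..<k} * total x (Suc m - k)"] by (simp del: sum.lessThan_Suc)
 finally show ?thesis by (simp add: lessThan_Suc_atMost)
qed

text \<open>The equation A' = F' A determines all coefficients from the constant one, and the
  composite exp F satisfies it.\<close>

lemma fps_exp_compose_unique:
 fixes F A :: "'b::field_char_0 fps"
 assumes "fps_nth F 0 = 0" "fps_nth A 0 = 1" "fps_deriv A = fps_deriv F * A"
 shows "fps_exp 1 oo F = A"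
proof -
 let ?E = "fps_exp 1 oo F"
 have d: "fps_deriv ?E = fps_deriv F * ?E" using assms(1) by (simp add: fps_compose_deriv mult.commute)
 have uniq: "fps_nth A n = fps_nth ?E n" for n
 proof (induction n rule: less_induct)
  case (less n)
  show ?case
  proof (cases n)
   case 0 then show ?thesis using assms(2) by simp
  next
   case (Suc m)
   have "fps_nth (fps_deriv F * A) m = fps_nth (fps_deriv F * ?E) m"
    unfolding fps_mult_nth using less Suc by (intro sum.cong refl) auto
   then have "fps_nth (fps_deriv A) m = fps_nth (fps_deriv ?E) m" using assms(3) d by simp
   then have "of_nat (m + 1) * fps_nth A (m + 1) = of_nat (m + 1) * fps_nth ?E (m + 1)" unfolding fps_deriv_nth .
   then show ?thesis using Suc by (simp del: of_nat_Suc)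
  qed
 qed
 show ?thesis by (rule fps_ext) (simp add: uniq)
qed

lemma Suc_mult_divide_fact: "of_nat (Suc j) * (a / fact (Suc j)) = a / fact j" for a :: "'b::field_char_0"
 unfolding fact_Suc by (simp del: of_nat_Suc)

lemma fraction_rearrange:
 fixes n v w :: "'b::field"
 assumes "n \<noteq> 0" "v \<noteq> 0" "w \<noteq> 0" shows "(p * q) * (n / (v * w) * (r * s)) / n = (p * r / v) * (q * s / w)"
 using assms by simp

text \<open>The sizes of the two parts in \<open>total_Suc\<close> add up, so the factor
  \<open>c ^ n\<close> passes through the recursion.\<close>

lemma exp_ctotal:
 fixes x c :: "'b::field_char_0"
 shows "fps_exp 1 oo Abs_fps (\<lambda>n. if n = 0 then 0 else c ^ n * ctotal x {..<n} / fact n) = Abs_fps (\<lambda>n. c ^ n * total x n / fact n)"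
proof -
 define C where "C n = ctotal x {..<n}" for n
 define u where "u = (\<lambda>n. if n = 0 then 0 else c ^ n * C n / fact n)"
 define a where "a = (\<lambda>n. c ^ n * total x n / fact n)"
 have u: "of_nat (Suc j) * u (Suc j) = c ^ Suc j * C (Suc j) / fact j" for j
  using Suc_mult_divide_fact[of j "c ^ Suc j * C (Suc j)"] unfolding u_def by simp
 have "of_nat (Suc m) * a (Suc m) = (\<Sum>j\<le>m. (of_nat (Suc j) * u (Suc j)) * a (m - j))" for m
 proof -
  have "of_nat (Suc m) * a (Suc m) = c ^ Suc m * total x (Suc m) / fact m"
   unfolding a_def by (rule Suc_mult_divide_fact)
  also have "\<dots> = (\<Sum>j\<le>m. c ^ Suc m * (of_nat (m choose j) * (C (Suc j) * total x (m - j))) / fact m)"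
   unfolding total_Suc C_def by (simp only: sum_distrib_left sum_divide_distrib)
  also have "\<dots> = (\<Sum>j\<le>m. (of_nat (Suc j) * u (Suc j)) * a (m - j))"
  proof (intro sum.cong refl)
   fix j assume "j \<in> {..m}"
   then have j: "j \<le> m" by simp
   have b: "of_nat (m choose j) = (fact m / (fact j * fact (m - j)) :: 'b)" by (rule binomial_fact[OF j])
   have cc: "c ^ Suc m = c ^ Suc j * c ^ (m - j)" using power_add[of c "Suc j" "m - j"] j by (simp only: add_Suc le_add_diff_inverse)
   show "c ^ Suc m * (of_nat (m choose j) * (C (Suc j) * total x (m - j))) / fact m = (of_nat (Suc j) * u (Suc j)) * a (m - j)"
    unfolding u a_def b cc by (rule fraction_rearrange[OF fact_nonzero fact_nonzero fact_nonzero])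
  qed
  finally show ?thesis .
 qed
 note rec = this
 have "fps_exp 1 oo Abs_fps u = Abs_fps a"
 proof (rule fps_exp_compose_unique)
  show "fps_deriv (Abs_fps a) = fps_deriv (Abs_fps u) * Abs_fps a"
   by (rule fps_ext) (simp only: fps_deriv_nth fps_mult_nth atLeast0AtMost fps_nth_Abs_fps Suc_eq_plus1[symmetric] rec)
 qed (simp_all add: u_def a_def total_def)
 then show ?thesis unfolding u_def a_def C_def .
qed

section \<open>Counting Belyi maps\<close>

text \<open>An abstract orbit count. A framed object has exactly one combinatorial datum
  (\<open>a\<close>, \<open>b\<close>), framed objects with the same datum are isomorphic as such
  (\<open>c\<close>), isomorphisms keep the datum (\<open>d\<close>), automorphisms act freely on
  framings (\<open>e\<close>) and all data occur (\<open>f\<close>). Thus an object with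
  automorphism group A has N / |A| data, and these sets of data partition \<open>Cb\<close>.\<close>

lemma weighted_class_count:
 fixes M :: "'m set" and Fr :: "'m \<Rightarrow> 'f set" and RR :: "'m \<Rightarrow> 'f \<Rightarrow> 'c \<Rightarrow> bool"
  and iso :: "'m \<Rightarrow> 'm \<Rightarrow> 'h set" and act :: "'h \<Rightarrow> 'f \<Rightarrow> 'f" and N :: nat
 assumes Fr: "\<And>x. x \<in> M \<Longrightarrow> finite (Fr x) \<and> card (Fr x) = N" and N: "0 < N" and fin: "finite Cb"
  and a: "\<And>x \<phi>. x \<in> M \<Longrightarrow> \<phi> \<in> Fr x \<Longrightarrow> \<exists>c\<in>Cb. RR x \<phi> c"
  and b: "\<And>x \<phi> c c'. x \<in> M \<Longrightarrow> \<phi> \<in> Fr x \<Longrightarrow> RR x \<phi> c \<Longrightarrow> RR x \<phi> c' \<Longrightarrow> c = c'"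
  and c: "\<And>x y \<phi> \<psi> c. x \<in> M \<Longrightarrow> y \<in> M \<Longrightarrow> \<phi> \<in> Fr x \<Longrightarrow> \<psi> \<in> Fr y \<Longrightarrow> RR x \<phi> c \<Longrightarrow> RR y \<psi> c \<Longrightarrow> \<exists>h\<in>iso x y. act h \<phi> = \<psi>"
  and d: "\<And>x y h \<phi> c. x \<in> M \<Longrightarrow> y \<in> M \<Longrightarrow> h \<in> iso x y \<Longrightarrow> \<phi> \<in> Fr x \<Longrightarrow> RR x \<phi> c \<Longrightarrow> act h \<phi> \<in> Fr y \<and> RR y (act h \<phi>) c"
  and e: "\<And>x h h' \<phi>. x \<in> M \<Longrightarrow> h \<in> iso x x \<Longrightarrow> h' \<in> iso x x \<Longrightarrow> \<phi> \<in> Fr x \<Longrightarrow> act h \<phi> = act h' \<phi> \<Longrightarrow> h = h'"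
  and f: "\<And>c. c \<in> Cb \<Longrightarrow> \<exists>x\<in>M. \<exists>\<phi>\<in>Fr x. RR x \<phi> c"
 shows "(\<Sum>C\<in>M // {(x, y) \<in> M \<times> M. iso x y \<noteq> {}}. 1 / of_nat (card (iso (SOME x. x \<in> C) (SOME x. x \<in> C)))) = (of_nat (card Cb) / of_nat N :: rat)"
proof -
 define R where "R = {(x, y) \<in> M \<times> M. iso x y \<noteq> {}}"
 \<comment> \<open>All data of the object x under its various framings; isomorphic objects have the
   same data and other objects have disjoint sets.\<close>
 define K where "K x = {c. \<exists>\<phi>\<in>Fr x. RR x \<phi> c}" for x
 have Kne: "K x \<noteq> {}" if x: "x \<in> M" for x
 proof -
  have "Fr x \<noteq> {}" using Fr[OF x] N by (metis card.empty less_irrefl)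
  then obtain \<phi> where "\<phi> \<in> Fr x" by blast
  then show ?thesis using a[OF x] unfolding K_def by blast
 qed
 have KC: "K x \<subseteq> Cb" if x: "x \<in> M" for x
 proof
  fix c' assume "c' \<in> K x"
  then obtain \<phi> where p: "\<phi> \<in> Fr x" "RR x \<phi> c'" unfolding K_def by blast
  obtain c'' where "c'' \<in> Cb" "RR x \<phi> c''" using a[OF x p(1)] by blast
  then show "c' \<in> Cb" using b[OF x p(1) p(2)] by blast
 qed
 have meet: "iso x y \<noteq> {}" if x: "x \<in> M" "y \<in> M" and m: "c' \<in> K x" "c' \<in> K y" for x y c'
 proof -
  obtain \<phi> \<psi> where "\<phi> \<in> Fr x" "RR x \<phi> c'" "\<psi> \<in> Fr y" "RR y \<psi> c'" using m unfolding K_def by blast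
  then show ?thesis using c[OF x] by blast
 qed
 have sub: "K x \<subseteq> K y" if x: "x \<in> M" "y \<in> M" and ne: "iso x y \<noteq> {}" for x y
 proof
  fix c' assume "c' \<in> K x"
  then obtain \<phi> where p: "\<phi> \<in> Fr x" "RR x \<phi> c'" unfolding K_def by blast
  obtain h where "h \<in> iso x y" using ne by blast
  then show "c' \<in> K y" using d[OF x _ p] unfolding K_def by blast
 qed
 have iff: "iso x y \<noteq> {} \<longleftrightarrow> K x = K y" if x: "x \<in> M" "y \<in> M" for x y
 proof
  assume i: "iso x y \<noteq> {}"
  have s: "K x \<subseteq> K y" by (rule sub[OF x i])
  obtain c' where "c' \<in> K x" using Kne[OF x(1)] by blast
  then have "iso y x \<noteq> {}" using meet[OF x(2,1)] s by blast
  then show "K x = K y" using s sub[OF x(2,1)] by blast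
 next
  assume k: "K x = K y"
  obtain c' where "c' \<in> K x" using Kne[OF x(1)] by blast
  then show "iso x y \<noteq> {}" using meet[OF x] k by blast
 qed
 have disj: "K x = K y" if x: "x \<in> M" "y \<in> M" and ne: "K x \<inter> K y \<noteq> {}" for x y
 proof -
  obtain c' where "c' \<in> K x" "c' \<in> K y" using ne by blast
  then show ?thesis using iff[OF x] meet[OF x] by blast
 qed
 \<comment> \<open>The framings with a given datum form a free orbit of the automorphism
   group.\<close>
 have orbit: "card (iso x x) * card (K x) = N" if x: "x \<in> M" for x
 proof -
  define G where "G \<phi> = (THE c. RR x \<phi> c)" for \<phi>
  have G: "RR x \<phi> (G \<phi>)" if p: "\<phi> \<in> Fr x" for \<phi>
  proof -
   obtain c' where c': "RR x \<phi> c'" using a[OF x p] by blast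
   show ?thesis unfolding G_def
   proof (rule theI)
    show "y = c'" if "RR x \<phi> y" for y by (rule b[OF x p that c'])
   qed (rule c')
  qed
  have KG: "K x = G ` Fr x"
  proof
   show "K x \<subseteq> G ` Fr x"
   proof
    fix c' assume "c' \<in> K x"
    then obtain \<phi> where p: "\<phi> \<in> Fr x" "RR x \<phi> c'" unfolding K_def by blast
    then show "c' \<in> G ` Fr x" using b[OF x p(1) p(2) G[OF p(1)]] by blast
   qed
   show "G ` Fr x \<subseteq> K x" unfolding K_def using G by blast
  qed
  have fibre: "card {\<phi> \<in> Fr x. G \<phi> = c'} = card (iso x x)" if c': "c' \<in> G ` Fr x" for c'
  proof -
   obtain \<phi> where p: "c' = G \<phi>" "\<phi> \<in> Fr x" using c' by (rule imageE)
   have "bij_betw (\<lambda>h. act h \<phi>) (iso x x) {\<phi> \<in> Fr x. G \<phi> = c'}"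
   proof (rule bij_betw_imageI)
    show "inj_on (\<lambda>h. act h \<phi>) (iso x x)" by (rule inj_onI) (rule e[OF x _ _ p(2)], assumption+)
    show "(\<lambda>h. act h \<phi>) ` iso x x = {\<phi> \<in> Fr x. G \<phi> = c'}"
    proof
     show "(\<lambda>h. act h \<phi>) ` iso x x \<subseteq> {\<phi> \<in> Fr x. G \<phi> = c'}"
     proof (rule image_subsetI)
      fix h assume "h \<in> iso x x"
      from d[OF x x this p(2) G[OF p(2)]] have "act h \<phi> \<in> Fr x" "RR x (act h \<phi>) (G \<phi>)" by blast+
      then show "act h \<phi> \<in> {\<phi> \<in> Fr x. G \<phi> = c'}" using b[OF x _ G] p(1) by blast
     qed
     show "{\<phi> \<in> Fr x. G \<phi> = c'} \<subseteq> (\<lambda>h. act h \<phi>) ` iso x x"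
     proof
      fix \<psi> assume "\<psi> \<in> {\<phi> \<in> Fr x. G \<phi> = c'}"
      then have q: "\<psi> \<in> Fr x" "G \<psi> = G \<phi>" using p(1) by auto
      have "RR x \<psi> (G \<phi>)" using G[OF q(1)] q(2) by simp
      then obtain h where "h \<in> iso x x" "act h \<phi> = \<psi>" using c[OF x x p(2) q(1) G[OF p(2)]] by blast
      then show "\<psi> \<in> (\<lambda>h. act h \<phi>) ` iso x x" by blast
     qed
    qed
   qed
   then show ?thesis by (simp add: bij_betw_same_card)
  qed
  have "N = (\<Sum>c'\<in>G ` Fr x. card {\<phi> \<in> Fr x. G \<phi> = c'})"
   using Fr[OF x] sum.image_gen[of "Fr x" "\<lambda>_. 1::nat" G] by simp
  also have "\<dots> = (\<Sum>c'\<in>G ` Fr x. card (iso x x))" by (intro sum.cong refl fibre)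
  also have "\<dots> = card (iso x x) * card (K x)" unfolding KG by simp
  finally show ?thesis by simp
 qed
 define r where "r C = (SOME x. x \<in> C)" for C :: "'m set"
 have cls: "R `` {x} = {y \<in> M. K y = K x}" if x: "x \<in> M" for x
  unfolding R_def Image_singleton using iff[OF x] x by blast
 have C: "\<exists>x\<in>M. C = {y \<in> M. K y = K x}" if "C \<in> M // R" for C
  using that cls unfolding quotient_def by blast
 have rC: "r C \<in> M \<and> C = {y \<in> M. K y = K (r C)}" if cq: "C \<in> M // R" for C
 proof -
  obtain x where x: "x \<in> M" "C = {y \<in> M. K y = K x}" using C[OF cq] by blast
  then have "x \<in> C" by simp
  then have "r C \<in> C" unfolding r_def by (rule someI)
  then have "r C \<in> M" "K (r C) = K x" using x(2) by simp_all
  then show ?thesis using x(2) by simp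
 qed
 have inj: "inj_on (\<lambda>C. K (r C)) (M // R)"
 proof (rule inj_onI)
  fix C D assume cd: "C \<in> M // R" "D \<in> M // R" "K (r C) = K (r D)"
  have e: "C = {y \<in> M. K y = K (r C)}" "D = {y \<in> M. K y = K (r D)}" using rC cd(1,2) by blast+
  show "C = D" by (rule trans[OF e(1)[unfolded cd(3)] e(2)[symmetric]])
 qed
 have im: "(\<lambda>C. K (r C)) ` (M // R) = K ` M"
 proof
  show "(\<lambda>C. K (r C)) ` (M // R) \<subseteq> K ` M" using rC by blast
  show "K ` M \<subseteq> (\<lambda>C. K (r C)) ` (M // R)"
  proof (rule image_subsetI)
   fix x assume x: "x \<in> M"
   have cq: "R `` {x} \<in> M // R" by (rule quotientI[OF x])
   have "x \<in> R `` {x}" unfolding cls[OF x] using x by simp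
   moreover have "R `` {x} = {y \<in> M. K y = K (r (R `` {x}))}" using rC[OF cq] by blast
   ultimately have "K x = K (r (R `` {x}))" by blast
   then show "K x \<in> (\<lambda>C. K (r C)) ` (M // R)" using cq by blast
  qed
 qed
 have "(\<Sum>C\<in>M // R. 1 / of_nat (card (iso (r C) (r C)))) = (\<Sum>C\<in>M // R. of_nat (card (K (r C))) / of_nat N :: rat)"
 proof (intro sum.cong refl)
  fix C assume "C \<in> M // R"
  then have o: "card (iso (r C) (r C)) * card (K (r C)) = N" using orbit rC by blast
  then have "card (iso (r C) (r C)) \<noteq> 0" "card (K (r C)) \<noteq> 0" using N by (metis mult_0 less_irrefl, metis mult_0_right less_irrefl)
  then show "1 / of_nat (card (iso (r C) (r C))) = (of_nat (card (K (r C))) / of_nat N :: rat)"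
   unfolding o[symmetric] of_nat_mult by simp
 qed
 also have "\<dots> = (\<Sum>k\<in>K ` M. of_nat (card k) / of_nat N)"
  unfolding im[symmetric] sum.reindex[OF inj] comp_def ..
 also have "\<dots> = of_nat (\<Sum>k\<in>K ` M. card k) / of_nat N" by (simp only: of_nat_sum sum_divide_distrib)
 also have "(\<Sum>k\<in>K ` M. card k) = card (\<Union>(K ` M))"
 proof (rule card_Union_disjoint[symmetric])
  show "pairwise disjnt (K ` M)" unfolding pairwise_def disjnt_def using disj by blast
  show "\<And>A. A \<in> K ` M \<Longrightarrow> finite A" using KC finite_subset[OF _ fin] by blast
 qed
 also have "\<Union>(K ` M) = Cb"
 proof
  show "\<Union>(K ` M) \<subseteq> Cb" using KC by blast
  show "Cb \<subseteq> \<Union>(K ` M)" using f unfolding K_def by blast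
 qed
 finally show ?thesis unfolding r_def R_def .
qed

lemma card_bijections:
 assumes "finite A" "card A = card A'" "finite A'"
 shows "card {\<phi> \<in> extensional A. bij_betw \<phi> A A'} = fact (card A)" "finite {\<phi> \<in> extensional A. bij_betw \<phi> A A'}"
proof -
 obtain b where b: "bij_betw b A A'" using finite_same_card_bij[OF assms(1,3,2)] by blast
 have "bij_betw (\<lambda>p. restrict (b \<circ> p) A) {p. p permutes A} {\<phi> \<in> extensional A. bij_betw \<phi> A A'}"
 proof (rule bij_betw_imageI)
  show "inj_on (\<lambda>p. restrict (b \<circ> p) A) {p. p permutes A}"
  proof (rule inj_onI)
   fix p q assume pq: "p \<in> {p. p permutes A}" "q \<in> {p. p permutes A}" "restrict (b \<circ> p) A = restrict (b \<circ> q) A"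
   have p: "p permutes A" "q permutes A" using pq by auto
   show "p = q"
   proof
    fix u show "p u = q u"
    proof (cases "u \<in> A")
     case True
     have "b (p u) = b (q u)" using fun_cong[OF pq(3), of u] True by simp
     moreover have "p u \<in> A" "q u \<in> A" using True permutes_in_image[OF p(1)] permutes_in_image[OF p(2)] by blast+
     ultimately show ?thesis using bij_betw_imp_inj_on[OF b] by (simp add: inj_on_eq_iff)
    next
     case False then show ?thesis using permutes_not_in[OF p(1)] permutes_not_in[OF p(2)] by simp
    qed
   qed
  qed
  show "(\<lambda>p. restrict (b \<circ> p) A) ` {p. p permutes A} = {\<phi> \<in> extensional A. bij_betw \<phi> A A'}"
  proof
   show "(\<lambda>p. restrict (b \<circ> p) A) ` {p. p permutes A} \<subseteq> {\<phi> \<in> extensional A. bij_betw \<phi> A A'}"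
   proof (rule image_subsetI)
    fix p assume "p \<in> {p. p permutes A}"
    then have "bij_betw (b \<circ> p) A A'" using bij_betw_trans[OF permutes_imp_bij b] by simp
    then have "bij_betw (restrict (b \<circ> p) A) A A'" by (rule bij_betw_cong[THEN iffD1, rotated]) simp
    then show "restrict (b \<circ> p) A \<in> {\<phi> \<in> extensional A. bij_betw \<phi> A A'}" by simp
   qed
   show "{\<phi> \<in> extensional A. bij_betw \<phi> A A'} \<subseteq> (\<lambda>p. restrict (b \<circ> p) A) ` {p. p permutes A}"
   proof
    fix \<phi> assume "\<phi> \<in> {\<phi> \<in> extensional A. bij_betw \<phi> A A'}"
    then have p: "\<phi> \<in> extensional A" "bij_betw \<phi> A A'" by auto
    define p where "p u = (if u \<in> A then inv_into A b (\<phi> u) else u)" for u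
    have "bij_betw (inv_into A b \<circ> \<phi>) A A" by (rule bij_betw_trans[OF p(2) bij_betw_inv_into[OF b]])
    then have "bij_betw p A A" by (rule bij_betw_cong[THEN iffD1, rotated]) (simp add: p_def)
    then have "p permutes A" by (rule bij_imp_permutes) (simp add: p_def)
    moreover have "\<phi> = restrict (b \<circ> p) A"
    proof
     fix u show "\<phi> u = restrict (b \<circ> p) A u"
      using bij_betw_inv_into_right[OF b, of "\<phi> u"] bij_betwE[OF p(2)] extensional_arb[OF p(1), of u] by (simp add: p_def)
    qed
    ultimately show "\<phi> \<in> (\<lambda>p. restrict (b \<circ> p) A) ` {p. p permutes A}" by blast
   qed
  qed
 qed
 note bij = this
 show "card {\<phi> \<in> extensional A. bij_betw \<phi> A A'} = fact (card A)"
  using bij_betw_same_card[OF bij] card_permutations[OF refl assms(1)] by simp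
 show "finite {\<phi> \<in> extensional A. bij_betw \<phi> A A'}"
  using bij_betw_finite[OF bij] finite_permutations[OF assms(1)] by simp
qed

section \<open>The combinatorial data of framed Belyi maps\<close>

definition tperm :: "(nat \<Rightarrow> nat) \<times> (nat \<Rightarrow> nat) \<Rightarrow> 3 \<Rightarrow> nat \<Rightarrow> nat" where
 "tperm w i = (if i = 1 then fst w else if i = 2 then snd w else id)"

lemma tperm [simp]: "tperm w 1 = fst w" "tperm w 2 = snd w" "tperm w 3 = id"
 by (simp_all add: tperm_def)

lemma tperm_eq: "t 3 = id \<Longrightarrow> t = tperm (t 1, t 2)"
proof
 fix i assume "t 3 = id" then show "t i = tperm (t 1, t 2) i" using exhaust_3[of i] by (auto simp: tperm_def)
qed

text \<open>The rotation \<open>rot 3\<close> about the corner over infinity for the tiling with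
  permutations \<open>tperm w\<close>, so its cycles are the poles.\<close>

definition pole_perm :: "(nat \<Rightarrow> nat) \<times> (nat \<Rightarrow> nat) \<Rightarrow> nat \<Rightarrow> nat" where
 "pole_perm w = Hilbert_Choice.inv (snd w) \<circ> fst w"

context tiling
begin

lemma P1_cover: "P1_cover X f"
proof
 show "compact_space X" by (rule compact_X)
 show "\<exists>k. has_local_degree X P1 f y k" if "y \<in> topspace X" for y using branched_cover that by (simp add: branched_cover_def)
 show "has_local_degree X P1 f y 1" if "y \<in> topspace X" "f y \<notin> {Some 0, Some 1, None}" for y
  using unramified that by (simp add: unramified_over_def)
qed (fact Haus contf)+

lemma vertices_True: "vertices i = (\<lambda>p. S (True, p) (axis i 1)) ` {..<d}"
proof
 show "vertices i \<subseteq> (\<lambda>p. S (True, p) (axis i 1)) ` {..<d}"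
 proof
  fix z assume "z \<in> vertices i"
  then obtain p where "p < d" "z = S (True, p) (axis i 1)" by (rule vertex_True)
  then show "z \<in> (\<lambda>p. S (True, p) (axis i 1)) ` {..<d}" by blast
 qed
 show "(\<lambda>p. S (True, p) (axis i 1)) ` {..<d} \<subseteq> vertices i"
  unfolding vertices_def by (rule image_subsetI) (rule image_eqI[of _ _ "(True, _)"], simp_all add: tiles_def)
qed

lemma corner_orbit_eq: "p < d \<Longrightarrow> q < d \<Longrightarrow> S (True, p) (axis i 1) = S (True, q) (axis i 1) \<longleftrightarrow> orbit (rot i) p = orbit (rot i) q"
 using corner_orbit orbit_eq_iff[OF finite_lessThan rot_permutes] by simp

lemma card_vertices: "card (vertices i) = ncyc {..<d} (rot i)"
 unfolding vertices_True ncyc_def by (rule card_image_cong) (simp add: corner_orbit_eq)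

lemma rot_tperm:
 assumes "t = tperm w"
 shows "ncyc {..<d} (rot 1) = ncyc {..<d} (snd w)" "ncyc {..<d} (rot 2) = ncyc {..<d} (fst w)" "rot 3 = pole_perm w"
proof -
 have e: "(1::3) + 2 = 3" "(1::3) + 1 = 2" "(2::3) + 2 = 1" "(2::3) + 1 = 3" "(3::3) + 2 = 2" "(3::3) + 1 = 1" by simp_all
 have t12: "t 1 = fst w" "t 2 = snd w" "t 3 = id" unfolding assms tperm by (rule refl)+
 have p: "fst w permutes {..<d}" using perm[of 1] unfolding t12 .
 have "rot 1 = snd w" unfolding rot_def e t12 by (simp add: inv_id)
 then show "ncyc {..<d} (rot 1) = ncyc {..<d} (snd w)" by simp
 have "permutation (fst w)" using p by (auto simp: permutation_permutes)
 moreover have "rot 2 = Hilbert_Choice.inv (fst w)" unfolding rot_def e t12 by simp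
 ultimately show "ncyc {..<d} (rot 2) = ncyc {..<d} (fst w)" unfolding ncyc_def using orbit_inv_eq[of "fst w"] by simp
 show "rot 3 = pole_perm w" unfolding rot_def e t12 pole_perm_def ..
qed

text \<open>Because \<open>t 3\<close> is the identity, the two tiles with the same index are
  neighbours, and adjacency of tiles reduces to the action of the pair on indices.\<close>

lemma connected_iff_transitive:
 assumes t: "t = tperm w" and d: "0 < d"
 shows "connected_space X \<longleftrightarrow> transitive_on {..<d} (fst w) (snd w)"
 unfolding connected_iff
proof
 assume conn: "\<forall>x\<in>tiles d. \<forall>x'\<in>tiles d. (x, x') \<in> glue t d 0"
 show "transitive_on {..<d} (fst w) (snd w)" unfolding transitive_on_def
 proof (intro allI impI)
  fix K assume K: "K \<subseteq> {..<d}" "K \<noteq> {}" "fst w ` K \<subseteq> K" "snd w ` K \<subseteq> K"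
  have fK: "finite K" using K(1) finite_subset by blast
  have inv: "t i p \<in> K \<longleftrightarrow> p \<in> K" for i p
  proof -
   have "t i ` K \<subseteq> K" using K(3,4) unfolding t tperm_def by auto
   then have im: "t i ` K = K" by (rule invariant_image[OF fK perm])
   show ?thesis
   proof
    assume "t i p \<in> K"
    then obtain q where "q \<in> K" "t i p = t i q" using im by blast
    then show "p \<in> K" using permutes_inj[OF perm[of i]] by (simp add: inj_eq)
   qed (use im in blast)
  qed
  obtain p0 where p0: "p0 \<in> K" using K(2) by blast
  have "p \<in> K" if p: "p < d" for p
  proof -
   have "p0 < d" using p0 K(1) by blast
   then have "((True, p0), (True, p)) \<in> glue t d 0" using conn p by (simp add: tiles_def)
   then have "snd (True, p0) \<in> K \<longleftrightarrow> snd (True, p) \<in> K"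
    by (rule glue_invariant[where P = "\<lambda>x. snd x \<in> K"]) (simp add: inv)
   then show ?thesis using p0 by simp
  qed
  then show "K = {..<d}" using K(1) by blast
 qed
next
 assume tr: "transitive_on {..<d} (fst w) (snd w)"
 define K where "K = {p. p < d \<and> ((True, 0), (True, p)) \<in> glue t d 0}"
 have id: "((True, p), (False, p)) \<in> glue t d 0" if "p < d" for p
  using glue_step[of p d 0 3 t] that by (simp add: t)
 have st: "t i p \<in> K" if "p \<in> K" for i p
 proof -
  have p: "p < d" "((True, 0), (True, p)) \<in> glue t d 0" using that by (auto simp: K_def)
  have q: "t i p < d" using permutes_in_image[OF perm[of i], of p] p(1) by simp
  have "((True, p), (False, t i p)) \<in> glue t d 0" by (rule glue_step[OF p(1)]) simp
  then have "((True, 0), (True, t i p)) \<in> glue t d 0" using p(2) id[OF q] glue_trans glue_sym by metis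
  then show ?thesis using q by (simp add: K_def)
 qed
 have "K = {..<d}"
 proof (rule tr[unfolded transitive_on_def, rule_format])
  show "K \<subseteq> {..<d}" by (auto simp: K_def)
  have "0 \<in> K" using d by (simp add: K_def)
  then show "K \<noteq> {}" by blast
  show "fst w ` K \<subseteq> K" using st[of _ 1] by (auto simp: t)
  show "snd w ` K \<subseteq> K" using st[of _ 2] by (auto simp: t)
 qed
 then have all: "((True, 0), x) \<in> glue t d 0" if "x \<in> tiles d" for x
 proof -
  obtain s p where x: "x = (s, p)" by (metis surj_pair)
  then have p: "p < d" using that by (simp add: tiles_def)
  then have "p \<in> K" using \<open>K = {..<d}\<close> by simp
  then have g: "((True, 0), (True, p)) \<in> glue t d 0" by (simp add: K_def)
  show ?thesis
  proof (cases s)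
   case True then show ?thesis unfolding x using g by simp
  next
   case False then show ?thesis unfolding x using glue_trans[OF g id[OF p]] by simp
  qed
 qed
 then show "\<forall>x\<in>tiles d. \<forall>x'\<in>tiles d. (x, x') \<in> glue t d 0" using glue_trans glue_sym by metis
qed

lemma poles_vertices: "{p \<in> topspace X. f p = None} = vertices 3"
proof
 show "{p \<in> topspace X. f p = None} \<subseteq> vertices 3"
 proof
  fix y assume y: "y \<in> {p \<in> topspace X. f p = None}"
  then have "S (tile_of y) (bary (f y)) = y" "tile_of y \<in> tiles d" using tile_of[of y] by simp_all
  then have "S (tile_of y) (axis 3 1) = y" "tile_of y \<in> tiles d" using y bary_corner(3) by simp_all
  then show "y \<in> vertices 3" unfolding vertices_def by (metis imageI)
 qed
 show "vertices 3 \<subseteq> {p \<in> topspace X. f p = None}"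
 proof
  fix z assume "z \<in> vertices 3"
  then obtain x where x: "z = S x (axis 3 1)" "x \<in> tiles d" unfolding vertices_def by (rule imageE)
  then show "z \<in> {p \<in> topspace X. f p = None}" using fS[OF x(2) axis_in_tri[of 3]] kap_corner(3) by simp
 qed
qed

end

text \<open>The vertices over 0, 1 and infinity are disjoint sets, counted by the cycles of the
  three rotations. The inequality expresses that the rank of H_1 is non-negative.\<close>

lemma (in connected_tiling) genus_tperm:
 assumes "t = tperm w"
 shows "has_genus X g \<longleftrightarrow> ncyc {..<d} (fst w) + ncyc {..<d} (snd w) + ncyc {..<d} (pole_perm w) + 2 * g = d + 2"
  and "ncyc {..<d} (fst w) + ncyc {..<d} (snd w) + ncyc {..<d} (pole_perm w) \<le> d + 2"
proof -
 have b: "bary (f z) = axis i 1" if z: "z \<in> vertices i" for i z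
 proof -
  obtain x where x: "z = S x (axis i 1)" "x \<in> tiles d" using z unfolding vertices_def by (rule imageE)
  show ?thesis unfolding x(1) fS[OF x(2) axis_in_tri] by (rule bary_kap[OF axis_in_tri])
 qed
 have dj: "vertices i \<inter> vertices j = {}" if ij: "i \<noteq> j" for i j
 proof (rule equals0I)
  fix z assume "z \<in> vertices i \<inter> vertices j"
  then have "axis i (1::real) = axis j 1" using b[of z i] b[of z j] by simp
  then show False using ij by (simp add: axis_eq_axis)
 qed
 have fin: "finite (vertices i)" for i by (simp add: vertices_def)
 have "verts = vertices 1 \<union> (vertices 2 \<union> vertices 3)" by (simp only: verts_def UNIV_3 UN_insert UN_empty Un_empty_right)
 then have "card verts = card (vertices 1) + (card (vertices 2) + card (vertices 3))"
  using dj[of 1 2] dj[of 1 3] dj[of 2 3] fin by (simp add: card_Un_disjoint Int_Un_distrib)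
 then have v: "card verts = ncyc {..<d} (fst w) + ncyc {..<d} (snd w) + ncyc {..<d} (pole_perm w)"
  unfolding card_vertices rot_tperm[OF assms] by simp
 show "has_genus X g \<longleftrightarrow> ncyc {..<d} (fst w) + ncyc {..<d} (snd w) + ncyc {..<d} (pole_perm w) + 2 * g = d + 2"
  using has_genus_iff[of g] unfolding v .
 obtain r where "r + card verts = d + 2" by (rule homology_free) blast
 then show "ncyc {..<d} (fst w) + ncyc {..<d} (snd w) + ncyc {..<d} (pole_perm w) \<le> d + 2" unfolding v by simp
qed

lemma tiling_transport:
 assumes T: "tiling X f d t S" and h: "homeomorphic_map X X' h" and f': "continuous_map X' P1 f'" "\<And>y. y \<in> topspace X \<Longrightarrow> f' (h y) = f y"
 shows "tiling X' f' d t (\<lambda>x v. h (S x v))"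
proof -
 interpret tiling X f d t S by fact
 have inj: "inj_on h (topspace X)" and im: "h ` topspace X = topspace X'"
  using h homeomorphic_imp_injective_map homeomorphic_imp_surjective_map by blast+
 show ?thesis
 proof
  show "Hausdorff_space X'" using Haus h homeomorphic_Hausdorff_space homeomorphic_map_imp_homeomorphic_space by blast
  show "continuous_map (top_of_set tri) X' (\<lambda>v. h (S x v))" if "x \<in> tiles d" for x
   using continuous_map_compose[OF contS[OF that] homeomorphic_imp_continuous_map[OF h]] by (simp add: comp_def)
  show "f' (h (S x v)) = kap (fst x) v" if "x \<in> tiles d" "v \<in> tri" for x v
   using f'(2)[OF S_in[OF that]] fS[OF that] by simp
  show "\<exists>x\<in>tiles d. \<exists>v\<in>tri. y = h (S x v)" if y: "y \<in> topspace X'" for y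
  proof -
   obtain z where z: "y = h z" "z \<in> topspace X" using y im by blast
   obtain x v where "x \<in> tiles d" "v \<in> tri" "z = S x v" using cover[OF z(2)] by blast
   then show ?thesis unfolding z(1) by blast
  qed
  show "h (S x v) = h (S x' v) \<longleftrightarrow> (x, x') \<in> glue t d v" if "x \<in> tiles d" "x' \<in> tiles d" "v \<in> tri" for x x' v
   using S_eq[OF that] inj_on_eq_iff[OF inj S_in[OF that(1,3)] S_in[OF that(2,3)]] by simp
 qed (fact perm f')+
qed

text \<open>Upper tiles are the unique lifts from their centres, and lower tiles are fixed through
  side 3. The permutations are read off at the midpoints of the sides, where only two tiles
  meet.\<close>

lemma framing_unique:
 assumes T: "tiling X f d t S" and T': "tiling X f d t' S'" and t3: "t 3 = id" "t' 3 = id"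
  and \<phi>: "\<And>p. p < d \<Longrightarrow> S (True, p) ctr = S' (True, p) ctr"
 shows "t = t'" "\<And>x v. x \<in> tiles d \<Longrightarrow> v \<in> tri \<Longrightarrow> S x v = S' x v"
proof -
 interpret T: tiling X f d t S by fact
 interpret T': tiling X f d t' S' by fact
 interpret P1_cover X f by (rule T.P1_cover)
 have tl: "(s, p) \<in> tiles d" if "p < d" for s p using that by (simp add: tiles_def)
 have m: "midp i \<in> tri" for i by (rule ptri_tri[OF midp(1)])
 have agree: "S (s, p) v = S' (s, p) v" if p: "p < d" "a \<in> ptri" "S (s, p) a = S' (s, p) a" "v \<in> tri" for s p a v
 proof (rule sections_agree[where s = s and a = a])
  show "f (S (s, p) v) = kap s v" if "v \<in> tri" for v using T.fS[OF tl[OF p(1)] that] by simp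
  show "f (S' (s, p) v) = kap s v" if "v \<in> tri" for v using T'.fS[OF tl[OF p(1)] that] by simp
 qed (fact T.contS[OF tl[OF p(1)]] T'.contS[OF tl[OF p(1)]] p)+
 have tr: "S (True, p) v = S' (True, p) v" if "p < d" "v \<in> tri" for p v by (rule agree[OF that(1) ctr_ptri \<phi>[OF that(1)] that(2)])
 have lt: "t i p < d" "t' i p < d" if "p < d" for i p
  using permutes_in_image[OF T.perm[of i], of p] permutes_in_image[OF T'.perm[of i], of p] that by simp_all
 have st: "S (True, p) (midp i) = S (False, t i p) (midp i)" if "p < d" for p i
  using T.S_eq[OF tl[OF that] tl[OF lt(1)[OF that]] m] glue_step[OF that midp(2)] by blast
 have st': "S' (True, p) (midp i) = S' (False, t' i p) (midp i)" if "p < d" for p i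
  using T'.S_eq[OF tl[OF that] tl[OF lt(2)[OF that]] m] glue_step[OF that midp(2)] by blast
 have fl: "S (False, p) v = S' (False, p) v" if p: "p < d" "v \<in> tri" for p v
 proof (rule agree[OF p(1) midp(1)[of 3] _ p(2)])
  show "S (False, p) (midp 3) = S' (False, p) (midp 3)"
   using st[OF p(1), of 3] st'[OF p(1), of 3] tr[OF p(1) m[of 3]] unfolding t3 id_apply by metis
 qed
 show "S x v = S' x v" if x: "x \<in> tiles d" "v \<in> tri" for x v
 proof -
  obtain s p where sp: "x = (s, p)" by (metis surj_pair)
  then have p: "p < d" using x(1) by (simp add: tiles_def)
  show ?thesis
  proof (cases s)
   case True then show ?thesis using tr[OF p x(2)] sp by simp
  next
   case False then show ?thesis using fl[OF p x(2)] sp by simp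
  qed
 qed
 show "t = t'"
 proof (intro ext)
  fix i p show "t i p = t' i p"
  proof (cases "p < d")
   case True
   have "S (False, t i p) (midp i) = S' (False, t' i p) (midp i)"
    using st[OF True, of i] st'[OF True, of i] tr[OF True m[of i]] by simp
   also have "\<dots> = S (False, t' i p) (midp i)" using fl[OF lt(2)[OF True] m] by simp
   finally have g: "((False, t i p), (False, t' i p)) \<in> glue t d (midp i)"
    using T.S_eq[OF tl[OF lt(1)[OF True]] tl[OF lt(2)[OF True]] m] by blast
   have "midp i $ j \<noteq> 0" if "j \<noteq> i" for j using that by (simp add: midp_def)
   from glue_edge[OF T.perm midp(2) this g] show ?thesis by simp
  next
   case False
   then show ?thesis using permutes_not_in[OF T.perm[of i], of p] permutes_not_in[OF T'.perm[of i], of p] by simp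
  qed
 qed
qed

text \<open>Pole labels transferred to the sheets: l corresponds to a bijection from the cycles of
  \<open>pole_perm w\<close> to the n labels.\<close>

definition labelling :: "nat \<Rightarrow> nat \<Rightarrow> (nat \<Rightarrow> nat) \<times> (nat \<Rightarrow> nat) \<Rightarrow> (nat \<Rightarrow> nat) \<Rightarrow> bool" where
 "labelling d n w l \<longleftrightarrow> l \<in> extensional {..<d} \<and> l ` {..<d} = {..<n} \<and>
   (\<forall>p<d. \<forall>q<d. l p = l q \<longleftrightarrow> orbit (pole_perm w) p = orbit (pole_perm w) q)"

text \<open>The combinatorial counterpart of \<open>belyi_maps\<close>: the number of sheets with
  label i is the order of the i-th pole, and the last condition is Euler's formula.\<close>

definition combs :: "nat \<Rightarrow> nat list \<Rightarrow> (((nat \<Rightarrow> nat) \<times> (nat \<Rightarrow> nat)) \<times> (nat \<Rightarrow> nat)) set" where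
 "combs g \<mu> = {c. fst c \<in> transitive_pairs {..<sum_list \<mu>} \<and> labelling (sum_list \<mu>) (length \<mu>) (fst c) (snd c) \<and>
   (\<forall>i<length \<mu>. card {p. p < sum_list \<mu> \<and> snd c p = i} = \<mu> ! i) \<and>
   ncyc {..<sum_list \<mu>} (fst (fst c)) + ncyc {..<sum_list \<mu>} (snd (fst c)) + ncyc {..<sum_list \<mu>} (pole_perm (fst c)) + 2 * g = sum_list \<mu> + 2}"

text \<open>The centres of the upper tiles; a framing is a numbering of these points.\<close>

definition fibre :: "belyi \<Rightarrow> real set" where
 "fibre \<Gamma> = {y \<in> topspace (source \<Gamma>). proj \<Gamma> y = kap True ctr}"

definition framings :: "nat \<Rightarrow> belyi \<Rightarrow> (nat \<Rightarrow> real) set" where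
 "framings d \<Gamma> = {\<phi> \<in> extensional {..<d}. bij_betw \<phi> {..<d} (fibre \<Gamma>)}"

text \<open>The tile with centre \<open>\<phi> p\<close> has index p, and the label of the sheet p
  is that of the pole at corner 3 of this tile.\<close>

definition realizes :: "nat \<Rightarrow> nat \<Rightarrow> belyi \<Rightarrow> (nat \<Rightarrow> real) \<Rightarrow> ((nat \<Rightarrow> nat) \<times> (nat \<Rightarrow> nat)) \<times> (nat \<Rightarrow> nat) \<Rightarrow> bool" where
 "realizes d n \<Gamma> \<phi> c \<longleftrightarrow> (\<exists>S. tiling (source \<Gamma>) (proj \<Gamma>) d (tperm (fst c)) S \<and> (\<forall>p<d. S (True, p) ctr = \<phi> p) \<and>
   snd c \<in> extensional {..<d} \<and> (\<forall>p<d. snd c p < n \<and> pole \<Gamma> (snd c p) = S (True, p) (axis 3 1)))"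

text \<open>The conditions correspond one to one: connectedness to transitivity, genus to Euler's
  formula, and pole orders to the numbers of upper tiles at the poles, since local degrees are
  unique. The orders add up to the number of sheets.\<close>

lemma tiling_belyi_iff:
 assumes T: "tiling (source \<Gamma>) (proj \<Gamma>) d (tperm w) S" and d: "0 < d"
  and l: "l \<in> extensional {..<d}" "\<And>p. p < d \<Longrightarrow> l p < length \<mu> \<and> pole \<Gamma> (l p) = S (True, p) (axis 3 1)"
  and pole: "bij_betw (pole \<Gamma>) {..<length \<mu>} {p \<in> topspace (source \<Gamma>). proj \<Gamma> p = None}"
 shows "\<Gamma> \<in> belyi_maps g \<mu> \<longleftrightarrow> d = sum_list \<mu> \<and> (w, l) \<in> combs g \<mu>"
proof -
 interpret tiling "source \<Gamma>" "proj \<Gamma>" d "tperm w" S by (rule T)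
 let ?n = "length \<mu>"
 have inj: "inj_on (pole \<Gamma>) {..<?n}" by (rule bij_betw_imp_inj_on[OF pole])
 have eqS: "l p = i \<longleftrightarrow> S (True, p) (axis 3 1) = pole \<Gamma> i" if "p < d" "i < ?n" for p i
  using l(2)[OF that(1)] that(2) inj by (metis inj_on_eq_iff lessThan_iff)
 have surj: "\<exists>p<d. l p = i" if i: "i < ?n" for i
 proof -
  have "pole \<Gamma> i \<in> vertices 3" using bij_betwE[OF pole] i unfolding poles_vertices by blast
  then obtain p where "p < d" "pole \<Gamma> i = S (True, p) (axis 3 1)" by (rule vertex_True)
  then show ?thesis using eqS i by metis
 qed
 have im: "l ` {..<d} = {..<?n}" using l(2) surj by force
 have wp: "w \<in> perm_pairs {..<d}" using perm[of 1] perm[of 2] by (simp add: perm_pairs_def mem_Times_iff)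
 have lab: "labelling d ?n w l" unfolding labelling_def
 proof (intro conjI l(1) im allI impI)
  fix p q assume pq: "p < d" "q < d"
  have "l p = l q \<longleftrightarrow> S (True, p) (axis 3 1) = S (True, q) (axis 3 1)"
   using eqS[OF pq(1), of "l q"] l(2)[OF pq(2)] by metis
  then show "l p = l q \<longleftrightarrow> orbit (pole_perm w) p = orbit (pole_perm w) q"
   using corner_orbit_eq[OF pq, of 3] rot_tperm(3)[OF refl] by simp
 qed
 have deg: "has_local_degree (source \<Gamma>) P1 (proj \<Gamma>) (pole \<Gamma> i) k \<longleftrightarrow> card {p. p < d \<and> l p = i} = k" if i: "i < ?n" for i k
 proof -
  have "pole \<Gamma> i \<in> vertices 3" using bij_betwE[OF pole] i unfolding poles_vertices by blast
  then obtain p where p: "p < d" "pole \<Gamma> i = S (True, p) (axis 3 1)" by (rule vertex_True)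
  have "has_local_degree (source \<Gamma>) P1 (proj \<Gamma>) (pole \<Gamma> i) (card {p. p < d \<and> S (True, p) (axis 3 1) = pole \<Gamma> i})"
   by (rule vertex_local_degrees(1)[OF p])
  moreover have "{p. p < d \<and> S (True, p) (axis 3 1) = pole \<Gamma> i} = {p. p < d \<and> l p = i}" using eqS i by blast
  ultimately have L: "has_local_degree (source \<Gamma>) P1 (proj \<Gamma>) (pole \<Gamma> i) (card {p. p < d \<and> l p = i})" by (simp only:)
  show ?thesis
  proof
   assume "has_local_degree (source \<Gamma>) P1 (proj \<Gamma>) (pole \<Gamma> i) k"
   from local_degree_unique[OF L this] show "card {p. p < d \<and> l p = i} = k" .
  next
   assume "card {p. p < d \<and> l p = i} = k"
   then show "has_local_degree (source \<Gamma>) P1 (proj \<Gamma>) (pole \<Gamma> i) k" using L by (simp only:)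
  qed
 qed
 have cards: "(\<forall>i<?n. has_local_degree (source \<Gamma>) P1 (proj \<Gamma>) (pole \<Gamma> i) (\<mu> ! i)) \<longleftrightarrow> (\<forall>i<?n. card {p. p < d \<and> l p = i} = \<mu> ! i)"
  using deg by blast
 have dsum: "d = sum_list \<mu>" if "\<forall>i<?n. card {p. p < d \<and> l p = i} = \<mu> ! i"
 proof -
  have "d = (\<Sum>p<d. 1)" by simp
  also have "\<dots> = (\<Sum>i\<in>l ` {..<d}. \<Sum>p\<in>{p \<in> {..<d}. l p = i}. 1)" by (rule sum.image_gen) simp
  also have "\<dots> = (\<Sum>i<?n. card {p. p < d \<and> l p = i})" unfolding im by simp
  also have "\<dots> = (\<Sum>i<?n. \<mu> ! i)" using that by (intro sum.cong) simp_all
  also have "\<dots> = sum_list \<mu>" by (simp add: sum_list_sum_nth atLeast0LessThan)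
  finally show ?thesis .
 qed
 have conn: "connected_space (source \<Gamma>) \<longleftrightarrow> transitive_on {..<d} (fst w) (snd w)" by (rule connected_iff_transitive[OF refl d])
 have gen: "has_genus (source \<Gamma>) g \<longleftrightarrow> ncyc {..<d} (fst w) + ncyc {..<d} (snd w) + ncyc {..<d} (pole_perm w) + 2 * g = d + 2"
  if "connected_space (source \<Gamma>)"
 proof -
  interpret connected_tiling "source \<Gamma>" "proj \<Gamma>" d "tperm w" S by unfold_locales (fact that d)+
  show ?thesis by (rule genus_tperm(1)[OF refl])
 qed
 have surf: "compact_connected_surface (source \<Gamma>) \<longleftrightarrow> connected_space (source \<Gamma>)"
  using compact_connected_surface[OF _ d] by (auto simp: compact_connected_surface_def)
 have "\<Gamma> \<in> belyi_maps g \<mu> \<longleftrightarrow> connected_space (source \<Gamma>) \<and> has_genus (source \<Gamma>) g \<and> (\<forall>i<?n. card {p. p < d \<and> l p = i} = \<mu> ! i)"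
  unfolding belyi_maps_def using surf branched_cover unramified pole cards by simp
 also have "\<dots> \<longleftrightarrow> d = sum_list \<mu> \<and> (w, l) \<in> combs g \<mu>"
 proof
  assume L: "connected_space (source \<Gamma>) \<and> has_genus (source \<Gamma>) g \<and> (\<forall>i<?n. card {p. p < d \<and> l p = i} = \<mu> ! i)"
  then have ds: "sum_list \<mu> = d" using dsum by simp
  show "d = sum_list \<mu> \<and> (w, l) \<in> combs g \<mu>"
   unfolding combs_def mem_Collect_eq fst_conv snd_conv ds transitive_pairs_def using L conn gen lab wp by blast
 next
  assume R: "d = sum_list \<mu> \<and> (w, l) \<in> combs g \<mu>"
  then have ds: "sum_list \<mu> = d" by simp
  show "connected_space (source \<Gamma>) \<and> has_genus (source \<Gamma>) g \<and> (\<forall>i<?n. card {p. p < d \<and> l p = i} = \<mu> ! i)"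
   using R unfolding combs_def mem_Collect_eq fst_conv snd_conv ds transitive_pairs_def using conn gen by blast
 qed
 finally show ?thesis .
qed

lemma belyi_tiling:
 assumes \<Gamma>: "\<Gamma> \<in> belyi_maps g \<mu>" and \<phi>: "bij_betw \<phi> {..<d} (fibre \<Gamma>)" and d: "0 < d"
 shows "\<exists>c. c \<in> combs g \<mu> \<and> realizes d (length \<mu>) \<Gamma> \<phi> c \<and> d = sum_list \<mu>"
proof -
 have B: "compact_connected_surface (source \<Gamma>)" "branched_cover (source \<Gamma>) P1 (proj \<Gamma>)"
  "unramified_over (source \<Gamma>) P1 (proj \<Gamma>) (topspace P1 - {Some 0, Some 1, None})"
  "bij_betw (pole \<Gamma>) {..<length \<mu>} {p \<in> topspace (source \<Gamma>). proj \<Gamma> p = None}"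
  using \<Gamma> by (auto simp: belyi_maps_def)
 interpret P1_cover "source \<Gamma>" "proj \<Gamma>"
 proof
  show "has_local_degree (source \<Gamma>) P1 (proj \<Gamma>) y 1" if "y \<in> topspace (source \<Gamma>)" "proj \<Gamma> y \<notin> {Some 0, Some 1, None}" for y
   using B(3) that by (simp add: unramified_over_def)
 qed (use B in \<open>auto simp: compact_connected_surface_def branched_cover_def\<close>)
 have "bij_betw \<phi> {..<d} (centres True)" using \<phi> by (simp add: fibre_def centres_def)
 then obtain t S where T: "tiling (source \<Gamma>) (proj \<Gamma>) d t S" "t 3 = id" "\<And>p. p < d \<Longrightarrow> S (True, p) ctr = \<phi> p"
  by (rule tiling_of_framing) blast
 define w where "w = (t 1, t 2)"
 have tw: "t = tperm w" unfolding w_def by (rule tperm_eq[of t, OF T(2)])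
 interpret T: tiling "source \<Gamma>" "proj \<Gamma>" d "tperm w" S using T(1) unfolding tw .
 define l where "l = (\<lambda>p\<in>{..<d}. inv_into {..<length \<mu>} (pole \<Gamma>) (S (True, p) (axis 3 1)))"
 have l: "l p < length \<mu> \<and> pole \<Gamma> (l p) = S (True, p) (axis 3 1)" if p: "p < d" for p
 proof -
  have "S (True, p) (axis 3 1) \<in> T.vertices 3" unfolding T.vertices_True using p by simp
  then have S: "S (True, p) (axis 3 1) \<in> pole \<Gamma> ` {..<length \<mu>}" using bij_betw_imp_surj_on[OF B(4)] T.poles_vertices by simp
  show ?thesis using inv_into_into[OF S] f_inv_into_f[OF S] p by (simp add: l_def)
 qed
 have le: "l \<in> extensional {..<d}" by (simp add: l_def)
 have "d = sum_list \<mu> \<and> (w, l) \<in> combs g \<mu>"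
  using tiling_belyi_iff[OF T.tiling_axioms d le l B(4), of g] \<Gamma> by blast
 moreover have "realizes d (length \<mu>) \<Gamma> \<phi> (w, l)" unfolding realizes_def fst_conv snd_conv
  using T.tiling_axioms T(3) le l by blast
 ultimately show ?thesis by blast
qed

text \<open>\<open>belyi_tiling\<close> for a numbering of the whole fibre identifies its size with
  the sum of the pole orders. The fibre is non-empty because any point lies in a lifted triangle,
  which has an upper neighbour.\<close>

lemma card_fibre:
 assumes \<Gamma>: "\<Gamma> \<in> belyi_maps g \<mu>"
 shows "card (fibre \<Gamma>) = sum_list \<mu>" "finite (fibre \<Gamma>)" "0 < sum_list \<mu>"
proof -
 have B: "compact_connected_surface (source \<Gamma>)" "branched_cover (source \<Gamma>) P1 (proj \<Gamma>)"
  "unramified_over (source \<Gamma>) P1 (proj \<Gamma>) (topspace P1 - {Some 0, Some 1, None})"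
  using \<Gamma> by (auto simp: belyi_maps_def)
 interpret P1_cover "source \<Gamma>" "proj \<Gamma>"
 proof
  show "has_local_degree (source \<Gamma>) P1 (proj \<Gamma>) y 1" if "y \<in> topspace (source \<Gamma>)" "proj \<Gamma> y \<notin> {Some 0, Some 1, None}" for y
   using B(3) that by (simp add: unramified_over_def)
 qed (use B in \<open>auto simp: compact_connected_surface_def branched_cover_def\<close>)
 have fc: "fibre \<Gamma> = centres True" by (simp add: fibre_def centres_def)
 show fin: "finite (fibre \<Gamma>)" unfolding fc by (rule finite_centres)
 have "topspace (source \<Gamma>) \<noteq> {}" using B(1) unfolding compact_connected_surface_def by (elim conjE)
 then obtain y where y: "y \<in> topspace (source \<Gamma>)" by blast
 obtain s where s: "proj \<Gamma> y = kap s (bary (proj \<Gamma> y))" by (rule kap_cases)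
 obtain x where x: "x \<in> centres s" using sec_cover[OF y s bary_in_tri] by blast
 obtain x' where "x' \<in> centres True" by (rule edge_partner[OF x])
 then have pos: "0 < card (fibre \<Gamma>)" using fin unfolding fc by (simp add: card_gt_0_iff) blast
 obtain \<phi> where "bij_betw \<phi> {..<card (fibre \<Gamma>)} (fibre \<Gamma>)"
  using ex_bij_betw_nat_finite[OF fin] by (auto simp: atLeast0LessThan)
 from belyi_tiling[OF \<Gamma> this pos] show "card (fibre \<Gamma>) = sum_list \<mu>" by blast
 then show "0 < sum_list \<mu>" using pos by simp
qed

definition move :: "nat \<Rightarrow> (real \<Rightarrow> real) \<Rightarrow> (nat \<Rightarrow> real) \<Rightarrow> nat \<Rightarrow> real" where
 "move d h \<phi> = restrict (h \<circ> \<phi>) {..<d}"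

text \<open>By \<open>framing_unique\<close> the framing determines the permutations and the
  corners, and distinct labels belong to distinct poles.\<close>

lemma realizes_unique:
 assumes r: "realizes d n \<Gamma> \<phi> c" "realizes d n \<Gamma> \<phi> c'" and pole: "inj_on (pole \<Gamma>) {..<n}"
 shows "c = c'"
proof -
 obtain S where S: "tiling (source \<Gamma>) (proj \<Gamma>) d (tperm (fst c)) S" "\<And>p. p < d \<Longrightarrow> S (True, p) ctr = \<phi> p"
  "snd c \<in> extensional {..<d}" "\<And>p. p < d \<Longrightarrow> snd c p < n \<and> pole \<Gamma> (snd c p) = S (True, p) (axis 3 1)"
  using r(1) unfolding realizes_def by blast
 obtain S' where S': "tiling (source \<Gamma>) (proj \<Gamma>) d (tperm (fst c')) S'" "\<And>p. p < d \<Longrightarrow> S' (True, p) ctr = \<phi> p"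
  "snd c' \<in> extensional {..<d}" "\<And>p. p < d \<Longrightarrow> snd c' p < n \<and> pole \<Gamma> (snd c' p) = S' (True, p) (axis 3 1)"
  using r(2) unfolding realizes_def by blast
 have eq: "S (True, p) ctr = S' (True, p) ctr" if "p < d" for p using S(2) S'(2) that by simp
 have t: "tperm (fst c) = tperm (fst c')" by (rule framing_unique(1)[OF S(1) S'(1) tperm(3) tperm(3) eq])
 have "fst c = fst c'" using fun_cong[OF t, of 1] fun_cong[OF t, of 2] unfolding tperm by (rule prod_eqI)
 moreover have "snd c = snd c'"
 proof (rule extensionalityI[OF S(3) S'(3)])
  fix p assume "p \<in> {..<d}"
  then have p: "p < d" by simp
  have "S (True, p) (axis 3 1) = S' (True, p) (axis 3 1)"
   by (rule framing_unique(2)[OF S(1) S'(1) tperm(3) tperm(3) eq]) (use p in \<open>simp_all add: tiles_def\<close>)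
  then have "pole \<Gamma> (snd c p) = pole \<Gamma> (snd c' p)" using S(4)[OF p] S'(4)[OF p] by simp
  then show "snd c p = snd c' p" using inj_on_eq_iff[OF pole, of "snd c p" "snd c' p"] S(4)[OF p] S'(4)[OF p] by simp
 qed
 ultimately show ?thesis by (rule prod_eqI)
qed

text \<open>Equal permutations give homeomorphic tilings. Every label occurs on some sheet, so all
  poles are matched by the corners of tiles.\<close>

lemma realizes_iso:
 assumes r: "realizes d n \<Gamma> \<phi> c" "realizes d n \<Gamma>' \<phi>' c" and lab: "snd c ` {..<d} = {..<n}"
  and \<phi>: "\<phi> \<in> framings d \<Gamma>" "\<phi>' \<in> framings d \<Gamma>'"
 shows "\<exists>h\<in>belyi_isos n \<Gamma> \<Gamma>'. move d h \<phi> = \<phi>'"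
proof -
 obtain S where S: "tiling (source \<Gamma>) (proj \<Gamma>) d (tperm (fst c)) S" "\<And>p. p < d \<Longrightarrow> S (True, p) ctr = \<phi> p"
  "\<And>p. p < d \<Longrightarrow> snd c p < n \<and> pole \<Gamma> (snd c p) = S (True, p) (axis 3 1)"
  using r(1) unfolding realizes_def by blast
 obtain S' where S': "tiling (source \<Gamma>') (proj \<Gamma>') d (tperm (fst c)) S'" "\<And>p. p < d \<Longrightarrow> S' (True, p) ctr = \<phi>' p"
  "\<And>p. p < d \<Longrightarrow> snd c p < n \<and> pole \<Gamma>' (snd c p) = S' (True, p) (axis 3 1)"
  using r(2) unfolding realizes_def by blast
 interpret T: tiling "source \<Gamma>" "proj \<Gamma>" d "tperm (fst c)" S by (rule S(1))
 obtain h where h: "homeomorphic_map (source \<Gamma>) (source \<Gamma>') h" "\<And>x v. x \<in> tiles d \<Longrightarrow> v \<in> tri \<Longrightarrow> h (S x v) = S' x v"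
  "\<And>y. y \<in> topspace (source \<Gamma>) \<Longrightarrow> proj \<Gamma>' (h y) = proj \<Gamma> y"
  by (rule tiling_homeomorphic[OF S(1) S'(1)]) blast
 define k where "k = restrict h (topspace (source \<Gamma>))"
 have tl: "(True, p) \<in> tiles d" if "p < d" for p using that by (simp add: tiles_def)
 have kS: "k (S (True, p) v) = S' (True, p) v" if "p < d" "v \<in> tri" for p v
  using h(2)[OF tl[OF that(1)] that(2)] T.S_in[OF tl[OF that(1)] that(2)] by (simp add: k_def)
 have "k \<in> belyi_isos n \<Gamma> \<Gamma>'" unfolding belyi_isos_def
 proof (intro CollectI conjI ballI allI impI)
  show "k \<in> extensional (topspace (source \<Gamma>))" by (simp add: k_def)
  show "homeomorphic_map (source \<Gamma>) (source \<Gamma>') k" by (rule homeomorphic_map_eq[OF h(1)]) (simp add: k_def)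
  show "proj \<Gamma>' (k q) = proj \<Gamma> q" if "q \<in> topspace (source \<Gamma>)" for q using h(3)[OF that] that by (simp add: k_def)
  fix i assume "i < n"
  then have "i \<in> snd c ` {..<d}" using lab by simp
  then obtain p where p: "i = snd c p" "p < d" by auto
  have "pole \<Gamma> i = S (True, p) (axis 3 1)" "pole \<Gamma>' i = S' (True, p) (axis 3 1)" using S(3)[OF p(2)] S'(3)[OF p(2)] p(1) by simp_all
  then show "k (pole \<Gamma> i) = pole \<Gamma>' i" using kS[OF p(2) axis_in_tri] by simp
 qed
 moreover have "move d k \<phi> = \<phi>'"
 proof (rule extensionalityI)
  show "move d k \<phi> \<in> extensional {..<d}" by (simp add: move_def)
  show "\<phi>' \<in> extensional {..<d}" using \<phi>(2) by (simp add: framings_def)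
  fix p assume "p \<in> {..<d}"
  then have p: "p < d" by simp
  show "move d k \<phi> p = \<phi>' p" using kS[OF p ptri_tri[OF ctr_ptri]] S(2)[OF p] S'(2)[OF p] p by (simp add: move_def)
 qed
 ultimately show ?thesis by blast
qed

lemma realizes_move:
 assumes h: "h \<in> belyi_isos n \<Gamma> \<Gamma>'" and \<phi>: "\<phi> \<in> framings d \<Gamma>" and r: "realizes d n \<Gamma> \<phi> c" and f': "continuous_map (source \<Gamma>') P1 (proj \<Gamma>')"
 shows "move d h \<phi> \<in> framings d \<Gamma>' \<and> realizes d n \<Gamma>' (move d h \<phi>) c"
proof
 have H: "homeomorphic_map (source \<Gamma>) (source \<Gamma>') h" "\<And>q. q \<in> topspace (source \<Gamma>) \<Longrightarrow> proj \<Gamma>' (h q) = proj \<Gamma> q"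
  "\<And>i. i < n \<Longrightarrow> h (pole \<Gamma> i) = pole \<Gamma>' i" using h by (auto simp: belyi_isos_def)
 have inj: "inj_on h (topspace (source \<Gamma>))" and im: "h ` topspace (source \<Gamma>) = topspace (source \<Gamma>')"
  using H(1) homeomorphic_imp_injective_map homeomorphic_imp_surjective_map by blast+
 have "bij_betw h (fibre \<Gamma>) (fibre \<Gamma>')"
 proof (rule bij_betw_imageI)
  show "inj_on h (fibre \<Gamma>)" by (rule inj_on_subset[OF inj]) (auto simp: fibre_def)
  show "h ` fibre \<Gamma> = fibre \<Gamma>'"
  proof
   show "h ` fibre \<Gamma> \<subseteq> fibre \<Gamma>'" using im H(2) by (auto simp: fibre_def)
   show "fibre \<Gamma>' \<subseteq> h ` fibre \<Gamma>"
   proof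
    fix y assume "y \<in> fibre \<Gamma>'"
    then have y: "y \<in> topspace (source \<Gamma>')" "proj \<Gamma>' y = kap True ctr" by (simp_all add: fibre_def)
    obtain z where z: "z \<in> topspace (source \<Gamma>)" "y = h z" using y(1) im by blast
    then have "z \<in> fibre \<Gamma>" using y(2) H(2)[OF z(1)] by (simp add: fibre_def)
    then show "y \<in> h ` fibre \<Gamma>" using z(2) by blast
   qed
  qed
 qed
 then have "bij_betw (h \<circ> \<phi>) {..<d} (fibre \<Gamma>')" using bij_betw_trans[of \<phi> "{..<d}" "fibre \<Gamma>"] \<phi> by (simp add: framings_def)
 then have "bij_betw (move d h \<phi>) {..<d} (fibre \<Gamma>')" unfolding move_def by (rule bij_betw_cong[THEN iffD1, rotated]) simp
 then show "move d h \<phi> \<in> framings d \<Gamma>'" by (simp add: framings_def move_def)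
 obtain S where S: "tiling (source \<Gamma>) (proj \<Gamma>) d (tperm (fst c)) S" "\<And>p. p < d \<Longrightarrow> S (True, p) ctr = \<phi> p"
  "snd c \<in> extensional {..<d}" "\<And>p. p < d \<Longrightarrow> snd c p < n \<and> pole \<Gamma> (snd c p) = S (True, p) (axis 3 1)"
  using r unfolding realizes_def by blast
 have "tiling (source \<Gamma>') (proj \<Gamma>') d (tperm (fst c)) (\<lambda>x v. h (S x v))" by (rule tiling_transport[OF S(1) H(1) f' H(2)])
 moreover have "h (S (True, p) ctr) = move d h \<phi> p" if "p < d" for p using S(2)[OF that] that by (simp add: move_def)
 moreover have "snd c p < n \<and> pole \<Gamma>' (snd c p) = h (S (True, p) (axis 3 1))" if "p < d" for p
  using S(4)[OF that] H(3) by metis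
 ultimately show "realizes d n \<Gamma>' (move d h \<phi>) c" unfolding realizes_def using S(3)
  by (intro exI[of _ "\<lambda>x v. h (S x v)"]) simp
qed

text \<open>Moving the tiling by either map gives a tiling with the same framing, and
  \<open>framing_unique\<close> applies.\<close>

lemma iso_determined:
 assumes h: "h \<in> belyi_isos n \<Gamma> \<Gamma>" "h' \<in> belyi_isos n \<Gamma> \<Gamma>" and r: "realizes d n \<Gamma> \<phi> c" and eq: "move d h \<phi> = move d h' \<phi>"
 shows "h = h'"
proof -
 have H: "homeomorphic_map (source \<Gamma>) (source \<Gamma>) h" "\<And>q. q \<in> topspace (source \<Gamma>) \<Longrightarrow> proj \<Gamma> (h q) = proj \<Gamma> q" "h \<in> extensional (topspace (source \<Gamma>))"
  using h(1) by (auto simp: belyi_isos_def)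
 have H': "homeomorphic_map (source \<Gamma>) (source \<Gamma>) h'" "\<And>q. q \<in> topspace (source \<Gamma>) \<Longrightarrow> proj \<Gamma> (h' q) = proj \<Gamma> q" "h' \<in> extensional (topspace (source \<Gamma>))"
  using h(2) by (auto simp: belyi_isos_def)
 obtain S where S: "tiling (source \<Gamma>) (proj \<Gamma>) d (tperm (fst c)) S" "\<And>p. p < d \<Longrightarrow> S (True, p) ctr = \<phi> p"
  using r unfolding realizes_def by blast
 interpret T: tiling "source \<Gamma>" "proj \<Gamma>" d "tperm (fst c)" S by (rule S(1))
 have T1: "tiling (source \<Gamma>) (proj \<Gamma>) d (tperm (fst c)) (\<lambda>x v. h (S x v))" by (rule tiling_transport[OF S(1) H(1) T.contf H(2)])
 have T2: "tiling (source \<Gamma>) (proj \<Gamma>) d (tperm (fst c)) (\<lambda>x v. h' (S x v))" by (rule tiling_transport[OF S(1) H'(1) T.contf H'(2)])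
 have e: "h (S (True, p) ctr) = h' (S (True, p) ctr)" if "p < d" for p
  using fun_cong[OF eq, of p] S(2)[OF that] that by (simp add: move_def)
 show ?thesis
 proof (rule extensionalityI[OF H(3) H'(3)])
  fix y assume "y \<in> topspace (source \<Gamma>)"
  then obtain x v where x: "x \<in> tiles d" "v \<in> tri" "y = S x v" using T.cover by blast
  show "h y = h' y" unfolding x(3) by (rule framing_unique(2)[OF T1 T2 tperm(3) tperm(3) e x(1,2)])
 qed
qed

text \<open>The surface glued from the pair, with the i-th pole at corner 3 of any upper tile
  labelled i.\<close>

lemma combs_realized:
 assumes c: "c \<in> combs g \<mu>" and d: "0 < sum_list \<mu>"
 shows "\<exists>\<Gamma>\<in>belyi_maps g \<mu>. \<exists>\<phi>\<in>framings (sum_list \<mu>) \<Gamma>. realizes (sum_list \<mu>) (length \<mu>) \<Gamma> \<phi> c"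
proof -
 define d where "d = sum_list \<mu>"
 define w where "w = fst c"
 define l where "l = snd c"
 have cw: "c = (w, l)" by (simp add: w_def l_def)
 have C: "w \<in> perm_pairs {..<d}" "labelling d (length \<mu>) w l" using c by (auto simp: combs_def d_def w_def l_def transitive_pairs_def)
 have perm: "tperm w i permutes {..<d}" for i
  using C(1) by (auto simp: tperm_def perm_pairs_def permutes_id)
 obtain X :: "real topology" and f S where T: "tiling X f d (tperm w) S" using tiling_exists[of "tperm w" d] perm by metis
 interpret tiling X f d "tperm w" S by (rule T)
 have lab: "l \<in> extensional {..<d}" "l ` {..<d} = {..<length \<mu>}"
  "\<And>p q. p < d \<Longrightarrow> q < d \<Longrightarrow> l p = l q \<longleftrightarrow> orbit (pole_perm w) p = orbit (pole_perm w) q"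
  using C(2) by (auto simp: labelling_def)
 have lS: "l p = l q \<longleftrightarrow> S (True, p) (axis 3 1) = S (True, q) (axis 3 1)" if "p < d" "q < d" for p q
  using lab(3)[OF that] corner_orbit_eq[OF that, of 3] rot_tperm(3)[OF refl] by simp
 define po where "po i = S (True, inv_into {..<d} l i) (axis 3 1)" for i
 have inv: "inv_into {..<d} l i < d" "l (inv_into {..<d} l i) = i" if "i < length \<mu>" for i
  using inv_into_into[of i l "{..<d}"] f_inv_into_f[of i l "{..<d}"] lab(2) that by auto
 have pl: "po (l p) = S (True, p) (axis 3 1)" and ll: "l p < length \<mu>" if p: "p < d" for p
 proof -
  show lp: "l p < length \<mu>" using lab(2) p by blast
  show "po (l p) = S (True, p) (axis 3 1)" unfolding po_def using lS[OF inv(1)[OF lp] p] inv(2)[OF lp] by blast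
 qed
 define \<Gamma> where "\<Gamma> = \<lparr>source = X, proj = f, pole = po\<rparr>"
 have G: "source \<Gamma> = X" "proj \<Gamma> = f" "pole \<Gamma> = po" by (simp_all add: \<Gamma>_def)
 have bij: "bij_betw po {..<length \<mu>} {p \<in> topspace X. f p = None}"
 proof (rule bij_betw_imageI)
  show "inj_on po {..<length \<mu>}"
  proof (rule inj_onI)
   fix i j assume ij: "i \<in> {..<length \<mu>}" "j \<in> {..<length \<mu>}" "po i = po j"
   then have i: "i < length \<mu>" "j < length \<mu>" by simp_all
   have "l (inv_into {..<d} l i) = l (inv_into {..<d} l j)" using lS[OF inv(1)[OF i(1)] inv(1)[OF i(2)]] ij(3) unfolding po_def by blast
   then show "i = j" using inv(2)[OF i(1)] inv(2)[OF i(2)] by simp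
  qed
  have "po ` {..<length \<mu>} = (\<lambda>p. po (l p)) ` {..<d}" using lab(2) by (metis image_image)
  also have "\<dots> = vertices 3" unfolding vertices_True using pl by (intro image_cong) simp_all
  finally show "po ` {..<length \<mu>} = {p \<in> topspace X. f p = None}" unfolding poles_vertices .
 qed
 have tl: "(True, p) \<in> tiles d" if "p < d" for p using that by (simp add: tiles_def)
 have ct: "ctr \<in> tri" by (rule ptri_tri[OF ctr_ptri])
 have "\<Gamma> \<in> belyi_maps g \<mu>"
  using tiling_belyi_iff[of \<Gamma> d w S l \<mu> g] T d lab(1) pl ll bij c unfolding G d_def cw by blast
 define \<phi> where "\<phi> = (\<lambda>p\<in>{..<d}. S (True, p) ctr)"
 have "bij_betw \<phi> {..<d} (fibre \<Gamma>)"
 proof (rule bij_betw_imageI)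
  show "inj_on \<phi> {..<d}"
  proof (rule inj_onI)
   fix p q assume pq: "p \<in> {..<d}" "q \<in> {..<d}" "\<phi> p = \<phi> q"
   then have "S (True, p) ctr = S (True, q) ctr" by (simp add: \<phi>_def)
   then have "((True, p), (True, q)) \<in> glue (tperm w) d ctr" using S_eq[OF tl tl ct, of p q] pq(1,2) by simp
   moreover have "glue (tperm w) d ctr = Id" by (rule glue_interior) (simp add: ctr_def)
   ultimately show "p = q" by simp
  qed
  show "\<phi> ` {..<d} = fibre \<Gamma>"
  proof
   show "\<phi> ` {..<d} \<subseteq> fibre \<Gamma>"
   proof (rule image_subsetI)
    fix p assume "p \<in> {..<d}"
    then have p: "p < d" by simp
    show "\<phi> p \<in> fibre \<Gamma>" using fS[OF tl[OF p] ct] S_in[OF tl[OF p] ct] p by (simp add: \<phi>_def fibre_def G)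
   qed
   show "fibre \<Gamma> \<subseteq> \<phi> ` {..<d}"
   proof
    fix y assume "y \<in> fibre \<Gamma>"
    then have y: "y \<in> topspace X" "f y = kap True ctr" by (simp_all add: fibre_def G)
    obtain x v where x: "x \<in> tiles d" "v \<in> tri" "y = S x v" using cover[OF y(1)] by blast
    have "kap (fst x) v = kap True ctr" using fS[OF x(1,2)] x(3) y(2) by simp
    then have "v = ctr \<and> (fst x = True \<or> (\<exists>i. v $ i = 0))" using kap_eq_iff[OF x(2) ct, of "fst x" True] by blast
    then have vx: "v = ctr" "fst x" by (auto simp: ctr_def)
    have "snd x < d" using x(1) by (simp add: tiles_def mem_Times_iff)
    moreover have "x = (True, snd x)" using vx(2) by (simp add: prod_eq_iff)
    ultimately have "y = \<phi> (snd x)" using x(3) vx(1) by (simp add: \<phi>_def)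
    then show "y \<in> \<phi> ` {..<d}" using \<open>snd x < d\<close> by blast
   qed
  qed
 qed
 then have fr: "\<phi> \<in> framings d \<Gamma>" by (simp add: framings_def \<phi>_def)
 have "realizes d (length \<mu>) \<Gamma> \<phi> c" unfolding realizes_def cw fst_conv snd_conv G
  by (intro exI[of _ S] conjI T lab(1) allI impI) (simp_all add: \<phi>_def pl ll)
 then show ?thesis using \<open>\<Gamma> \<in> belyi_maps g \<mu>\<close> fr unfolding d_def by blast
qed

lemma finite_combs: "finite (combs g \<mu>)"
proof -
 have "combs g \<mu> \<subseteq> perm_pairs {..<sum_list \<mu>} \<times> ({..<sum_list \<mu>} \<rightarrow>\<^sub>E {..<length \<mu>})"
 proof
  fix c assume c: "c \<in> combs g \<mu>"
  then have "fst c \<in> perm_pairs {..<sum_list \<mu>}" "labelling (sum_list \<mu>) (length \<mu>) (fst c) (snd c)"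
   by (auto simp: combs_def transitive_pairs_def)
  moreover from this(2) have "snd c \<in> {..<sum_list \<mu>} \<rightarrow>\<^sub>E {..<length \<mu>}"
   unfolding labelling_def by (auto simp: PiE_def)
  ultimately show "c \<in> perm_pairs {..<sum_list \<mu>} \<times> ({..<sum_list \<mu>} \<rightarrow>\<^sub>E {..<length \<mu>})" by (simp add: mem_Times_iff)
 qed
 then show ?thesis by (rule finite_subset) (intro finite_cartesian_product finite_perm_pairs finite_PiE; simp)
qed

text \<open>This is \<open>weighted_class_count\<close> with the d! numberings of the fibre as
  framings.\<close>

theorem B_eq_card_combs:
 assumes d: "0 < sum_list \<mu>" shows "B g \<mu> = of_nat (card (combs g \<mu>)) / fact (sum_list \<mu>)"
proof -
 let ?d = "sum_list \<mu>" and ?n = "length \<mu>"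
 have "B g \<mu> = (\<Sum>C\<in>belyi_maps g \<mu> // {(x, y) \<in> belyi_maps g \<mu> \<times> belyi_maps g \<mu>. belyi_isos ?n x y \<noteq> {}}.
   1 / of_nat (card (belyi_isos ?n (SOME x. x \<in> C) (SOME x. x \<in> C))))"
  unfolding B_def belyi_classes_def belyi_rel_def aut_count_def Let_def ..
 also have "\<dots> = of_nat (card (combs g \<mu>)) / of_nat (fact ?d)"
 proof (rule weighted_class_count[where Fr = "framings ?d" and RR = "realizes ?d ?n" and act = "move ?d"])
  fix x assume x: "x \<in> belyi_maps g \<mu>"
  show "finite (framings ?d x) \<and> card (framings ?d x) = fact ?d"
   using card_bijections[of "{..<?d}" "fibre x"] card_fibre[OF x] by (simp add: framings_def)
  have pole: "inj_on (pole x) {..<?n}" using x by (auto simp: belyi_maps_def bij_betw_def)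
  fix \<phi> assume \<phi>: "\<phi> \<in> framings ?d x"
  then have b: "bij_betw \<phi> {..<?d} (fibre x)" by (simp add: framings_def)
  show "\<exists>c\<in>combs g \<mu>. realizes ?d ?n x \<phi> c" using belyi_tiling[OF x b d] by blast
  show "c = c'" if "realizes ?d ?n x \<phi> c" "realizes ?d ?n x \<phi> c'" for c c' by (rule realizes_unique[OF that pole])
  show "h = h'" if "h \<in> belyi_isos ?n x x" "h' \<in> belyi_isos ?n x x" "move ?d h \<phi> = move ?d h' \<phi>" for h h'
   using belyi_tiling[OF x b d] iso_determined[OF that(1,2) _ that(3)] by blast
  fix y assume y: "y \<in> belyi_maps g \<mu>"
  have cy: "continuous_map (source y) P1 (proj y)" using y by (simp add: belyi_maps_def branched_cover_def)
  show "move ?d h \<phi> \<in> framings ?d y \<and> realizes ?d ?n y (move ?d h \<phi>) c" if "h \<in> belyi_isos ?n x y" "realizes ?d ?n x \<phi> c" for h c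
   by (rule realizes_move[OF that(1) \<phi> that(2) cy])
  show "\<exists>h\<in>belyi_isos ?n x y. move ?d h \<phi> = \<psi>"
   if \<psi>: "\<psi> \<in> framings ?d y" and r: "realizes ?d ?n x \<phi> c" "realizes ?d ?n y \<psi> c" for \<psi> c
  proof -
   obtain c' where c': "c' \<in> combs g \<mu>" "realizes ?d ?n x \<phi> c'" using belyi_tiling[OF x b d] by blast
   have "c = c'" by (rule realizes_unique[OF r(1) c'(2) pole])
   then have "snd c ` {..<?d} = {..<?n}" using c'(1) by (auto simp: combs_def labelling_def)
   then show ?thesis by (rule realizes_iso[OF r _ \<phi> \<psi>])
  qed
 next
  fix c assume "c \<in> combs g \<mu>"
  then show "\<exists>x\<in>belyi_maps g \<mu>. \<exists>\<phi>\<in>framings ?d x. realizes ?d ?n x \<phi> c" by (rule combs_realized[OF _ d])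
 qed (simp_all add: finite_combs)
 finally show ?thesis by simp
qed

section \<open>The generating series\<close>

text \<open>Composing with the map to cycles identifies labellings with bijections from the set of
  cycles to the labels.\<close>

lemma card_labellings:
 assumes w: "w \<in> perm_pairs {..<d}"
 shows "card {l. labelling d (ncyc {..<d} (pole_perm w)) w l} = fact (ncyc {..<d} (pole_perm w))" (is "card ?L = fact ?n")
proof -
 define O1 where "O1 = orbit (pole_perm w) ` {..<d}"
 let ?o = "orbit (pole_perm w)"
 have n: "?n = card O1" by (simp add: ncyc_def O1_def)
 have fin: "finite O1" by (simp add: O1_def)
 define \<Phi> where "\<Phi> = {\<phi> \<in> extensional O1. bij_betw \<phi> O1 {..<?n}}"
 have "bij_betw (\<lambda>\<phi>. restrict (\<phi> \<circ> ?o) {..<d}) \<Phi> ?L"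
 proof (rule bij_betw_imageI)
  show "inj_on (\<lambda>\<phi>. restrict (\<phi> \<circ> ?o) {..<d}) \<Phi>"
  proof (rule inj_onI)
   fix \<phi> \<psi> assume a: "\<phi> \<in> \<Phi>" "\<psi> \<in> \<Phi>" "restrict (\<phi> \<circ> ?o) {..<d} = restrict (\<psi> \<circ> ?o) {..<d}"
   show "\<phi> = \<psi>"
   proof (rule extensionalityI[of _ O1])
    fix u assume "u \<in> O1"
    then obtain p where p: "u = ?o p" "p \<in> {..<d}" unfolding O1_def by (rule imageE)
    show "\<phi> u = \<psi> u" using fun_cong[OF a(3), of p] p by simp
   qed (use a in \<open>simp_all add: \<Phi>_def\<close>)
  qed
  show "(\<lambda>\<phi>. restrict (\<phi> \<circ> ?o) {..<d}) ` \<Phi> = ?L"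
  proof
   show "(\<lambda>\<phi>. restrict (\<phi> \<circ> ?o) {..<d}) ` \<Phi> \<subseteq> ?L"
   proof (rule image_subsetI)
    fix \<phi> assume "\<phi> \<in> \<Phi>"
    then have b: "bij_betw \<phi> O1 {..<?n}" by (simp add: \<Phi>_def)
    have i: "\<phi> ` O1 = {..<?n}" by (rule bij_betw_imp_surj_on[OF b])
    have "restrict (\<phi> \<circ> ?o) {..<d} ` {..<d} = \<phi> ` O1" unfolding O1_def image_image by (intro image_cong) simp_all
    moreover have "\<phi> (?o p) = \<phi> (?o q) \<longleftrightarrow> ?o p = ?o q" if "p < d" "q < d" for p q
     using inj_on_eq_iff[OF bij_betw_imp_inj_on[OF b], of "?o p" "?o q"] that by (simp add: O1_def)
    ultimately show "restrict (\<phi> \<circ> ?o) {..<d} \<in> ?L" using i by (simp add: labelling_def)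
   qed
   show "?L \<subseteq> (\<lambda>\<phi>. restrict (\<phi> \<circ> ?o) {..<d}) ` \<Phi>"
   proof
    fix l assume "l \<in> ?L"
    then have l: "l \<in> extensional {..<d}" "l ` {..<d} = {..<?n}" "\<And>p q. p < d \<Longrightarrow> q < d \<Longrightarrow> l p = l q \<longleftrightarrow> ?o p = ?o q"
     by (auto simp: labelling_def)
    define r where "r u = inv_into {..<d} ?o u" for u
    have r: "r u < d \<and> ?o (r u) = u" if "u \<in> O1" for u
     using inv_into_into[of u ?o "{..<d}"] f_inv_into_f[of u ?o "{..<d}"] that by (simp add: O1_def r_def)
    define \<phi> where "\<phi> = (\<lambda>u\<in>O1. l (r u))"
    have oO: "?o p \<in> O1" if "p < d" for p using that by (simp add: O1_def)
    have \<phi>o: "\<phi> (?o p) = l p" if "p < d" for p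
     using r[OF oO[OF that]] l(3)[of "r (?o p)" p] that oO[OF that] by (simp add: \<phi>_def)
    have "bij_betw \<phi> O1 {..<?n}"
    proof (rule bij_betw_imageI)
     show "inj_on \<phi> O1"
     proof (rule inj_onI)
      fix u v assume uv: "u \<in> O1" "v \<in> O1" "\<phi> u = \<phi> v"
      then have "l (r u) = l (r v)" by (simp add: \<phi>_def)
      then have "?o (r u) = ?o (r v)" using l(3) r[OF uv(1)] r[OF uv(2)] by blast
      then show "u = v" using r[OF uv(1)] r[OF uv(2)] by simp
     qed
     have "\<phi> ` O1 = (\<lambda>p. \<phi> (?o p)) ` {..<d}" unfolding O1_def image_image ..
     also have "\<dots> = l ` {..<d}" using \<phi>o by (intro image_cong) simp_all
     finally show "\<phi> ` O1 = {..<?n}" unfolding l(2) .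
    qed
    then have "\<phi> \<in> \<Phi>" by (simp add: \<Phi>_def \<phi>_def)
    moreover have "l = restrict (\<phi> \<circ> ?o) {..<d}"
     by (rule extensionalityI[OF l(1)]) (simp_all add: \<phi>o)
    ultimately show "l \<in> (\<lambda>\<phi>. restrict (\<phi> \<circ> ?o) {..<d}) ` \<Phi>" by (intro image_eqI[of _ _ \<phi>])
   qed
  qed
 qed
 then have "card ?L = card \<Phi>" using bij_betw_same_card by metis
 also have "\<dots> = fact ?n" unfolding \<Phi>_def n using card_bijections(1)[of O1 "{..<card O1}"] fin by simp
 finally show ?thesis .
qed

definition pairs_of_type :: "nat \<Rightarrow> nat \<Rightarrow> nat \<Rightarrow> ((nat \<Rightarrow> nat) \<times> (nat \<Rightarrow> nat)) set" where
 "pairs_of_type d g n = {w \<in> transitive_pairs {..<d}. ncyc {..<d} (pole_perm w) = n \<and>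
   ncyc {..<d} (fst w) + ncyc {..<d} (snd w) + n + 2 * g = d + 2}"

lemma finite_pairs: "finite (transitive_pairs {..<d})" "finite (pairs_of_type d g n)"
 using finite_perm_pairs[of "{..<d}"] by (simp_all add: transitive_pairs_def pairs_of_type_def)

text \<open>A labelled pair determines the list of its pole orders, so summing over \<mu> removes
  the prescription of the orders; each pair has n! labellings.\<close>

lemma sum_combs:
 "(\<Sum>\<mu> | length \<mu> = n \<and> sum_list \<mu> = d. card (combs g \<mu>)) = fact n * card (pairs_of_type d g n)"
proof -
 define M where "M = {\<mu>. length \<mu> = n \<and> sum_list \<mu> = d}"
 have "M \<subseteq> {\<mu>. set \<mu> \<subseteq> {..d} \<and> length \<mu> = n}" unfolding M_def using member_le_sum_list by fastforce
 then have fM: "finite M" using finite_lists_length_eq[of "{..d}" n] finite_subset by blast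
 have lab_n: "ncyc {..<d} (pole_perm w) = n" if "labelling d n w l" for w l
 proof -
  have "card (l ` {..<d}) = ncyc {..<d} (pole_perm w)" unfolding ncyc_def
   by (rule card_image_cong) (use that in \<open>simp add: labelling_def\<close>)
  then show ?thesis using that by (simp add: labelling_def)
 qed
 have \<mu>: "\<mu> = map (\<lambda>i. card {p. p < d \<and> snd c p = i}) [0..<n]" if "\<mu> \<in> M" "c \<in> combs g \<mu>" for \<mu> c
  using that by (intro nth_equalityI) (simp_all add: M_def combs_def)
 have un: "(\<Union>\<mu>\<in>M. combs g \<mu>) = Sigma (pairs_of_type d g n) (\<lambda>w. {l. labelling d n w l})"
 proof
  show "(\<Union>\<mu>\<in>M. combs g \<mu>) \<subseteq> Sigma (pairs_of_type d g n) (\<lambda>w. {l. labelling d n w l})"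
  proof (rule UN_least, rule subsetI)
   fix \<mu> c assume m: "\<mu> \<in> M" and c: "c \<in> combs g \<mu>"
   have l: "labelling d n (fst c) (snd c)" using m c by (simp add: M_def combs_def)
   have "fst c \<in> pairs_of_type d g n" using m c lab_n[OF l] by (simp add: M_def combs_def pairs_of_type_def)
   then show "c \<in> Sigma (pairs_of_type d g n) (\<lambda>w. {l. labelling d n w l})" using l by (simp add: mem_Sigma_iff[of "fst c" "snd c", simplified])
  qed
  show "Sigma (pairs_of_type d g n) (\<lambda>w. {l. labelling d n w l}) \<subseteq> (\<Union>\<mu>\<in>M. combs g \<mu>)"
  proof
   fix c assume "c \<in> Sigma (pairs_of_type d g n) (\<lambda>w. {l. labelling d n w l})"
   then obtain w l where c: "c = (w, l)" and w: "w \<in> pairs_of_type d g n" and l: "labelling d n w l" by (elim SigmaE) simp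
   define \<mu> where "\<mu> = map (\<lambda>i. card {p. p < d \<and> l p = i}) [0..<n]"
   have im: "l ` {..<d} = {..<n}" using l by (simp add: labelling_def)
   have "d = (\<Sum>p<d. 1)" by simp
   also have "\<dots> = (\<Sum>i\<in>l ` {..<d}. \<Sum>p\<in>{p \<in> {..<d}. l p = i}. 1)" by (rule sum.image_gen) simp
   also have "\<dots> = (\<Sum>i<n. card {p. p < d \<and> l p = i})" unfolding im by simp
   also have "\<dots> = sum_list \<mu>" by (simp add: \<mu>_def interv_sum_list_conv_sum_set_nat atLeast0LessThan)
   finally have s: "sum_list \<mu> = d" by simp
   have len: "length \<mu> = n" by (simp add: \<mu>_def)
   have "c \<in> combs g \<mu>" unfolding combs_def mem_Collect_eq c fst_conv snd_conv s len
    using w l by (simp add: \<mu>_def pairs_of_type_def)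
   then show "c \<in> (\<Union>\<mu>\<in>M. combs g \<mu>)" using s len by (auto simp: M_def)
  qed
 qed
 have "(\<Sum>\<mu>\<in>M. card (combs g \<mu>)) = card (\<Union>\<mu>\<in>M. combs g \<mu>)"
 proof (rule card_UN_disjoint[symmetric, OF fM])
  show "\<forall>\<mu>\<in>M. finite (combs g \<mu>)" by (simp add: finite_combs)
  show "\<forall>\<mu>\<in>M. \<forall>\<nu>\<in>M. \<mu> \<noteq> \<nu> \<longrightarrow> combs g \<mu> \<inter> combs g \<nu> = {}"
  proof (intro ballI impI, rule ccontr)
   fix \<mu> \<nu> assume a: "\<mu> \<in> M" "\<nu> \<in> M" "\<mu> \<noteq> \<nu>" "combs g \<mu> \<inter> combs g \<nu> \<noteq> {}"
   then obtain c where c: "c \<in> combs g \<mu>" "c \<in> combs g \<nu>" by blast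
   have "\<mu> = \<nu>" by (rule trans[OF \<mu>[OF a(1) c(1)] \<mu>[OF a(2) c(2), symmetric]])
   then show False using a(3) by simp
  qed
 qed
 also have "\<dots> = (\<Sum>w\<in>pairs_of_type d g n. card {l. labelling d n w l})" unfolding un
 proof (rule card_SigmaI[OF finite_pairs(2)])
  show "\<forall>w\<in>pairs_of_type d g n. finite {l. labelling d n w l}"
  proof
   fix w
   have "{l. labelling d n w l} \<subseteq> {..<d} \<rightarrow>\<^sub>E {..<n}" unfolding labelling_def by (auto simp: PiE_def)
   then show "finite {l. labelling d n w l}" by (rule finite_subset) (intro finite_PiE; simp)
  qed
 qed
 also have "\<dots> = (\<Sum>w\<in>pairs_of_type d g n. fact n)"
 proof (intro sum.cong refl)
  fix w assume "w \<in> pairs_of_type d g n"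
  then have "w \<in> perm_pairs {..<d}" "ncyc {..<d} (pole_perm w) = n" by (simp_all add: pairs_of_type_def transitive_pairs_def)
  then show "card {l. labelling d n w l} = fact n" using card_labellings[of w d] by simp
 qed
 finally show ?thesis unfolding M_def by (simp add: mult.commute)
qed

text \<open>The n! from the labellings cancels against the denominator. Lists with a zero entry,
  which \<open>F\<close> sends to 0, have no combinatorial data either.\<close>

lemma diagonal_F:
 assumes d: "0 < d"
 shows "fps_nth (diagonal n (F g n)) d / fact n = of_nat (card (pairs_of_type d g n)) / fact d"
proof -
 have "F g n \<mu> = of_nat (card (combs g \<mu>)) / fact d" if m: "length \<mu> = n" "sum_list \<mu> = d" for \<mu>
 proof (cases "\<forall>m\<in>set \<mu>. 1 \<le> m")
  case True
  then show ?thesis using B_eq_card_combs[of \<mu> g] m d by (simp add: F_def)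
 next
  case False
  then obtain i where i: "i < n" "\<mu> ! i = 0" using m(1) by (auto simp: in_set_conv_nth not_le)
  \<comment> \<open>A labelling uses every label, so all pole orders are positive.\<close>
  have "combs g \<mu> = {}"
  proof (rule equals0I)
   fix c assume c: "c \<in> combs g \<mu>"
   then have "card {p. p < d \<and> snd c p = i} = 0" using i m by (simp add: combs_def)
   then have "{p. p < d \<and> snd c p = i} = {}" by simp
   moreover have "i \<in> snd c ` {..<d}" using c i m by (simp add: combs_def labelling_def)
   ultimately show False by auto
  qed
  moreover have "F g n \<mu> = 0" unfolding F_def by (rule if_not_P) (use False in blast)
  ultimately show ?thesis by simp
 qed
 then have "fps_nth (diagonal n (F g n)) d = (\<Sum>\<mu> | length \<mu> = n \<and> sum_list \<mu> = d. of_nat (card (combs g \<mu>)) / fact d)"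
  unfolding diagonal_def fps_nth_Abs_fps by (intro sum.cong refl) simp
 also have "\<dots> = of_nat (\<Sum>\<mu> | length \<mu> = n \<and> sum_list \<mu> = d. card (combs g \<mu>)) / fact d"
  by (simp only: of_nat_sum sum_divide_distrib)
 finally show ?thesis unfolding sum_combs by simp
qed

lemma diagonal_F_0: assumes "1 \<le> n" shows "fps_nth (diagonal n (F g n)) 0 = 0"
proof -
 have "F g n \<mu> = 0" if m: "length \<mu> = n" "sum_list \<mu> = 0" for \<mu>
 proof -
  obtain a where "a \<in> set \<mu>" using m(1) assms by (cases \<mu>) auto
  moreover have "a = 0" if "a \<in> set \<mu>" for a using m(2) that by (simp add: sum_list_eq_0_iff)
  ultimately show ?thesis by (auto simp: F_def)
 qed
 then show ?thesis unfolding diagonal_def fps_nth_Abs_fps by (intro sum.neutral) simp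
qed

text \<open>The Euler characteristic is even because the three permutations multiply to the identity.\<close>

lemma type_exists:
 assumes w: "w \<in> transitive_pairs {..<d}" and d: "0 < d"
 shows "\<exists>g. w \<in> pairs_of_type d g (ncyc {..<d} (pole_perm w))"
proof -
 let ?c = "\<lambda>p. ncyc {..<d} p"
 have p: "fst w permutes {..<d}" "snd w permutes {..<d}" using w by (auto simp: transitive_pairs_def perm_pairs_def)
 have pp: "pole_perm w permutes {..<d}" unfolding pole_perm_def by (intro permutes_compose p permutes_inv)
 have perm: "permutation (fst w)" "permutation (snd w)" "permutation (Hilbert_Choice.inv (snd w))"
  using p permutes_inv[OF p(2)] by (auto simp: permutation_permutes)
 have "sign (pole_perm w) = sign (snd w) * sign (fst w)"
  unfolding pole_perm_def sign_compose[OF perm(3,1)] sign_inverse[OF perm(2)] ..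
 then have "(- 1 :: int) ^ (d + ?c (pole_perm w)) = (- 1) ^ (d + ?c (snd w)) * (- 1) ^ (d + ?c (fst w))"
  using sign_ncyc[OF finite_lessThan pp] sign_ncyc[OF finite_lessThan p(1)] sign_ncyc[OF finite_lessThan p(2)] by simp
 then have "(- 1 :: int) ^ (d + ?c (pole_perm w)) = (- 1) ^ ((d + ?c (snd w)) + (d + ?c (fst w)))" by (simp only: power_add)
 then have ev: "even (d + ?c (fst w) + ?c (snd w) + ?c (pole_perm w))" by (auto simp: minus_one_power_iff split: if_splits)
 have tp: "tperm w i permutes {..<d}" for i using p by (auto simp: tperm_def permutes_id)
 \<comment> \<open>That the genus is not negative is a topological fact: it is taken from the
   surface glued from the pair.\<close>
 obtain X :: "real topology" and f S where T: "tiling X f d (tperm w) S" using tiling_exists[of "tperm w" d] tp by metis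
 interpret tiling X f d "tperm w" S by (rule T)
 have cs: "connected_space X" using connected_iff_transitive[OF refl d] w by (simp add: transitive_pairs_def)
 interpret connected_tiling X f d "tperm w" S by unfold_locales (fact cs d)+
 have le: "?c (fst w) + ?c (snd w) + ?c (pole_perm w) \<le> d + 2" by (rule genus_tperm(2)[OF refl])
 have "even (d + 2 - (?c (fst w) + ?c (snd w) + ?c (pole_perm w)))" using ev le by presburger
 then obtain g where "d + 2 - (?c (fst w) + ?c (snd w) + ?c (pole_perm w)) = 2 * g" by (rule evenE)
 then have "w \<in> pairs_of_type d g (?c (pole_perm w))" using w le by (simp add: pairs_of_type_def)
 then show ?thesis by blast
qed

lemma fls_X_power_nth: "fls_nth (fls_X ^ a * (fls_X_inv ^ b * fls_X_inv ^ c)) k = (if k = int a - int b - int c then 1 else (0 :: rat))"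
proof -
 have "fls_X ^ a * (fls_X_inv ^ b * fls_X_inv ^ c) = (fls_X_intpow (int a - int b - int c) :: rat fls)"
  by (simp add: fls_X_power_conv_shift_1 fls_X_inv_power_conv_shift_1 fls_times_both_shifted_simp algebra_simps)
 then show ?thesis by simp
qed

text \<open>By Euler's formula a pair of type (g, n) has 2g - 2 + n = d - c(\<alpha>) - c(\<beta>).
  Every transitive pair has exactly one type, so the sum over all types with a given exponent counts
  the pairs with that exponent, which is a coefficient of \<hbar>^d \<open>ctotal\<close>
  (1/\<hbar>).\<close>

lemma free_energy_eq:
 "free_energy = Abs_fps (\<lambda>d. if d = 0 then 0 else fls_X ^ d * ctotal fls_X_inv {..<d} / fact d)"
proof (rule fps_ext)
 fix d
 let ?G = "\<lambda>k. {(g, n). 1 \<le> n \<and> 2 * int g - 2 + int n = k}"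
 have finG: "finite (?G k)" for k
 proof (rule finite_subset)
  show "?G k \<subseteq> {..nat (k + 2)} \<times> {..nat (k + 2)}" by auto
 qed simp
 show "fps_nth free_energy d = fps_nth (Abs_fps (\<lambda>d. if d = 0 then 0 else fls_X ^ d * ctotal fls_X_inv {..<d} / fact d)) d"
 proof (cases "d = 0")
  case True
  have "(\<Sum>(g, n)\<in>?G k. fps_nth (diagonal n (F g n)) 0 / fact n) = 0" for k
  proof (rule sum.neutral, rule ballI)
   fix x assume x: "x \<in> ?G k"
   obtain g n where gn: "x = (g, n)" by (rule prod.exhaust)
   then have "1 \<le> n" using x by simp
   then show "(case x of (g, n) \<Rightarrow> fps_nth (diagonal n (F g n)) 0 / fact n) = 0" unfolding gn using diagonal_F_0 by simp
  qed
  then have "fps_nth free_energy d = Abs_fls (\<lambda>k. 0)" unfolding True free_energy_def fps_nth_Abs_fps by simp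
  also have "\<dots> = Abs_fls (fls_nth 0)" by (rule arg_cong[where f = Abs_fls]) auto
  also have "\<dots> = (0 :: rat fls)" by (rule fls_nth_inverse)
  finally show ?thesis using True by simp
 next
  case False
  then have d: "0 < d" by simp
  define Y :: "rat fls" where "Y = fls_X ^ d * ctotal fls_X_inv {..<d} / fact d"
  define W where "W = transitive_pairs {..<d}"
  let ?e = "\<lambda>w. int d - int (ncyc {..<d} (fst w)) - int (ncyc {..<d} (snd w))"
  have Y1: "Y = fls_const (1 / fact d) * (\<Sum>w\<in>W. fls_X ^ d * (fls_X_inv ^ ncyc {..<d} (fst w) * fls_X_inv ^ ncyc {..<d} (snd w)))"
  proof -
   have "(fact d :: rat fls) = fls_const (fact d)" by (metis fls_of_nat of_nat_fact)
   then have "1 / (fact d :: rat fls) = fls_const (1 / fact d)"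
    by (simp add: fls_inverse_const[symmetric] inverse_eq_divide[symmetric])
   moreover have "Y = (1 / fact d) * (fls_X ^ d * ctotal fls_X_inv {..<d})" by (simp add: Y_def)
   ultimately show ?thesis unfolding ctotal_def weight_def W_def by (simp only: sum_distrib_left)
  qed
  have Yk: "fls_nth Y k = of_nat (card {w \<in> W. ?e w = k}) / fact d" for k
  proof -
   have "fls_nth Y k = (1 / fact d) * (\<Sum>w\<in>W. if k = ?e w then 1 else 0)"
    unfolding Y1 by (simp add: fls_nth_sum fls_X_power_nth)
   also have "(\<Sum>w\<in>W. if k = ?e w then 1 else 0 :: rat) = of_nat (card {w \<in> W. ?e w = k})"
    using finite_pairs(1)[of d] by (simp add: W_def sum.If_cases Int_def eq_commute)
   finally show ?thesis by simp
  qed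
  have cov: "{w \<in> W. ?e w = k} = (\<Union>(g, n)\<in>?G k. pairs_of_type d g n)" for k
  proof
   show "{w \<in> W. ?e w = k} \<subseteq> (\<Union>(g, n)\<in>?G k. pairs_of_type d g n)"
   proof
    fix w assume w: "w \<in> {w \<in> W. ?e w = k}"
    then have wW: "w \<in> transitive_pairs {..<d}" by (simp add: W_def)
    obtain g where g: "w \<in> pairs_of_type d g (ncyc {..<d} (pole_perm w))" using type_exists[OF wW d] by blast
    have "0 < ncyc {..<d} (pole_perm w)" unfolding ncyc_def using d by (simp add: card_gt_0_iff lessThan_empty_iff)
    moreover have "2 * int g - 2 + int (ncyc {..<d} (pole_perm w)) = k" using g w by (simp add: pairs_of_type_def)
    ultimately show "w \<in> (\<Union>(g, n)\<in>?G k. pairs_of_type d g n)" using g by (intro UN_I[of "(g, ncyc {..<d} (pole_perm w))"]) simp_all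
   qed
   show "(\<Union>(g, n)\<in>?G k. pairs_of_type d g n) \<subseteq> {w \<in> W. ?e w = k}"
   proof (rule UN_least)
    fix x assume x: "x \<in> ?G k"
    obtain g n where gn: "x = (g, n)" by (rule prod.exhaust)
    have "2 * int g - 2 + int n = k" using x gn by simp
    then show "(case x of (g, n) \<Rightarrow> pairs_of_type d g n) \<subseteq> {w \<in> W. ?e w = k}"
     unfolding gn prod.case by (auto simp: pairs_of_type_def W_def)
   qed
  qed
  have Gk: "(\<Sum>(g, n)\<in>?G k. fps_nth (diagonal n (F g n)) d / fact n) = fls_nth Y k" for k
  proof -
   have "(\<Sum>(g, n)\<in>?G k. fps_nth (diagonal n (F g n)) d / fact n) = (\<Sum>x\<in>?G k. of_nat (card (case x of (g, n) \<Rightarrow> pairs_of_type d g n)) / fact d)"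
    by (intro sum.cong refl) (simp add: case_prod_unfold diagonal_F[OF d])
   also have "\<dots> = of_nat (\<Sum>x\<in>?G k. card (case x of (g, n) \<Rightarrow> pairs_of_type d g n)) / fact d"
    by (simp only: of_nat_sum sum_divide_distrib)
   also have "(\<Sum>x\<in>?G k. card (case x of (g, n) \<Rightarrow> pairs_of_type d g n)) = card (\<Union>x\<in>?G k. case x of (g, n) \<Rightarrow> pairs_of_type d g n)"
   proof (rule card_UN_disjoint[symmetric, OF finG])
    show "\<forall>x\<in>?G k. finite (case x of (g, n) \<Rightarrow> pairs_of_type d g n)" by (simp add: case_prod_unfold finite_pairs)
    show "\<forall>x\<in>?G k. \<forall>y\<in>?G k. x \<noteq> y \<longrightarrow> (case x of (g, n) \<Rightarrow> pairs_of_type d g n) \<inter> (case y of (g, n) \<Rightarrow> pairs_of_type d g n) = {}"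
    proof (intro ballI impI equals0I)
     fix x y w assume a: "x \<noteq> y" "w \<in> (case x of (g, n) \<Rightarrow> pairs_of_type d g n) \<inter> (case y of (g, n) \<Rightarrow> pairs_of_type d g n)"
     obtain g n where x: "x = (g, n)" by (rule prod.exhaust)
     obtain g' n' where y: "y = (g', n')" by (rule prod.exhaust)
     have "w \<in> pairs_of_type d g n" "w \<in> pairs_of_type d g' n'" using a(2) unfolding x y by simp_all
     then have "n = n'" "g = g'" by (simp_all add: pairs_of_type_def)
     then show False using a(1) x y by simp
    qed
   qed
   finally show ?thesis unfolding Yk cov .
  qed
  have "fps_nth free_energy d = Abs_fls (fls_nth Y)" unfolding free_energy_def fps_nth_Abs_fps Gk ..
  also have "\<dots> = Y" by (rule fls_nth_inverse)
  finally show ?thesis using False by (simp add: Y_def)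
 qed
qed

theorem Zbar_eq: "Zbar = Abs_fps (\<lambda>d. fls_X ^ d * total fls_X_inv d / fact d)"
 unfolding Zbar_def free_energy_eq by (rule exp_ctotal)

section \<open>The recurrence of the coefficients and the differential equation\<close>

definition zc :: "nat \<Rightarrow> rat fls" where "zc d = fls_X ^ d * total fls_X_inv d / fact d"

lemma X_inv: "fls_X * fls_X_inv = (1 :: 'b::field fls)"
 by (simp add: fls_X_times_conv_shift fls_X_inv_conv_shift_1)

text \<open>Consecutive coefficients have the ratio \<hbar> (1/\<hbar> + n)^2 / (n + 1); one more
  factor \<hbar> clears the denominators.\<close>

lemma zc_Suc: "fls_X * (of_nat (Suc n) * zc (Suc n)) = (1 + of_nat n * fls_X)\<^sup>2 * zc n"
proof -
 have "fls_X * (fls_X_inv + of_nat n) = (1 + of_nat n * fls_X :: rat fls)" using X_inv[where 'b = rat] by (simp add: distrib_left mult.commute)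
 then have s: "(fls_X * (fls_X_inv + of_nat n))\<^sup>2 = (1 + of_nat n * fls_X :: rat fls)\<^sup>2" by simp
 have "of_nat (Suc n) * zc (Suc n) = fls_X ^ Suc n * total fls_X_inv (Suc n) / fact n"
  unfolding zc_def by (rule Suc_mult_divide_fact)
 also have "\<dots> = fls_X * (fls_X_inv + of_nat n)\<^sup>2 * zc n" by (simp add: total_def zc_def power_mult_distrib mult_ac)
 finally show ?thesis unfolding s[symmetric] by (simp add: power2_eq_square mult_ac)
qed

lemma fps_to_fls_prod: "fps_to_fls (\<Prod>i<d. f i) = (\<Prod>i<d. fps_to_fls (f i))" for f :: "nat \<Rightarrow> 'b::comm_ring_1 fps"
 by (induction d) (simp_all add: fls_times_fps_to_fls)

text \<open>Multiplication by \<hbar>^d distributes one \<hbar> over each factor of one of the two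
  products already scaled by \<hbar>^d, leaving a polynomial: the square of the product of the 1 + i
  \<hbar>, divided by d!.\<close>

lemma zc_laurent: "is_laurent_poly (zc d)"
proof -
 define P :: "rat poly" where "P = Polynomial.smult (1 / fact d) ((\<Prod>i<d. [:1, of_nat i:])\<^sup>2)"
 have "fps_of_poly ([:1, of_nat i:] :: rat poly) = 1 + of_nat i * fps_X" for i
  by (simp add: fps_of_poly_pCons fps_of_nat[symmetric])
 then have e: "fps_to_fls (fps_of_poly P) = fls_const (1 / fact d) * (\<Prod>i<d. 1 + of_nat i * fls_X)\<^sup>2"
  by (simp add: P_def fps_of_poly_smult fps_of_poly_power fps_of_poly_prod fls_times_fps_to_fls fps_to_fls_power fps_to_fls_prod)
 have "fls_X ^ d * (\<Prod>i<d. fls_X_inv + of_nat i) = (\<Prod>i<d. fls_X * (fls_X_inv + of_nat i) :: rat fls)" by (simp add: prod.distrib)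
 also have "\<dots> = (\<Prod>i<d. 1 + of_nat i * fls_X)" using X_inv[where 'b = rat] by (intro prod.cong refl) (simp add: distrib_left mult.commute)
 finally have pr: "fls_X ^ d * (\<Prod>i<d. fls_X_inv + of_nat i) = (\<Prod>i<d. 1 + of_nat i * fls_X :: rat fls)" .
 have f: "(fact d :: rat fls) = fls_const (fact d)" by (metis fls_of_nat of_nat_fact)
 have g1: "a * (a * b\<^sup>2 / c) = (a * b)\<^sup>2 / c" for a b c :: "rat fls" by (simp add: power2_eq_square mult_ac)
 have g2: "u / fls_const c = fls_const (1 / c) * u" for u :: "rat fls" and c
  by (simp add: divide_inverse fls_inverse_const mult.commute)
 have "fls_X ^ d * zc d = (fls_X ^ d * (\<Prod>i<d. fls_X_inv + of_nat i))\<^sup>2 / fact d"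
  unfolding zc_def total_def by (rule g1)
 also have "\<dots> = fps_to_fls (fps_of_poly P)" unfolding pr e f by (rule g2)
 finally have "fls_X ^ d * zc d = fps_to_fls (fps_of_poly P)" .
 then have z: "fls_nth (zc d) k = (if k + int d < 0 then 0 else Polynomial.coeff P (nat (k + int d)))" for k
 proof -
  have "fls_nth (zc d) k = fls_nth (fls_X ^ d * zc d) (k + int d)" by (simp add: fls_X_power_times_conv_shift)
  also have "\<dots> = fls_nth (fps_to_fls (fps_of_poly P)) (k + int d)" by (simp only: \<open>fls_X ^ d * zc d = fps_to_fls (fps_of_poly P)\<close>)
  finally show ?thesis by simp
 qed
 have "{k. fls_nth (zc d) k \<noteq> 0} \<subseteq> (\<lambda>m. int m - int d) ` {m. Polynomial.coeff P m \<noteq> 0}"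
 proof
  fix k assume "k \<in> {k. fls_nth (zc d) k \<noteq> 0}"
  then have k: "\<not> k + int d < 0" "Polynomial.coeff P (nat (k + int d)) \<noteq> 0" unfolding mem_Collect_eq z by (auto split: if_splits)
  show "k \<in> (\<lambda>m. int m - int d) ` {m. Polynomial.coeff P m \<noteq> 0}" by (rule image_eqI[of _ _ "nat (k + int d)"]) (use k in simp_all)
 qed
 then show ?thesis unfolding is_laurent_poly_def
 proof (rule finite_subset)
  have "finite {m. Polynomial.coeff P m \<noteq> 0}" using MOST_coeff_eq_0[of P] by (simp add: eventually_cofinite)
  then show "finite ((\<lambda>m. int m - int d) ` {m. Polynomial.coeff P m \<noteq> 0})" by (rule finite_imageI)
 qed
qed

text \<open>Coefficientwise this is \<open>zc_Suc\<close>: with X for 1/x the operators X d/dX and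
  X^2 d^2/dX^2 multiply the n-th coefficient by n and n (n - 1), and (1 + n \<hbar>)^2 = 1 + n
  (\<hbar>^2 + 2 \<hbar>) + n (n - 1) \<hbar>^2.\<close>

lemma fps_ode:
 defines "z \<equiv> Abs_fps zc" and "h \<equiv> fps_const fls_X"
 shows "h * fps_deriv z = z + (h\<^sup>2 + 2 * h) * (fps_X * fps_deriv z) + h\<^sup>2 * (fps_X\<^sup>2 * fps_deriv (fps_deriv z))"
proof (rule fps_ext)
 fix n
 have d1: "fps_nth (fps_X * fps_deriv z) n = of_nat n * zc n"
  by (cases n) (simp_all add: z_def)
 have d2: "fps_nth (fps_X\<^sup>2 * fps_deriv (fps_deriv z)) n = of_nat n * (of_nat n - 1) * zc n"
 proof -
  consider "n = 0" | "n = 1" | m where "n = Suc (Suc m)" by (metis One_nat_def nat.exhaust)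
  then show ?thesis
   by cases (simp_all add: power2_eq_square mult.assoc z_def algebra_simps)
 qed
 have r: "fps_nth ((h\<^sup>2 + 2 * h) * (fps_X * fps_deriv z)) n = (fls_X\<^sup>2 + 2 * fls_X) * (of_nat n * zc n)"
 proof -
  have "(h\<^sup>2 + 2 * h) * (fps_X * fps_deriv z) = h * (h * (fps_X * fps_deriv z)) + (h * (fps_X * fps_deriv z) + h * (fps_X * fps_deriv z))"
   by (simp add: power2_eq_square algebra_simps)
  then show ?thesis unfolding h_def by (simp only: fps_add_nth fps_mult_left_const_nth d1) (simp add: power2_eq_square algebra_simps)
 qed
 have s: "fps_nth (h\<^sup>2 * (fps_X\<^sup>2 * fps_deriv (fps_deriv z))) n = fls_X\<^sup>2 * (of_nat n * (of_nat n - 1) * zc n)"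
  unfolding h_def fps_const_power fps_mult_left_const_nth d2 ..
 have "fps_nth (h * fps_deriv z) n = fls_X * (of_nat (Suc n) * zc (Suc n))" unfolding h_def fps_mult_left_const_nth by (simp add: z_def)
 also have "\<dots> = (1 + of_nat n * fls_X)\<^sup>2 * zc n" by (rule zc_Suc)
 also have "\<dots> = zc n + (fls_X\<^sup>2 + 2 * fls_X) * (of_nat n * zc n) + fls_X\<^sup>2 * (of_nat n * (of_nat n - 1) * zc n)"
  by (simp add: power2_eq_square algebra_simps)
 finally show "fps_nth (h * fps_deriv z) n = fps_nth (z + (h\<^sup>2 + 2 * h) * (fps_X * fps_deriv z) + h\<^sup>2 * (fps_X\<^sup>2 * fps_deriv (fps_deriv z))) n"
  unfolding fps_add_nth r s by (simp add: z_def)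
qed

lemma fls_ode:
 defines "f \<equiv> fps_to_fls Zbar"
 shows "hbar * fls_deriv f = f + (hbar\<^sup>2 + 2 * hbar) * (fls_X * fls_deriv f) + hbar\<^sup>2 * (fls_X\<^sup>2 * fls_deriv (fls_deriv f))"
proof -
 define z where "z = Abs_fps zc"
 define h where "h = fps_const (fls_X :: rat fls)"
 have Zz: "Zbar = z" unfolding Zbar_eq z_def zc_def ..
 have H: "hbar = fps_to_fls h" unfolding hbar_def h_def by simp
 have X: "fls_X = fps_to_fls (fps_X :: rat fls fps)" by simp
 have t: "(2 :: rat fls fls) = fps_to_fls 2" by simp
 have "fps_to_fls (h * fps_deriv z) = fps_to_fls (z + (h\<^sup>2 + 2 * h) * (fps_X * fps_deriv z) + h\<^sup>2 * (fps_X\<^sup>2 * fps_deriv (fps_deriv z)))"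
  using fps_ode unfolding z_def h_def by simp
 then show ?thesis unfolding f_def Zz H X t
  by (simp only: fps_to_fls_plus fls_times_fps_to_fls fps_to_fls_power fls_deriv_fps_to_fls)
qed

text \<open>Here X is 1/x, Y is x, and f1, f2 are derivatives with respect to 1/x. The left side is
  X times the difference of the two sides of the equation \<open>ode\<close>.\<close>

lemma quantum_curve_algebra:
 fixes h X Y f f1 f2 :: "'b::field"
 assumes XY: "X * Y = 1" and h: "h \<noteq> 0" and ode: "h * f1 = f + (h\<^sup>2 + 2 * h) * (X * f1) + h\<^sup>2 * (X\<^sup>2 * f2)"
 shows "Y * h\<^sup>2 * (X\<^sup>2 * (2 * X * f1 + X\<^sup>2 * f2)) + h * (h - 2 + Y) * (- (X\<^sup>2 * f1)) + X * f = 0"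
proof -
 have "Y * h\<^sup>2 * (X\<^sup>2 * (2 * X * f1 + X\<^sup>2 * f2)) + h * (h - 2 + Y) * (- (X\<^sup>2 * f1)) + X * f
  = X * ((X * Y) * (h\<^sup>2 * (2 * X * f1 + X\<^sup>2 * f2)) - h * (h - 2) * (X * f1) - (X * Y) * (h * f1) + f)"
  by (simp add: power2_eq_square algebra_simps)
 also have "\<dots> = X * (f + (h\<^sup>2 + 2 * h) * (X * f1) + h\<^sup>2 * (X\<^sup>2 * f2) - h * f1)"
  unfolding XY by (simp add: power2_eq_square algebra_simps)
 finally show ?thesis unfolding ode by simp
qed

theorem theorem2:
 shows "(\<forall>d. is_laurent_poly (fps_nth Zbar d)) \<and>
  yhat (xhat (yhat Z)) - xhat (yhat Z) + Z = 0 \<and>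
  (let f = fps_to_fls Zbar in
   xvar * hbar ^ 2 * ddx (ddx f) + hbar * (hbar - 2 + xvar) * ddx f + inverse xvar * f = 0)"
proof -
 define f where "f = fps_to_fls Zbar"
 define f1 where "f1 = fls_deriv f"
 define f2 where "f2 = fls_deriv f1"
 define X :: "rat fls fls" where "X = fls_X"
 have lp: "\<forall>d. is_laurent_poly (fps_nth Zbar d)" using zc_laurent unfolding Zbar_eq zc_def by simp
 have XY: "X * xvar = 1" unfolding X_def xvar_def by (rule X_inv)
 have X0: "X \<noteq> 0" using XY by auto
 have iX: "inverse xvar = X" using XY by (metis inverse_unique mult.commute)
 have h0: "hbar \<noteq> 0" unfolding hbar_def by simp
 have ih: "inverse (hbar * xvar) = X * inverse hbar" using iX by (simp add: mult.commute)
 have hih: "hbar * inverse hbar = 1" using h0 by simp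
 have dX2: "fls_deriv (X ^ 2 * u) = 2 * X * u + X ^ 2 * fls_deriv u" for u
  unfolding X_def by (simp add: power2_eq_square algebra_simps)
 have D: "ddx u = - (X\<^sup>2 * fls_deriv u)" for u unfolding ddx_def X_def ..
 have D1: "ddx f = - (X\<^sup>2 * f1)" unfolding D f1_def ..
 have D2: "ddx (ddx f) = X\<^sup>2 * (2 * X * f1 + X\<^sup>2 * f2)"
 proof -
  have "ddx (ddx f) = X\<^sup>2 * fls_deriv (X\<^sup>2 * f1)" unfolding D1 unfolding D fls_deriv_neg mult_minus_right minus_minus ..
  then show ?thesis unfolding dX2 f2_def .
 qed
 have ode: "hbar * f1 = f + (hbar\<^sup>2 + 2 * hbar) * (X * f1) + hbar\<^sup>2 * (X\<^sup>2 * f2)"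
  using fls_ode unfolding f_def f1_def f2_def X_def .
 have Q: "xvar * hbar ^ 2 * ddx (ddx f) + hbar * (hbar - 2 + xvar) * ddx f + inverse xvar * f = 0"
  unfolding iX D2 unfolding D1 by (rule quantum_curve_algebra[OF XY h0 ode])
 \<comment> \<open>Conjugation by the symbol \<open>x\<close> to the power -1/\<hbar> turns
   \<open>yhat\<close> into -\<hbar> d/dx + 1/x, which is here expressed in X = 1/x.\<close>
 define v where "v = hbar * X\<^sup>2 * f1 + X * f"
 have yZ: "yhat Z = Wave v"
 proof -
  have "- hbar * (ddx f - inverse (hbar * xvar) * f) = hbar * X\<^sup>2 * f1 + (hbar * inverse hbar) * (X * f)"
   unfolding D1 ih by (simp add: algebra_simps)
  then show ?thesis unfolding yhat_def Z_def ddx_wave.simps scale.simps f_def[symmetric] v_def hih by simp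
 qed
 have xyZ: "xhat (yhat Z) = Wave (hbar * X * f1 + f)"
 proof -
  have "xvar * v = (X * xvar) * (hbar * X * f1 + f)" unfolding v_def by (simp add: power2_eq_square algebra_simps)
  then show ?thesis unfolding yZ xhat_def scale.simps XY by simp
 qed
 have hc: "fls_deriv (hbar * u) = hbar * fls_deriv u" for u unfolding hbar_def by simp
 have Xd: "fls_deriv (X * u) = u + X * fls_deriv u" for u unfolding X_def by simp
 have "fls_deriv (hbar * X * f1 + f) = hbar * (f1 + X * f2) + f1"
  unfolding mult.assoc fls_deriv_add hc Xd f2_def f1_def ..
 then have dd: "ddx (hbar * X * f1 + f) = - (X\<^sup>2 * (hbar * (f1 + X * f2) + f1))" unfolding D by simp
 have yxyZ: "yhat (xhat (yhat Z)) = Wave (hbar * (X\<^sup>2 * (hbar * (f1 + X * f2) + f1)) + X * (hbar * X * f1 + f))"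
 proof -
  have "- hbar * (ddx (hbar * X * f1 + f) - inverse (hbar * xvar) * (hbar * X * f1 + f)) =
    hbar * (X\<^sup>2 * (hbar * (f1 + X * f2) + f1)) + (hbar * inverse hbar) * (X * (hbar * X * f1 + f))"
   unfolding dd ih by (simp add: algebra_simps)
  then have e: "- hbar * (ddx (hbar * X * f1 + f) - inverse (hbar * xvar) * (hbar * X * f1 + f)) =
    hbar * (X\<^sup>2 * (hbar * (f1 + X * f2) + f1)) + X * (hbar * X * f1 + f)" unfolding hih mult_1_left .
  show ?thesis unfolding xyZ unfolding yhat_def ddx_wave.simps scale.simps e ..
 qed
 \<comment> \<open>The operator form produces the same multiple of the differential equation, by X =
   1/x.\<close>
 have "hbar * (X\<^sup>2 * (hbar * (f1 + X * f2) + f1)) + X * (hbar * X * f1 + f) - (hbar * X * f1 + f) + f =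
   X * (f + (hbar\<^sup>2 + 2 * hbar) * (X * f1) + hbar\<^sup>2 * (X\<^sup>2 * f2) - hbar * f1)"
  by (simp add: power2_eq_square algebra_simps)
 also have "\<dots> = 0" unfolding ode by simp
 finally have "yhat (xhat (yhat Z)) - xhat (yhat Z) + Z = 0"
  unfolding yxyZ unfolding xyZ unfolding Z_def f_def[symmetric] minus_wave_def plus_wave_def zero_wave_def wave.sel
  by (rule arg_cong[where f = Wave])
 then show ?thesis using lp Q unfolding f_def Let_def by blast
qed

end
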